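(* Let $S\subset\mathbb{N}$ be any finite set. For each $n$ let $C_n\subset\mathbb{R}^n$ be the $n$-dimensional cross-polytope, the convex hull of the set $\{\pm e_1,\dots,\pm e_n\}$ of unit coordinate vectors and their negatives. Let $Q_n(S)$ be the rank-selected poset consisting of the faces of $C_n$ whose dimension lies in $S$, together with $\emptyset$ and $C_n$, ordered by inclusion. Let $|Q_n(S)|$ be its geometric realization and let $$L^C_n(S)=\sum_i(-1)^iH_i(|Q_n(S)|;\mathbb{Q})$$ be the associated Lefschetz representation, a virtual representation of the hyperoctahedral group $W_n=(\mathbb{Z}/2\mathbb{Z})^n\rtimes S_n$. Then the sequence $\{L^C_n(S)\}$ of virtual $W_n$-representations is multiplicity stable.
   Context: $W_n$ acts on $\mathbb{R}^n$ by signed permutation matrices, hence on $C_n$, on the poset $Q_n(S)$, on its geometric realization (the simplicial complex of chains), and on homology. A virtual representation is a formal $\mathbb{Z}$-linear combination of representations. Irreducible $\mathbb{Q}W_n$-representations are classified by double partitions $(\lambda^+,\lambda^-)$ with $|\lambda^+|+|\lambda^-|=n$. For a partition $\lambda$ of $n$, $V_{(\lambda,0)}$ is the pullback to $W_n$ of the irreducible $S_n$-representation of type $\lambda$, and $V_{(0,\lambda)}=V_{(\lambda,0)}\otimes\nu$ where $\nu$ is the one-dimensional representation trivial on $S_n$ on which each $\mathbb{Z}/2\mathbb{Z}$ factor acts by $-1$. If $|\lambda^+|=k$, $|\lambda^-|=n-k$, then $V_{(\lambda^+,\lambda^-)}=\mathrm{Ind}_{W_k\times W_{n-k}}^{W_n}V_{(\lambda^+,0)}\boxtimes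 V_{(0,\lambda^-)}$. For an arbitrary double partition $\lambda=(\lambda^+,\lambda^-)$ with $|\lambda^+|+|\lambda^-|=k$ and $n\ge k+\lambda^+_1$, put $V(\lambda)_n=V_{((n-k,\lambda^+),\lambda^-)}$. A sequence of virtual $W_n$-representations $\sum_\lambda c_{\lambda,n}V(\lambda)_n$ ($c_{\lambda,n}\in\mathbb{Z}$) is multiplicity stable if for each double partition $\lambda$ the multiplicity $c_{\lambda,n}$ is eventually independent of $n$. *)

theory Defs
  imports "HOL-Analysis.Analysis" "HOL-Analysis.Finite_Function_Topology"
    "HOL-Algebra.Algebra" "HOL-Algebra.Algebraic_Closure_Type"
    "HOL-Combinatorics.Permutations"
begin

section \<open>Representations over the rationals\<close>

text \<open>
  A representation is a module over the field of rational numbers (in the sense of HOL-Algebra)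
  together with an action of a group. The fields \<open>mult\<close> and \<open>one\<close> that the module record inherits
  from rings play no role.
\<close>

record ('v, 'g) rep = "(rat, 'v) module" +
  act :: "'g \<Rightarrow> 'v \<Rightarrow> 'v"

definition rat_field :: "rat ring" where
  "rat_field = ring_of_type_algebra"

definition rep_iso :: "('g, 'b) monoid_scheme \<Rightarrow> ('v, 'g) rep \<Rightarrow> ('w, 'g) rep \<Rightarrow> bool" where
  "rep_iso G M N \<longleftrightarrow> (\<exists>\<phi>. bij_betw \<phi> (carrier M) (carrier N) \<and>
     (\<forall>u\<in>carrier M. \<forall>v\<in>carrier M. \<phi> (u \<oplus>\<^bsub>M\<^esub> v) = \<phi> u \<oplus>\<^bsub>N\<^esub> \<phi> v) \<and>
     (\<forall>c. \<forall>v\<in>carrier M. \<phi> (c \<odot>\<^bsub>M\<^esub> v) = c \<odot>\<^bsub>N\<^esub> \<phi> v) \<and>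
     (\<forall>g\<in>carrier G. \<forall>v\<in>carrier M. \<phi> (act M g v) = act N g (\<phi> v)))"

definition subrep :: "('g, 'b) monoid_scheme \<Rightarrow> ('v, 'g) rep \<Rightarrow> 'v set \<Rightarrow> bool" where
  "subrep G M U \<longleftrightarrow> submodule U rat_field M \<and> (\<forall>g\<in>carrier G. \<forall>u\<in>U. act M g u \<in> U)"

definition irreducible_rep :: "('g, 'b) monoid_scheme \<Rightarrow> ('v, 'g) rep \<Rightarrow> bool" where
  "irreducible_rep G M \<longleftrightarrow> carrier M \<noteq> {\<zero>\<^bsub>M\<^esub>} \<and>
     (\<forall>U. subrep G M U \<longrightarrow> U = {\<zero>\<^bsub>M\<^esub>} \<or> U = carrier M)"

definition irreducible_decomposition ::
    "('g, 'b) monoid_scheme \<Rightarrow> ('v, 'g) rep \<Rightarrow> nat \<Rightarrow> (nat \<Rightarrow> 'v set) \<Rightarrow> bool" where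
  "irreducible_decomposition G M r U \<longleftrightarrow>
     (\<forall>i<r. subrep G M (U i) \<and> irreducible_rep G (M\<lparr>carrier := U i\<rparr>)) \<and>
     (\<forall>v\<in>carrier M. \<exists>!x. x \<in> (\<Pi>\<^sub>E i\<in>{..<r}. U i) \<and> v = (\<Oplus>\<^bsub>M\<^esub>i\<in>{..<r}. x i))"

text \<open>
  The multiplicity of an irreducible representation \<open>V\<close> in \<open>M\<close>: the number of summands isomorphic
  to \<open>V\<close> in a decomposition of \<open>M\<close> into irreducibles. For finite groups and finite-dimensional \<open>M\<close>
  a decomposition exists and this number does not depend on it.
\<close>

definition rep_multiplicity ::
    "('g, 'b) monoid_scheme \<Rightarrow> ('v, 'g) rep \<Rightarrow> ('w, 'g) rep \<Rightarrow> nat" where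
  "rep_multiplicity G V M = (THE m. \<exists>r U. irreducible_decomposition G M r U \<and>
     m = card {i. i < r \<and> rep_iso G (M\<lparr>carrier := U i\<rparr>) V})"

text \<open>Virtual representations: formal integer combinations, as lists of coefficient-term pairs.\<close>

type_synonym ('v, 'g) virtual_rep = "(int \<times> ('v, 'g) rep) list"

definition virtual_multiplicity ::
    "('g, 'b) monoid_scheme \<Rightarrow> ('v, 'g) rep \<Rightarrow> ('w, 'g) virtual_rep \<Rightarrow> int" where
  "virtual_multiplicity G V L = (\<Sum>(c, M)\<leftarrow>L. c * int (rep_multiplicity G V M))"


section \<open>Constructions of representations\<close>

definition change_act :: "('v, 'g) rep \<Rightarrow> ('h \<Rightarrow> 'v \<Rightarrow> 'v) \<Rightarrow> ('v, 'h) rep" where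
  "change_act M a = \<lparr>carrier = carrier M, mult = mult M, one = one M, ring.zero = ring.zero M,
     ring.add = ring.add M, smult = smult M, act = a\<rparr>"

definition pullback_rep :: "('h \<Rightarrow> 'g) \<Rightarrow> ('v, 'g) rep \<Rightarrow> ('v, 'h) rep" where
  "pullback_rep \<phi> M = change_act M (\<lambda>h. act M (\<phi> h))"

text \<open>Tensor product with the one-dimensional representation on which \<open>g\<close> acts as \<open>\<epsilon> g\<close>.\<close>

definition twist_rep :: "('g \<Rightarrow> rat) \<Rightarrow> ('v, 'g) rep \<Rightarrow> ('v, 'g) rep" where
  "twist_rep \<epsilon> M = change_act M (\<lambda>g v. \<epsilon> g \<odot>\<^bsub>M\<^esub> act M g v)"

definition fun_rep ::
    "('x \<Rightarrow> rat) set \<Rightarrow> ('g \<Rightarrow> ('x \<Rightarrow> rat) \<Rightarrow> ('x \<Rightarrow> rat)) \<Rightarrow> ('x \<Rightarrow> rat, 'g) rep" where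
  "fun_rep V a = \<lparr>carrier = V, mult = undefined, one = undefined, ring.zero = (\<lambda>_. 0),
     ring.add = (\<lambda>f h x. f x + h x), smult = (\<lambda>c f x. c * f x), act = a\<rparr>"

text \<open>
  External tensor product of representations realised on spaces of functions on \<open>'x\<close> and \<open>'y\<close>,
  realised as the span of the functions \<open>(x, y) \<mapsto> u x * v y\<close>. The pair \<open>(g, h)\<close> acts by \<open>g\<close> in the
  first variable followed by \<open>h\<close> in the second one, so that \<open>u \<otimes> v \<mapsto> g u \<otimes> h v\<close>.
\<close>

definition ext_tensor ::
    "('x \<Rightarrow> rat, 'g) rep \<Rightarrow> ('y \<Rightarrow> rat, 'h) rep \<Rightarrow> ('x \<times> 'y \<Rightarrow> rat, 'g \<times> 'h) rep" where
  "ext_tensor M N = fun_rep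
     {(\<lambda>(x, y). \<Sum>i<r. u i x * v i y) | (r :: nat) u v.
        (\<forall>i<r. u i \<in> carrier M) \<and> (\<forall>i<r. v i \<in> carrier N)}
     (\<lambda>(g, h) F (x, y). act N h (\<lambda>y'. act M g (\<lambda>x'. F (x', y')) x) y)"

text \<open>
  Induction from \<open>H\<close> to \<open>G\<close> along an injective homomorphism \<open>\<iota>\<close>, as the space of functions
  \<open>f : G \<rightarrow> M\<close> with \<open>f (g \<iota>(h)) = h\<^sup>-\<^sup>1 f g\<close>, on which \<open>G\<close> acts by left translation.
\<close>

definition ind_rep :: "('g, 'b) monoid_scheme \<Rightarrow> ('h, 'c) monoid_scheme \<Rightarrow> ('h \<Rightarrow> 'g) \<Rightarrow>
    ('v, 'h) rep \<Rightarrow> ('g \<Rightarrow> 'v, 'g) rep" where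
  "ind_rep G H \<iota> M =
     \<lparr>carrier = {f \<in> carrier G \<rightarrow>\<^sub>E carrier M.
        \<forall>g\<in>carrier G. \<forall>h\<in>carrier H. f (g \<otimes>\<^bsub>G\<^esub> \<iota> h) = act M (inv\<^bsub>H\<^esub> h) (f g)},
      mult = undefined, one = undefined,
      ring.zero = (\<lambda>g\<in>carrier G. \<zero>\<^bsub>M\<^esub>),
      ring.add = (\<lambda>f f'. \<lambda>g\<in>carrier G. f g \<oplus>\<^bsub>M\<^esub> f' g),
      smult = (\<lambda>c f. \<lambda>g\<in>carrier G. c \<odot>\<^bsub>M\<^esub> f g),
      act = (\<lambda>x f. \<lambda>g\<in>carrier G. f (inv\<^bsub>G\<^esub> x \<otimes>\<^bsub>G\<^esub> g))\<rparr>"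

text \<open>
  The elements of the quotient are the cosets of \<open>B\<close>. In the scalar multiplication, \<open>B\<close> is added so
  that the result is a full coset also for the scalar 0.
\<close>

definition quotient_rep :: "('v, 'g) rep \<Rightarrow> 'v set \<Rightarrow> ('v set, 'g) rep" where
  "quotient_rep M B = \<lparr>carrier = a_rcosets\<^bsub>M\<^esub> B, mult = undefined, one = undefined,
     ring.zero = B, ring.add = (\<lambda>C D. C <+>\<^bsub>M\<^esub> D),
     smult = (\<lambda>c C. B <+>\<^bsub>M\<^esub> ((\<lambda>x. c \<odot>\<^bsub>M\<^esub> x) ` C)),
     act = (\<lambda>g C. act M g ` C)\<rparr>"


section \<open>Irreducible representations of symmetric groups\<close>

definition is_partition :: "nat list \<Rightarrow> bool" where
  "is_partition l \<longleftrightarrow> sorted_wrt (\<ge>) l \<and> 0 \<notin> set l"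

text \<open>
  The row and column of the entry \<open>m \<in> {1..sum_list l}\<close> in the Young tableau of shape \<open>l\<close> whose
  rows are filled consecutively with 1, 2, 3, ... (rows counted from 0, columns from 1).
\<close>

definition tableau_row :: "nat list \<Rightarrow> nat \<Rightarrow> nat" where
  "tableau_row l m = (LEAST i. m \<le> sum_list (take (Suc i) l))"

definition tableau_col :: "nat list \<Rightarrow> nat \<Rightarrow> nat" where
  "tableau_col l m = m - sum_list (take (tableau_row l m) l)"

text \<open>Elements of the rational group algebra are functions that vanish outside of the group.\<close>

definition conv ::
    "('g, 'b) monoid_scheme \<Rightarrow> ('g \<Rightarrow> rat) \<Rightarrow> ('g \<Rightarrow> rat) \<Rightarrow> ('g \<Rightarrow> rat)" where
  "conv G a b = (\<lambda>g. if g \<in> carrier G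
     then \<Sum>x\<in>carrier G. a x * b (inv\<^bsub>G\<^esub> x \<otimes>\<^bsub>G\<^esub> g) else 0)"

definition row_sum :: "nat list \<Rightarrow> (nat \<Rightarrow> nat) \<Rightarrow> rat" where
  "row_sum l p = (if p permutes {1..sum_list l} \<and>
       (\<forall>m\<in>{1..sum_list l}. tableau_row l (p m) = tableau_row l m) then 1 else 0)"

definition col_signed_sum :: "nat list \<Rightarrow> (nat \<Rightarrow> nat) \<Rightarrow> rat" where
  "col_signed_sum l p = (if p permutes {1..sum_list l} \<and>
       (\<forall>m\<in>{1..sum_list l}. tableau_col l (p m) = tableau_col l m) then of_int (sign p) else 0)"

definition young_symmetrizer :: "nat list \<Rightarrow> (nat \<Rightarrow> nat) \<Rightarrow> rat" where
  "young_symmetrizer l = conv (sym_group (sum_list l)) (row_sum l) (col_signed_sum l)"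

text \<open>
  The irreducible representation of type \<open>l\<close>: the left ideal of the group algebra generated by the
  Young symmetrizer. In this convention \<open>[n]\<close> gives the trivial representation.
\<close>

definition sym_irrep :: "nat list \<Rightarrow> ((nat \<Rightarrow> nat) \<Rightarrow> rat, nat \<Rightarrow> nat) rep" where
  "sym_irrep l = (let G = sym_group (sum_list l) in
     fun_rep {conv G a (young_symmetrizer l) | a. True}
       (\<lambda>g f x. if x \<in> carrier G then f (inv\<^bsub>G\<^esub> g \<otimes>\<^bsub>G\<^esub> x) else 0))"


section \<open>Hyperoctahedral groups and their irreducible representations\<close>

text \<open>
  The pair \<open>(s, p)\<close> stands for the signed permutation matrix with \<open>e\<^sub>i \<mapsto> s (p i) e\<^bsub>p i\<^esub>\<close>.
\<close>

type_synonym signed_perm = "(nat \<Rightarrow> int) \<times> (nat \<Rightarrow> nat)"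

definition hyperoct :: "nat \<Rightarrow> signed_perm monoid" where
  "hyperoct n =
     \<lparr>carrier = {(s, p). p permutes {1..n} \<and> (\<forall>i\<in>{1..n}. s i \<in> {1, -1}) \<and> (\<forall>i. i \<notin> {1..n} \<longrightarrow> s i = 1)},
      mult = (\<lambda>(s, p) (t, q). (\<lambda>i. s i * t (inv_into UNIV p i), p \<circ> q)),
      one = (\<lambda>_. 1, id)\<rparr>"

definition nu :: "nat \<Rightarrow> signed_perm \<Rightarrow> rat" where
  "nu n = (\<lambda>(s, p). of_int (\<Prod>i\<in>{1..n}. s i))"

text \<open>\<open>V\<^bsub>(l,0)\<^esub>\<close> and \<open>V\<^bsub>(0,l)\<^esub>\<close>\<close>

definition hyperoct_plus :: "nat list \<Rightarrow> ((nat \<Rightarrow> nat) \<Rightarrow> rat, signed_perm) rep" where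
  "hyperoct_plus l = pullback_rep snd (sym_irrep l)"

definition hyperoct_minus :: "nat list \<Rightarrow> ((nat \<Rightarrow> nat) \<Rightarrow> rat, signed_perm) rep" where
  "hyperoct_minus l = twist_rep (nu (sum_list l)) (hyperoct_plus l)"

text \<open>
  The block inclusion of \<open>hyperoct k \<times> hyperoct m\<close> into \<open>hyperoct (k + m)\<close>: the first factor acts
  on the coordinates \<open>1..k\<close>, the second one on \<open>k+1..k+m\<close>.
\<close>

definition block_incl :: "nat \<Rightarrow> signed_perm \<times> signed_perm \<Rightarrow> signed_perm" where
  "block_incl k = (\<lambda>((s, p), (t, q)).
     (\<lambda>i. if i \<le> k then s i else t (i - k), \<lambda>i. if i \<le> k then p i else q (i - k) + k))"

definition hyperoct_irrep :: "nat list \<Rightarrow> nat list \<Rightarrow>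
    (signed_perm \<Rightarrow> (nat \<Rightarrow> nat) \<times> (nat \<Rightarrow> nat) \<Rightarrow> rat, signed_perm) rep" where
  "hyperoct_irrep lp lm = (let k = sum_list lp; m = sum_list lm in
     ind_rep (hyperoct (k + m)) (hyperoct k \<times>\<times> hyperoct m) (block_incl k)
       (ext_tensor (hyperoct_plus lp) (hyperoct_minus lm)))"

text \<open>
  \<open>V(\<lambda>)\<^sub>n\<close> for the double partition \<open>\<lambda> = (lp, lm)\<close> of \<open>k = sum_list lp + sum_list lm\<close>. It is
  meaningful for \<open>n \<ge> k + \<lambda>\<^sup>+\<^sub>1\<close> only; it is used for large \<open>n\<close> only.
\<close>

definition stable_irrep :: "nat list \<Rightarrow> nat list \<Rightarrow> nat \<Rightarrow>
    (signed_perm \<Rightarrow> (nat \<Rightarrow> nat) \<times> (nat \<Rightarrow> nat) \<Rightarrow> rat, signed_perm) rep" where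
  "stable_irrep lp lm n = hyperoct_irrep ((n - (sum_list lp + sum_list lm)) # lp) lm"

definition multiplicity_stable :: "(nat \<Rightarrow> ('v, signed_perm) virtual_rep) \<Rightarrow> bool" where
  "multiplicity_stable L \<longleftrightarrow> (\<forall>lp lm. is_partition lp \<longrightarrow> is_partition lm \<longrightarrow>
     (\<exists>c. \<forall>\<^sub>F n in sequentially. virtual_multiplicity (hyperoct n) (stable_irrep lp lm n) (L n) = c))"


section \<open>Homology of the order complex of a finite family of sets\<close>

text \<open>
  The \<open>i\<close>-simplices of the geometric realization of a family \<open>P\<close> of sets, ordered by inclusion.
\<close>

definition order_simplices :: "'a set set \<Rightarrow> nat \<Rightarrow> 'a set set set" where
  "order_simplices P i = {\<sigma>. finite \<sigma> \<and> card \<sigma> = Suc i \<and> subset.chain P \<sigma>}"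

definition order_chains :: "'a set set \<Rightarrow> nat \<Rightarrow> ('a set set \<Rightarrow> rat) set" where
  "order_chains P i = {c. \<forall>\<sigma>. \<sigma> \<notin> order_simplices P i \<longrightarrow> c \<sigma> = 0}"

text \<open>
  Simplices are oriented by the inclusion order of their vertices, so the vertex \<open>x\<close> of \<open>\<sigma>\<close> has
  number \<open>card {y \<in> \<sigma>. y \<subset> x}\<close>. In degree 0 the boundary is 0: homology is not reduced.
\<close>

definition order_boundary ::
    "'a set set \<Rightarrow> nat \<Rightarrow> ('a set set \<Rightarrow> rat) \<Rightarrow> ('a set set \<Rightarrow> rat)" where
  "order_boundary P i c = (\<lambda>\<tau>. if i = 0 then 0 else
     \<Sum>\<sigma>\<in>order_simplices P i. \<Sum>x\<in>{x\<in>\<sigma>. \<sigma> - {x} = \<tau>}. (-1) ^ card {y\<in>\<sigma>. y \<subset> x} * c \<sigma>)"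

definition order_cycles :: "'a set set \<Rightarrow> nat \<Rightarrow> ('a set set \<Rightarrow> rat) set" where
  "order_cycles P i = {c \<in> order_chains P i. order_boundary P i c = (\<lambda>_. 0)}"

definition order_boundaries :: "'a set set \<Rightarrow> nat \<Rightarrow> ('a set set \<Rightarrow> rat) set" where
  "order_boundaries P i = order_boundary P (Suc i) ` order_chains P (Suc i)"

text \<open>
  \<open>G\<close> acts on the points by \<open>\<alpha>\<close>, hence on sets of points, on chains of sets, and on functions on
  chains of sets. The action preserves inclusions and hence the orientations: there are no signs.
\<close>

definition homology_rep :: "('g, 'b) monoid_scheme \<Rightarrow> ('g \<Rightarrow> 'a \<Rightarrow> 'a) \<Rightarrow> 'a set set \<Rightarrow> nat \<Rightarrow>
    (('a set set \<Rightarrow> rat) set, 'g) rep" where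
  "homology_rep G \<alpha> P i = quotient_rep
     (fun_rep (order_cycles P i) (\<lambda>g c \<sigma>. c ((\<lambda>F. \<alpha> (inv\<^bsub>G\<^esub> g) ` F) ` \<sigma>)))
     (order_boundaries P i)"

text \<open>A finite \<open>P\<close> has no \<open>i\<close>-simplices, and hence no homology in degree \<open>i\<close>, for \<open>i \<ge> card P\<close>.\<close>

definition lefschetz_rep :: "('g, 'b) monoid_scheme \<Rightarrow> ('g \<Rightarrow> 'a \<Rightarrow> 'a) \<Rightarrow> 'a set set \<Rightarrow>
    (('a set set \<Rightarrow> rat) set, 'g) virtual_rep" where
  "lefschetz_rep G \<alpha> P = map (\<lambda>i. ((-1) ^ i, homology_rep G \<alpha> P i)) [0..<card P]"


section \<open>Rank-selected posets of faces of cross-polytopes\<close>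

text \<open>
  \<open>\<real>\<^sup>n\<close> is the subspace of \<open>nat \<Rightarrow>\<^sub>0 real\<close> of vectors supported on \<open>{1..n}\<close>.
\<close>

definition cross_polytope :: "nat \<Rightarrow> (nat \<Rightarrow>\<^sub>0 real) set" where
  "cross_polytope n = convex hull
     ((\<lambda>i. Poly_Mapping.single i 1) ` {1..n} \<union> (\<lambda>i. - Poly_Mapping.single i 1) ` {1..n})"

text \<open>
  \<open>aff_dim F = int d\<close>, with the definition of \<open>aff_dim\<close>, which the library restricts to Euclidean
  spaces. The empty face has no dimension in this sense.
\<close>

definition has_aff_dim :: "'a::real_vector set \<Rightarrow> nat \<Rightarrow> bool" where
  "has_aff_dim F d \<longleftrightarrow>
     (\<exists>B. affine hull B = affine hull F \<and> \<not> affine_dependent B \<and> card B = Suc d)"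

definition rank_selected :: "nat set \<Rightarrow> nat \<Rightarrow> (nat \<Rightarrow>\<^sub>0 real) set set" where
  "rank_selected S n =
     {F. F face_of cross_polytope n \<and> (\<exists>d\<in>S. has_aff_dim F d)} \<union> {{}, cross_polytope n}"

definition hyperoct_act :: "signed_perm \<Rightarrow> (nat \<Rightarrow>\<^sub>0 real) \<Rightarrow> (nat \<Rightarrow>\<^sub>0 real)" where
  "hyperoct_act = (\<lambda>(s, p) x. \<Sum>i\<in>Poly_Mapping.keys x.
     Poly_Mapping.single (p i) (of_int (s (p i)) * Poly_Mapping.lookup x i))"

text \<open>
  The realization of all of \<open>rank_selected S n\<close>, as a poset with least element \<open>{}\<close> and greatest
  element \<open>cross_polytope n\<close>, is a cone. For bounded posets it is a common convention to take the
  realization of the proper part instead. Both versions are defined.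
\<close>

definition lefschetz_cross :: "nat set \<Rightarrow> nat \<Rightarrow>
    (((nat \<Rightarrow>\<^sub>0 real) set set \<Rightarrow> rat) set, signed_perm) virtual_rep" where
  "lefschetz_cross S n = lefschetz_rep (hyperoct n) hyperoct_act (rank_selected S n)"

definition lefschetz_cross_proper :: "nat set \<Rightarrow> nat \<Rightarrow>
    (((nat \<Rightarrow>\<^sub>0 real) set set \<Rightarrow> rat) set, signed_perm) virtual_rep" where
  "lefschetz_cross_proper S n =
     lefschetz_rep (hyperoct n) hyperoct_act (rank_selected S n - {{}, cross_polytope n})"

end

theory Submission
  imports Defs "HOL-Library.Function_Algebras"
begin

text \<open>
  Multiplicities become dimensions. Let \<open>A\<close> be the sum over a row group weighted by a character with
  values \<open>1\<close> and \<open>-1\<close>, \<open>B\<close> the corresponding signed sum over a column group, and \<open>E = B A\<close>. As for Young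
  symmetrizers, \<open>B g A\<close> is a scalar multiple of \<open>E\<close> for every group element \<open>g\<close> (locale
  \<open>char_pair\<close>). So \<open>E\<close> has rank at most one on every irreducible representation, it is nonzero on one
  isomorphism class only, and the multiplicity of this class in a permutation representation \<open>H\<close> is
  \<open>dim (E H)\<close> (\<open>rep_multiplicity_eq_dim\<close>). For the hyperoctahedral group, a pair of tableaux gives such
  groups: all sign changes are included, with the character that multiplies the signs in the second
  tableau (\<open>char_pair_labelling\<close>). The class that is detected is that of the left ideal generated by
  \<open>A B\<close>; evaluating its elements on the cosets of the block subgroup identifies it with the induced
  representation \<open>V\<^bsub>(\<lambda>\<^sup>+,\<lambda>\<^sup>-)\<^esub>\<close> (\<open>pair_ideal_iso_Ind\<close>).

  Homology becomes chains. Over the rationals a homology group is isomorphic to the invariant space of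
  cycles orthogonal to the boundaries, so that \<open>dim (E -)\<close> is additive along the chain complex, and the
  Euler characteristic argument replaces the multiplicity in the Lefschetz representation by the
  alternating sum of \<open>dim (E C\<^sub>i)\<close> over the spaces \<open>C\<^sub>i\<close> of functions on the \<open>i\<close>-simplices
  (\<open>virtual_multiplicity_lefschetz\<close>).

  Each \<open>dim (E C\<^sub>i)\<close> stabilizes. A proper nonempty face of the cross-polytope is the hull of a set of
  vertices without antipodes, and its dimension is one less than the number of these vertices. So the
  selected faces for \<open>n\<close> are exactly the selected faces for \<open>n + 1\<close> that do not involve the coordinate
  \<open>n + 1\<close>, and all members of a chain together involve at most \<open>d\<close> coordinates, where \<open>d\<close> depends on
  \<open>S\<close> only. After a relabelling, the tableaux for \<open>n + 1\<close> arise from those for \<open>n\<close> by putting \<open>n + 1\<close> at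
  the end of the long first row. Restriction of functions from the simplices for \<open>n + 1\<close> to those for \<open>n\<close>
  then maps one image of \<open>E\<close> isomorphically onto the other: a coordinate that a chain does not involve
  can be exchanged with \<open>n + 1\<close> by an element of the row group, and if \<open>n\<close> is large there is one in the
  part of the first row that lies beyond all other rows (\<open>dim_lab_op_Suc\<close>).
\<close>

section \<open>Spaces of rational functions\<close>

definition fscale :: "rat \<Rightarrow> ('x \<Rightarrow> rat) \<Rightarrow> 'x \<Rightarrow> rat" where
  "fscale c f = (\<lambda>x. c * f x)"

lemma fscale_apply: "fscale c f x = c * f x"
  by (simp add: fscale_def)

text \<open>
  Functions are treated as vectors. Evaluation at a point is a simplification only where it is asked for.
\<close>

declare plus_fun_apply [simp del] zero_fun_apply [simp del] minus_apply [simp del]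
  uminus_apply [simp del]

lemmas pointwise = plus_fun_apply zero_fun_apply minus_apply uminus_apply fscale_apply

lemma sum_fun_apply: "(sum f A) x = (\<Sum>a\<in>A. f a x)"
  for f :: "'a \<Rightarrow> 'x \<Rightarrow> 'b::comm_monoid_add"
  by (induction A rule: infinite_finite_induct) (auto simp: pointwise)

interpretation fs: vector_space "fscale :: rat \<Rightarrow> ('x \<Rightarrow> rat) \<Rightarrow> 'x \<Rightarrow> rat"
  by unfold_locales (auto simp: pointwise fun_eq_iff algebra_simps)

interpretation fsp: vector_space_pair "fscale :: rat \<Rightarrow> ('x \<Rightarrow> rat) \<Rightarrow> 'x \<Rightarrow> rat"
  "fscale :: rat \<Rightarrow> ('y \<Rightarrow> rat) \<Rightarrow> 'y \<Rightarrow> rat"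
  by unfold_locales

definition flinear :: "(('x \<Rightarrow> rat) \<Rightarrow> ('y \<Rightarrow> rat)) \<Rightarrow> bool" where
  "flinear \<phi> \<longleftrightarrow> (\<forall>f g. \<phi> (f + g) = \<phi> f + \<phi> g) \<and> (\<forall>c f. \<phi> (fscale c f) = fscale c (\<phi> f))"

lemma flinear_iff_linear: "flinear \<phi> \<longleftrightarrow> Vector_Spaces.linear fscale fscale \<phi>"
  unfolding flinear_def Vector_Spaces.linear_iff by (simp add: fs.vector_space_axioms)

lemma flinear_add: "flinear \<phi> \<Longrightarrow> \<phi> (f + g) = \<phi> f + \<phi> g"
  and flinear_scale: "flinear \<phi> \<Longrightarrow> \<phi> (fscale c f) = fscale c (\<phi> f)"
  by (auto simp: flinear_def)

lemma flinear_zero: "flinear \<phi> \<Longrightarrow> \<phi> 0 = 0"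
  by (metis flinear_scale fs.scale_zero_left)

lemma flinear_diff: "flinear \<phi> \<Longrightarrow> \<phi> (f - g) = \<phi> f - \<phi> g"
  by (metis add_diff_cancel diff_add_cancel flinear_add)

lemma flinear_sum: "flinear \<phi> \<Longrightarrow> \<phi> (sum f A) = (\<Sum>a\<in>A. \<phi> (f a))"
  by (induction A rule: infinite_finite_induct) (auto simp: flinear_zero flinear_add)

lemma flinear_comp: "flinear \<phi> \<Longrightarrow> flinear \<psi> \<Longrightarrow> flinear (\<lambda>f. \<phi> (\<psi> f))"
  by (auto simp: flinear_def)

lemma flinear_image_subspace: "flinear \<phi> \<Longrightarrow> fs.subspace U \<Longrightarrow> fs.subspace (\<phi> ` U)"
  by (simp add: flinear_iff_linear fsp.linear_subspace_image)

definition supp_on :: "'x set \<Rightarrow> ('x \<Rightarrow> rat) set" where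
  "supp_on D = {f. \<forall>x. x \<notin> D \<longrightarrow> f x = 0}"

definition delta :: "'x \<Rightarrow> 'x \<Rightarrow> rat" where
  "delta x = (\<lambda>y. if y = x then 1 else 0)"

lemma supp_on_eq_span: assumes "finite D" shows "supp_on D = fs.span (delta ` D)"
proof
  show "supp_on D \<subseteq> fs.span (delta ` D)"
  proof
    fix f assume f: "f \<in> supp_on D"
    have "f = (\<Sum>x\<in>D. fscale (f x) (delta x))"
    proof
      fix y
      have "(\<Sum>x\<in>D. fscale (f x) (delta x)) y = (\<Sum>x\<in>D. if y = x then f x else 0)"
        by (simp add: sum_fun_apply pointwise delta_def if_distrib cong: if_cong)
      also have "\<dots> = f y"
        using f assms by (auto simp: supp_on_def)
      finally show "f y = (\<Sum>x\<in>D. fscale (f x) (delta x)) y" ..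
    qed
    moreover have "(\<Sum>x\<in>D. fscale (f x) (delta x)) \<in> fs.span (delta ` D)"
      by (intro fs.span_sum fs.span_scale fs.span_base imageI)
    ultimately show "f \<in> fs.span (delta ` D)" by simp
  qed
next
  have "fs.subspace (supp_on D)"
    by (auto simp: fs.subspace_def supp_on_def pointwise)
  then show "fs.span (delta ` D) \<subseteq> supp_on D"
    by (rule fs.span_minimal[rotated]) (auto simp: supp_on_def delta_def)
qed

lemma subspace_supp_on: "fs.subspace (supp_on D)"
  by (auto simp: fs.subspace_def supp_on_def pointwise)

lemma finite_basis:
  assumes "finite D" "fs.subspace U" "U \<subseteq> supp_on D"
  obtains b where "finite b" "b \<subseteq> U" "fs.independent b" "fs.span b = U" "card b = fs.dim U"
proof -
  obtain b where b: "b \<subseteq> U" "fs.independent b" "U \<subseteq> fs.span b" "card b = fs.dim U"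
    using fs.basis_exists by blast
  have "finite b"
    using fs.independent_span_bound[of "delta ` D" b] b assms supp_on_eq_span[of D] by auto
  moreover have "fs.span b = U"
    using b assms fs.span_minimal by blast
  ultimately show thesis using b that by blast
qed

lemma dim_inj_image:
  assumes "flinear \<phi>" "inj_on \<phi> U" "fs.subspace U"
  shows "fs.dim (\<phi> ` U) = fs.dim U"
proof -
  obtain b where b: "b \<subseteq> U" "fs.independent b" "U \<subseteq> fs.span b" "card b = fs.dim U"
    using fs.basis_exists by blast
  have sp: "fs.span b = U"
    using b assms fs.span_minimal by blast
  have lin: "Vector_Spaces.linear fscale fscale \<phi>"
    using assms flinear_iff_linear by blast
  have ind: "fs.independent (\<phi> ` b)"
    using fsp.linear_independent_injective_image[OF lin b(2)] assms sp by simp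
  have "card (\<phi> ` b) = card b"
    using assms(2) b(1) by (meson card_image inj_on_subset)
  then show ?thesis
    using fs.dim_unique[of "\<phi> ` b" "\<phi> ` U"] ind b sp fsp.linear_span_image[OF lin, of b] by force
qed

lemma dim_psubspace:
  assumes "finite D" "fs.subspace U" "fs.subspace W" "W \<subseteq> supp_on D" "U \<subset> W"
  shows "fs.dim U < fs.dim W"
proof -
  obtain b where b: "finite b" "b \<subseteq> U" "fs.independent b" "fs.span b = U" "card b = fs.dim U"
    using finite_basis[of D U] assms by blast
  obtain c where c: "finite c" "c \<subseteq> W" "fs.independent c" "fs.span c = W" "card c = fs.dim W"
    using finite_basis[of D W] assms by blast
  obtain a where a: "a \<in> W" "a \<notin> U" using assms by blast
  have "fs.independent (insert a b)"
    using a b fs.independent_insertI by metis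
  moreover have "insert a b \<subseteq> fs.span c" using a b c assms by blast
  ultimately have "card (insert a b) \<le> card c"
    using fs.independent_span_bound[OF c(1)] by blast
  moreover have "a \<notin> b" using a b by blast
  ultimately show ?thesis using b c by simp
qed

lemma dim_direct_sum:
  assumes "finite D" "fs.subspace U" "fs.subspace W" "U \<subseteq> supp_on D" "W \<subseteq> supp_on D"
    and int: "U \<inter> W \<subseteq> {0}"
  shows "fs.dim {u + w | u w. u \<in> U \<and> w \<in> W} = fs.dim U + fs.dim W"
proof -
  obtain b where b: "finite b" "b \<subseteq> U" "fs.independent b" "fs.span b = U" "card b = fs.dim U"
    using finite_basis[of D U] assms by blast
  obtain c where c: "finite c" "c \<subseteq> W" "fs.independent c" "fs.span c = W" "card c = fs.dim W"
    using finite_basis[of D W] assms by blast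
  have disj: "b \<inter> c = {}"
    using b c int fs.dependent_zero by blast
  have "fs.independent (b \<union> c)"
  proof (rule fs.independent_if_scalars_zero)
    show "finite (b \<union> c)" using b c by simp
    fix f x assume z: "(\<Sum>x\<in>b \<union> c. fscale (f x) x) = 0" and x: "x \<in> b \<union> c"
    let ?B = "\<Sum>x\<in>b. fscale (f x) x" and ?C = "\<Sum>x\<in>c. fscale (f x) x"
    have s: "?B + ?C = 0"
      using z by (simp add: sum.union_disjoint b c disj)
    have "?B \<in> fs.span b" "?C \<in> fs.span c"
      by (intro fs.span_sum fs.span_scale fs.span_base; assumption)+
    then have B: "?B \<in> U" and C: "?C \<in> W"
      by (simp_all add: b c)
    have "?B = - ?C" using s by (rule eq_neg_iff_add_eq_0[THEN iffD2])
    then have "?B \<in> W" using fs.subspace_neg[OF assms(3) C] by (simp only:)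
    then have B0: "?B = 0" using B int by blast
    have C0: "?C = 0" using s unfolding B0 by (simp only: add_0_left)
    show "f x = 0"
      using x fs.independentD[OF b(3) b(1) subset_refl B0] fs.independentD[OF c(3) c(1) subset_refl C0]
      by blast
  qed
  moreover have "fs.span (b \<union> c) = {u + w | u w. u \<in> U \<and> w \<in> W}"
    by (simp add: fs.span_Un b c)
  ultimately show ?thesis
    by (metis b(1,5) c(1,5) card_Un_disjoint disj fs.dim_span_eq_card_independent)
qed

definition ip :: "'x set \<Rightarrow> ('x \<Rightarrow> rat) \<Rightarrow> ('x \<Rightarrow> rat) \<Rightarrow> rat" where
  "ip D f g = (\<Sum>x\<in>D. f x * g x)"

lemma ip_commute: "ip D f h = ip D h f"
  by (simp add: ip_def mult.commute)

lemma ip_add_left: "ip D (f + g) h = ip D f h + ip D g h"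
  by (simp add: ip_def pointwise distrib_right sum.distrib)

lemma ip_diff_left: "ip D (f - g) h = ip D f h - ip D g h"
  by (simp add: ip_def pointwise left_diff_distrib sum_subtractf)

lemma ip_scale_left: "ip D (fscale c f) h = c * ip D f h"
  by (simp add: ip_def pointwise sum_distrib_left mult.assoc)

lemma ip_zero_left [simp]: "ip D 0 h = 0"
  by (simp add: ip_def pointwise)

lemma ip_zero_right [simp]: "ip D h 0 = 0"
  by (simp add: ip_def pointwise)

lemma ip_add_right: "ip D h (f + g) = ip D h f + ip D h g"
  using ip_add_left[of D f g h] by (simp only: ip_commute[of D _ h])

lemma ip_scale_right: "ip D h (fscale c f) = c * ip D h f"
  using ip_scale_left[of D c f h] by (simp only: ip_commute[of D _ h])

lemma ip_sum_left: "ip D (sum f A) h = (\<Sum>a\<in>A. ip D (f a) h)"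
  by (induction A rule: infinite_finite_induct) (auto simp: ip_add_left)

lemma ip_sum_right: "ip D h (sum f A) = (\<Sum>a\<in>A. ip D h (f a))"
  by (induction A rule: infinite_finite_induct) (auto simp: ip_add_right)

lemma ip_self_zero:
  assumes "finite D" "f \<in> supp_on D" "ip D f f = 0"
  shows "f = 0"
proof -
  have "\<forall>x\<in>D. f x * f x = 0"
    using assms(1,3) sum_nonneg_eq_0_iff[of D "\<lambda>x. f x * f x"] by (simp add: ip_def)
  then show ?thesis using assms(2) by (fastforce simp: supp_on_def pointwise)
qed

text \<open>
  The standard inner product is anisotropic over the rationals, so orthogonal projections exist although
  lengths need not: the vectors of a finite generating set are made orthogonal one after the other.
\<close>

lemma orthogonal_projection:
  assumes "finite D" "fs.subspace U" "U \<subseteq> supp_on D"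
  obtains u where "u \<in> U" "\<And>w. w \<in> U \<Longrightarrow> ip D (f - u) w = 0"
proof -
  obtain b where b: "finite b" "b \<subseteq> U" "fs.span b = U"
    using finite_basis[of D U] assms by metis
  have "b \<subseteq> supp_on D \<Longrightarrow> \<forall>f. \<exists>u\<in>fs.span b. \<forall>w\<in>fs.span b. ip D (f - u) w = 0"
    using b(1)
  proof (induction b)
    case empty
    then show ?case by simp
  next
    case (insert a b)
    then obtain u where u: "u \<in> fs.span b" "\<forall>w\<in>fs.span b. ip D (a - u) w = 0"
      by blast
    define a' where "a' = a - u"
    have a'_b: "ip D a' w = 0" "ip D w a' = 0" if "w \<in> fs.span b" for w
      using u(2) that by (simp_all add: a'_def ip_commute[of D w])
    have sub: "fs.span b \<subseteq> fs.span (insert a b)"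
      by (simp add: fs.span_mono subset_insertI)
    have a'_in: "a' \<in> fs.span (insert a b)"
      unfolding a'_def by (meson u(1) sub fs.span_diff fs.span_base insertI1 subsetD)
    have "fs.span (insert a b) \<subseteq> supp_on D"
      using insert.prems fs.span_minimal subspace_supp_on by blast
    then have a'_supp: "a' \<in> supp_on D" using a'_in by blast
    show ?case
    proof
      fix f
      obtain v where v: "v \<in> fs.span b" "\<forall>w\<in>fs.span b. ip D (f - v) w = 0"
        using insert by blast
      define c where "c = ip D f a' / ip D a' a'"
      have c: "ip D f a' = c * ip D a' a'"
        using ip_self_zero[OF assms(1) a'_supp] unfolding c_def
        by (cases "ip D a' a' = 0") auto
      have "ip D (f - (v + fscale c a')) w = 0" if "w \<in> fs.span (insert a b)" for w
      proof -
        obtain k where "w - fscale k a \<in> fs.span b"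
          using \<open>w \<in> _\<close> fs.span_breakdown_eq by blast
        moreover have "w - fscale k a' = (w - fscale k a) + fscale k u"
          by (simp add: a'_def fs.scale_right_diff_distrib)
        ultimately have k: "w - fscale k a' \<in> fs.span b"
          using fs.span_add[OF _ fs.span_scale[OF u(1)]] by metis
        define w' where "w' = w - fscale k a'"
        have w: "w = w' + fscale k a'" "w' \<in> fs.span b" using k by (auto simp: w'_def)
        have "ip D f w' = ip D v w'"
          using v(2) w(2) by (simp add: ip_diff_left)
        moreover have "ip D a' w' = 0" "ip D v a' = 0"
          using a'_b w(2) v(1) by auto
        ultimately show ?thesis
          unfolding w(1) by (simp add: ip_add_left ip_add_right ip_diff_left ip_scale_left
              ip_scale_right c)
      qed
      moreover have "v + fscale c a' \<in> fs.span (insert a b)"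
        by (meson a'_in fs.span_add fs.span_scale sub subsetD v(1))
      ultimately show "\<exists>u\<in>fs.span (insert a b). \<forall>w\<in>fs.span (insert a b). ip D (f - u) w = 0"
        by blast
    qed
  qed
  then show thesis using b assms that by blast
qed

definition orth :: "'x set \<Rightarrow> ('x \<Rightarrow> rat) set \<Rightarrow> ('x \<Rightarrow> rat) set" where
  "orth D U = {f \<in> supp_on D. \<forall>u\<in>U. ip D f u = 0}"

lemma subspace_orth: "fs.subspace (orth D U)"
  by (auto simp: fs.subspace_def orth_def ip_add_left ip_scale_left supp_on_def pointwise)

lemma orth_disjoint: "finite D \<Longrightarrow> U \<inter> orth D U \<subseteq> {0}"
  using ip_self_zero by (fastforce simp: orth_def)

lemma orth_decomp:
  assumes "finite D" "fs.subspace U" "U \<subseteq> supp_on D" "f \<in> supp_on D"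
  obtains u w where "u \<in> U" "w \<in> orth D U" "f = u + w"
proof -
  obtain u where u: "u \<in> U" "\<And>w. w \<in> U \<Longrightarrow> ip D (f - u) w = 0"
    using orthogonal_projection[OF assms(1-3)] by metis
  have "f - u \<in> orth D U"
    using u assms subspace_supp_on fs.subspace_diff unfolding orth_def by blast
  then show thesis using u that[of u "f - u"] by simp
qed

section \<open>Isomorphisms and decompositions of representations\<close>

lemma carrier_rat_field [simp]: "carrier rat_field = UNIV"
  and add_rat_field [simp]: "a \<oplus>\<^bsub>rat_field\<^esub> b = a + b"
  and mult_rat_field [simp]: "a \<otimes>\<^bsub>rat_field\<^esub> b = a * b"
  and one_rat_field [simp]: "\<one>\<^bsub>rat_field\<^esub> = 1"
  and zero_rat_field [simp]: "\<zero>\<^bsub>rat_field\<^esub> = 0"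
  by (simp_all add: rat_field_def ring_of_type_algebra_def)

lemma cring_rat_field: "cring rat_field"
  unfolding rat_field_def by (rule cring_from_type_algebra)

definition is_rep :: "('g, 'b) monoid_scheme \<Rightarrow> ('v, 'g) rep \<Rightarrow> bool" where
  "is_rep G M \<longleftrightarrow> module rat_field M \<and> (\<forall>g\<in>carrier G. \<forall>v\<in>carrier M. act M g v \<in> carrier M)"

definition is_iso :: "('g, 'b) monoid_scheme \<Rightarrow> ('v, 'g) rep \<Rightarrow> ('w, 'g) rep \<Rightarrow> ('v \<Rightarrow> 'w) \<Rightarrow> bool" where
  "is_iso G M N \<phi> \<longleftrightarrow> bij_betw \<phi> (carrier M) (carrier N) \<and>
     (\<forall>u\<in>carrier M. \<forall>v\<in>carrier M. \<phi> (u \<oplus>\<^bsub>M\<^esub> v) = \<phi> u \<oplus>\<^bsub>N\<^esub> \<phi> v) \<and>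
     (\<forall>c. \<forall>v\<in>carrier M. \<phi> (c \<odot>\<^bsub>M\<^esub> v) = c \<odot>\<^bsub>N\<^esub> \<phi> v) \<and>
     (\<forall>g\<in>carrier G. \<forall>v\<in>carrier M. \<phi> (act M g v) = act N g (\<phi> v))"

lemma rep_iso_iff_is_iso: "rep_iso G M N \<longleftrightarrow> (\<exists>\<phi>. is_iso G M N \<phi>)"
  by (simp add: rep_iso_def is_iso_def)

lemma is_rep_closed:
  assumes "is_rep G M"
  shows "\<zero>\<^bsub>M\<^esub> \<in> carrier M"
    and "u \<in> carrier M \<Longrightarrow> v \<in> carrier M \<Longrightarrow> u \<oplus>\<^bsub>M\<^esub> v \<in> carrier M"
    and "u \<in> carrier M \<Longrightarrow> c \<odot>\<^bsub>M\<^esub> u \<in> carrier M"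
    and "g \<in> carrier G \<Longrightarrow> u \<in> carrier M \<Longrightarrow> act M g u \<in> carrier M"
proof -
  interpret module rat_field M using assms by (simp add: is_rep_def)
  show "\<zero>\<^bsub>M\<^esub> \<in> carrier M" by simp
  show "u \<in> carrier M \<Longrightarrow> v \<in> carrier M \<Longrightarrow> u \<oplus>\<^bsub>M\<^esub> v \<in> carrier M" by simp
  show "u \<in> carrier M \<Longrightarrow> c \<odot>\<^bsub>M\<^esub> u \<in> carrier M" by simp
  show "g \<in> carrier G \<Longrightarrow> u \<in> carrier M \<Longrightarrow> act M g u \<in> carrier M"
    using assms by (simp add: is_rep_def)
qed

lemma is_rep_zero_smult:
  assumes "is_rep G M" "u \<in> carrier M"
  shows "0 \<odot>\<^bsub>M\<^esub> u = \<zero>\<^bsub>M\<^esub>"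
proof -
  interpret module rat_field M using assms by (simp add: is_rep_def)
  show ?thesis using smult_l_null assms by simp
qed

lemma subrep_iff:
  assumes "is_rep G M"
  shows "subrep G M U \<longleftrightarrow> U \<subseteq> carrier M \<and> \<zero>\<^bsub>M\<^esub> \<in> U \<and> (\<forall>u\<in>U. \<forall>v\<in>U. u \<oplus>\<^bsub>M\<^esub> v \<in> U) \<and>
    (\<forall>c. \<forall>u\<in>U. c \<odot>\<^bsub>M\<^esub> u \<in> U) \<and> (\<forall>g\<in>carrier G. \<forall>u\<in>U. act M g u \<in> U)"
proof -
  interpret module rat_field M using assms by (simp add: is_rep_def)
  have neg: "\<ominus>\<^bsub>M\<^esub> a = (-1) \<odot>\<^bsub>M\<^esub> a" if "a \<in> carrier M" for a
  proof -
    have "\<ominus>\<^bsub>rat_field\<^esub> 1 = -1"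
      by (rule R.minus_equality) auto
    then show ?thesis using smult_l_minus[of 1 a] smult_one[of a] that by simp
  qed
  have "submodule U rat_field M" if "U \<subseteq> carrier M" "\<zero>\<^bsub>M\<^esub> \<in> U" "\<forall>u\<in>U. \<forall>v\<in>U. u \<oplus>\<^bsub>M\<^esub> v \<in> U"
    "\<forall>c. \<forall>u\<in>U. c \<odot>\<^bsub>M\<^esub> u \<in> U"
    using that by (intro submoduleI) (auto simp: neg subset_iff)
  moreover have "\<zero>\<^bsub>M\<^esub> \<in> U" if "submodule U rat_field M"
    using subgroup.one_closed[OF submodule.axioms(1)[OF that]] by simp
  ultimately show ?thesis
    unfolding subrep_def using submoduleE[of U] by auto
qed

lemma subrep_subset: "is_rep G M \<Longrightarrow> subrep G M U \<Longrightarrow> U \<subseteq> carrier M"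
  by (simp add: subrep_iff)

lemma is_rep_subrep:
  assumes "is_rep G M" "subrep G M U"
  shows "is_rep G (M\<lparr>carrier := U\<rparr>)"
  using assms submodule.submodule_is_module[of U rat_field M]
  by (auto simp: is_rep_def subrep_def)

lemma is_iso_inv:
  assumes "is_iso G M N \<phi>" "is_rep G M"
  shows "is_iso G N M (inv_into (carrier M) \<phi>)"
proof -
  let ?\<psi> = "inv_into (carrier M) \<phi>"
  have b: "bij_betw \<phi> (carrier M) (carrier N)" using assms by (simp add: is_iso_def)
  have b': "bij_betw ?\<psi> (carrier N) (carrier M)" using b by (rule bij_betw_inv_into)
  have c: "?\<psi> w \<in> carrier M" "\<phi> (?\<psi> w) = w" if "w \<in> carrier N" for w
    using b b' that by (auto simp: bij_betwE bij_betw_inv_into_right)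
  have e: "?\<psi> w = v" if "v \<in> carrier M" "w = \<phi> v" for v w
    using b that by (simp add: bij_betw_inv_into_left)
  show ?thesis
    unfolding is_iso_def
  proof (intro conjI ballI allI)
    fix u v assume "u \<in> carrier N" "v \<in> carrier N"
    then show "?\<psi> (u \<oplus>\<^bsub>N\<^esub> v) = ?\<psi> u \<oplus>\<^bsub>M\<^esub> ?\<psi> v"
      using assms c by (intro e) (auto simp: is_iso_def is_rep_closed[OF assms(2)])
  next
    fix k v assume "v \<in> carrier N"
    then show "?\<psi> (k \<odot>\<^bsub>N\<^esub> v) = k \<odot>\<^bsub>M\<^esub> ?\<psi> v"
      using assms c by (intro e) (auto simp: is_iso_def is_rep_closed[OF assms(2)])
  next
    fix g v assume "g \<in> carrier G" "v \<in> carrier N"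
    then show "?\<psi> (act N g v) = act M g (?\<psi> v)"
      using assms c by (intro e) (auto simp: is_iso_def is_rep_closed[OF assms(2)])
  qed (rule b')
qed

lemma is_iso_comp:
  assumes "is_iso G M N \<phi>" "is_iso G N P \<psi>"
  shows "is_iso G M P (\<psi> \<circ> \<phi>)"
proof -
  have "\<phi> v \<in> carrier N" if "v \<in> carrier M" for v
    using assms(1) that by (auto simp: is_iso_def bij_betwE)
  then show ?thesis
    using assms bij_betw_trans by (auto simp: is_iso_def)
qed

lemma rep_iso_sym: "rep_iso G M N \<Longrightarrow> is_rep G M \<Longrightarrow> rep_iso G N M"
  using is_iso_inv by (metis rep_iso_iff_is_iso)

lemma rep_iso_trans: "rep_iso G M N \<Longrightarrow> rep_iso G N P \<Longrightarrow> rep_iso G M P"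
  using is_iso_comp by (metis rep_iso_iff_is_iso)

lemma is_iso_zero:
  assumes "is_iso G M N \<phi>" "is_rep G M" "is_rep G N"
  shows "\<phi> \<zero>\<^bsub>M\<^esub> = \<zero>\<^bsub>N\<^esub>"
proof -
  have z: "\<zero>\<^bsub>M\<^esub> \<in> carrier M" by (rule is_rep_closed[OF assms(2)])
  then have "\<phi> \<zero>\<^bsub>M\<^esub> \<in> carrier N" using assms by (auto simp: is_iso_def bij_betwE)
  moreover have "\<phi> (0 \<odot>\<^bsub>M\<^esub> \<zero>\<^bsub>M\<^esub>) = 0 \<odot>\<^bsub>N\<^esub> \<phi> \<zero>\<^bsub>M\<^esub>"
    using assms z by (auto simp: is_iso_def)
  ultimately show ?thesis
    using is_rep_zero_smult[OF assms(2) z] is_rep_zero_smult[OF assms(3)] by simp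
qed

lemma subrep_image:
  assumes "is_iso G M N \<phi>" "is_rep G M" "is_rep G N" "subrep G M U"
  shows "subrep G N (\<phi> ` U)"
proof -
  have U: "U \<subseteq> carrier M" "\<zero>\<^bsub>M\<^esub> \<in> U" "\<forall>u\<in>U. \<forall>v\<in>U. u \<oplus>\<^bsub>M\<^esub> v \<in> U"
    "\<forall>c. \<forall>u\<in>U. c \<odot>\<^bsub>M\<^esub> u \<in> U" "\<forall>g\<in>carrier G. \<forall>u\<in>U. act M g u \<in> U"
    using assms(4) subrep_iff[OF assms(2)] by auto
  have *: "\<phi> u \<oplus>\<^bsub>N\<^esub> \<phi> v = \<phi> (u \<oplus>\<^bsub>M\<^esub> v)" "c \<odot>\<^bsub>N\<^esub> \<phi> u = \<phi> (c \<odot>\<^bsub>M\<^esub> u)"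
    "g \<in> carrier G \<Longrightarrow> act N g (\<phi> u) = \<phi> (act M g u)" "\<phi> u \<in> carrier N"
    if "u \<in> U" "v \<in> U" for u v c g
    using assms(1) U(1) that by (auto simp: is_iso_def bij_betwE subset_iff)
  show ?thesis
    unfolding subrep_iff[OF assms(3)] is_iso_zero[OF assms(1-3), symmetric]
    using U(2-5) * by auto
qed

lemma is_iso_restrict:
  assumes "is_iso G M N \<phi>" "U \<subseteq> carrier M"
  shows "is_iso G (M\<lparr>carrier := U\<rparr>) (N\<lparr>carrier := \<phi> ` U\<rparr>) \<phi>"
  using assms by (auto simp: is_iso_def bij_betw_def subset_iff intro: inj_on_subset)

lemma irreducible_rep_iso:
  assumes iso: "is_iso G M N \<phi>" and M: "is_rep G M" and N: "is_rep G N"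
    and irr: "irreducible_rep G M"
  shows "irreducible_rep G N"
proof -
  have b: "bij_betw \<phi> (carrier M) (carrier N)" using iso by (simp add: is_iso_def)
  let ?\<psi> = "inv_into (carrier M) \<phi>"
  have iso': "is_iso G N M ?\<psi>" using is_iso_inv iso M by blast
  have z: "\<phi> \<zero>\<^bsub>M\<^esub> = \<zero>\<^bsub>N\<^esub>" by (rule is_iso_zero[OF iso M N])
  have "carrier N \<noteq> {\<zero>\<^bsub>N\<^esub>}"
  proof
    assume "carrier N = {\<zero>\<^bsub>N\<^esub>}"
    then have "\<phi> v = \<phi> \<zero>\<^bsub>M\<^esub>" if "v \<in> carrier M" for v
      using bij_betwE[OF b] that z by simp
    then have "v = \<zero>\<^bsub>M\<^esub>" if "v \<in> carrier M" for v
      using inj_onD[OF bij_betw_imp_inj_on[OF b]] is_rep_closed(1)[OF M] that by blast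
    then have "carrier M = {\<zero>\<^bsub>M\<^esub>}" using is_rep_closed(1)[OF M] by blast
    then show False using irr unfolding irreducible_rep_def by blast
  qed
  moreover have "W = {\<zero>\<^bsub>N\<^esub>} \<or> W = carrier N" if W: "subrep G N W" for W
  proof -
    have sub: "W \<subseteq> carrier N" by (rule subrep_subset[OF N W])
    have "subrep G M (?\<psi> ` W)" by (rule subrep_image[OF iso' N M W])
    then have "?\<psi> ` W = {\<zero>\<^bsub>M\<^esub>} \<or> ?\<psi> ` W = carrier M"
      using irr unfolding irreducible_rep_def by blast
    moreover have "\<phi> ` ?\<psi> ` W = W"
      using b sub by (simp add: image_inv_into_cancel bij_betw_def)
    moreover have "\<phi> ` {\<zero>\<^bsub>M\<^esub>} = {\<zero>\<^bsub>N\<^esub>}" by (simp add: z)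
    moreover have "\<phi> ` carrier M = carrier N" by (rule bij_betw_imp_surj_on[OF b])
    ultimately show ?thesis by metis
  qed
  ultimately show ?thesis unfolding irreducible_rep_def by blast
qed

lemma is_iso_finsum:
  assumes iso: "is_iso G M N \<phi>" and M: "is_rep G M" and N: "is_rep G N"
    and "finite I" "x ` I \<subseteq> carrier M"
  shows "\<phi> (\<Oplus>\<^bsub>M\<^esub>i\<in>I. x i) = (\<Oplus>\<^bsub>N\<^esub>i\<in>I. \<phi> (x i)) \<and> (\<Oplus>\<^bsub>M\<^esub>i\<in>I. x i) \<in> carrier M"
  using assms(4,5)
proof (induction I)
  case empty
  interpret M: module rat_field M using M by (simp add: is_rep_def)
  interpret N: module rat_field N using N by (simp add: is_rep_def)
  show ?case using is_iso_zero[OF iso M N] by simp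
next
  case (insert i I)
  interpret M: module rat_field M using M by (simp add: is_rep_def)
  interpret N: module rat_field N using N by (simp add: is_rep_def)
  have c: "\<phi> v \<in> carrier N" if "v \<in> carrier M" for v
    using iso that by (auto simp: is_iso_def bij_betwE)
  have "(\<Oplus>\<^bsub>M\<^esub>i\<in>insert i I. x i) = x i \<oplus>\<^bsub>M\<^esub> (\<Oplus>\<^bsub>M\<^esub>i\<in>I. x i)"
    using insert by (intro M.finsum_insert) auto
  moreover have "(\<Oplus>\<^bsub>N\<^esub>i\<in>insert i I. \<phi> (x i)) = \<phi> (x i) \<oplus>\<^bsub>N\<^esub> (\<Oplus>\<^bsub>N\<^esub>i\<in>I. \<phi> (x i))"
    using insert c by (intro N.finsum_insert) auto
  moreover have "x i \<in> carrier M" and IH: "\<phi> (\<Oplus>\<^bsub>M\<^esub>i\<in>I. x i) = (\<Oplus>\<^bsub>N\<^esub>i\<in>I. \<phi> (x i))"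
    "(\<Oplus>\<^bsub>M\<^esub>i\<in>I. x i) \<in> carrier M"
    using insert by auto
  moreover from this have "\<phi> (x i \<oplus>\<^bsub>M\<^esub> (\<Oplus>\<^bsub>M\<^esub>i\<in>I. x i)) = \<phi> (x i) \<oplus>\<^bsub>N\<^esub> \<phi> (\<Oplus>\<^bsub>M\<^esub>i\<in>I. x i)"
    using iso unfolding is_iso_def by blast
  ultimately show ?case
    using is_rep_closed(2)[OF M] by simp
qed

lemma irreducible_decomposition_iso:
  assumes iso: "is_iso G M N \<phi>" and M: "is_rep G M" and N: "is_rep G N"
    and dec: "irreducible_decomposition G M r U"
  shows "irreducible_decomposition G N r (\<lambda>i. \<phi> ` U i)"
    and "i < r \<Longrightarrow> rep_iso G (M\<lparr>carrier := U i\<rparr>) (N\<lparr>carrier := \<phi> ` U i\<rparr>)"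
proof -
  let ?\<psi> = "inv_into (carrier M) \<phi>"
  have b: "bij_betw \<phi> (carrier M) (carrier N)" using iso by (simp add: is_iso_def)
  have sub: "subrep G M (U i)" "irreducible_rep G (M\<lparr>carrier := U i\<rparr>)" if "i < r" for i
    using dec that by (auto simp: irreducible_decomposition_def)
  have UM: "U i \<subseteq> carrier M" if "i < r" for i
    by (rule subrep_subset[OF M sub(1)[OF that]])
  have subN: "subrep G N (\<phi> ` U i)" if "i < r" for i
    by (rule subrep_image[OF iso M N sub(1)[OF that]])
  have res: "is_iso G (M\<lparr>carrier := U i\<rparr>) (N\<lparr>carrier := \<phi> ` U i\<rparr>) \<phi>" if "i < r" for i
    by (rule is_iso_restrict[OF iso UM[OF that]])
  then show "i < r \<Longrightarrow> rep_iso G (M\<lparr>carrier := U i\<rparr>) (N\<lparr>carrier := \<phi> ` U i\<rparr>)"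
    by (auto simp: rep_iso_iff_is_iso)
  have inv1: "?\<psi> (\<phi> v) = v" if "v \<in> carrier M" for v
    using b that by (simp add: bij_betw_inv_into_left)
  have ex: "\<exists>!y. y \<in> (\<Pi>\<^sub>E i\<in>{..<r}. \<phi> ` U i) \<and> w = (\<Oplus>\<^bsub>N\<^esub>i\<in>{..<r}. y i)"
    if w: "w \<in> carrier N" for w
  proof -
    obtain v where v: "v \<in> carrier M" "w = \<phi> v" using b w by (auto simp: bij_betw_def)
    have uni: "\<exists>!x. x \<in> (\<Pi>\<^sub>E i\<in>{..<r}. U i) \<and> v = (\<Oplus>\<^bsub>M\<^esub>i\<in>{..<r}. x i)"
      using dec v by (auto simp: irreducible_decomposition_def)
    then obtain x where x: "x \<in> (\<Pi>\<^sub>E i\<in>{..<r}. U i)" "v = (\<Oplus>\<^bsub>M\<^esub>i\<in>{..<r}. x i)" by blast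
    have xM: "x ` {..<r} \<subseteq> carrier M" using x(1) UM by (auto simp: PiE_def Pi_def)
    let ?y = "\<lambda>i\<in>{..<r}. \<phi> (x i)"
    show ?thesis
    proof (rule ex1I[of _ ?y])
      have "(\<Oplus>\<^bsub>N\<^esub>i\<in>{..<r}. ?y i) = (\<Oplus>\<^bsub>N\<^esub>i\<in>{..<r}. \<phi> (x i))"
      proof -
        interpret N: module rat_field N using N by (simp add: is_rep_def)
        show ?thesis using xM b
          by (intro N.finsum_cong') (auto simp: bij_betwE)
      qed
      then show "?y \<in> (\<Pi>\<^sub>E i\<in>{..<r}. \<phi> ` U i) \<and> w = (\<Oplus>\<^bsub>N\<^esub>i\<in>{..<r}. ?y i)"
        using is_iso_finsum[OF iso M N _ xM] x v by auto
    next
      fix y assume y: "y \<in> (\<Pi>\<^sub>E i\<in>{..<r}. \<phi> ` U i) \<and> w = (\<Oplus>\<^bsub>N\<^esub>i\<in>{..<r}. y i)"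
      let ?x = "\<lambda>i\<in>{..<r}. ?\<psi> (y i)"
      have yi: "?\<psi> (y i) \<in> U i \<and> \<phi> (?\<psi> (y i)) = y i" if i: "i < r" for i
      proof -
        obtain u where "u \<in> U i" "y i = \<phi> u" using y i by (auto simp: PiE_def Pi_def)
        then show ?thesis using inv1 UM[OF i] by auto
      qed
      have x'M: "?x ` {..<r} \<subseteq> carrier M" using yi UM by auto
      have "\<phi> (\<Oplus>\<^bsub>M\<^esub>i\<in>{..<r}. ?x i) = (\<Oplus>\<^bsub>N\<^esub>i\<in>{..<r}. \<phi> (?x i))"
        using is_iso_finsum[OF iso M N _ x'M] by auto
      also have "\<dots> = (\<Oplus>\<^bsub>N\<^esub>i\<in>{..<r}. y i)"
      proof -
        interpret N: module rat_field N using N by (simp add: is_rep_def)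
        have "y i \<in> carrier N" if "i < r" for i
          using yi[OF that] UM[OF that] b by (metis bij_betwE subsetD)
        then show ?thesis
          by (intro N.finsum_cong') (auto simp: yi)
      qed
      finally have "\<phi> (\<Oplus>\<^bsub>M\<^esub>i\<in>{..<r}. ?x i) = \<phi> v" using y v by simp
      moreover have "(\<Oplus>\<^bsub>M\<^esub>i\<in>{..<r}. ?x i) \<in> carrier M"
        using is_iso_finsum[OF iso M N _ x'M] by auto
      ultimately have "v = (\<Oplus>\<^bsub>M\<^esub>i\<in>{..<r}. ?x i)" using b v by (metis inv1)
      moreover have "?x \<in> (\<Pi>\<^sub>E i\<in>{..<r}. U i)" using yi by auto
      ultimately have "?x = x" using uni x by blast
      then have "\<phi> (x i) = y i" if "i < r" for i
        using yi[OF that] that by auto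
      then show "y = ?y" using y by (auto simp: PiE_def extensional_def fun_eq_iff)
    qed
  qed
  have "irreducible_rep G (N\<lparr>carrier := \<phi> ` U i\<rparr>)" if i: "i < r" for i
    by (rule irreducible_rep_iso[OF res[OF i] is_rep_subrep[OF M sub(1)[OF i]]
          is_rep_subrep[OF N subN[OF i]] sub(2)[OF i]])
  then show "irreducible_decomposition G N r (\<lambda>i. \<phi> ` U i)"
    using subN ex by (auto simp: irreducible_decomposition_def)
qed

lemma rep_multiplicity_iso_aux:
  assumes iso: "is_iso G M N \<phi>" and M: "is_rep G M" and N: "is_rep G N"
    and dec: "irreducible_decomposition G M r U"
  shows "\<exists>U'. irreducible_decomposition G N r U' \<and>
    {i. i < r \<and> rep_iso G (N\<lparr>carrier := U' i\<rparr>) V} = {i. i < r \<and> rep_iso G (M\<lparr>carrier := U i\<rparr>) V}"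
proof (intro exI conjI)
  show "irreducible_decomposition G N r (\<lambda>i. \<phi> ` U i)"
    by (rule irreducible_decomposition_iso(1)[OF assms])
  have "rep_iso G (N\<lparr>carrier := \<phi> ` U i\<rparr>) V \<longleftrightarrow> rep_iso G (M\<lparr>carrier := U i\<rparr>) V" if "i < r" for i
  proof -
    have a: "rep_iso G (M\<lparr>carrier := U i\<rparr>) (N\<lparr>carrier := \<phi> ` U i\<rparr>)"
      by (rule irreducible_decomposition_iso(2)[OF assms that])
    have "is_rep G (M\<lparr>carrier := U i\<rparr>)"
      using dec that M by (auto simp: irreducible_decomposition_def intro: is_rep_subrep)
    then have b: "rep_iso G (N\<lparr>carrier := \<phi> ` U i\<rparr>) (M\<lparr>carrier := U i\<rparr>)"
      by (rule rep_iso_sym[OF a])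
    show ?thesis
      by (rule iffI) (erule rep_iso_trans[OF a], erule rep_iso_trans[OF b])
  qed
  then show "{i. i < r \<and> rep_iso G (N\<lparr>carrier := \<phi> ` U i\<rparr>) V} =
      {i. i < r \<and> rep_iso G (M\<lparr>carrier := U i\<rparr>) V}" by blast
qed

text \<open>Irreducible decompositions can be carried along an isomorphism in both directions.\<close>

lemma rep_multiplicity_iso:
  assumes "is_iso G M N \<phi>" "is_rep G M" "is_rep G N"
  shows "rep_multiplicity G V M = rep_multiplicity G V N"
proof -
  have "(\<exists>r U. irreducible_decomposition G M r U \<and> m = card {i. i < r \<and> rep_iso G (M\<lparr>carrier := U i\<rparr>) V})
    \<longleftrightarrow> (\<exists>r U. irreducible_decomposition G N r U \<and> m = card {i. i < r \<and> rep_iso G (N\<lparr>carrier := U i\<rparr>) V})" for m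
  proof (intro iffI; elim exE conjE)
    fix r U
    assume d: "irreducible_decomposition G M r U"
      and m: "m = card {i. i < r \<and> rep_iso G (M\<lparr>carrier := U i\<rparr>) V}"
    obtain U' where "irreducible_decomposition G N r U'"
      "{i. i < r \<and> rep_iso G (N\<lparr>carrier := U' i\<rparr>) V} = {i. i < r \<and> rep_iso G (M\<lparr>carrier := U i\<rparr>) V}"
      using rep_multiplicity_iso_aux[OF assms d, of V] by blast
    then show "\<exists>r U. irreducible_decomposition G N r U \<and> m = card {i. i < r \<and> rep_iso G (N\<lparr>carrier := U i\<rparr>) V}"
      unfolding m by (intro exI[of _ r] exI[of _ U']) simp
  next
    fix r U
    assume d: "irreducible_decomposition G N r U"
      and m: "m = card {i. i < r \<and> rep_iso G (N\<lparr>carrier := U i\<rparr>) V}"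
    obtain U' where "irreducible_decomposition G M r U'"
      "{i. i < r \<and> rep_iso G (M\<lparr>carrier := U' i\<rparr>) V} = {i. i < r \<and> rep_iso G (N\<lparr>carrier := U i\<rparr>) V}"
      using rep_multiplicity_iso_aux[OF is_iso_inv[OF assms(1,2)] assms(3,2) d, of V] by blast
    then show "\<exists>r U. irreducible_decomposition G M r U \<and> m = card {i. i < r \<and> rep_iso G (M\<lparr>carrier := U i\<rparr>) V}"
      unfolding m by (intro exI[of _ r] exI[of _ U']) simp
  qed
  then show ?thesis unfolding rep_multiplicity_def by simp
qed

lemma rep_multiplicity_cong:
  fixes M :: "('w, 'g) rep"
  assumes "rep_iso G V V'" "rep_iso G V' V"
  shows "rep_multiplicity G V M = rep_multiplicity G V' M"
proof -
  have "rep_iso G N V \<longleftrightarrow> rep_iso G N V'" for N :: "('w, 'g) rep"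
    by (rule iffI) (erule rep_iso_trans[OF _ assms(1)], erule rep_iso_trans[OF _ assms(2)])
  then show ?thesis unfolding rep_multiplicity_def by simp
qed

section \<open>Permutation representations\<close>

lemma fun_rep_simps [simp]:
  "carrier (fun_rep U a) = U" "\<zero>\<^bsub>fun_rep U a\<^esub> = 0" "f \<oplus>\<^bsub>fun_rep U a\<^esub> g = f + g"
  "c \<odot>\<^bsub>fun_rep U a\<^esub> f = fscale c f" "act (fun_rep U a) = a"
  "(fun_rep U a)\<lparr>carrier := W\<rparr> = fun_rep W a"
  by (simp_all add: fun_rep_def plus_fun_def zero_fun_def fscale_def)

lemma module_fun_rep:
  assumes "fs.subspace U"
  shows "module rat_field (fun_rep U a)"
proof (intro moduleI cring_rat_field abelian_groupI)
  note [simp] = fs.subspace_0[OF assms] fs.subspace_add[OF assms] fs.subspace_scale[OF assms]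
  fix x assume "x \<in> carrier (fun_rep U a)"
  then show "\<exists>y\<in>carrier (fun_rep U a). y \<oplus>\<^bsub>fun_rep U a\<^esub> x = \<zero>\<^bsub>fun_rep U a\<^esub>"
    using fs.subspace_neg[OF assms] by (intro bexI[of _ "- x"]) auto
qed (use assms in \<open>auto simp: fs.subspace_0 fs.subspace_add fs.subspace_scale add.assoc add.commute
    fs.scale_left_distrib fs.scale_right_distrib\<close>)

lemma finsum_fun_rep:
  assumes "fs.subspace U" "finite I" "x ` I \<subseteq> U"
  shows "(\<Oplus>\<^bsub>fun_rep U a\<^esub>i\<in>I. x i) = (\<Sum>i\<in>I. x i)"
proof -
  interpret M: module rat_field "fun_rep U a" by (rule module_fun_rep[OF assms(1)])
  show ?thesis
    using assms(2,3)
  proof (induction I)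
    case empty
    then show ?case by simp
  next
    case (insert i I)
    have "finsum (fun_rep U a) x (insert i I) = x i \<oplus>\<^bsub>fun_rep U a\<^esub> finsum (fun_rep U a) x I"
      using insert by (intro M.finsum_insert) auto
    then show ?case using insert by simp
  qed
qed

text \<open>Subrepresentations and irreducibility inside a space of functions, phrased without records.\<close>

definition gsub :: "('g, 'b) monoid_scheme \<Rightarrow> ('g \<Rightarrow> ('x \<Rightarrow> rat) \<Rightarrow> ('x \<Rightarrow> rat)) \<Rightarrow> ('x \<Rightarrow> rat) set \<Rightarrow> bool" where
  "gsub G a U \<longleftrightarrow> fs.subspace U \<and> (\<forall>g\<in>carrier G. \<forall>u\<in>U. a g u \<in> U)"

definition girr :: "('g, 'b) monoid_scheme \<Rightarrow> ('g \<Rightarrow> ('x \<Rightarrow> rat) \<Rightarrow> ('x \<Rightarrow> rat)) \<Rightarrow> ('x \<Rightarrow> rat) set \<Rightarrow> bool" where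
  "girr G a U \<longleftrightarrow> gsub G a U \<and> U \<noteq> {0} \<and> (\<forall>W. gsub G a W \<longrightarrow> W \<subseteq> U \<longrightarrow> W = {0} \<or> W = U)"

lemma gsub_subspace: "gsub G a U \<Longrightarrow> fs.subspace U"
  and gsub_act: "gsub G a U \<Longrightarrow> g \<in> carrier G \<Longrightarrow> u \<in> U \<Longrightarrow> a g u \<in> U"
  by (auto simp: gsub_def)

lemma is_rep_fun_rep: "gsub G a U \<Longrightarrow> is_rep G (fun_rep U a)"
  by (auto simp: is_rep_def gsub_def module_fun_rep)

lemma subrep_fun_rep:
  assumes "gsub G a H"
  shows "subrep G (fun_rep H a) U \<longleftrightarrow> U \<subseteq> H \<and> gsub G a U"
  unfolding subrep_iff[OF is_rep_fun_rep[OF assms]] by (auto simp: gsub_def fs.subspace_def)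

lemma irreducible_fun_rep:
  assumes "gsub G a U"
  shows "irreducible_rep G (fun_rep U a) \<longleftrightarrow> girr G a U"
  using assms unfolding irreducible_rep_def girr_def subrep_fun_rep[OF assms] by auto

lemma irreducible_decomposition_fun_rep:
  assumes H: "gsub G a H"
  shows "irreducible_decomposition G (fun_rep H a) r U \<longleftrightarrow>
     (\<forall>i<r. U i \<subseteq> H \<and> girr G a (U i)) \<and>
     (\<forall>v\<in>H. \<exists>!x. x \<in> (\<Pi>\<^sub>E i\<in>{..<r}. U i) \<and> v = (\<Sum>i<r. x i))"
proof -
  have A: "subrep G (fun_rep H a) W \<and> irreducible_rep G ((fun_rep H a)\<lparr>carrier := W\<rparr>)
      \<longleftrightarrow> W \<subseteq> H \<and> girr G a W" for W
    unfolding subrep_fun_rep[OF H] fun_rep_simps using irreducible_fun_rep[of G a W]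
    by (auto simp: girr_def)
  have B: "(x \<in> (\<Pi>\<^sub>E i\<in>{..<r}. U i) \<and> v = (\<Oplus>\<^bsub>fun_rep H a\<^esub>i\<in>{..<r}. x i)) \<longleftrightarrow>
      (x \<in> (\<Pi>\<^sub>E i\<in>{..<r}. U i) \<and> v = (\<Sum>i<r. x i))" if "\<forall>i<r. U i \<subseteq> H" for x v
  proof -
    have "x ` {..<r} \<subseteq> H" if "x \<in> (\<Pi>\<^sub>E i\<in>{..<r}. U i)"
      using that \<open>\<forall>i<r. U i \<subseteq> H\<close> by (auto simp: PiE_def Pi_def)
    then show ?thesis
      using finsum_fun_rep[OF gsub_subspace[OF H], of "{..<r}" x] by auto
  qed
  show ?thesis
    unfolding irreducible_decomposition_def A unfolding fun_rep_simps(1)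
    by (rule conj_cong) (use B in simp_all)
qed

definition pact :: "('g, 'b) monoid_scheme \<Rightarrow> ('g \<Rightarrow> 'x \<Rightarrow> 'x) \<Rightarrow> 'g \<Rightarrow> ('x \<Rightarrow> rat) \<Rightarrow> ('x \<Rightarrow> rat)" where
  "pact G \<rho> g f = (\<lambda>x. f (\<rho> (inv\<^bsub>G\<^esub> g) x))"

locale finite_action = group G for G :: "('g, 'b) monoid_scheme" (structure) +
  fixes \<rho> :: "'g \<Rightarrow> 'x \<Rightarrow> 'x"
  assumes fin: "finite (carrier G)"
    and act_one: "\<rho> \<one> x = x"
    and act_mult: "g \<in> carrier G \<Longrightarrow> h \<in> carrier G \<Longrightarrow> \<rho> (g \<otimes> h) x = \<rho> g (\<rho> h x)"
begin

abbreviation "P \<equiv> pact G \<rho>"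

lemma flinear_P: "flinear (P g)"
  by (auto simp: flinear_def pact_def fun_eq_iff pointwise)

lemma P_one [simp]: "P \<one> f = f"
  by (simp add: pact_def act_one)

lemma P_mult: "g \<in> carrier G \<Longrightarrow> h \<in> carrier G \<Longrightarrow> P (g \<otimes> h) f = P g (P h f)"
  by (simp add: pact_def act_mult inv_mult_group)

lemma P_inv_P [simp]: "g \<in> carrier G \<Longrightarrow> P (inv g) (P g f) = f"
  and P_P_inv [simp]: "g \<in> carrier G \<Longrightarrow> P g (P (inv g) f) = f"
  by (simp_all flip: P_mult)

lemma \<rho>_inv_\<rho> [simp]: "g \<in> carrier G \<Longrightarrow> \<rho> (inv g) (\<rho> g x) = x"
  and \<rho>_\<rho>_inv [simp]: "g \<in> carrier G \<Longrightarrow> \<rho> g (\<rho> (inv g) x) = x"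
  by (simp_all flip: act_mult add: act_one)

definition stable :: "'x set \<Rightarrow> bool" where
  "stable D \<longleftrightarrow> (\<forall>g\<in>carrier G. \<forall>x\<in>D. \<rho> g x \<in> D)"

lemma stable_iff: "stable D \<Longrightarrow> g \<in> carrier G \<Longrightarrow> \<rho> g x \<in> D \<longleftrightarrow> x \<in> D"
  unfolding stable_def using \<rho>_inv_\<rho> inv_closed by metis

lemma P_supp_on: "stable D \<Longrightarrow> g \<in> carrier G \<Longrightarrow> f \<in> supp_on D \<Longrightarrow> P g f \<in> supp_on D"
  by (auto simp: supp_on_def pact_def stable_iff)

lemma gsub_supp_on: "stable D \<Longrightarrow> gsub G P (supp_on D)"
  by (auto simp: gsub_def subspace_supp_on P_supp_on)

lemma ip_P:
  assumes "stable D" "g \<in> carrier G"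
  shows "ip D (P g f) (P g h) = ip D f h"
proof -
  have "bij_betw (\<rho> (inv g)) D D"
    using assms by (intro bij_betwI[where g = "\<rho> g"]) (auto simp: stable_def)
  then show ?thesis
    unfolding ip_def pact_def by (rule sum.reindex_bij_betw)
qed

lemma ip_P_left:
  assumes "stable D" "g \<in> carrier G"
  shows "ip D (P g f) h = ip D f (P (inv g) h)"
  using ip_P[OF assms, of f "P (inv g) h"] assms(2) by simp

lemma gsub_orth:
  assumes "stable D" "gsub G P U"
  shows "gsub G P (orth D U)"
  unfolding gsub_def
proof (intro conjI ballI subspace_orth)
  fix g f assume g: "g \<in> carrier G" and f: "f \<in> orth D U"
  then show "P g f \<in> orth D U"
    using assms by (auto simp: orth_def P_supp_on ip_P_left gsub_def)
qed

lemma gsub_Int: "gsub G P U \<Longrightarrow> gsub G P W \<Longrightarrow> gsub G P (U \<inter> W)"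
  by (auto simp: gsub_def intro: fs.subspace_inter)

text \<open>An invariant subspace of least positive dimension is irreducible.\<close>

lemma exists_irreducible:
  assumes "finite D" "gsub G P H" "H \<subseteq> supp_on D" "H \<noteq> {0}"
  shows "\<exists>U\<subseteq>H. girr G P U"
  using assms(2-)
proof (induction "fs.dim H" arbitrary: H rule: less_induct)
  case less
  show ?case
  proof (cases "girr G P H")
    case False
    then obtain W where W: "gsub G P W" "W \<subseteq> H" "W \<noteq> {0}" "W \<noteq> H"
      using less.prems unfolding girr_def by blast
    then have "fs.dim W < fs.dim H"
      using less.prems by (intro dim_psubspace[OF assms(1)]) (auto simp: gsub_def)
    then obtain U where "U \<subseteq> W" "girr G P U"
      using less.hyps[of W] W less.prems(2) by blast
    then show ?thesis using W(2) by blast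
  qed blast
qed

text \<open>
  With orthogonal summands, the uniqueness of components that a decomposition demands is automatic.
\<close>

definition orth_dec :: "'x set \<Rightarrow> ('x \<Rightarrow> rat) set \<Rightarrow> nat \<Rightarrow> (nat \<Rightarrow> ('x \<Rightarrow> rat) set) \<Rightarrow> bool" where
  "orth_dec D H r U \<longleftrightarrow> (\<forall>i<r. U i \<subseteq> H \<and> girr G P (U i)) \<and>
    (\<forall>i<r. \<forall>j<r. i \<noteq> j \<longrightarrow> (\<forall>u\<in>U i. \<forall>w\<in>U j. ip D u w = 0)) \<and>
    (\<forall>v\<in>H. \<exists>x. (\<forall>i<r. x i \<in> U i) \<and> v = (\<Sum>i<r. x i))"

lemma orth_decD:
  assumes "orth_dec D H r U"
  shows "i < r \<Longrightarrow> U i \<subseteq> H \<and> girr G P (U i)"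
    and "i < r \<Longrightarrow> j < r \<Longrightarrow> i \<noteq> j \<Longrightarrow> u \<in> U i \<Longrightarrow> w \<in> U j \<Longrightarrow> ip D u w = 0"
    and "v \<in> H \<Longrightarrow> \<exists>x. (\<forall>i<r. x i \<in> U i) \<and> v = (\<Sum>i<r. x i)"
  using assms by (simp_all add: orth_dec_def)

text \<open>
  Maschke's theorem: splitting off an irreducible summand leaves its orthogonal complement, which
  is again invariant because a permutation action preserves the standard inner product.
\<close>

lemma exists_orthogonal_decomposition:
  assumes "finite D" "stable D" "gsub G P H" "H \<subseteq> supp_on D"
  shows "\<exists>r U. orth_dec D H r U"
  using assms(3-)
proof (induction "fs.dim H" arbitrary: H rule: less_induct)
  case less
  show ?case
  proof (cases "H = {0}")
    case True
    show ?thesis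
      by (intro exI[of _ "0::nat"] exI[of _ "\<lambda>_::nat. {0 :: 'x \<Rightarrow> rat}"]) (simp add: True orth_dec_def)
  next
    case False
    obtain V where V: "V \<subseteq> H" "girr G P V"
      using exists_irreducible[OF assms(1) less.prems False] by blast
    then have Vg: "gsub G P V" "V \<noteq> {0}" by (auto simp: girr_def)
    define H' where "H' = H \<inter> orth D V"
    have H': "gsub G P H'" "H' \<subseteq> supp_on D" "H' \<subseteq> H"
      unfolding H'_def using gsub_Int gsub_orth assms(2) less.prems Vg by auto
    have "H' \<noteq> H"
    proof
      assume "H' = H"
      then have "V \<subseteq> {0}" using V(1) orth_disjoint[OF assms(1), of V] unfolding H'_def by blast
      then show False using Vg fs.subspace_0[of V] by (auto simp: gsub_def)
    qed
    then have "fs.dim H' < fs.dim H"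
      using less.prems H' by (intro dim_psubspace[OF assms(1)]) (auto simp: gsub_def)
    from less.hyps[OF this H'(1,2)]
    obtain r U where dec: "orth_dec D H' r U" by blast
    note U = orth_decD[OF dec]
    define U' where "U' = (\<lambda>i. if i < r then U i else V)"
    have VU: "ip D u w = 0" "ip D w u = 0" if "u \<in> V" "w \<in> U i" "i < r" for u w i
      using U(1)[of i] that by (auto simp: H'_def orth_def ip_commute[of D u])
    show ?thesis
      unfolding orth_dec_def
    proof (intro exI[of _ "Suc r"] exI[of _ U'] conjI allI impI ballI)
      fix i assume "i < Suc r"
      then show "U' i \<subseteq> H" "girr G P (U' i)" using U(1)[of i] V H'(3) by (auto simp: U'_def)
    next
      fix i j u w assume "i < Suc r" "j < Suc r" "i \<noteq> j" "u \<in> U' i" "w \<in> U' j"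
      then show "ip D u w = 0"
        using U(2)[of i j u w] VU by (auto simp: U'_def split: if_splits)
    next
      fix v assume v: "v \<in> H"
      then have "v \<in> supp_on D" using less.prems by blast
      then obtain u w where uw: "u \<in> V" "w \<in> orth D V" "v = u + w"
        using orth_decomp[OF assms(1) gsub_subspace[OF Vg(1)], of v] V(1) less.prems(2) by (metis subset_trans)
      have "w = v - u" using uw by simp
      then have "w \<in> H"
        using fs.subspace_diff[OF gsub_subspace[OF less.prems(1)] v, of u] V(1) uw(1) by blast
      then have "w \<in> H'" using uw by (simp add: H'_def)
      then obtain x where x: "\<forall>i<r. x i \<in> U i" "w = (\<Sum>i<r. x i)" using U(3) by blast
      have "(\<Sum>i<r. (x(r := u)) i) = (\<Sum>i<r. x i)" by (intro sum.cong) auto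
      then have "v = (\<Sum>i<Suc r. (x(r := u)) i)"
        by (simp only: sum.lessThan_Suc uw(3) x(2)) (simp add: add.commute)
      moreover have "\<forall>i<Suc r. (x(r := u)) i \<in> U' i" using x(1) uw(1) by (auto simp: U'_def)
      ultimately show "\<exists>x. (\<forall>i<Suc r. x i \<in> U' i) \<and> v = (\<Sum>i<Suc r. x i)" by blast
    qed
  qed
qed

lemma exists_irreducible_decomposition:
  assumes "finite D" "stable D" "gsub G P H" "H \<subseteq> supp_on D"
  shows "\<exists>r U. irreducible_decomposition G (fun_rep H P) r U"
proof -
  obtain r U where dec: "orth_dec D H r U"
    using exists_orthogonal_decomposition[OF assms] by blast
  note U = orth_decD[OF dec]
  have "\<exists>!x. x \<in> (\<Pi>\<^sub>E i\<in>{..<r}. U i) \<and> v = (\<Sum>i<r. x i)" if vH: "v \<in> H" for v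
  proof -
    obtain x where x: "\<forall>i<r. x i \<in> U i" "v = (\<Sum>i<r. x i)" using U(3)[OF vH] by blast
    show ?thesis
    proof (rule ex1I[of _ "restrict x {..<r}"])
      show "restrict x {..<r} \<in> (\<Pi>\<^sub>E i\<in>{..<r}. U i) \<and> v = (\<Sum>i<r. restrict x {..<r} i)"
        using x by auto
    next
      fix y assume y: "y \<in> (\<Pi>\<^sub>E i\<in>{..<r}. U i) \<and> v = (\<Sum>i<r. y i)"
      have "y j = x j" if j: "j < r" for j
      proof -
        define z where "z = (\<lambda>i. y i - x i)"
        have zU: "z i \<in> U i" if "i < r" for i
          using y x U(1)[OF that] that unfolding z_def girr_def gsub_def
          by (auto intro!: fs.subspace_diff simp: PiE_def Pi_def)
        have "(\<Sum>i<r. z i) = 0" using x y by (simp add: z_def sum_subtractf)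
        then have "0 = ip D (\<Sum>i<r. z i) (z j)" by simp
        also have "\<dots> = (\<Sum>i<r. ip D (z i) (z j))" by (rule ip_sum_left)
        also have "\<dots> = (\<Sum>i<r. if i = j then ip D (z j) (z j) else 0)"
          using U(2)[OF _ j _ zU zU[OF j]] by (intro sum.cong) auto
        also have "\<dots> = ip D (z j) (z j)" using j by (subst sum.delta) auto
        finally have "ip D (z j) (z j) = 0" by simp
        moreover have "z j \<in> supp_on D" using zU[OF j] U(1)[OF j] assms(4) by blast
        ultimately have "z j = 0" using ip_self_zero[OF assms(1)] by blast
        then show ?thesis by (simp add: z_def)
      qed
      then show "y = restrict x {..<r}"
        using y by (auto simp: fun_eq_iff PiE_def extensional_def)
    qed
  qed
  then have "\<forall>v\<in>H. \<exists>!x. x \<in> (\<Pi>\<^sub>E i\<in>{..<r}. U i) \<and> v = (\<Sum>i<r. x i)" by (rule ballI)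
  moreover have "\<forall>i<r. U i \<subseteq> H \<and> girr G P (U i)" using U(1) by simp
  ultimately have "irreducible_decomposition G (fun_rep H P) r U"
    unfolding irreducible_decomposition_fun_rep[OF assms(3)] by (rule conjI[rotated])
  then show ?thesis by (intro exI)
qed

end

section \<open>Pairs of subgroups with sign characters\<close>

definition wsum :: "('g, 'b) monoid_scheme \<Rightarrow> ('g \<Rightarrow> 'x \<Rightarrow> 'x) \<Rightarrow> 'g set \<Rightarrow> ('g \<Rightarrow> rat) \<Rightarrow>
    ('x \<Rightarrow> rat) \<Rightarrow> ('x \<Rightarrow> rat)" where
  "wsum G \<rho> R \<alpha> f = (\<Sum>r\<in>R. fscale (\<alpha> r) (pact G \<rho> r f))"

locale sign_char = group G for G :: "('g, 'b) monoid_scheme" (structure) +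
  fixes R :: "'g set" and \<alpha> :: "'g \<Rightarrow> rat"
  assumes sub: "subgroup R G"
    and mult: "r \<in> R \<Longrightarrow> s \<in> R \<Longrightarrow> \<alpha> (r \<otimes> s) = \<alpha> r * \<alpha> s"
    and pm: "r \<in> R \<Longrightarrow> \<alpha> r = 1 \<or> \<alpha> r = -1"
begin

lemma mem_carrier: "r \<in> R \<Longrightarrow> r \<in> carrier G"
  using subgroup.subset[OF sub] by blast

lemma mult_mem: "r \<in> R \<Longrightarrow> s \<in> R \<Longrightarrow> r \<otimes> s \<in> R"
  and inv_mem: "r \<in> R \<Longrightarrow> inv r \<in> R"
  and one_mem: "\<one> \<in> R"
  using sub by (auto simp: subgroup.m_closed subgroup.m_inv_closed subgroup.one_closed)

lemma sq: "r \<in> R \<Longrightarrow> \<alpha> r * \<alpha> r = 1"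
  using pm by fastforce

lemma char_one: "\<alpha> \<one> = 1"
  using mult[OF one_mem one_mem] pm[OF one_mem] by auto

lemma char_inv: assumes "r \<in> R" shows "\<alpha> (inv r) = \<alpha> r"
proof -
  have "\<alpha> r * \<alpha> (inv r) = 1"
    using mult[OF assms inv_mem[OF assms]] mem_carrier[OF assms] char_one by simp
  then show ?thesis using pm[OF assms] pm[OF inv_mem[OF assms]] by auto
qed

end

locale sign_char_action = sign_char G R \<alpha> + finite_action G \<rho>
  for G :: "('g, 'b) monoid_scheme" (structure) and R \<alpha> and \<rho> :: "'g \<Rightarrow> 'x \<Rightarrow> 'x"
begin

abbreviation "A \<equiv> wsum G \<rho> R \<alpha>"

lemma finR: "finite R"
  using finite_subset[OF subgroup.subset[OF sub] fin] .

lemma flinear_A: "flinear A"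
  unfolding flinear_def wsum_def
  by (simp add: flinear_add[OF flinear_P] flinear_scale[OF flinear_P] fs.scale_right_distrib
      sum.distrib fs.scale_sum_right mult.commute)

lemma P_A: assumes "r \<in> R" shows "P r (A f) = fscale (\<alpha> r) (A f)"
proof -
  have r: "r \<in> carrier G" by (rule mem_carrier[OF assms])
  have "P r (A f) = (\<Sum>s\<in>R. fscale (\<alpha> s) (P (r \<otimes> s) f))"
    unfolding wsum_def flinear_sum[OF flinear_P] flinear_scale[OF flinear_P]
    by (intro sum.cong) (auto simp: P_mult r mem_carrier)
  also have "\<dots> = (\<Sum>s\<in>R. fscale (\<alpha> r) (fscale (\<alpha> (r \<otimes> s)) (P (r \<otimes> s) f)))"
    by (intro sum.cong) (simp_all add: mult assms sq flip: mult.assoc)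
  also have "\<dots> = (\<Sum>s\<in>R. fscale (\<alpha> r) (fscale (\<alpha> s) (P s f)))"
    by (rule sum.reindex_bij_witness[of _ "\<lambda>s. inv r \<otimes> s" "\<lambda>s. r \<otimes> s"])
      (auto simp: mult_mem inv_mem assms mem_carrier r inv_solve_left simp flip: m_assoc)
  also have "\<dots> = fscale (\<alpha> r) (A f)"
    unfolding wsum_def by (rule fs.scale_sum_right[symmetric])
  finally show ?thesis .
qed

lemma A_P: assumes "r \<in> R" shows "A (P r f) = fscale (\<alpha> r) (A f)"
proof -
  have r: "r \<in> carrier G" by (rule mem_carrier[OF assms])
  have "A (P r f) = (\<Sum>s\<in>R. fscale (\<alpha> s) (P (s \<otimes> r) f))"
    unfolding wsum_def by (intro sum.cong) (auto simp: P_mult r mem_carrier)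
  also have "\<dots> = (\<Sum>s\<in>R. fscale (\<alpha> r) (fscale (\<alpha> (s \<otimes> r)) (P (s \<otimes> r) f)))"
    by (intro sum.cong) (simp_all add: mult assms sq mult.left_commute)
  also have "\<dots> = (\<Sum>s\<in>R. fscale (\<alpha> r) (fscale (\<alpha> s) (P s f)))"
    by (rule sum.reindex_bij_witness[of _ "\<lambda>s. s \<otimes> inv r" "\<lambda>s. s \<otimes> r"])
      (auto simp: mult_mem inv_mem assms mem_carrier r m_assoc)
  also have "\<dots> = fscale (\<alpha> r) (A f)"
    unfolding wsum_def by (rule fs.scale_sum_right[symmetric])
  finally show ?thesis .
qed

lemma A_A: "A (A f) = fscale (of_nat (card R)) (A f)"
proof -
  have "A (A f) = (\<Sum>r\<in>R. fscale (\<alpha> r) (P r (A f)))" by (rule wsum_def)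
  also have "\<dots> = (\<Sum>r\<in>R. A f)" by (intro sum.cong) (simp_all add: P_A sq)
  also have "\<dots> = fscale (of_nat (card R)) (A f)"
    by (rule ext) (simp add: sum_fun_apply pointwise)
  finally show ?thesis .
qed

lemma gsub_A: "gsub G P U \<Longrightarrow> f \<in> U \<Longrightarrow> A f \<in> U"
  unfolding wsum_def by (intro fs.subspace_sum fs.subspace_scale) (auto simp: gsub_def mem_carrier)

lemma ip_A:
  assumes "stable D"
  shows "ip D (A f) h = ip D f (A h)"
proof -
  have "ip D (A f) h = (\<Sum>r\<in>R. \<alpha> r * ip D f (P (inv r) h))"
    unfolding wsum_def ip_sum_left ip_scale_left
    by (intro sum.cong) (auto simp: ip_P_left[OF assms] mem_carrier)
  also have "\<dots> = (\<Sum>r\<in>R. \<alpha> r * ip D f (P r h))"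
    by (rule sum.reindex_bij_witness[of _ "\<lambda>s. inv s" "\<lambda>s. inv s"])
      (auto simp: inv_mem mem_carrier char_inv)
  finally show ?thesis
    unfolding wsum_def ip_sum_right ip_scale_right .
qed

end

text \<open>
  The abstract shape of a row group with its character and a column group with its character: an
  element either factors as a column element times a row element or conjugates some row element
  to a column element of opposite sign.
\<close>

locale char_pair = R: sign_char G R \<alpha> + C: sign_char G C \<beta>
  for G :: "('g, 'b) monoid_scheme" (structure) and R \<alpha> C \<beta> +
  assumes fin: "finite (carrier G)"
    and agree: "x \<in> R \<Longrightarrow> x \<in> C \<Longrightarrow> \<alpha> x = \<beta> x"
    and dich: "g \<in> carrier G \<Longrightarrow> (\<exists>c\<in>C. \<exists>r\<in>R. g = c \<otimes> r) \<or>
      (\<exists>r\<in>R. g \<otimes> r \<otimes> inv g \<in> C \<and> \<alpha> r \<noteq> \<beta> (g \<otimes> r \<otimes> inv g))"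
begin

text \<open>
  Multiplicities are measured by \<open>BA\<close>, but the left ideal that is isomorphic to an induced
  representation is generated by \<open>AB\<close>. The symmetry of the notion allows passing between the two.
\<close>

lemma swap: "char_pair G C \<beta> R \<alpha>"
proof unfold_locales
  show "finite (carrier G)" by (rule fin)
  show "x \<in> C \<Longrightarrow> x \<in> R \<Longrightarrow> \<beta> x = \<alpha> x" for x by (rule agree[symmetric])
  fix g assume g: "g \<in> carrier G"
  show "(\<exists>c\<in>R. \<exists>r\<in>C. g = c \<otimes> r) \<or> (\<exists>r\<in>C. g \<otimes> r \<otimes> inv g \<in> R \<and> \<beta> r \<noteq> \<alpha> (g \<otimes> r \<otimes> inv g))"
    using dich[OF R.inv_closed[OF g]]
  proof (elim disjE bexE conjE)
    fix c r assume "c \<in> C" "r \<in> R" and e: "inv g = c \<otimes> r"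
    have "g = inv (c \<otimes> r)" using g by (simp flip: e)
    also have "\<dots> = inv r \<otimes> inv c"
      using \<open>c \<in> C\<close> \<open>r \<in> R\<close> by (simp add: R.inv_mult_group R.mem_carrier C.mem_carrier)
    finally show ?thesis using \<open>c \<in> C\<close> \<open>r \<in> R\<close> C.inv_mem R.inv_mem by blast
  next
    fix r assume r: "r \<in> R" and c: "inv g \<otimes> r \<otimes> inv (inv g) \<in> C"
      "\<alpha> r \<noteq> \<beta> (inv g \<otimes> r \<otimes> inv (inv g))"
    let ?c = "inv g \<otimes> r \<otimes> g"
    have "g \<otimes> ?c \<otimes> inv g = r"
      using g R.mem_carrier[OF r] by (simp add: R.m_assoc) (simp flip: R.m_assoc)
    then show ?thesis using c r g by (intro disjI2 bexI[of _ ?c]) auto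
  qed
qed

text \<open>
  The scalar with \<open>B g A = \<kappa> g B A\<close>. Two factorizations of \<open>g\<close> differ by an element of \<open>R \<inter> C\<close>, on
  which the characters agree, so the choice among them is immaterial.
\<close>

definition \<kappa> :: "'g \<Rightarrow> rat" where
  "\<kappa> g = (if \<exists>c\<in>C. \<exists>r\<in>R. g = c \<otimes> r
     then let p = SOME p. fst p \<in> C \<and> snd p \<in> R \<and> g = fst p \<otimes> snd p in \<beta> (fst p) * \<alpha> (snd p) else 0)"

lemma \<kappa>_cases:
  assumes "g \<in> carrier G"
  obtains c r where "c \<in> C" "r \<in> R" "g = c \<otimes> r" "\<kappa> g = \<beta> c * \<alpha> r"
  | r where "r \<in> R" "g \<otimes> r \<otimes> inv g \<in> C" "\<alpha> r \<noteq> \<beta> (g \<otimes> r \<otimes> inv g)" "\<kappa> g = 0"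
proof (cases "\<exists>c\<in>C. \<exists>r\<in>R. g = c \<otimes> r")
  case True
  define p where "p = (SOME p. fst p \<in> C \<and> snd p \<in> R \<and> g = fst p \<otimes> snd p)"
  have "\<exists>p. fst p \<in> C \<and> snd p \<in> R \<and> g = fst p \<otimes> snd p" using True by auto
  then have "fst p \<in> C \<and> snd p \<in> R \<and> g = fst p \<otimes> snd p" unfolding p_def by (rule someI_ex)
  moreover have "\<kappa> g = \<beta> (fst p) * \<alpha> (snd p)" using True by (simp add: \<kappa>_def p_def Let_def)
  ultimately show thesis using that(1) by blast
next
  case False
  then have "\<kappa> g = 0" unfolding \<kappa>_def by (rule if_not_P)
  then show thesis using False dich[OF assms] that(2) by blast
qed

text \<open>The scalar with \<open>E E = \<gamma> E\<close>.\<close>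

definition \<gamma> :: rat where
  "\<gamma> = (\<Sum>r\<in>R. \<Sum>c\<in>C. \<alpha> r * \<beta> c * \<kappa> (r \<otimes> c))"

end

locale char_pair_action = char_pair G R \<alpha> C \<beta> + finite_action G \<rho>
  for G :: "('g, 'b) monoid_scheme" (structure) and R \<alpha> C \<beta> and \<rho> :: "'g \<Rightarrow> 'x \<Rightarrow> 'x"
begin

sublocale R: sign_char_action G R \<alpha> \<rho> ..
sublocale C: sign_char_action G C \<beta> \<rho> ..

abbreviation A where "A \<equiv> wsum G \<rho> R \<alpha>"
abbreviation B where "B \<equiv> wsum G \<rho> C \<beta>"
abbreviation E where "E f \<equiv> B (A f)"

lemma flinear_E: "flinear E"
  by (rule flinear_comp[OF C.flinear_A R.flinear_A])

lemmas B_scale = flinear_scale[OF C.flinear_A]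
lemmas A_scale = flinear_scale[OF R.flinear_A]

text \<open>
  If \<open>g\<close> conjugates \<open>r\<close> to a column element of opposite sign, then inserting \<open>r\<close> between \<open>g\<close> and \<open>A\<close>
  changes the sign of \<open>B g A\<close>, which therefore vanishes.
\<close>

lemma B_P_A:
  assumes "g \<in> carrier G"
  shows "B (P g (A f)) = fscale (\<kappa> g) (E f)"
proof (cases rule: \<kappa>_cases[OF assms])
  case (1 c r)
  then have "P g (A f) = P c (fscale (\<alpha> r) (A f))"
    by (simp add: P_mult R.mem_carrier C.mem_carrier R.P_A)
  then show ?thesis
    using 1 by (simp add: flinear_scale[OF flinear_P] B_scale C.A_P mult.commute)
next
  case (2 r)
  let ?c = "g \<otimes> r \<otimes> inv g"
  have "fscale (\<alpha> r) (B (P g (A f))) = B (P g (P r (A f)))"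
    using 2 by (simp add: R.P_A flinear_scale[OF flinear_P] B_scale)
  also have "P g (P r (A f)) = P ?c (P g (A f))"
    using assms R.mem_carrier[OF 2(1)] by (simp add: R.m_assoc flip: P_mult)
  also have "B \<dots> = fscale (\<beta> ?c) (B (P g (A f)))" by (rule C.A_P[OF 2(2)])
  finally have "fscale (\<alpha> r) (B (P g (A f))) = fscale (\<beta> ?c) (B (P g (A f)))" .
  then have "B (P g (A f)) = 0" using 2(3) by (simp add: fs.scale_cancel_right)
  then show ?thesis using 2(4) by simp
qed

lemma A_P_B:
  assumes g: "g \<in> carrier G"
  shows "A (P g (B f)) = fscale (\<kappa> (inv g)) (A (B f))"
proof (cases rule: \<kappa>_cases[OF R.inv_closed[OF assms]])
  case (1 c r)
  have "g = inv (c \<otimes> r)" using g by (simp flip: 1(3))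
  also have "\<dots> = inv r \<otimes> inv c"
    using 1 by (simp add: R.inv_mult_group R.mem_carrier C.mem_carrier)
  finally have "P g (B f) = P (inv r) (fscale (\<beta> c) (B f))"
    using 1 by (simp add: P_mult R.mem_carrier C.mem_carrier C.P_A C.inv_mem C.char_inv)
  then show ?thesis
    using 1 by (simp add: flinear_scale[OF flinear_P] A_scale R.A_P R.inv_mem R.char_inv)
next
  case (2 r)
  let ?c = "inv g \<otimes> r \<otimes> g"
  have c: "?c \<in> C" "\<alpha> r \<noteq> \<beta> ?c" using 2 g by auto
  have r: "r \<in> carrier G" by (rule R.mem_carrier[OF 2(1)])
  have "fscale (\<beta> ?c) (A (P g (B f))) = A (P g (P ?c (B f)))"
    using c by (simp add: C.P_A flinear_scale[OF flinear_P] A_scale)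
  also have "P g (P ?c (B f)) = P (g \<otimes> ?c) (B f)"
    using g r by (simp add: P_mult)
  also have "g \<otimes> ?c = r \<otimes> g" using g r by (simp flip: R.m_assoc)
  also have "P (r \<otimes> g) (B f) = P r (P g (B f))" using g r by (simp add: P_mult)
  also have "A \<dots> = fscale (\<alpha> r) (A (P g (B f)))" by (rule R.A_P[OF 2(1)])
  finally have "A (P g (B f)) = 0" using c(2) by (simp add: fs.scale_cancel_right)
  then show ?thesis using 2(4) by simp
qed

lemma E_E: "E (E f) = fscale \<gamma> (E f)"
proof -
  have "E (E f) = B (\<Sum>r\<in>R. fscale (\<alpha> r) (P r (\<Sum>c\<in>C. fscale (\<beta> c) (P c (A f)))))"
    by (simp only: wsum_def)
  also have "\<dots> = (\<Sum>r\<in>R. \<Sum>c\<in>C. fscale (\<alpha> r * \<beta> c) (B (P r (P c (A f)))))"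
    by (simp add: flinear_sum[OF C.flinear_A] flinear_sum[OF flinear_P] flinear_scale[OF flinear_P]
        B_scale fs.scale_sum_right)
  also have "\<dots> = (\<Sum>r\<in>R. \<Sum>c\<in>C. fscale (\<alpha> r * \<beta> c * \<kappa> (r \<otimes> c)) (E f))"
    by (intro sum.cong) (auto simp: R.mem_carrier C.mem_carrier B_P_A simp flip: P_mult)
  also have "\<dots> = fscale \<gamma> (E f)"
    by (simp add: \<gamma>_def fs.scale_sum_left)
  finally show ?thesis .
qed

lemma E_P_E:
  assumes "g \<in> carrier G"
  shows "E (P g (E f)) = fscale (\<kappa> (inv g) * \<gamma>) (E f)"
  using A_P_B[OF assms, of "A f"] E_E[of f] by (simp add: B_scale)

lemma gsub_E: "gsub G P U \<Longrightarrow> f \<in> U \<Longrightarrow> E f \<in> U"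
  by (intro R.gsub_A C.gsub_A)

text \<open>
  Both \<open>A\<close> and \<open>B\<close> are selfadjoint and idempotent up to positive factors. So if \<open>BABA\<close> kills \<open>f\<close>,
  then \<open>ABA f\<close> is orthogonal to itself, hence zero, and then \<open>BA f\<close> is orthogonal to itself.
\<close>

lemma E_ne_zero_imp_gamma:
  assumes "finite D" "stable D" "f \<in> supp_on D" "E f \<noteq> 0"
  shows "\<gamma> \<noteq> 0"
proof
  assume "\<gamma> = 0"
  then have z: "E (E f) = 0" by (simp add: E_E)
  have s: "A f \<in> supp_on D" "A (E f) \<in> supp_on D" "E f \<in> supp_on D"
    using gsub_supp_on[OF assms(2)] assms(3) by (auto intro: R.gsub_A C.gsub_A)
  have "ip D (A (E f)) (A (E f)) = ip D (E f) (A (A (E f)))" by (rule R.ip_A[OF assms(2)])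
  also have "\<dots> = of_nat (card R) * ip D (A f) (E (E f))"
    by (simp add: R.A_A ip_scale_right C.ip_A[OF assms(2)])
  finally have "A (E f) = 0" using z ip_self_zero[OF assms(1) s(2)] by simp
  then have "0 = ip D f (A (E f))" by simp
  also have "\<dots> = ip D (A f) (B (A f))" by (simp add: R.ip_A[OF assms(2)])
  finally have "ip D (A f) (B (A f)) = 0" by simp
  then have "ip D (A f) (B (B (A f))) = 0" by (simp add: C.A_A ip_scale_right)
  then have "ip D (E f) (E f) = 0" by (simp add: C.ip_A[OF assms(2)])
  then show False using ip_self_zero[OF assms(1) s(3)] assms(4) by blast
qed

text \<open>The action of an element of the group algebra.\<close>

definition comb :: "('g \<Rightarrow> rat) \<Rightarrow> ('x \<Rightarrow> rat) \<Rightarrow> ('x \<Rightarrow> rat)" where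
  "comb a f = (\<Sum>g\<in>carrier G. fscale (a g) (P g f))"

lemma comb_add: "comb (a + b) f = comb a f + comb b f"
  and comb_diff: "comb (a - b) f = comb a f - comb b f"
  and comb_fscale: "comb (fscale c a) f = fscale c (comb a f)"
  and comb_zero: "comb 0 f = 0"
  by (simp_all add: comb_def pointwise fs.scale_left_distrib fs.scale_left_diff_distrib sum.distrib
      sum_subtractf fs.scale_sum_right)

lemma P_comb:
  assumes "h \<in> carrier G"
  shows "P h (comb a f) = comb (\<lambda>g. a (inv h \<otimes> g)) f"
proof -
  have "P h (comb a f) = (\<Sum>g\<in>carrier G. fscale (a g) (P (h \<otimes> g) f))"
    unfolding comb_def flinear_sum[OF flinear_P] flinear_scale[OF flinear_P]
    by (intro sum.cong) (auto simp: P_mult assms)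
  also have "\<dots> = comb (\<lambda>g. a (inv h \<otimes> g)) f"
    unfolding comb_def
    by (rule sum.reindex_bij_witness[of _ "\<lambda>g. inv h \<otimes> g" "\<lambda>g. h \<otimes> g"])
      (auto simp: assms simp flip: R.m_assoc)
  finally show ?thesis .
qed

lemma comb_delta: "g \<in> carrier G \<Longrightarrow> comb (delta g) f = P g f"
  unfolding comb_def delta_def using fin by (simp add: if_distrib[of "\<lambda>c. fscale c _"] cong: if_cong)

lemma self_eq_comb: "comb (delta \<one>) f = f"
  by (simp add: comb_delta)

lemma gsub_range_comb: "gsub G P (range (\<lambda>a. comb a f))"
  unfolding gsub_def fs.subspace_def
proof (intro conjI ballI allI)
  show "0 \<in> range (\<lambda>a. comb a f)" using comb_zero[of f] by (metis rangeI)
qed (auto simp: P_comb simp flip: comb_add comb_fscale)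

lemma gsub_comb: "gsub G P U \<Longrightarrow> f \<in> U \<Longrightarrow> comb a f \<in> U"
  unfolding comb_def by (intro fs.subspace_sum fs.subspace_scale) (auto simp: gsub_def)

lemma girr_generated:
  assumes "girr G P U" "u \<in> U" "u \<noteq> 0"
  shows "U = range (\<lambda>a. comb a u)"
proof -
  have U: "gsub G P U" using assms(1) by (simp add: girr_def)
  have "range (\<lambda>a. comb a u) \<subseteq> U" using gsub_comb[OF U assms(2)] by blast
  moreover have "u \<in> range (\<lambda>a. comb a u)" using self_eq_comb by (metis rangeI)
  ultimately show ?thesis
    using assms(1,3) gsub_range_comb[of u] unfolding girr_def by blast
qed

text \<open>
  Compressed by \<open>E\<close>, the whole group algebra acts on \<open>E f\<close> by scalars that are independent of \<open>f\<close> and of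
  the representation.
\<close>

lemma E_comb_E: "E (comb a (E f)) = fscale (\<Sum>g\<in>carrier G. a g * (\<kappa> (inv g) * \<gamma>)) (E f)"
  unfolding comb_def flinear_sum[OF flinear_E] flinear_scale[OF flinear_E] fs.scale_sum_left
  by (intro sum.cong) (auto simp: E_P_E)

text \<open>
  The left ideal generated by \<open>BA\<close> is irreducible: as \<open>E\<close> maps it to the line of its generator, a
  proper subrepresentation is killed by \<open>E\<close>, and then the generator is orthogonal to it.
\<close>

lemma girr_range_comb:
  assumes "finite D" "stable D" "f \<in> supp_on D" "E f \<noteq> 0"
  shows "girr G P (range (\<lambda>a. comb a (E f)))" (is "girr G P ?V")
  unfolding girr_def
proof (intro conjI allI impI gsub_range_comb)
  let ?v = "E f"
  have vV: "?v \<in> ?V" using self_eq_comb by (metis rangeI)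
  then show "?V \<noteq> {0}" using assms(4) by blast
  fix W assume W: "gsub G P W" "W \<subseteq> ?V"
  have vD: "?v \<in> supp_on D" by (rule gsub_E[OF gsub_supp_on[OF assms(2)] assms(3)])
  have VD: "?V \<subseteq> supp_on D" using gsub_comb[OF gsub_supp_on[OF assms(2)] vD] by blast
  have gen: "?V \<subseteq> Z" if "gsub G P Z" "?v \<in> Z" for Z
    using gsub_comb[OF that] by blast
  show "W = {0} \<or> W = ?V"
  proof (cases "\<forall>w\<in>W. E w = 0")
    case False
    then obtain w where w: "w \<in> W" "E w \<noteq> 0" by blast
    then obtain a where "w = comb a ?v" using W by blast
    then obtain k where k: "E w = fscale k ?v" using E_comb_E by blast
    then have "k \<noteq> 0" using w by auto
    then have "?v = fscale (inverse k) (E w)" using k by simp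
    moreover have "E w \<in> W" using gsub_E W w by blast
    ultimately have "?v \<in> W" using fs.subspace_scale[OF gsub_subspace[OF W(1)]] by metis
    then show ?thesis using gen[OF W(1)] W(2) by blast
  next
    case True
    obtain w u where wu: "w \<in> W" "u \<in> orth D W" "?v = w + u"
      by (rule orth_decomp[OF assms(1) gsub_subspace[OF W(1)] subset_trans[OF W(2) VD] vD]) (rule that)
    have "fscale \<gamma> ?v = E ?v" by (rule E_E[symmetric])
    also have "\<dots> = E w + E u" unfolding wu(3) by (rule flinear_add[OF flinear_E])
    also have "\<dots> = E u" using True wu(1) by simp
    finally have "fscale \<gamma> ?v = E u" .
    moreover have "E u \<in> orth D W" using gsub_E[OF gsub_orth[OF assms(2) W(1)] wu(2)] .
    ultimately have "fscale (inverse \<gamma>) (fscale \<gamma> ?v) \<in> orth D W"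
      using fs.subspace_scale[OF subspace_orth] by metis
    then have "?v \<in> orth D W" using E_ne_zero_imp_gamma[OF assms] by simp
    then have "?V \<subseteq> orth D W" by (rule gen[OF gsub_orth[OF assms(2) W(1)]])
    then have "W \<subseteq> {0}" using W(2) orth_disjoint[OF assms(1), of W] by blast
    then show ?thesis using fs.subspace_0[OF gsub_subspace[OF W(1)]] by blast
  qed
qed

end

section \<open>Multiplicities as dimensions\<close>

context char_pair
begin

lemma char_pair_actionI: "finite_action G \<rho> \<Longrightarrow> char_pair_action G R \<alpha> C \<beta> \<rho>"
  by (intro char_pair_action.intro char_pair_axioms)

text \<open>
  The scalars \<open>\<kappa>\<close> and \<open>\<gamma>\<close> are the same for all actions. So a relation between the translates of the
  vector \<open>E u\<close> of one representation is detected by scalars and holds for the translates of the vector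
  \<open>E v\<close> of another irreducible one.
\<close>

lemma comb_E_eq_zero_transfer:
  fixes \<rho> :: "'g \<Rightarrow> 'x \<Rightarrow> 'x" and \<sigma> :: "'g \<Rightarrow> 'y \<Rightarrow> 'y"
  assumes \<rho>: "finite_action G \<rho>" and \<sigma>: "finite_action G \<sigma>"
    and u: "wsum G \<rho> C \<beta> (wsum G \<rho> R \<alpha> u) \<noteq> 0"
    and V: "girr G (pact G \<sigma>) V" "v \<in> V" "wsum G \<sigma> C \<beta> (wsum G \<sigma> R \<alpha> v) \<noteq> 0"
    and z: "char_pair_action.comb G \<rho> x (wsum G \<rho> C \<beta> (wsum G \<rho> R \<alpha> u)) = 0"
  shows "char_pair_action.comb G \<sigma> x (wsum G \<sigma> C \<beta> (wsum G \<sigma> R \<alpha> v)) = 0"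
proof (rule ccontr)
  interpret a: char_pair_action G R \<alpha> C \<beta> \<rho> by (rule char_pair_actionI[OF \<rho>])
  interpret b: char_pair_action G R \<alpha> C \<beta> \<sigma> by (rule char_pair_actionI[OF \<sigma>])
  define w where "w = b.comb x (b.E v)"
  assume "b.comb x (b.E v) \<noteq> 0"
  then have w0: "w \<noteq> 0" by (simp add: w_def)
  have Vg: "gsub G (pact G \<sigma>) V" using V(1) by (simp add: girr_def)
  have wV: "w \<in> V"
    unfolding w_def by (intro b.gsub_comb[OF Vg] b.gsub_E[OF Vg] V(2))
  have Ew: "b.E (pact G \<sigma> h w) = 0" if h: "h \<in> carrier G" for h
  proof -
    let ?k = "\<Sum>g\<in>carrier G. x (inv\<^bsub>G\<^esub> h \<otimes>\<^bsub>G\<^esub> g) * (\<kappa> (inv\<^bsub>G\<^esub> g) * \<gamma>)"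
    have "fscale ?k (a.E u) = a.E (pact G \<rho> h (a.comb x (a.E u)))"
      by (simp only: a.P_comb[OF h] a.E_comb_E)
    also have "\<dots> = 0"
      by (simp only: z flinear_zero[OF a.flinear_P] flinear_zero[OF a.flinear_E])
    finally have "?k = 0" using u by simp
    moreover have "b.E (pact G \<sigma> h w) = fscale ?k (b.E v)"
      by (simp only: w_def b.P_comb[OF h] b.E_comb_E)
    ultimately show ?thesis by simp
  qed
  obtain y where "v = b.comb y w"
    using b.girr_generated[OF V(1) wV w0] V(2) by blast
  then have "b.E v = (\<Sum>h\<in>carrier G. fscale (y h) (b.E (pact G \<sigma> h w)))"
    by (simp only: b.comb_def flinear_sum[OF b.flinear_E] flinear_scale[OF b.flinear_E])
  also have "\<dots> = 0" by (simp add: Ew)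
  finally show False using V(3) by simp
qed

text \<open>
  By the previous lemma in both directions, \<open>a \<cdot> E u \<mapsto> a \<cdot> E v\<close> for \<open>a\<close> in the group algebra is a
  well-defined bijection.
\<close>

lemma rep_iso_if_E_ne_zero:
  fixes \<rho> :: "'g \<Rightarrow> 'x \<Rightarrow> 'x" and \<sigma> :: "'g \<Rightarrow> 'y \<Rightarrow> 'y"
  assumes \<rho>: "finite_action G \<rho>" and \<sigma>: "finite_action G \<sigma>"
    and U: "girr G (pact G \<rho>) U" "u \<in> U" "wsum G \<rho> C \<beta> (wsum G \<rho> R \<alpha> u) \<noteq> 0"
    and V: "girr G (pact G \<sigma>) V" "v \<in> V" "wsum G \<sigma> C \<beta> (wsum G \<sigma> R \<alpha> v) \<noteq> 0"
  shows "rep_iso G (fun_rep U (pact G \<rho>)) (fun_rep V (pact G \<sigma>))"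
proof -
  interpret a: char_pair_action G R \<alpha> C \<beta> \<rho> by (rule char_pair_actionI[OF \<rho>])
  interpret b: char_pair_action G R \<alpha> C \<beta> \<sigma> by (rule char_pair_actionI[OF \<sigma>])
  have Ug: "gsub G (pact G \<rho>) U" and Vg: "gsub G (pact G \<sigma>) V"
    using U(1) V(1) by (simp_all add: girr_def)
  define f where "f x = a.comb x (a.E u)" for x
  define h where "h x = b.comb x (b.E v)" for x
  have Uf: "U = range f" unfolding f_def
    by (rule a.girr_generated[OF U(1) a.gsub_E[OF Ug U(2)] U(3)])
  have Vh: "V = range h" unfolding h_def
    by (rule b.girr_generated[OF V(1) b.gsub_E[OF Vg V(2)] V(3)])
  have zero: "f x = 0 \<longleftrightarrow> h x = 0" for x
    unfolding f_def h_def
    using comb_E_eq_zero_transfer[OF \<rho> \<sigma> U(3) V] comb_E_eq_zero_transfer[OF \<sigma> \<rho> V(3) U] by blast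
  have eq: "f x = f y \<longleftrightarrow> h x = h y" for x y
    using zero[of "x - y"] by (simp add: f_def h_def a.comb_diff b.comb_diff)
  define \<phi> where "\<phi> w = h (SOME x. f x = w)" for w
  have \<phi>: "\<phi> (f x) = h x" for x
  proof -
    have "f (SOME y. f y = f x) = f x" by (rule someI[of "\<lambda>y. f y = f x" x]) (rule refl)
    then show ?thesis unfolding \<phi>_def eq .
  qed
  have "is_iso G (fun_rep U (pact G \<rho>)) (fun_rep V (pact G \<sigma>)) \<phi>"
    unfolding is_iso_def fun_rep_simps
  proof (intro conjI ballI allI)
    show "bij_betw \<phi> U V"
      unfolding bij_betw_def inj_on_def Uf Vh by (auto simp: \<phi> eq image_iff)
  next
    fix w w' assume "w \<in> U" "w' \<in> U"
    then obtain x y where [simp]: "w = f x" "w' = f y" by (auto simp: Uf)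
    have "w + w' = f (x + y)" by (simp add: f_def a.comb_add)
    then show "\<phi> (w + w') = \<phi> w + \<phi> w'" by (simp add: \<phi>) (simp add: h_def b.comb_add)
  next
    fix c w assume "w \<in> U"
    then obtain x where [simp]: "w = f x" by (auto simp: Uf)
    have "fscale c w = f (fscale c x)" by (simp add: f_def a.comb_fscale)
    then show "\<phi> (fscale c w) = fscale c (\<phi> w)" by (simp add: \<phi>) (simp add: h_def b.comb_fscale)
  next
    fix g w assume g: "g \<in> carrier G" and "w \<in> U"
    then obtain x where [simp]: "w = f x" by (auto simp: Uf)
    have "pact G \<rho> g w = f (\<lambda>k. x (inv\<^bsub>G\<^esub> g \<otimes>\<^bsub>G\<^esub> k))" by (simp add: f_def a.P_comb[OF g])
    then show "\<phi> (pact G \<rho> g w) = pact G \<sigma> g (\<phi> w)" by (simp add: \<phi>) (simp add: h_def b.P_comb[OF g])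
  qed
  then show ?thesis by (auto simp: rep_iso_iff_is_iso)
qed

end

lemma is_iso_wsum:
  assumes iso: "is_iso G (fun_rep U (pact G \<rho>)) (fun_rep V (pact G \<sigma>)) \<phi>"
    and U: "gsub G (pact G \<rho>) U" and "finite S" "S \<subseteq> carrier G" and f: "f \<in> U"
  shows "\<phi> (wsum G \<rho> S \<theta> f) = wsum G \<sigma> S \<theta> (\<phi> f) \<and> wsum G \<rho> S \<theta> f \<in> U"
  using assms(3,4)
proof (induction S)
  case empty
  have "\<phi> (fscale 0 0) = fscale 0 (\<phi> 0)"
    using iso fs.subspace_0[OF gsub_subspace[OF U]] unfolding is_iso_def fun_rep_simps by blast
  then show ?case using fs.subspace_0[OF gsub_subspace[OF U]] by (simp add: wsum_def)
next
  case (insert s S)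
  let ?w = "wsum G \<rho> S \<theta> f"
  have s: "pact G \<rho> s f \<in> U" using U f insert.prems by (auto simp: gsub_def)
  have t: "fscale (\<theta> s) (pact G \<rho> s f) \<in> U" using fs.subspace_scale[OF gsub_subspace[OF U] s] .
  have IH: "\<phi> ?w = wsum G \<sigma> S \<theta> (\<phi> f)" "?w \<in> U" using insert by auto
  have add: "\<phi> (fscale (\<theta> s) (pact G \<rho> s f) + ?w) = \<phi> (fscale (\<theta> s) (pact G \<rho> s f)) + \<phi> ?w"
    using iso t IH(2) unfolding is_iso_def fun_rep_simps by blast
  have sc: "\<phi> (fscale (\<theta> s) (pact G \<rho> s f)) = fscale (\<theta> s) (\<phi> (pact G \<rho> s f))"
    using iso s unfolding is_iso_def fun_rep_simps by blast
  have eq: "\<phi> (pact G \<rho> s f) = pact G \<sigma> s (\<phi> f)"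
    using iso f insert.prems unfolding is_iso_def fun_rep_simps by blast
  have e: "wsum G \<rho> (insert s S) \<theta> f = fscale (\<theta> s) (pact G \<rho> s f) + ?w"
    "wsum G \<sigma> (insert s S) \<theta> (\<phi> f) = fscale (\<theta> s) (pact G \<sigma> s (\<phi> f)) + wsum G \<sigma> S \<theta> (\<phi> f)"
    using insert.hyps by (simp_all add: wsum_def)
  show ?case
    unfolding e add sc eq IH(1) using fs.subspace_add[OF gsub_subspace[OF U] t IH(2)] by simp
qed

context char_pair_action
begin

lemma E_ne_zero_if_rep_iso:
  assumes \<sigma>: "finite_action G \<sigma>" and U: "gsub G P U" and V: "gsub G (pact G \<sigma>) V" "v \<in> V"
    "wsum G \<sigma> C \<beta> (wsum G \<sigma> R \<alpha> v) \<noteq> 0"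
    and "rep_iso G (fun_rep U P) (fun_rep V (pact G \<sigma>))"
  shows "\<exists>u\<in>U. E u \<noteq> 0"
proof -
  obtain \<phi> where iso: "is_iso G (fun_rep U P) (fun_rep V (pact G \<sigma>)) \<phi>"
    using assms(6) by (auto simp: rep_iso_iff_is_iso)
  then obtain u where u: "u \<in> U" "\<phi> u = v"
    using V(2) by (auto simp: is_iso_def bij_betw_def)
  note w = is_iso_wsum[OF iso U]
  have Au: "A u \<in> U" "\<phi> (A u) = wsum G \<sigma> R \<alpha> v"
    using w[OF R.finR subgroup.subset[OF R.sub] u(1)] u(2) by auto
  then have "\<phi> (E u) = wsum G \<sigma> C \<beta> (wsum G \<sigma> R \<alpha> v)"
    using w[OF C.finR subgroup.subset[OF C.sub] Au(1)] by auto
  moreover have "\<phi> 0 = 0"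
    using is_iso_zero[OF iso is_rep_fun_rep[OF U] is_rep_fun_rep[OF V(1)]] by simp
  ultimately show ?thesis using V(3) u(1) by metis
qed

lemma E_irreducible_line:
  assumes "girr G P U" "u \<in> U" "E u \<noteq> 0" "w \<in> U"
  shows "\<exists>k. E w = fscale k (E u)"
proof -
  have "gsub G P U" using assms(1) by (simp add: girr_def)
  then have "w \<in> range (\<lambda>a. comb a (E u))"
    using girr_generated[OF assms(1) gsub_E assms(3)] assms(2,4) by blast
  then show ?thesis using E_comb_E by blast
qed

text \<open>
  \<open>E\<close> maps every irreducible summand to a line or to zero, and the summands of the first kind are
  exactly those isomorphic to \<open>V\<close>.
\<close>

lemma card_isomorphic_summands:
  assumes dec: "irreducible_decomposition G (fun_rep H P) r U" and H: "gsub G P H"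
    and \<sigma>: "finite_action G \<sigma>" and V: "girr G (pact G \<sigma>) V" "v \<in> V"
    "wsum G \<sigma> C \<beta> (wsum G \<sigma> R \<alpha> v) \<noteq> 0"
  shows "card {i. i < r \<and> rep_iso G ((fun_rep H P)\<lparr>carrier := U i\<rparr>) (fun_rep V (pact G \<sigma>))} =
    fs.dim (E ` H)"
proof -
  have UH: "U i \<subseteq> H" and irr: "girr G P (U i)" if "i < r" for i
    using dec that unfolding irreducible_decomposition_fun_rep[OF H] by blast+
  have uni: "\<exists>!x. x \<in> (\<Pi>\<^sub>E i\<in>{..<r}. U i) \<and> w = (\<Sum>i<r. x i)" if "w \<in> H" for w
    using dec that unfolding irreducible_decomposition_fun_rep[OF H] by blast
  have Ug: "gsub G P (U i)" if "i < r" for i using irr[OF that] by (simp add: girr_def)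
  have Vg: "gsub G (pact G \<sigma>) V" using V(1) by (simp add: girr_def)
  define J where "J = {i. i < r \<and> (\<exists>u\<in>U i. E u \<noteq> 0)}"
  have J: "{i. i < r \<and> rep_iso G ((fun_rep H P)\<lparr>carrier := U i\<rparr>) (fun_rep V (pact G \<sigma>))} = J"
  proof (rule Set.set_eqI)
    fix i
    show "i \<in> {i. i < r \<and> rep_iso G ((fun_rep H P)\<lparr>carrier := U i\<rparr>) (fun_rep V (pact G \<sigma>))} \<longleftrightarrow> i \<in> J"
      using rep_iso_if_E_ne_zero[OF finite_action_axioms \<sigma> irr _ _ V, of i]
        E_ne_zero_if_rep_iso[OF \<sigma> Ug Vg V(2,3), of i]
      by (auto simp: J_def)
  qed
  have "\<forall>i\<in>J. \<exists>u. u \<in> U i \<and> E u \<noteq> 0" by (auto simp: J_def)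
  then obtain u where u: "\<And>i. i \<in> J \<Longrightarrow> u i \<in> U i \<and> E (u i) \<noteq> 0" by metis
  define e where "e i = E (u i)" for i
  have Jr: "i < r" if "i \<in> J" for i using that by (simp add: J_def)
  have eU: "e i \<in> U i" "e i \<noteq> 0" if "i \<in> J" for i
    using gsub_E[OF Ug[OF Jr[OF that]]] u[OF that] by (auto simp: e_def)
  have finJ: "finite J" by (simp add: J_def)
  have indep: "k i = 0" if z: "(\<Sum>i\<in>J. fscale (k i) (e i)) = 0" and i: "i \<in> J" for k i
  proof -
    define x where "x = (\<lambda>i\<in>{..<r}. if i \<in> J then fscale (k i) (e i) else 0)"
    define y where "y = (\<lambda>i\<in>{..<r}. 0 :: 'x \<Rightarrow> rat)"
    have U0: "0 \<in> U i" if "i < r" for i using fs.subspace_0[OF gsub_subspace[OF Ug[OF that]]] .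
    have "x \<in> (\<Pi>\<^sub>E i\<in>{..<r}. U i)"
      using fs.subspace_scale[OF gsub_subspace[OF Ug[OF Jr]] eU(1)] U0 by (auto simp: x_def)
    moreover have "(\<Sum>i<r. x i) = (\<Sum>i\<in>J. fscale (k i) (e i))"
      by (rule sum.mono_neutral_cong_right) (auto simp: x_def Jr)
    moreover have "y \<in> (\<Pi>\<^sub>E i\<in>{..<r}. U i)" using U0 by (auto simp: y_def)
    moreover have "(\<Sum>i<r. y i) = 0" by (simp add: y_def)
    ultimately have "x = y"
      using uni[OF fs.subspace_0[OF gsub_subspace[OF H]]] z by metis
    then have "x i = y i" by simp
    then show ?thesis using i Jr[OF i] eU(2)[OF i] by (simp add: x_def y_def)
  qed
  have inj: "inj_on e J"
  proof (rule inj_onI, rule ccontr)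
    fix i j assume ij: "i \<in> J" "j \<in> J" "e i = e j" "i \<noteq> j"
    let ?k = "\<lambda>l. if l = i then 1 else if l = j then -1 else (0::rat)"
    have "(\<Sum>l\<in>J. fscale (?k l) (e l)) = (\<Sum>l\<in>{i, j}. fscale (?k l) (e l))"
      using ij finJ by (intro sum.mono_neutral_right) auto
    also have "\<dots> = 0" using ij by simp
    finally have "?k i = 0" using ij(1) by (rule indep)
    then show False by simp
  qed
  have "fs.independent (e ` J)"
  proof (rule fs.independent_if_scalars_zero)
    fix k w assume z: "(\<Sum>w\<in>e ` J. fscale (k w) w) = 0" and "w \<in> e ` J"
    then obtain i where i: "i \<in> J" "w = e i" by blast
    have "(\<Sum>i\<in>J. fscale (k (e i)) (e i)) = 0"
      using z by (simp add: sum.reindex[OF inj] comp_def)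
    then have "k (e i) = 0" using indep[of "\<lambda>i. k (e i)" i] i(1) by simp
    then show "k w = 0" using i by simp
  qed (use finJ in simp)
  moreover have "e ` J \<subseteq> E ` H" using u UH Jr by (auto simp: e_def)
  moreover have "E ` H \<subseteq> fs.span (e ` J)"
  proof (rule image_subsetI)
    fix w assume "w \<in> H"
    then obtain x where x: "x \<in> (\<Pi>\<^sub>E i\<in>{..<r}. U i)" "w = (\<Sum>i<r. x i)" using uni by metis
    have "E (x i) \<in> fs.span (e ` J)" if i: "i < r" for i
    proof (cases "i \<in> J")
      case True
      have "x i \<in> U i" using x(1) i by (auto simp: PiE_def Pi_def)
      then obtain k where "E (x i) = fscale k (e i)"
        using E_irreducible_line[OF irr[OF i]] u[OF True] unfolding e_def by blast
      then show ?thesis using True fs.span_scale[OF fs.span_base[of "e i"]] by simp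
    next
      case False
      then have "E (x i) = 0" using x(1) i by (auto simp: J_def PiE_def Pi_def)
      then show ?thesis by (simp add: fs.span_zero)
    qed
    then show "E w \<in> fs.span (e ` J)"
      unfolding x(2) flinear_sum[OF flinear_E] by (intro fs.span_sum) simp
  qed
  ultimately have "fs.dim (E ` H) = card (e ` J)"
    by (intro fs.dim_unique[of "e ` J"]) auto
  then show ?thesis unfolding J by (simp add: card_image[OF inj])
qed

text \<open>
  A decomposition exists by Maschke's theorem, and \<open>E H\<close> has as many dimensions as any decomposition has
  summands isomorphic to \<open>V\<close>. This also shows that their number does not depend on the decomposition.
\<close>

theorem rep_multiplicity_eq_dim:
  assumes D: "finite D" "stable D" and H: "gsub G P H" "H \<subseteq> supp_on D"
    and \<sigma>: "finite_action G \<sigma>" and V: "girr G (pact G \<sigma>) V" "v \<in> V"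
    "wsum G \<sigma> C \<beta> (wsum G \<sigma> R \<alpha> v) \<noteq> 0"
  shows "rep_multiplicity G (fun_rep V (pact G \<sigma>)) (fun_rep H P) = fs.dim (E ` H)"
proof -
  obtain r U where dec: "irreducible_decomposition G (fun_rep H P) r U"
    using exists_irreducible_decomposition[OF D H] by (elim exE)
  show ?thesis
    unfolding rep_multiplicity_def
  proof (rule the_equality)
    show "\<exists>r U. irreducible_decomposition G (fun_rep H P) r U \<and> fs.dim (E ` H) =
      card {i. i < r \<and> rep_iso G ((fun_rep H P)\<lparr>carrier := U i\<rparr>) (fun_rep V (pact G \<sigma>))}"
      using dec card_isomorphic_summands[OF dec H(1) \<sigma> V] by (intro exI[of _ r] exI[of _ U]) simp
  next
    fix m
    assume "\<exists>r U. irreducible_decomposition G (fun_rep H P) r U \<and> m =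
      card {i. i < r \<and> rep_iso G ((fun_rep H P)\<lparr>carrier := U i\<rparr>) (fun_rep V (pact G \<sigma>))}"
    then show "m = fs.dim (E ` H)"
      using card_isomorphic_summands[OF _ H(1) \<sigma> V] by (elim exE conjE) simp
  qed
qed

end

text \<open>
  Left translation of the group on itself, continued by the identity outside of the carrier so that it
  is an action on the whole type. It makes the group algebra a permutation representation.
\<close>

definition reg_act :: "('g, 'b) monoid_scheme \<Rightarrow> 'g \<Rightarrow> 'g \<Rightarrow> 'g" where
  "reg_act G g x = (if x \<in> carrier G then g \<otimes>\<^bsub>G\<^esub> x else x)"

text \<open>
  The left ideal of the group algebra that is generated by the product \<open>A B\<close>.
\<close>

definition pair_ideal :: "('g, 'b) monoid_scheme \<Rightarrow> 'g set \<Rightarrow> ('g \<Rightarrow> rat) \<Rightarrow> 'g set \<Rightarrow> ('g \<Rightarrow> rat) \<Rightarrow>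
    ('g \<Rightarrow> rat) set" where
  "pair_ideal G R \<alpha> C \<beta> = range (\<lambda>a. char_pair_action.comb G (reg_act G) a
     (wsum G (reg_act G) R \<alpha> (wsum G (reg_act G) C \<beta> (delta \<one>\<^bsub>G\<^esub>))))"

context char_pair
begin

lemma finite_action_reg: "finite_action G (reg_act G)"
  by unfold_locales (auto simp: reg_act_def fin R.m_assoc)

text \<open>
  The coefficient of the identity in \<open>A B\<close> counts the elements of \<open>R \<inter> C\<close>, on which the two characters
  agree. Hence the product is not zero.
\<close>

lemma wsum_wsum_one:
  "wsum G (reg_act G) R \<alpha> (wsum G (reg_act G) C \<beta> (delta \<one>\<^bsub>G\<^esub>)) \<one>\<^bsub>G\<^esub> = of_nat (card (R \<inter> C))"
proof -
  interpret a: char_pair_action G R \<alpha> C \<beta> "reg_act G"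
    by (rule char_pair_actionI[OF finite_action_reg])
  have "wsum G (reg_act G) R \<alpha> (wsum G (reg_act G) C \<beta> (delta \<one>\<^bsub>G\<^esub>)) \<one>\<^bsub>G\<^esub> =
     (\<Sum>r\<in>R. \<Sum>c\<in>C. \<alpha> r * \<beta> c * (if inv\<^bsub>G\<^esub> r = c then 1 else 0))"
    by (auto simp: wsum_def sum_fun_apply pointwise pact_def reg_act_def delta_def sum_distrib_left
        R.mem_carrier C.mem_carrier R.inv_solve_left' mult.assoc intro!: sum.cong)
  also have "\<dots> = (\<Sum>r\<in>R. if r \<in> C then 1 else 0)"
  proof (intro sum.cong refl)
    fix r assume r: "r \<in> R"
    have "inv\<^bsub>G\<^esub> r \<in> C \<longleftrightarrow> r \<in> C"
      using C.inv_mem[of r] C.inv_mem[of "inv\<^bsub>G\<^esub> r"] R.mem_carrier[OF r] by auto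
    moreover have "\<alpha> r * \<beta> (inv\<^bsub>G\<^esub> r) = 1" if "r \<in> C"
      using C.char_inv[OF that] agree[OF r that] R.sq[OF r] by simp
    ultimately show "(\<Sum>c\<in>C. \<alpha> r * \<beta> c * (if inv\<^bsub>G\<^esub> r = c then 1 else 0)) = (if r \<in> C then 1 else 0)"
      using a.C.finR by (simp add: if_distrib cong: if_cong)
  qed
  also have "\<dots> = of_nat (card (R \<inter> C))"
    using a.R.finR by (simp add: sum.If_cases)
  finally show ?thesis .
qed

lemma card_Int_ne_zero: "card (R \<inter> C) \<noteq> 0"
  using R.one_mem C.one_mem finite_subset[OF subgroup.subset[OF R.sub] fin] by auto

lemma pair_ideal_irreducible: "girr G (pact G (reg_act G)) (pair_ideal G R \<alpha> C \<beta>)"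
proof -
  interpret s: char_pair G C \<beta> R \<alpha> by (rule swap)
  interpret b: char_pair_action G C \<beta> R \<alpha> "reg_act G"
    by (rule s.char_pair_actionI[OF finite_action_reg])
  have "b.E (delta \<one>\<^bsub>G\<^esub>) \<noteq> 0"
    using wsum_wsum_one card_Int_ne_zero by (auto simp: pointwise)
  then show ?thesis
    unfolding pair_ideal_def
    by (intro b.girr_range_comb[of "carrier G"]) (auto simp: fin b.stable_def reg_act_def supp_on_def delta_def)
qed

lemma exists_E_ne_zero_pair_ideal:
  "\<exists>v\<in>pair_ideal G R \<alpha> C \<beta>. wsum G (reg_act G) C \<beta> (wsum G (reg_act G) R \<alpha> v) \<noteq> 0"
proof -
  interpret s: char_pair G C \<beta> R \<alpha> by (rule swap)
  interpret b: char_pair_action G C \<beta> R \<alpha> "reg_act G"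
    by (rule s.char_pair_actionI[OF finite_action_reg])
  have d: "b.E (delta \<one>\<^bsub>G\<^esub>) \<noteq> 0"
    using wsum_wsum_one card_Int_ne_zero by (auto simp: pointwise)
  have "s.\<gamma> \<noteq> 0"
    by (rule b.E_ne_zero_imp_gamma[OF fin _ _ d]) (auto simp: b.stable_def reg_act_def supp_on_def delta_def)
  then have e: "b.E (b.E (delta \<one>\<^bsub>G\<^esub>)) \<noteq> 0" using d by (simp add: b.E_E)
  have "wsum G (reg_act G) C \<beta> (wsum G (reg_act G) R \<alpha> (b.E (delta \<one>\<^bsub>G\<^esub>))) \<noteq> 0"
  proof
    assume z: "wsum G (reg_act G) C \<beta> (wsum G (reg_act G) R \<alpha> (b.E (delta \<one>\<^bsub>G\<^esub>))) = 0"
    have "fscale (of_nat (card R)) (b.A (b.E (delta \<one>\<^bsub>G\<^esub>))) = 0"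
      using z by (simp only: b.C.A_A b.A_scale)
    moreover have "card R \<noteq> 0"
      using b.C.finR R.one_mem by auto
    ultimately have "b.A (b.E (delta \<one>\<^bsub>G\<^esub>)) = 0" by simp
    then show False using e flinear_zero[OF b.C.flinear_A] by simp
  qed
  moreover have "b.E (delta \<one>\<^bsub>G\<^esub>) \<in> pair_ideal G R \<alpha> C \<beta>"
    unfolding pair_ideal_def using b.self_eq_comb[of "b.E (delta \<one>\<^bsub>G\<^esub>)"] by (metis rangeI)
  ultimately show ?thesis by blast
qed

end

section \<open>Quotients by a complemented subspace\<close>

lemma is_rep_transfer:
  assumes M: "is_rep G M" and iso: "is_iso G M N \<phi>" and zero: "\<phi> \<zero>\<^bsub>M\<^esub> = \<zero>\<^bsub>N\<^esub>"
  shows "is_rep G N"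
proof -
  interpret M: module rat_field M using M by (simp add: is_rep_def)
  have bij: "bij_betw \<phi> (carrier M) (carrier N)" using iso by (simp add: is_iso_def)
  have pre: "\<exists>u\<in>carrier M. \<phi> u = w" if "w \<in> carrier N" for w
    using bij_betw_imp_surj_on[OF bij, symmetric] that by auto
  have c: "\<phi> u \<in> carrier N" if "u \<in> carrier M" for u using bij that by (auto simp: bij_betw_def)
  have add: "\<phi> u \<oplus>\<^bsub>N\<^esub> \<phi> v = \<phi> (u \<oplus>\<^bsub>M\<^esub> v)" if "u \<in> carrier M" "v \<in> carrier M" for u v
    using iso that by (simp add: is_iso_def)
  have sm: "k \<odot>\<^bsub>N\<^esub> \<phi> u = \<phi> (k \<odot>\<^bsub>M\<^esub> u)" if "u \<in> carrier M" for k u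
    using iso that by (simp add: is_iso_def)
  have ac: "act N g (\<phi> u) = \<phi> (act M g u)" if "u \<in> carrier M" "g \<in> carrier G" for g u
    using iso that by (simp add: is_iso_def)
  have "module rat_field N"
  proof (intro moduleI cring_rat_field abelian_groupI)
    fix x y assume "x \<in> carrier N" "y \<in> carrier N"
    then obtain u v where [simp]: "u \<in> carrier M" "v \<in> carrier M" "x = \<phi> u" "y = \<phi> v"
      using pre by metis
    show "x \<oplus>\<^bsub>N\<^esub> y \<in> carrier N" by (simp add: add c)
    show "x \<oplus>\<^bsub>N\<^esub> y = y \<oplus>\<^bsub>N\<^esub> x" by (simp add: add M.add.m_comm)
    fix a show "a \<odot>\<^bsub>N\<^esub> (x \<oplus>\<^bsub>N\<^esub> y) = a \<odot>\<^bsub>N\<^esub> x \<oplus>\<^bsub>N\<^esub> a \<odot>\<^bsub>N\<^esub> y"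
      by (simp add: add sm M.smult_r_distr)
  next
    fix x y z assume "x \<in> carrier N" "y \<in> carrier N" "z \<in> carrier N"
    then obtain u v w where [simp]: "u \<in> carrier M" "v \<in> carrier M" "w \<in> carrier M"
      "x = \<phi> u" "y = \<phi> v" "z = \<phi> w" using pre by metis
    show "x \<oplus>\<^bsub>N\<^esub> y \<oplus>\<^bsub>N\<^esub> z = x \<oplus>\<^bsub>N\<^esub> (y \<oplus>\<^bsub>N\<^esub> z)" by (simp add: add M.add.m_assoc)
  next
    fix x assume "x \<in> carrier N"
    then obtain u where [simp]: "u \<in> carrier M" "x = \<phi> u" using pre by metis
    show "\<zero>\<^bsub>N\<^esub> \<oplus>\<^bsub>N\<^esub> x = x" by (simp add: add flip: zero)
    show "\<exists>y\<in>carrier N. y \<oplus>\<^bsub>N\<^esub> x = \<zero>\<^bsub>N\<^esub>"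
      by (intro bexI[of _ "\<phi> (\<ominus>\<^bsub>M\<^esub> u)"]) (simp_all add: add c M.l_neg flip: zero)
    show "\<one>\<^bsub>rat_field\<^esub> \<odot>\<^bsub>N\<^esub> x = x" using M.smult_one[of u] by (simp add: sm)
    fix a b
    show "a \<odot>\<^bsub>N\<^esub> x \<in> carrier N" by (simp add: sm c)
    show "(a \<oplus>\<^bsub>rat_field\<^esub> b) \<odot>\<^bsub>N\<^esub> x = a \<odot>\<^bsub>N\<^esub> x \<oplus>\<^bsub>N\<^esub> b \<odot>\<^bsub>N\<^esub> x"
      using M.smult_l_distr[of a b u] by (simp add: sm add)
    show "a \<otimes>\<^bsub>rat_field\<^esub> b \<odot>\<^bsub>N\<^esub> x = a \<odot>\<^bsub>N\<^esub> (b \<odot>\<^bsub>N\<^esub> x)"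
      using M.smult_assoc1[of a b u] by (simp add: sm)
  next
    show "\<zero>\<^bsub>N\<^esub> \<in> carrier N" by (simp add: c flip: zero)
  qed
  moreover have "act N g w \<in> carrier N" if "g \<in> carrier G" "w \<in> carrier N" for g w
  proof -
    obtain u where "u \<in> carrier M" "w = \<phi> u" using pre \<open>w \<in> carrier N\<close> by metis
    then show ?thesis using that(1) by (simp add: ac c is_rep_closed[OF M])
  qed
  ultimately show ?thesis by (simp add: is_rep_def)
qed

definition coset :: "('x \<Rightarrow> rat) set \<Rightarrow> ('x \<Rightarrow> rat) \<Rightarrow> ('x \<Rightarrow> rat) set" where
  "coset U k = {f. f - k \<in> U}"

lemma mem_coset: "f \<in> coset U k \<longleftrightarrow> f - k \<in> U"
  by (simp add: coset_def)

lemma coset_eq_iff: assumes "fs.subspace U" shows "coset U k = coset U l \<longleftrightarrow> k - l \<in> U"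
proof
  assume "coset U k = coset U l"
  moreover have "k \<in> coset U k" using fs.subspace_0[OF assms] by (simp add: mem_coset)
  ultimately show "k - l \<in> U" by (simp add: mem_coset)
next
  assume *: "k - l \<in> U"
  show "coset U k = coset U l"
  proof (rule Set.set_eqI)
    fix f
    show "f \<in> coset U k \<longleftrightarrow> f \<in> coset U l"
      using fs.subspace_add[OF assms _ *, of "f - k"] fs.subspace_diff[OF assms _ *, of "f - l"]
      by (auto simp: mem_coset)
  qed
qed

context finite_action
begin

text \<open>
  An invariant complement of \<open>U\<close> in \<open>Z\<close> is a system of representatives for the quotient.
\<close>

lemma quotient_rep_complement:
  assumes Z: "gsub G P Z" and U: "gsub G P U" "U \<subseteq> Z" and K: "gsub G P K" "K \<subseteq> Z"
    and split: "\<And>z. z \<in> Z \<Longrightarrow> \<exists>u\<in>U. \<exists>k\<in>K. z = u + k" and int: "U \<inter> K \<subseteq> {0}"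
  shows "is_iso G (fun_rep K P) (quotient_rep (fun_rep Z P) U) (coset U)" (is "is_iso G ?M ?N _")
    and "is_rep G (quotient_rep (fun_rep Z P) U)"
proof -
  note sU = gsub_subspace[OF U(1)]
  have cos: "a_r_coset (fun_rep Z P) U k = coset U k" for k
  proof -
    have "a_r_coset (fun_rep Z P) U k = (\<lambda>u. u + k) ` U"
      by (auto simp: a_r_coset_def r_coset_def)
    also have "\<dots> = coset U k"
    proof
      show "coset U k \<subseteq> (\<lambda>u. u + k) ` U"
      proof
        fix f assume "f \<in> coset U k"
        then show "f \<in> (\<lambda>u. u + k) ` U"
          unfolding mem_coset by (rule rev_image_eqI) simp
      qed
    qed (auto simp: mem_coset)
    finally show ?thesis .
  qed
  have set_add: "set_add (fun_rep Z P) S T = (\<lambda>(s, t). s + t) ` (S \<times> T)" for S T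
    by (force simp: set_add_def set_mult_def)
  have self: "k \<in> coset U k" for k using fs.subspace_0[OF sU] by (simp add: mem_coset)
  have car: "carrier ?N = coset U ` Z"
    by (auto simp: quotient_rep_def A_RCOSETS_def' cos)
  have zero: "coset U 0 = U" by (auto simp: mem_coset)
  have add: "coset U u \<oplus>\<^bsub>?N\<^esub> coset U v = coset U (u + v)" for u v
  proof -
    have "(\<lambda>(s, t). s + t) ` (coset U u \<times> coset U v) = coset U (u + v)" (is "?L = ?R")
    proof
      show "?L \<subseteq> ?R"
      proof (clarsimp simp: mem_coset)
        fix s t assume "s - u \<in> U" "t - v \<in> U"
        then have "(s - u) + (t - v) \<in> U" by (rule fs.subspace_add[OF sU])
        then show "s + t - (u + v) \<in> U" by (simp add: algebra_simps)
      qed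
      show "?R \<subseteq> ?L"
      proof
        fix f assume "f \<in> ?R"
        then have "(f - v, v) \<in> coset U u \<times> coset U v"
          using self[of v] by (simp add: mem_coset algebra_simps)
        then show "f \<in> ?L" by (rule rev_image_eqI) simp
      qed
    qed
    then show ?thesis by (simp add: quotient_rep_def set_add)
  qed
  have smult: "c \<odot>\<^bsub>?N\<^esub> coset U u = coset U (fscale c u)" for c u
  proof -
    have "(\<lambda>(s, t). s + t) ` (U \<times> fscale c ` coset U u) = coset U (fscale c u)" (is "?L = ?R")
    proof
      show "?L \<subseteq> ?R"
      proof (clarsimp simp: mem_coset)
        fix s t assume "s \<in> U" "t - u \<in> U"
        then have "s + fscale c (t - u) \<in> U" by (intro fs.subspace_add[OF sU] fs.subspace_scale[OF sU])
        then show "s + fscale c t - fscale c u \<in> U" by (simp add: fs.scale_right_diff_distrib algebra_simps)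
      qed
      show "?R \<subseteq> ?L"
      proof
        fix f assume "f \<in> ?R"
        then have "(f - fscale c u, fscale c u) \<in> U \<times> fscale c ` coset U u"
          using imageI[OF self[of u], of "fscale c"] by (simp add: mem_coset)
        then show "f \<in> ?L" by (rule rev_image_eqI) simp
      qed
    qed
    then show ?thesis by (simp add: quotient_rep_def set_add)
  qed
  have act: "act ?N g (coset U u) = coset U (P g u)" if g: "g \<in> carrier G" for g u
  proof -
    have "P g ` coset U u = coset U (P g u)" (is "?L = ?R")
    proof
      show "?L \<subseteq> ?R"
        using gsub_act[OF U(1) g] by (auto simp: mem_coset simp flip: flinear_diff[OF flinear_P])
      show "?R \<subseteq> ?L"
      proof
        fix f assume "f \<in> ?R"
        then have "P (inv g) (f - P g u) \<in> U"
          using gsub_act[OF U(1) inv_closed[OF g]] by (simp add: mem_coset)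
        then have "P (inv g) f \<in> coset U u" by (simp add: mem_coset flinear_diff[OF flinear_P] g)
        then show "f \<in> ?L" by (rule rev_image_eqI) (simp add: g)
      qed
    qed
    then show ?thesis by (simp add: quotient_rep_def)
  qed
  show iso: "is_iso G ?M ?N (coset U)"
    unfolding is_iso_def fun_rep_simps
  proof (intro conjI ballI allI)
    show "bij_betw (coset U) K (carrier ?N)"
      unfolding bij_betw_def car
    proof
      show "inj_on (coset U) K"
      proof (rule inj_onI)
        fix k l assume "k \<in> K" "l \<in> K" "coset U k = coset U l"
        then have "k - l \<in> U \<inter> K"
          using fs.subspace_diff[OF gsub_subspace[OF K(1)]] by (simp add: coset_eq_iff[OF sU])
        then show "k = l" using int by auto
      qed
      show "coset U ` K = coset U ` Z"
      proof
        show "coset U ` K \<subseteq> coset U ` Z" using K(2) by blast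
        show "coset U ` Z \<subseteq> coset U ` K"
        proof (rule image_subsetI)
          fix z assume "z \<in> Z"
          then obtain u k where "u \<in> U" "k \<in> K" "z = u + k" using split by blast
          then have "coset U z = coset U k" by (simp add: coset_eq_iff[OF sU])
          then show "coset U z \<in> coset U ` K" using \<open>k \<in> K\<close> by blast
        qed
      qed
    qed
  qed (simp_all add: add smult act)
  show "is_rep G ?N"
    by (rule is_rep_transfer[OF is_rep_fun_rep[OF K(1)] iso]) (simp add: zero quotient_rep_def)
qed

end

section \<open>The order complex and its Euler characteristic\<close>

lemma order_simplices_iff:
  "\<sigma> \<in> order_simplices Q i \<longleftrightarrow> finite \<sigma> \<and> card \<sigma> = Suc i \<and> \<sigma> \<subseteq> Q \<and>
     (\<forall>x\<in>\<sigma>. \<forall>y\<in>\<sigma>. x \<noteq> y \<longrightarrow> x \<subset> y \<or> y \<subset> x)"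
  unfolding order_simplices_def subset_chain_def by blast

lemma finite_order_simplices: "finite Q \<Longrightarrow> finite (order_simplices Q i)"
  by (rule finite_subset[of _ "Pow Q"]) (auto simp: order_simplices_iff)

lemma order_simplices_empty: "finite Q \<Longrightarrow> card Q \<le> i \<Longrightarrow> order_simplices Q i = {}"
proof (rule ccontr)
  assume Q: "finite Q" "card Q \<le> i" and "order_simplices Q i \<noteq> {}"
  then obtain \<sigma> where "card \<sigma> = Suc i" "\<sigma> \<subseteq> Q" by (auto simp: order_simplices_iff)
  then show False using card_mono[OF Q(1), of \<sigma>] Q(2) by simp
qed

lemma order_simplices_face:
  assumes "\<sigma> \<in> order_simplices Q (Suc i)" "x \<in> \<sigma>"
  shows "\<sigma> - {x} \<in> order_simplices Q i"
  using assms by (auto simp: order_simplices_iff)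

lemma order_chains_eq: "order_chains Q i = supp_on (order_simplices Q i)"
  by (simp add: order_chains_def supp_on_def)

definition incidence :: "'a set set \<Rightarrow> 'a set \<Rightarrow> rat" where
  "incidence \<sigma> x = (-1) ^ card {y\<in>\<sigma>. y \<subset> x}"

lemma order_boundary_Suc:
  "order_boundary Q (Suc i) c \<tau> =
     (\<Sum>\<sigma>\<in>order_simplices Q (Suc i). \<Sum>x\<in>{x\<in>\<sigma>. \<sigma> - {x} = \<tau>}. incidence \<sigma> x * c \<sigma>)"
  by (simp add: order_boundary_def incidence_def)

lemma order_boundary_0: "order_boundary Q 0 c = 0"
  by (simp add: order_boundary_def zero_fun_def)

lemma flinear_order_boundary: "flinear (order_boundary Q i)"
  by (cases i) (auto simp: flinear_def fun_eq_iff order_boundary_Suc order_boundary_0 pointwise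
      distrib_left sum.distrib sum_distrib_left mult.left_commute)

lemma order_boundary_in_chains:
  "order_boundary Q (Suc i) c \<in> supp_on (order_simplices Q i)"
  unfolding supp_on_def mem_Collect_eq
proof (intro allI impI)
  fix \<tau> assume "\<tau> \<notin> order_simplices Q i"
  then have e: "{x\<in>\<sigma>. \<sigma> - {x} = \<tau>} = {}" if "\<sigma> \<in> order_simplices Q (Suc i)" for \<sigma>
    using order_simplices_face[OF that] by blast
  show "order_boundary Q (Suc i) c \<tau> = 0"
    unfolding order_boundary_Suc
  proof (rule sum.neutral, rule ballI)
    fix \<sigma> assume "\<sigma> \<in> order_simplices Q (Suc i)"
    from e[OF this] show "(\<Sum>x\<in>{x\<in>\<sigma>. \<sigma> - {x} = \<tau>}. incidence \<sigma> x * c \<sigma>) = 0"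
      by (simp only: sum.empty)
  qed
qed

text \<open>
  Removing two vertices in either order gives opposite signs, as one of them is counted when the other
  one is numbered.
\<close>

lemma incidence_swap:
  assumes "\<sigma> \<in> order_simplices Q i" "x \<in> \<sigma>" "y \<in> \<sigma>" "x \<noteq> y"
  shows "incidence (\<sigma> - {y}) x * incidence \<sigma> y = - (incidence (\<sigma> - {x}) y * incidence \<sigma> x)"
proof -
  have *: "incidence (\<sigma> - {y}) x * incidence \<sigma> y = - (incidence (\<sigma> - {x}) y * incidence \<sigma> x)"
    if "x \<subset> y" "x \<in> \<sigma>" "finite \<sigma>" for x y
  proof -
    have "{z \<in> \<sigma> - {y}. z \<subset> x} = {z \<in> \<sigma>. z \<subset> x}" using that by blast
    moreover have "{z \<in> \<sigma>. z \<subset> y} = insert x {z \<in> \<sigma> - {x}. z \<subset> y}" using that by blast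
    then have "card {z \<in> \<sigma>. z \<subset> y} = Suc (card {z \<in> \<sigma> - {x}. z \<subset> y})"
      using that(3) by simp
    ultimately show ?thesis by (simp add: incidence_def)
  qed
  have f: "finite \<sigma>" and "x \<subset> y \<or> y \<subset> x" using assms by (auto simp: order_simplices_iff)
  from this(2) show ?thesis
  proof
    assume "x \<subset> y"
    then show ?thesis by (rule *[OF _ assms(2) f])
  next
    assume "y \<subset> x"
    then show ?thesis using *[OF _ assms(3) f, of x] by simp
  qed
qed

lemma order_boundary_boundary:
  fixes Q :: "'a set set"
  assumes "finite Q"
  shows "order_boundary Q i (order_boundary Q (Suc i) c) = 0"
proof (cases i)
  case 0
  then show ?thesis by (simp add: order_boundary_0)
next
  case (Suc j)
  show ?thesis
  proof
    fix \<tau> :: "'a set set"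
    let ?D = "order_simplices Q (Suc j)" and ?D' = "order_simplices Q (Suc (Suc j))"
    define pairs where "pairs \<omega> = {(y, x). y \<in> \<omega> \<and> x \<in> \<omega> - {y} \<and> \<omega> - {y} - {x} = \<tau>}" for \<omega>
    define t where "t \<omega> = (\<lambda>(y, x). incidence (\<omega> - {y}) x * incidence \<omega> y)" for \<omega> :: "'a set set"
    have fin: "finite \<omega>" if "\<omega> \<in> order_simplices Q k" for \<omega> k using that by (simp add: order_simplices_iff)
    have zero: "(\<Sum>p\<in>pairs \<omega>. t \<omega> p) = 0" if \<omega>: "\<omega> \<in> ?D'" for \<omega>
    proof -
      have "(\<Sum>p\<in>pairs \<omega>. t \<omega> p) = (\<Sum>p\<in>pairs \<omega>. t \<omega> (prod.swap p))"
        by (rule sum.reindex_bij_witness[of _ prod.swap prod.swap]) (auto simp: pairs_def)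
      also have "\<dots> = (\<Sum>p\<in>pairs \<omega>. - t \<omega> p)"
      proof (intro sum.cong refl)
        fix p assume "p \<in> pairs \<omega>"
        then obtain y x where "p = (y, x)" "y \<in> \<omega>" "x \<in> \<omega>" "x \<noteq> y" by (auto simp: pairs_def)
        then show "t \<omega> (prod.swap p) = - t \<omega> p"
          using incidence_swap[OF \<omega>, of y x] by (simp add: t_def)
      qed
      finally show ?thesis by (simp add: sum_negf)
    qed
    have "order_boundary Q i (order_boundary Q (Suc i) c) \<tau> =
      (\<Sum>\<sigma>\<in>?D. \<Sum>x\<in>{x\<in>\<sigma>. \<sigma> - {x} = \<tau>}. \<Sum>\<omega>\<in>?D'. \<Sum>y\<in>{y\<in>\<omega>. \<omega> - {y} = \<sigma>}.
         incidence \<sigma> x * incidence \<omega> y * c \<omega>)"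
      by (simp add: Suc order_boundary_Suc sum_distrib_left mult.assoc)
    also have "\<dots> = (\<Sum>\<sigma>\<in>?D. \<Sum>\<omega>\<in>?D'. \<Sum>x\<in>{x\<in>\<sigma>. \<sigma> - {x} = \<tau>}. \<Sum>y\<in>{y\<in>\<omega>. \<omega> - {y} = \<sigma>}.
         incidence \<sigma> x * incidence \<omega> y * c \<omega>)"
      by (intro sum.cong refl sum.swap)
    also have "\<dots> = (\<Sum>\<omega>\<in>?D'. \<Sum>\<sigma>\<in>?D. \<Sum>x\<in>{x\<in>\<sigma>. \<sigma> - {x} = \<tau>}. \<Sum>y\<in>{y\<in>\<omega>. \<omega> - {y} = \<sigma>}.
         incidence \<sigma> x * incidence \<omega> y * c \<omega>)"
      by (rule sum.swap)
    also have "\<dots> = (\<Sum>\<omega>\<in>?D'. c \<omega> * (\<Sum>p\<in>pairs \<omega>. t \<omega> p))"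
    proof (intro sum.cong refl)
      fix \<omega> assume \<omega>: "\<omega> \<in> ?D'"
      have "(\<Sum>\<sigma>\<in>?D. \<Sum>x\<in>{x\<in>\<sigma>. \<sigma> - {x} = \<tau>}. \<Sum>y\<in>{y\<in>\<omega>. \<omega> - {y} = \<sigma>}.
          incidence \<sigma> x * incidence \<omega> y * c \<omega>) =
        (\<Sum>(\<sigma>, x, y)\<in>(SIGMA \<sigma>:?D. {x\<in>\<sigma>. \<sigma> - {x} = \<tau>} \<times> {y\<in>\<omega>. \<omega> - {y} = \<sigma>}).
          incidence \<sigma> x * incidence \<omega> y * c \<omega>)"
        using finite_order_simplices[OF assms] fin fin[OF \<omega>]
        by (subst sum.Sigma[symmetric]) (auto simp: sum.cartesian_product)
      also have "\<dots> = (\<Sum>p\<in>pairs \<omega>. c \<omega> * t \<omega> p)"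
        by (rule sum.reindex_bij_witness[of _ "\<lambda>(y, x). (\<omega> - {y}, x, y)" "\<lambda>(\<sigma>, x, y). (y, x)"])
          (use \<omega> in \<open>auto simp: pairs_def t_def order_simplices_face mult_ac\<close>)
      finally show "(\<Sum>\<sigma>\<in>?D. \<Sum>x\<in>{x\<in>\<sigma>. \<sigma> - {x} = \<tau>}. \<Sum>y\<in>{y\<in>\<omega>. \<omega> - {y} = \<sigma>}.
          incidence \<sigma> x * incidence \<omega> y * c \<omega>) = c \<omega> * (\<Sum>p\<in>pairs \<omega>. t \<omega> p)"
        by (simp add: sum_distrib_left)
    qed
    also have "\<dots> = 0" by (simp add: zero)
    finally show "order_boundary Q i (order_boundary Q (Suc i) c) \<tau> = 0 \<tau>"
      by (simp add: pointwise)
  qed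
qed

definition chain_act :: "('g \<Rightarrow> 'a \<Rightarrow> 'a) \<Rightarrow> 'g \<Rightarrow> 'a set set \<Rightarrow> 'a set set" where
  "chain_act \<alpha> g \<sigma> = (\<lambda>F. \<alpha> g ` F) ` \<sigma>"

locale poset_action = finite_action G \<theta> for G :: "('g, 'b) monoid_scheme" (structure)
    and \<theta> :: "'g \<Rightarrow> 'a \<Rightarrow> 'a" +
  fixes Q :: "'a set set"
  assumes finQ: "finite Q" and stabQ: "g \<in> carrier G \<Longrightarrow> F \<in> Q \<Longrightarrow> \<theta> g ` F \<in> Q"
begin

lemma finite_action_chain: "finite_action G (chain_act \<theta>)"
  by unfold_locales (auto simp: chain_act_def fin act_one act_mult image_image)

sublocale ch: finite_action G "chain_act \<theta>" by (rule finite_action_chain)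

abbreviation "D i \<equiv> order_simplices Q i"
abbreviation "bd i \<equiv> order_boundary Q i"

lemma inj_\<theta>: "g \<in> carrier G \<Longrightarrow> inj (\<theta> g)"
  by (rule inj_on_inverseI[of _ "\<theta> (inv g)"]) simp

lemma image_psubset: "g \<in> carrier G \<Longrightarrow> \<theta> g ` x \<subset> \<theta> g ` y \<longleftrightarrow> x \<subset> y"
  by (metis inj_\<theta> inj_image_subset_iff psubset_eq inj_image_eq_iff)

lemma inj_image_\<theta>: "g \<in> carrier G \<Longrightarrow> inj_on ((`) (\<theta> g)) S"
  by (metis inj_\<theta> inj_image_eq_iff inj_onI)

lemma stable_D: "ch.stable (D i)"
  unfolding ch.stable_def
proof (intro ballI)
  fix g \<sigma> assume g: "g \<in> carrier G" and \<sigma>: "\<sigma> \<in> D i"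
  have "card (chain_act \<theta> g \<sigma>) = card \<sigma>"
    unfolding chain_act_def by (rule card_image[OF inj_image_\<theta>[OF g]])
  moreover have "\<theta> g ` x \<subset> \<theta> g ` y \<or> \<theta> g ` y \<subset> \<theta> g ` x"
    if "x \<in> \<sigma>" "y \<in> \<sigma>" "\<theta> g ` x \<noteq> \<theta> g ` y" for x y
    using that \<sigma> unfolding image_psubset[OF g] order_simplices_iff by blast
  ultimately show "chain_act \<theta> g \<sigma> \<in> D i"
    using \<sigma> g stabQ unfolding order_simplices_iff by (auto simp: chain_act_def)
qed

lemma incidence_\<theta>:
  assumes g: "g \<in> carrier G"
  shows "incidence (chain_act \<theta> g \<sigma>) (\<theta> g ` x) = incidence \<sigma> x"
proof -
  have "{y \<in> chain_act \<theta> g \<sigma>. y \<subset> \<theta> g ` x} = (`) (\<theta> g) ` {y \<in> \<sigma>. y \<subset> x}"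
    unfolding chain_act_def Compr_image_eq image_psubset[OF g] ..
  then show ?thesis
    by (simp add: incidence_def card_image[OF inj_image_\<theta>[OF g]])
qed

text \<open>
  Group elements preserve inclusions, so they preserve the numbering of the vertices of a simplex.
\<close>

lemma bd_P:
  assumes g: "g \<in> carrier G"
  shows "bd i (ch.P g c) = ch.P g (bd i c)"
proof (cases i)
  case 0
  then show ?thesis by (simp add: order_boundary_0 flinear_zero[OF ch.flinear_P])
next
  case (Suc j)
  show ?thesis
  proof
    fix \<tau>
    let ?a = "chain_act \<theta>" and ?h = "inv g"
    have h: "?h \<in> carrier G" using g by simp
    have "bd i (ch.P g c) \<tau> =
      (\<Sum>\<sigma>\<in>D (Suc j). \<Sum>x\<in>{x\<in>\<sigma>. \<sigma> - {x} = \<tau>}. incidence \<sigma> x * c (?a ?h \<sigma>))"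
      by (simp add: Suc order_boundary_Suc pact_def)
    also have "\<dots> = (\<Sum>\<sigma>\<in>D (Suc j). \<Sum>x\<in>{x\<in>\<sigma>. \<sigma> - {x} = ?a ?h \<tau>}. incidence \<sigma> x * c \<sigma>)"
    proof (rule sum.reindex_bij_witness[of _ "?a g" "?a ?h"])
      fix \<sigma> assume \<sigma>: "\<sigma> \<in> D (Suc j)"
      show "?a g (?a ?h \<sigma>) = \<sigma>" "?a ?h (?a g \<sigma>) = \<sigma>" using g by simp_all
      show "?a ?h \<sigma> \<in> D (Suc j)" "?a g \<sigma> \<in> D (Suc j)"
        using stable_D g h \<sigma> by (auto simp: ch.stable_def)
      have diff: "?a ?h \<sigma> - {\<theta> ?h ` x} = ?a ?h (\<sigma> - {x})" for x
        unfolding chain_act_def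
        using inj_on_image_set_diff[OF inj_image_\<theta>[OF h, of UNIV], of \<sigma> "{x}"] by simp
      have inj: "?a ?h \<sigma>' = ?a ?h \<tau>' \<longleftrightarrow> \<sigma>' = \<tau>'" for \<sigma>' \<tau>'
        by (metis g ch.\<rho>_\<rho>_inv)
      have "(\<Sum>x\<in>{x\<in>?a ?h \<sigma>. ?a ?h \<sigma> - {x} = ?a ?h \<tau>}. incidence (?a ?h \<sigma>) x * c (?a ?h \<sigma>)) =
        (\<Sum>x\<in>(`) (\<theta> ?h) ` {x\<in>\<sigma>. \<sigma> - {x} = \<tau>}. incidence (?a ?h \<sigma>) x * c (?a ?h \<sigma>))"
      proof (rule sum.cong[OF _ refl])
        have "{x\<in>?a ?h \<sigma>. ?a ?h \<sigma> - {x} = ?a ?h \<tau>} =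
          {x\<in>(`) (\<theta> ?h) ` \<sigma>. ?a ?h \<sigma> - {x} = ?a ?h \<tau>}"
          by (simp only: chain_act_def)
        also have "\<dots> = (`) (\<theta> ?h) ` {x\<in>\<sigma>. ?a ?h \<sigma> - {\<theta> ?h ` x} = ?a ?h \<tau>}"
          by (rule Compr_image_eq)
        also have "\<dots> = (`) (\<theta> ?h) ` {x\<in>\<sigma>. \<sigma> - {x} = \<tau>}" by (simp only: diff inj)
        finally show "{x\<in>?a ?h \<sigma>. ?a ?h \<sigma> - {x} = ?a ?h \<tau>} = (`) (\<theta> ?h) ` {x\<in>\<sigma>. \<sigma> - {x} = \<tau>}" .
      qed
      also have "\<dots> = (\<Sum>x\<in>{x\<in>\<sigma>. \<sigma> - {x} = \<tau>}. incidence \<sigma> x * c (?a ?h \<sigma>))"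
        by (simp add: sum.reindex[OF inj_image_\<theta>[OF h]] incidence_\<theta>[OF h])
      finally show "(\<Sum>x\<in>{x\<in>?a ?h \<sigma>. ?a ?h \<sigma> - {x} = ?a ?h \<tau>}. incidence (?a ?h \<sigma>) x * c (?a ?h \<sigma>)) =
        (\<Sum>x\<in>{x\<in>\<sigma>. \<sigma> - {x} = \<tau>}. incidence \<sigma> x * c (?a ?h \<sigma>))" .
    qed
    also have "\<dots> = ch.P g (bd i c) \<tau>" by (simp add: Suc order_boundary_Suc pact_def)
    finally show "bd i (ch.P g c) \<tau> = ch.P g (bd i c) \<tau>" .
  qed
qed

abbreviation "Z i \<equiv> order_cycles Q i"
abbreviation "Bd i \<equiv> order_boundaries Q i"

lemma Z_eq: "Z i = {c \<in> supp_on (D i). bd i c = 0}"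
  by (simp add: order_cycles_def order_chains_eq zero_fun_def)

lemma gsub_Z: "gsub G ch.P (Z i)"
  using gsub_subspace[OF ch.gsub_supp_on[OF stable_D]] gsub_act[OF ch.gsub_supp_on[OF stable_D]]
  by (auto simp: Z_eq gsub_def bd_P fs.subspace_def flinear_zero[OF flinear_order_boundary]
      flinear_zero[OF ch.flinear_P]
      flinear_add[OF flinear_order_boundary] flinear_scale[OF flinear_order_boundary])

lemma gsub_Bd: "gsub G ch.P (Bd i)"
  unfolding gsub_def order_boundaries_def order_chains_eq
proof (intro conjI ballI)
  show "fs.subspace (bd (Suc i) ` supp_on (D (Suc i)))"
    by (rule flinear_image_subspace[OF flinear_order_boundary subspace_supp_on])
qed (auto simp: ch.P_supp_on[OF stable_D] simp flip: bd_P)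

lemma Bd_Z: "Bd i \<subseteq> Z i"
  by (auto simp: Z_eq order_boundaries_def order_boundary_in_chains order_boundary_boundary[OF finQ])

text \<open>Every homology class has exactly one cycle orthogonal to all boundaries.\<close>

definition harmonic :: "nat \<Rightarrow> ('a set set \<Rightarrow> rat) set" where
  "harmonic i = Z i \<inter> orth (D i) (Bd i)"

lemma Z_supp: "Z i \<subseteq> supp_on (D i)"
  by (auto simp: Z_eq)

lemma finD: "finite (D i)"
  by (rule finite_order_simplices[OF finQ])

lemma gsub_harmonic: "gsub G ch.P (harmonic i)"
  unfolding harmonic_def by (intro ch.gsub_Int gsub_Z ch.gsub_orth stable_D gsub_Bd)

lemma Z_split: assumes "z \<in> Z i" shows "\<exists>u\<in>Bd i. \<exists>k\<in>harmonic i. z = u + k"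
proof -
  obtain u k where uk: "u \<in> Bd i" "k \<in> orth (D i) (Bd i)" "z = u + k"
    by (rule orth_decomp[OF finD gsub_subspace[OF gsub_Bd] subset_trans[OF Bd_Z Z_supp] subsetD[OF Z_supp assms]]) (rule that)
  have "k = z - u" using uk(3) by simp
  then have "k \<in> Z i"
    using fs.subspace_diff[OF gsub_subspace[OF gsub_Z] assms subsetD[OF Bd_Z uk(1)]] by simp
  then show ?thesis using uk by (auto simp: harmonic_def)
qed

lemma Bd_harmonic: "Bd i \<inter> harmonic i \<subseteq> {0}"
  using orth_disjoint[OF finD, of "Bd i"] by (auto simp: harmonic_def)

lemma rep_multiplicity_homology:
  "rep_multiplicity G V (homology_rep G \<theta> Q i) = rep_multiplicity G V (fun_rep (harmonic i) ch.P)"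
proof -
  have "homology_rep G \<theta> Q i = quotient_rep (fun_rep (Z i) ch.P) (Bd i)"
    by (simp add: homology_rep_def pact_def[abs_def] chain_act_def[abs_def])
  moreover have "harmonic i \<subseteq> Z i" by (simp add: harmonic_def)
  ultimately show ?thesis
    using rep_multiplicity_iso[OF ch.quotient_rep_complement(1) is_rep_fun_rep
        ch.quotient_rep_complement(2), OF gsub_Z gsub_Bd Bd_Z gsub_harmonic _ Z_split Bd_harmonic gsub_harmonic
        gsub_Z gsub_Bd Bd_Z gsub_harmonic _ Z_split Bd_harmonic, of i V]
    by simp
qed

end

locale poset_pair = char_pair G R \<alpha> C \<beta> + poset_action G \<theta> Q
  for G :: "('g, 'b) monoid_scheme" (structure) and R \<alpha> C \<beta> and \<theta> :: "'g \<Rightarrow> 'a \<Rightarrow> 'a" and Q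
begin

sublocale ch: char_pair_action G R \<alpha> C \<beta> "chain_act \<theta>" ..

lemma wsum_bd:
  assumes "S \<subseteq> carrier G"
  shows "bd i (wsum G (chain_act \<theta>) S w c) = wsum G (chain_act \<theta>) S w (bd i c)"
  unfolding wsum_def flinear_sum[OF flinear_order_boundary] flinear_scale[OF flinear_order_boundary]
  using assms by (intro sum.cong) (auto simp: bd_P)

lemma E_bd: "bd i (ch.E c) = ch.E (bd i c)"
  using subgroup.subset[OF R.sub] subgroup.subset[OF C.sub] by (simp add: wsum_bd)

lemma dim_E_sum:
  assumes U: "gsub G ch.P U" "U \<subseteq> supp_on (D i)" and W: "gsub G ch.P W" "W \<subseteq> supp_on (D i)"
    and int: "U \<inter> W \<subseteq> {0}" and V: "V \<subseteq> {u + w | u w. u \<in> U \<and> w \<in> W}" "U \<subseteq> V" "W \<subseteq> V" "fs.subspace V"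
  shows "fs.dim (ch.E ` V) = fs.dim (ch.E ` U) + fs.dim (ch.E ` W)"
proof -
  have EU: "ch.E ` U \<subseteq> U" and EW: "ch.E ` W \<subseteq> W" using ch.gsub_E U(1) W(1) by blast+
  have "ch.E ` V = {u + w | u w. u \<in> ch.E ` U \<and> w \<in> ch.E ` W}" (is "_ = ?S")
  proof
    show "ch.E ` V \<subseteq> ?S"
    proof (rule image_subsetI)
      fix v assume "v \<in> V"
      then obtain u w where "u \<in> U" "w \<in> W" "v = u + w" using V(1) by blast
      then show "ch.E v \<in> ?S" using flinear_add[OF ch.flinear_E, of u w] by blast
    qed
    show "?S \<subseteq> ch.E ` V"
    proof
      fix f assume "f \<in> ?S"
      then obtain u w where uw: "u \<in> U" "w \<in> W" "f = ch.E u + ch.E w" by blast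
      then have "f = ch.E (u + w)" by (simp add: flinear_add[OF ch.flinear_E])
      moreover have "u + w \<in> V" using fs.subspace_add[OF V(4)] uw V(2,3) by blast
      ultimately show "f \<in> ch.E ` V" by (rule image_eqI)
    qed
  qed
  moreover have "ch.E ` U \<subseteq> supp_on (D i)" "ch.E ` W \<subseteq> supp_on (D i)" "ch.E ` U \<inter> ch.E ` W \<subseteq> {0}"
    using EU EW U(2) W(2) int by blast+
  ultimately show ?thesis
    using dim_direct_sum[OF finD flinear_image_subspace[OF ch.flinear_E gsub_subspace[OF U(1)]]
      flinear_image_subspace[OF ch.flinear_E gsub_subspace[OF W(1)]]] by simp
qed

abbreviation "d i \<equiv> fs.dim (ch.E ` supp_on (D i))"
abbreviation "h i \<equiv> fs.dim (ch.E ` harmonic i)"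
abbreviation "b i \<equiv> fs.dim (ch.E ` Bd i)"
abbreviation "coc i \<equiv> orth (D i) (Z i)"

lemma gsub_coc: "gsub G ch.P (coc i)"
  by (rule ch.gsub_orth[OF stable_D gsub_Z])

lemma coc_supp: "coc i \<subseteq> supp_on (D i)"
  by (auto simp: orth_def)

lemma d_split: "d i = fs.dim (ch.E ` Z i) + fs.dim (ch.E ` coc i)"
proof (rule dim_E_sum[OF gsub_Z Z_supp gsub_coc coc_supp orth_disjoint[OF finD]])
  show "supp_on (D i) \<subseteq> {u + w | u w. u \<in> Z i \<and> w \<in> coc i}"
  proof
    fix f assume "f \<in> supp_on (D i)"
    then obtain u w where "u \<in> Z i" "w \<in> coc i" "f = u + w"
      by (rule orth_decomp[OF finD gsub_subspace[OF gsub_Z] Z_supp])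
    then show "f \<in> {u + w | u w. u \<in> Z i \<and> w \<in> coc i}" by blast
  qed
qed (rule Z_supp coc_supp subspace_supp_on)+

lemma harmonic_Z: "harmonic i \<subseteq> Z i"
  by (simp add: harmonic_def)

lemma Z_dim_split: "fs.dim (ch.E ` Z i) = b i + h i"
proof (rule dim_E_sum[OF gsub_Bd subset_trans[OF Bd_Z Z_supp] gsub_harmonic subset_trans[OF harmonic_Z Z_supp] Bd_harmonic])
  show "Z i \<subseteq> {u + w | u w. u \<in> Bd i \<and> w \<in> harmonic i}"
    using Z_split by blast
qed (rule Bd_Z harmonic_Z gsub_subspace[OF gsub_Z])+

lemma coc_zero: "fs.dim (ch.E ` coc 0) = 0"
proof -
  have "Z 0 = supp_on (D 0)" by (auto simp: Z_eq order_boundary_0)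
  then have "coc 0 \<subseteq> {0}" using orth_disjoint[OF finD, of "Z 0"] coc_supp[of 0] by blast
  then have "ch.E ` coc 0 \<subseteq> {0}" using flinear_zero[OF ch.flinear_E] by auto
  then show ?thesis using fs.dim_le_card[of "ch.E ` coc 0" "{}"] by (auto simp: fs.span_empty)
qed

text \<open>The boundary map identifies the complement of the cycles with the boundaries one degree lower.\<close>

lemma coc_Suc: "fs.dim (ch.E ` coc (Suc i)) = b i"
proof -
  have "bd (Suc i) ` ch.E ` coc (Suc i) = ch.E ` bd (Suc i) ` coc (Suc i)"
    by (simp add: image_image E_bd)
  also have "bd (Suc i) ` coc (Suc i) = Bd i"
  proof
    show "bd (Suc i) ` coc (Suc i) \<subseteq> Bd i"
      using coc_supp by (auto simp: order_boundaries_def order_chains_eq)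
    show "Bd i \<subseteq> bd (Suc i) ` coc (Suc i)"
      unfolding order_boundaries_def order_chains_eq
    proof (rule image_subsetI)
      fix f assume "f \<in> supp_on (D (Suc i))"
      then obtain u w where uw: "u \<in> Z (Suc i)" "w \<in> coc (Suc i)" "f = u + w"
        by (rule orth_decomp[OF finD gsub_subspace[OF gsub_Z] Z_supp])
      then have "bd (Suc i) f = bd (Suc i) w"
        by (simp add: Z_eq flinear_add[OF flinear_order_boundary])
      then show "bd (Suc i) f \<in> bd (Suc i) ` coc (Suc i)" using uw(2) by (rule image_eqI)
    qed
  qed
  finally have e: "bd (Suc i) ` ch.E ` coc (Suc i) = ch.E ` Bd i" .
  have sub: "ch.E ` coc (Suc i) \<subseteq> coc (Suc i)" using ch.gsub_E[OF gsub_coc] by blast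
  have "inj_on (bd (Suc i)) (ch.E ` coc (Suc i))"
  proof (rule inj_onI)
    fix v w assume vw: "v \<in> ch.E ` coc (Suc i)" "w \<in> ch.E ` coc (Suc i)" "bd (Suc i) v = bd (Suc i) w"
    then have c: "v - w \<in> coc (Suc i)"
      using fs.subspace_diff[OF gsub_subspace[OF gsub_coc]] sub by blast
    then have "v - w \<in> Z (Suc i)"
      using vw(3) coc_supp by (auto simp: Z_eq flinear_diff[OF flinear_order_boundary])
    then have "v - w = 0" using c orth_disjoint[OF finD, of "Z (Suc i)"] by blast
    then show "v = w" by simp
  qed
  then show ?thesis
    unfolding e[symmetric]
    by (rule dim_inj_image[OF flinear_order_boundary _
          flinear_image_subspace[OF ch.flinear_E gsub_subspace[OF gsub_coc]], symmetric])
qed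

text \<open>
  The part of \<open>i\<close>-chains orthogonal to the cycles contributes the boundaries of degree \<open>i - 1\<close>, which
  cancel in the alternating sum; only the last term is left over.
\<close>

lemma euler_partial:
  "(\<Sum>i<Suc n. (-1) ^ i * int (d i)) = (\<Sum>i<Suc n. (-1) ^ i * int (h i)) + (-1) ^ n * int (b n)"
proof (induction n)
  case 0
  show ?case using d_split[of 0] Z_dim_split[of 0] coc_zero by simp
next
  case (Suc n)
  have "int (d (Suc n)) = int (b (Suc n)) + int (h (Suc n)) + int (b n)"
    using d_split[of "Suc n"] Z_dim_split[of "Suc n"] coc_Suc[of n] by simp
  then show ?case using Suc by (simp add: algebra_simps)
qed

lemma euler_characteristic:
  "(\<Sum>i<card Q. (-1) ^ i * int (h i)) = (\<Sum>i<card Q. (-1) ^ i * int (d i))"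
proof (cases "card Q")
  case (Suc n)
  have "D (Suc n) = {}" using order_simplices_empty[OF finQ, of "Suc n"] Suc by simp
  then have "supp_on (D (Suc n)) = {0}" by (auto simp: supp_on_def fun_eq_iff pointwise)
  then have "Bd n = {0}"
    by (simp add: order_boundaries_def order_chains_eq flinear_zero[OF flinear_order_boundary])
  then have "b n = 0"
    using fs.dim_le_card[of "ch.E ` Bd n" "{}"] flinear_zero[OF ch.flinear_E] by (auto simp: fs.span_empty)
  then show ?thesis using euler_partial[of n] Suc by simp
qed simp

text \<open>
  The number of summands in degree \<open>i\<close> is \<open>dim (E -)\<close> of the harmonic cycles, and the alternating sum
  over all degrees equals that for the chains.
\<close>

theorem virtual_multiplicity_lefschetz:
  assumes "finite_action G \<sigma>" "girr G (pact G \<sigma>) V" "v \<in> V"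
    "wsum G \<sigma> C \<beta> (wsum G \<sigma> R \<alpha> v) \<noteq> 0"
  shows "virtual_multiplicity G (fun_rep V (pact G \<sigma>)) (lefschetz_rep G \<theta> Q) =
    (\<Sum>i<card Q. (-1) ^ i * int (d i))"
proof -
  have m: "rep_multiplicity G (fun_rep V (pact G \<sigma>)) (homology_rep G \<theta> Q i) = h i" for i
    unfolding rep_multiplicity_homology
    by (rule ch.rep_multiplicity_eq_dim[OF finD stable_D gsub_harmonic subset_trans[OF harmonic_Z Z_supp] assms])
  have "virtual_multiplicity G (fun_rep V (pact G \<sigma>)) (lefschetz_rep G \<theta> Q) =
    (\<Sum>i<card Q. (-1) ^ i * int (h i))"
    by (simp add: virtual_multiplicity_def lefschetz_rep_def comp_def m sum_list_distinct_conv_sum_set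
        atLeast0LessThan)
  then show ?thesis by (simp add: euler_characteristic)
qed

end

section \<open>The hyperoctahedral group\<close>

lemma hyperoct_simps:
  "(s, p) \<in> carrier (hyperoct n) \<longleftrightarrow> p permutes {1..n} \<and> (\<forall>i\<in>{1..n}. s i \<in> {1, -1}) \<and> (\<forall>i. i \<notin> {1..n} \<longrightarrow> s i = 1)"
  "(s, p) \<otimes>\<^bsub>hyperoct n\<^esub> (t, q) = (\<lambda>i. s i * t (inv_into UNIV p i), p \<circ> q)"
  "\<one>\<^bsub>hyperoct n\<^esub> = (\<lambda>_. 1, id)"
  by (auto simp: hyperoct_def)

lemma hyperoct_sign: "(s, p) \<in> carrier (hyperoct n) \<Longrightarrow> s i = 1 \<or> s i = -1"
  by (cases "i \<in> {1..n}") (auto simp: hyperoct_simps)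

lemma hyperoct_sign_sq:
  assumes "(s, p) \<in> carrier (hyperoct n)"
  shows "s i * s i = 1"
  using hyperoct_sign[OF assms, of i] by auto

lemma hyperoct_permutes: "(s, p) \<in> carrier (hyperoct n) \<Longrightarrow> p permutes {1..n}"
  by (simp add: hyperoct_simps)

lemma group_hyperoct: "group (hyperoct n)"
proof (rule groupI)
  fix x y assume "x \<in> carrier (hyperoct n)" "y \<in> carrier (hyperoct n)"
  then obtain s p t q where x: "x = (s, p)" "(s, p) \<in> carrier (hyperoct n)"
    and y: "y = (t, q)" "(t, q) \<in> carrier (hyperoct n)"
    by (cases x, cases y) auto
  have p: "p permutes {1..n}" "q permutes {1..n}" using x y by (auto simp: hyperoct_simps)
  have "s i * t (inv_into UNIV p i) \<in> {1, -1}" for i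
    using hyperoct_sign[OF x(2), of i] hyperoct_sign[OF y(2), of "inv_into UNIV p i"] by auto
  moreover have "s i * t (inv_into UNIV p i) = 1" if "i \<notin> {1..n}" for i
    using permutes_not_in[OF permutes_inv[OF p(1)] that] that x y by (simp add: hyperoct_simps)
  ultimately show "x \<otimes>\<^bsub>hyperoct n\<^esub> y \<in> carrier (hyperoct n)"
    using permutes_compose[OF p(2,1)] by (simp add: x y hyperoct_simps del: insert_iff)
next
  show "\<one>\<^bsub>hyperoct n\<^esub> \<in> carrier (hyperoct n)"
    by (simp add: hyperoct_simps permutes_id)
next
  fix x y z assume "x \<in> carrier (hyperoct n)" "y \<in> carrier (hyperoct n)" "z \<in> carrier (hyperoct n)"
  then obtain s p t q u r where x: "x = (s, p)" "p permutes {1..n}" and y: "y = (t, q)" "q permutes {1..n}"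
    and z: "z = (u, r)"
    by (cases x, cases y, cases z) (auto simp: hyperoct_simps)
  have "inv_into UNIV (p \<circ> q) = inv_into UNIV q \<circ> inv_into UNIV p"
    by (rule o_inv_distrib[OF permutes_bij[OF x(2)] permutes_bij[OF y(2)]])
  then show "x \<otimes>\<^bsub>hyperoct n\<^esub> y \<otimes>\<^bsub>hyperoct n\<^esub> z = x \<otimes>\<^bsub>hyperoct n\<^esub> (y \<otimes>\<^bsub>hyperoct n\<^esub> z)"
    by (simp add: x y z hyperoct_simps comp_assoc mult.assoc)
next
  fix x assume "x \<in> carrier (hyperoct n)"
  then obtain s p where x: "x = (s, p)" "(s, p) \<in> carrier (hyperoct n)" by (cases x) auto
  show "\<one>\<^bsub>hyperoct n\<^esub> \<otimes>\<^bsub>hyperoct n\<^esub> x = x" by (simp add: x hyperoct_simps)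
  have p: "p permutes {1..n}" using x by (simp add: hyperoct_simps)
  have "(\<lambda>i. s (p i), inv_into UNIV p) \<in> carrier (hyperoct n)"
    using x(2) permutes_inv[OF p] permutes_not_in[OF p] hyperoct_sign[OF x(2)] by (simp add: hyperoct_simps)
  moreover have "(\<lambda>i. s (p i), inv_into UNIV p) \<otimes>\<^bsub>hyperoct n\<^esub> x = \<one>\<^bsub>hyperoct n\<^esub>"
    using hyperoct_sign_sq[OF x(2)]
    by (simp add: x(1) hyperoct_simps permutes_inv_inv[OF p] permutes_inv_o[OF p] fun_eq_iff)
  ultimately show "\<exists>y\<in>carrier (hyperoct n). y \<otimes>\<^bsub>hyperoct n\<^esub> x = \<one>\<^bsub>hyperoct n\<^esub>" by blast
qed

lemma inv_hyperoct:
  assumes "(s, p) \<in> carrier (hyperoct n)"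
  shows "inv\<^bsub>hyperoct n\<^esub> (s, p) = (\<lambda>i. s (p i), inv_into UNIV p)"
proof (rule group.inv_equality[OF group_hyperoct _ assms])
  have p: "p permutes {1..n}" using assms by (simp add: hyperoct_simps)
  show "(\<lambda>i. s (p i), inv_into UNIV p) \<in> carrier (hyperoct n)"
    using assms permutes_inv[OF p] permutes_not_in[OF p] hyperoct_sign[OF assms] by (simp add: hyperoct_simps)
  show "(\<lambda>i. s (p i), inv_into UNIV p) \<otimes>\<^bsub>hyperoct n\<^esub> (s, p) = \<one>\<^bsub>hyperoct n\<^esub>"
    using hyperoct_sign_sq[OF assms]
    by (simp add: hyperoct_simps permutes_inv_inv[OF p] permutes_inv_o[OF p] fun_eq_iff)
qed

lemma finite_hyperoct: "finite (carrier (hyperoct n))"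
proof -
  let ?f = "\<lambda>(s, p). (restrict s {1..n}, p)"
  have "inj_on ?f (carrier (hyperoct n))"
  proof (rule inj_onI)
    fix x y assume "x \<in> carrier (hyperoct n)" "y \<in> carrier (hyperoct n)" and f: "?f x = ?f y"
    then obtain s p t q where x: "x = (s, p)" "(s, p) \<in> carrier (hyperoct n)"
      and y: "y = (t, q)" "(t, q) \<in> carrier (hyperoct n)"
      by (cases x, cases y) auto
    have e: "restrict s {1..n} = restrict t {1..n}" "p = q" using f by (simp_all add: x y)
    have "s i = t i" for i
      using x y fun_cong[OF e(1), of i] by (cases "i \<in> {1..n}") (auto simp: hyperoct_simps)
    then show "x = y" using e(2) by (simp add: x y fun_eq_iff)
  qed
  moreover have "?f ` carrier (hyperoct n) \<subseteq> ({1..n} \<rightarrow>\<^sub>E {1, -1}) \<times> {p. p permutes {1..n}}"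
  proof (rule image_subsetI)
    fix x assume "x \<in> carrier (hyperoct n)"
    then obtain s p where x: "x = (s, p)" "(s, p) \<in> carrier (hyperoct n)" by (cases x) auto
    have "s i \<in> {1, -1}" for i using hyperoct_sign[OF x(2), of i] by simp
    then show "?f x \<in> ({1..n} \<rightarrow>\<^sub>E {1, -1}) \<times> {p. p permutes {1..n}}"
      using hyperoct_permutes[OF x(2)] by (simp add: x(1))
  qed
  moreover have "finite \<dots>" by (intro finite_cartesian_product finite_PiE finite_permutations) auto
  ultimately show ?thesis by (meson finite_imageD finite_subset)
qed

definition flip_at :: "nat \<Rightarrow> signed_perm" where
  "flip_at i = ((\<lambda>_. 1)(i := -1), id)"

lemma flip_at_carrier: "i \<in> {1..n} \<Longrightarrow> flip_at i \<in> carrier (hyperoct n)"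
  by (auto simp: flip_at_def hyperoct_simps permutes_id)

lemma perm_carrier: "p permutes {1..n} \<Longrightarrow> (\<lambda>_. 1, p) \<in> carrier (hyperoct n)"
  by (simp add: hyperoct_simps)

section \<open>Young pairs in the hyperoctahedral group\<close>

text \<open>
  A labelling places the numbers \<open>1..n\<close> in the cells of a pair of Young diagrams: \<open>side i\<close> tells
  whether \<open>i\<close> lies in the second diagram, on which sign changes act by \<open>-1\<close>. Only two properties
  matter: a cell holds at most one number, and the cells above an occupied cell are occupied.
\<close>

definition labelling :: "nat \<Rightarrow> (nat \<Rightarrow> bool) \<Rightarrow> (nat \<Rightarrow> nat) \<Rightarrow> (nat \<Rightarrow> nat) \<Rightarrow> bool" where
  "labelling n side rw cl \<longleftrightarrow>
     (\<forall>i\<in>{1..n}. \<forall>j\<in>{1..n}. side i = side j \<and> rw i = rw j \<and> cl i = cl j \<longrightarrow> i = j) \<and>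
     (\<forall>i\<in>{1..n}. \<forall>r<rw i. \<exists>j\<in>{1..n}. side j = side i \<and> cl j = cl i \<and> rw j = r)"

definition stab :: "nat \<Rightarrow> (nat \<Rightarrow> bool) \<Rightarrow> (nat \<Rightarrow> nat) \<Rightarrow> signed_perm set" where
  "stab n side f = {(s, p) \<in> carrier (hyperoct n). \<forall>i\<in>{1..n}. side (p i) = side i \<and> f (p i) = f i}"

definition chi :: "nat \<Rightarrow> (nat \<Rightarrow> bool) \<Rightarrow> signed_perm \<Rightarrow> rat" where
  "chi n side = (\<lambda>(s, p). \<Prod>i\<in>{i\<in>{1..n}. side i}. of_int (s i))"

definition chi_sign :: "nat \<Rightarrow> (nat \<Rightarrow> bool) \<Rightarrow> signed_perm \<Rightarrow> rat" where
  "chi_sign n side g = chi n side g * of_int (sign (snd g))"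

lemma chi_pm:
  assumes "g \<in> carrier (hyperoct n)"
  shows "chi n side g = 1 \<or> chi n side g = -1"
proof -
  obtain s p where g: "g = (s, p)" by (cases g)
  have "finite A \<Longrightarrow> (\<Prod>i\<in>A. of_int (s i)) = (1::rat) \<or> (\<Prod>i\<in>A. of_int (s i)) = (-1::rat)" for A
  proof (induction A rule: finite_induct)
    case (insert i A)
    then show ?case using hyperoct_sign[OF assms[unfolded g], of i] by auto
  qed simp
  then show ?thesis by (simp add: g chi_def)
qed

lemma side_bij:
  fixes n :: nat
  assumes "p permutes {1..n}" "\<forall>i\<in>{1..n}. side (p i) = side i"
  shows "bij_betw p {i\<in>{1..n}. side i} {i\<in>{1..n}. side i}"
proof (rule bij_betw_imageI)
  have fin: "finite {i\<in>{1..n}. side i}" by simp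
  show "inj_on p {i\<in>{1..n}. side i}" using permutes_inj[OF assms(1)] inj_on_subset by blast
  then show "p ` {i\<in>{1..n}. side i} = {i\<in>{1..n}. side i}"
    using assms(2) permutes_in_image[OF assms(1)]
    by (intro endo_inj_surj fin) auto
qed

lemma chi_mult:
  assumes "(s, p) \<in> carrier (hyperoct n)" "\<forall>i\<in>{1..n}. side (p i) = side i"
  shows "chi n side ((s, p) \<otimes>\<^bsub>hyperoct n\<^esub> (t, q)) = chi n side (s, p) * chi n side (t, q)"
proof -
  let ?M = "{i\<in>{1..n}. side i}"
  have p: "p permutes {1..n}" by (rule hyperoct_permutes[OF assms(1)])
  have "(\<Prod>i\<in>?M. rat_of_int (t (inv_into UNIV p i))) = (\<Prod>i\<in>?M. of_int (t (inv_into UNIV p (p i))))"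
    by (rule prod.reindex_bij_betw[OF side_bij[OF p assms(2)], symmetric])
  also have "\<dots> = (\<Prod>i\<in>?M. of_int (t i))" by (simp add: permutes_inverses(2)[OF p])
  finally show ?thesis by (simp add: hyperoct_simps chi_def prod.distrib)
qed

lemma subgroup_stab: "subgroup (stab n side f) (hyperoct n)"
proof (rule group.subgroupI[OF group_hyperoct])
  show "stab n side f \<subseteq> carrier (hyperoct n)" by (auto simp: stab_def)
  have "\<one>\<^bsub>hyperoct n\<^esub> \<in> stab n side f" by (auto simp: stab_def hyperoct_simps permutes_id)
  then show "stab n side f \<noteq> {}" by blast
  fix g assume "g \<in> stab n side f"
  then obtain s p where g: "g = (s, p)" "(s, p) \<in> carrier (hyperoct n)"
    "\<And>i. i \<in> {1..n} \<Longrightarrow> side (p i) = side i \<and> f (p i) = f i"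
    by (auto simp: stab_def)
  have p: "p permutes {1..n}" by (rule hyperoct_permutes[OF g(2)])
  have "side (inv_into UNIV p i) = side i \<and> f (inv_into UNIV p i) = f i" if "i \<in> {1..n}" for i
    using g(3)[of "inv_into UNIV p i"] that permutes_in_image[OF permutes_inv[OF p], of i]
      permutes_inverses(1)[OF p] by simp
  then show "inv\<^bsub>hyperoct n\<^esub> g \<in> stab n side f"
    using group.inv_closed[OF group_hyperoct g(2)]
    by (simp add: stab_def g(1) inv_hyperoct[OF g(2)])
  fix h assume "h \<in> stab n side f"
  then obtain t q where h: "h = (t, q)" "(t, q) \<in> carrier (hyperoct n)"
    "\<And>i. i \<in> {1..n} \<Longrightarrow> side (q i) = side i \<and> f (q i) = f i"
    by (auto simp: stab_def)
  have q: "q permutes {1..n}" by (rule hyperoct_permutes[OF h(2)])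
  have "side (p (q i)) = side i \<and> f (p (q i)) = f i" if "i \<in> {1..n}" for i
    using h(3)[OF that] g(3)[of "q i"] permutes_in_image[OF q, of i] that by simp
  then show "g \<otimes>\<^bsub>hyperoct n\<^esub> h \<in> stab n side f"
    using monoid.m_closed[OF group.is_monoid[OF group_hyperoct] g(2) h(2)]
    by (simp add: stab_def g(1) h(1) hyperoct_simps(2))
qed

lemma sign_char_chi: "sign_char (hyperoct n) (stab n side f) (chi n side)"
proof (intro sign_char.intro group_hyperoct sign_char_axioms.intro subgroup_stab)
  show "g \<in> stab n side f \<Longrightarrow> chi n side g = 1 \<or> chi n side g = -1" for g
    by (rule chi_pm) (auto simp: stab_def)
qed (auto simp: stab_def chi_mult)

lemma sign_char_chi_sign: "sign_char (hyperoct n) (stab n side f) (chi_sign n side)"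
proof (intro sign_char.intro group_hyperoct sign_char_axioms.intro subgroup_stab)
  fix g h assume g: "g \<in> stab n side f" and h: "h \<in> stab n side f"
  have "chi n side (g \<otimes>\<^bsub>hyperoct n\<^esub> h) = chi n side g * chi n side h"
    by (rule sign_char.mult[OF sign_char_chi g h])
  moreover have "sign (snd (g \<otimes>\<^bsub>hyperoct n\<^esub> h)) = sign (snd g) * sign (snd h)"
  proof -
    have "permutation (snd g)" "permutation (snd h)"
      using g h hyperoct_permutes permutes_imp_permutation[of "{1..n}"] by (auto simp: stab_def)
    then have "sign (snd g \<circ> snd h) = sign (snd g) * sign (snd h)" by (rule sign_compose)
    then show ?thesis by (cases g, cases h) (simp add: hyperoct_simps)
  qed
  ultimately show "chi_sign n side (g \<otimes>\<^bsub>hyperoct n\<^esub> h) = chi_sign n side g * chi_sign n side h"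
    by (simp add: chi_sign_def)
next
  fix g assume "g \<in> stab n side f"
  then have "chi n side g = 1 \<or> chi n side g = -1" by (rule sign_char.pm[OF sign_char_chi])
  then show "chi_sign n side g = 1 \<or> chi_sign n side g = -1"
    by (auto simp: chi_sign_def sign_def)
qed

lemma sum_ge_sum_lessThan:
  fixes A :: "nat set"
  assumes "finite A"
  shows "\<Sum>{..<card A} \<le> \<Sum>A" and "\<Sum>A = \<Sum>{..<card A} \<Longrightarrow> A = {..<card A}"
proof -
  have "\<Sum>{..<card A} \<le> \<Sum>A \<and> (\<Sum>A = \<Sum>{..<card A} \<longrightarrow> A = {..<card A})"
    using assms
  proof (induction "card A" arbitrary: A)
    case 0
    then show ?case by simp
  next
    case (Suc k)
    then have ne: "A \<noteq> {}" by auto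
    define m where "m = Max A"
    have m: "m \<in> A" "\<And>a. a \<in> A \<Longrightarrow> a \<le> m" using Suc.prems ne by (auto simp: m_def)
    define A' where "A' = A - {m}"
    have A': "card A' = k" "finite A'" "A = insert m A'" "m \<notin> A'"
      using Suc m by (auto simp: A'_def card_Diff_singleton)
    have IH: "\<Sum>{..<k} \<le> \<Sum>A'" "\<Sum>A' = \<Sum>{..<k} \<longrightarrow> A' = {..<k}"
      using Suc.hyps(1)[of A'] A' by auto
    have "A' \<subseteq> {..<m}" using m(2) A'(3,4) by (auto simp: le_less)
    then have km: "k \<le> m" using card_mono[of "{..<m}" A'] A'(1) by simp
    have s: "\<Sum>A = m + \<Sum>A'" using A' by simp
    have c: "{..<card A} = insert k {..<k}" using Suc.hyps(2) by (auto simp: lessThan_Suc)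
    have s': "\<Sum>{..<card A} = k + \<Sum>{..<k}" unfolding c by simp
    show ?case
    proof (intro conjI impI)
      show "\<Sum>{..<card A} \<le> \<Sum>A" using IH(1) km s s' by simp
      assume "\<Sum>A = \<Sum>{..<card A}"
      then have "m = k" "\<Sum>A' = \<Sum>{..<k}" using IH(1) km s s' by auto
      then show "A = {..<card A}" using IH(2) A'(3) c by simp
    qed
  qed
  then show "\<Sum>{..<card A} \<le> \<Sum>A" and "\<Sum>A = \<Sum>{..<card A} \<Longrightarrow> A = {..<card A}" by auto
qed

text \<open>
  If \<open>\<rho>\<close> has the same values as \<open>r\<close>, and in each column \<open>r\<close> takes the values \<open>0, 1, ..., k - 1\<close>
  while \<open>\<rho>\<close> takes distinct values, then \<open>\<rho>\<close> takes the same values as \<open>r\<close> in each column: these are the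
  smallest possible ones, and the sum over all columns leaves no slack.
\<close>

lemma column_values_eq:
  fixes r \<rho> :: "nat \<Rightarrow> nat" and c :: "nat \<Rightarrow> 'c"
  assumes fin: "finite A" and sum: "(\<Sum>i\<in>A. \<rho> i) = (\<Sum>i\<in>A. r i)"
    and r: "\<And>x. inj_on r {i\<in>A. c i = x}" "\<And>x. r ` {i\<in>A. c i = x} = {..<card {i\<in>A. c i = x}}"
    and \<rho>: "\<And>x. inj_on \<rho> {i\<in>A. c i = x}"
  shows "\<rho> ` {i\<in>A. c i = x} = r ` {i\<in>A. c i = x}"
proof -
  let ?F = "\<lambda>x. {i\<in>A. c i = x}"
  have finF: "finite (?F x)" for x using fin by simp
  have *: "sum f A = (\<Sum>x\<in>c ` A. \<Sum>(f ` ?F x))" if "\<And>x. inj_on f (?F x)" for f :: "nat \<Rightarrow> nat"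
  proof -
    have "sum f A = (\<Sum>x\<in>c ` A. sum f (?F x))"
      using fin by (rule sum.image_gen)
    then show ?thesis using that by (simp add: sum.reindex)
  qed
  have le: "\<Sum>(r ` ?F x) \<le> \<Sum>(\<rho> ` ?F x)" for x
    using sum_ge_sum_lessThan(1)[of "\<rho> ` ?F x"] finF r(2)[of x] by (simp add: card_image[OF \<rho>])
  have eq: "\<Sum>(r ` ?F x) = \<Sum>(\<rho> ` ?F x)" if "x \<in> c ` A" for x
  proof (rule ccontr)
    assume "\<Sum>(r ` ?F x) \<noteq> \<Sum>(\<rho> ` ?F x)"
    then have "\<Sum>(r ` ?F x) < \<Sum>(\<rho> ` ?F x)" using le[of x] by simp
    then have "(\<Sum>x\<in>c ` A. \<Sum>(r ` ?F x)) < (\<Sum>x\<in>c ` A. \<Sum>(\<rho> ` ?F x))"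
      using fin that le by (intro sum_strict_mono_ex1) auto
    then show False using sum *[OF r(1)] *[OF \<rho>] by simp
  qed
  show ?thesis
  proof (cases "x \<in> c ` A")
    case True
    then have "\<Sum>(\<rho> ` ?F x) = \<Sum>{..<card (\<rho> ` ?F x)}"
      using eq[OF True] r(2)[of x] by (simp add: card_image[OF \<rho>])
    then have "\<rho> ` ?F x = {..<card (\<rho> ` ?F x)}"
      using finF by (intro sum_ge_sum_lessThan(2)) auto
    then show ?thesis using r(2)[of x] by (simp add: card_image[OF \<rho>])
  next
    case False
    then have "?F x = {}" by blast
    then show ?thesis by (simp only: image_empty)
  qed
qed

lemma labelling_inj:
  "labelling n side rw cl \<Longrightarrow> i \<in> {1..n} \<Longrightarrow> j \<in> {1..n} \<Longrightarrow> side i = side j \<Longrightarrow> rw i = rw j \<Longrightarrow>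
    cl i = cl j \<Longrightarrow> i = j"
  unfolding labelling_def by blast

lemma labelling_down:
  "labelling n side rw cl \<Longrightarrow> i \<in> {1..n} \<Longrightarrow> r < rw i \<Longrightarrow>
    \<exists>j\<in>{1..n}. side j = side i \<and> cl j = cl i \<and> rw j = r"
  unfolding labelling_def by blast

lemma labelling_column:
  assumes "labelling n side rw cl"
  shows "inj_on rw {i\<in>{1..n}. (side i, cl i) = x}"
    and "rw ` {i\<in>{1..n}. (side i, cl i) = x} = {..<card {i\<in>{1..n}. (side i, cl i) = x}}"
proof -
  let ?F = "{i\<in>{1..n}. (side i, cl i) = x}"
  show inj: "inj_on rw ?F"
    using labelling_inj[OF assms] by (intro inj_onI) auto
  have down: "r \<in> rw ` ?F" if m: "m \<in> rw ` ?F" and "r \<le> m" for r m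
  proof (cases "r = m")
    case False
    obtain i where i: "i \<in> {1..n}" "(side i, cl i) = x" "m = rw i" using m by blast
    then obtain j where "j \<in> {1..n}" "side j = side i" "cl j = cl i" "rw j = r"
      using labelling_down[OF assms i(1), of r] False \<open>r \<le> m\<close> by auto
    then show ?thesis using i(2) by (intro image_eqI[of _ _ j]) auto
  qed (use m in simp)
  define S where "S = rw ` ?F"
  have "S = {..<card S}"
  proof (cases "S = {}")
    case False
    have fin: "finite S" by (simp add: S_def)
    have "r \<in> S \<longleftrightarrow> r \<in> {..<Suc (Max S)}" for r
      using Max_ge[OF fin, of r] down[folded S_def, OF Max_in[OF fin False], of r]
      by (metis lessThan_iff less_Suc_eq_le)
    then have e: "S = {..<Suc (Max S)}" by blast
    have "card S = Suc (Max S)" using arg_cong[OF e, of card] by simp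
    then show ?thesis using e by simp
  qed simp
  then have "rw ` ?F = {..<card (rw ` ?F)}" unfolding S_def .
  then show "rw ` ?F = {..<card ?F}" unfolding card_image[OF inj] .
qed

lemma conj_flip_at:
  assumes g: "(s, p) \<in> carrier (hyperoct n)" and i: "i \<in> {1..n}"
  shows "(s, p) \<otimes>\<^bsub>hyperoct n\<^esub> flip_at i \<otimes>\<^bsub>hyperoct n\<^esub> inv\<^bsub>hyperoct n\<^esub> (s, p) = flip_at (p i)"
proof -
  have p: "p permutes {1..n}" by (rule hyperoct_permutes[OF g])
  have "s j * ((\<lambda>_. 1)(i := -1)) (inv_into UNIV p j) * s (p (inv_into UNIV p j)) = ((\<lambda>_. 1)(p i := -1)) j" for j
    using hyperoct_sign_sq[OF g, of j] permutes_inverses[OF p] by auto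
  then show ?thesis
    by (simp add: flip_at_def inv_hyperoct[OF g] hyperoct_simps permutes_inv_o[OF p] fun_eq_iff)
qed

lemma flip_at_stab: "i \<in> {1..n} \<Longrightarrow> flip_at i \<in> stab n side f"
  using flip_at_carrier[of i n] by (simp add: stab_def flip_at_def)

lemma chi_flip_at: "i \<in> {1..n} \<Longrightarrow> chi n side (flip_at i) = (if side i then -1 else 1)"
  by (simp add: chi_def flip_at_def prod.delta if_distrib cong: if_cong)

lemma chi_perm [simp]: "chi n side (\<lambda>_. 1, p) = 1"
  by (simp add: chi_def)

lemma chi_conj:
  assumes g: "(s, p) \<in> carrier (hyperoct n)" "\<forall>i\<in>{1..n}. side (p i) = side i"
    and q: "q permutes {1..n}" "\<forall>i\<in>{1..n}. side (q i) = side i"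
  shows "chi n side ((s, p) \<otimes>\<^bsub>hyperoct n\<^esub> (\<lambda>_. 1, q) \<otimes>\<^bsub>hyperoct n\<^esub> inv\<^bsub>hyperoct n\<^esub> (s, p)) = 1"
proof -
  have f: "(s, p) \<in> stab n side (\<lambda>_. 0)" "(\<lambda>_. 1, q) \<in> stab n side (\<lambda>_. 0)"
    using g q perm_carrier[OF q(1)] by (auto simp: stab_def)
  interpret c: sign_char "hyperoct n" "stab n side (\<lambda>_. 0)" "chi n side" by (rule sign_char_chi)
  show ?thesis
    using f by (simp add: c.mult c.mult_mem c.inv_mem c.char_inv c.sq)
qed

text \<open>
  If \<open>p\<close> never takes two numbers of one column from the same row, then the columns can be permuted
  within themselves so that every number lands in the row prescribed by \<open>p\<close>: the prescribed rows of a
  column are distinct, and by counting they are exactly the rows that occur in it.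
\<close>

lemma labelling_column_perm:
  assumes L: "labelling n side rw cl" and p: "p permutes {1..n}" "\<forall>i\<in>{1..n}. side (p i) = side i"
    and inj: "\<And>i j. i \<in> {1..n} \<Longrightarrow> j \<in> {1..n} \<Longrightarrow> side i = side j \<Longrightarrow> cl i = cl j \<Longrightarrow>
      rw (inv_into UNIV p i) = rw (inv_into UNIV p j) \<Longrightarrow> i = j"
  obtains \<sigma> where "\<sigma> permutes {1..n}"
    "\<And>i. i \<in> {1..n} \<Longrightarrow> side (\<sigma> i) = side i \<and> cl (\<sigma> i) = cl i \<and> rw (\<sigma> i) = rw (inv_into UNIV p i)"
proof -
  let ?\<rho> = "\<lambda>i. rw (inv_into UNIV p i)"
  let ?F = "\<lambda>x. {i\<in>{1..n}. (side i, cl i) = x}"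
  have "(\<Sum>i\<in>{1..n}. ?\<rho> i) = (\<Sum>i\<in>{1..n}. rw i)"
    by (rule sum.reindex_bij_betw[OF permutes_imp_bij[OF permutes_inv[OF p(1)]]])
  then have img: "?\<rho> ` ?F x = rw ` ?F x" for x
    by (intro column_values_eq[where c = "\<lambda>i. (side i, cl i)"] labelling_column[OF L])
      (auto simp: inj_on_def intro: inj)
  have ex: "\<exists>j. j \<in> {1..n} \<and> side j = side i \<and> cl j = cl i \<and> rw j = ?\<rho> i" if "i \<in> {1..n}" for i
  proof -
    have "?\<rho> i \<in> ?\<rho> ` ?F (side i, cl i)" using that by blast
    then show ?thesis unfolding img by auto
  qed
  define \<sigma> where "\<sigma> i = (if i \<in> {1..n} then SOME j. j \<in> {1..n} \<and> side j = side i \<and> cl j = cl i \<and> rw j = ?\<rho> i else i)" for i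
  have \<sigma>: "\<sigma> i \<in> {1..n} \<and> side (\<sigma> i) = side i \<and> cl (\<sigma> i) = cl i \<and> rw (\<sigma> i) = ?\<rho> i" if "i \<in> {1..n}" for i
    using someI_ex[OF ex[OF that]] that by (simp only: \<sigma>_def if_True)
  have "inj_on \<sigma> {1..n}"
  proof (rule inj_onI)
    fix i j assume "i \<in> {1..n}" "j \<in> {1..n}" "\<sigma> i = \<sigma> j"
    then show "i = j" using \<sigma>[of i] \<sigma>[of j] inj[of i j] by metis
  qed
  moreover have "\<sigma> ` {1..n} \<subseteq> {1..n}" using \<sigma> by blast
  ultimately have "bij_betw \<sigma> {1..n} {1..n}"
    using endo_inj_surj[of "{1..n}" \<sigma>] by (simp add: bij_betw_def)
  then have "\<sigma> permutes {1..n}" by (rule bij_imp_permutes) (auto simp: \<sigma>_def)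
  then show thesis using \<sigma> that by blast
qed

text \<open>
  The row and column groups of a labelling, enlarged by all sign changes, form a pair as above. An
  element mixing the two sides moves a sign change across the sides. An element respecting them
  factors unless two numbers of a column come from the same row; their transposition then lies in
  the column group and is conjugate to a transposition in the row group.
\<close>

lemma char_pair_labelling:
  assumes L: "labelling n side rw cl"
  shows "char_pair (hyperoct n) (stab n side rw) (chi n side) (stab n side cl) (chi_sign n side)"
proof (intro char_pair.intro char_pair_axioms.intro sign_char_chi sign_char_chi_sign finite_hyperoct)
  fix g assume a: "g \<in> stab n side rw" "g \<in> stab n side cl"
  obtain s p where g: "g = (s, p)" by (cases g)
  have p: "p permutes {1..n}" using a by (auto simp: g stab_def hyperoct_simps)
  have "p i = i" for i
  proof (cases "i \<in> {1..n}")
    case True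
    then show ?thesis
      using L a permutes_in_image[OF p, of i] unfolding g labelling_def stab_def by blast
  qed (simp add: permutes_not_in[OF p])
  then have "p = id" by auto
  then show "chi n side g = chi_sign n side g" by (simp add: chi_sign_def g)
next
  fix g assume "g \<in> carrier (hyperoct n)"
  then obtain s p where g: "g = (s, p)" "(s, p) \<in> carrier (hyperoct n)" by (cases g) auto
  have p: "p permutes {1..n}" by (rule hyperoct_permutes[OF g(2)])
  let ?R = "stab n side rw" and ?C = "stab n side cl"
  let ?cj = "\<lambda>r. g \<otimes>\<^bsub>hyperoct n\<^esub> r \<otimes>\<^bsub>hyperoct n\<^esub> inv\<^bsub>hyperoct n\<^esub> g"
  let ?goal = "(\<exists>c\<in>?C. \<exists>r\<in>?R. g = c \<otimes>\<^bsub>hyperoct n\<^esub> r) \<or>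
     (\<exists>r\<in>?R. ?cj r \<in> ?C \<and> chi n side r \<noteq> chi_sign n side (?cj r))"
  consider (mix) i where "i \<in> {1..n}" "side (p i) \<noteq> side i"
    | (clash) i j where "\<forall>i\<in>{1..n}. side (p i) = side i" "i \<in> {1..n}" "j \<in> {1..n}" "side i = side j" "cl i = cl j"
      "rw (inv_into UNIV p i) = rw (inv_into UNIV p j)" "i \<noteq> j"
    | (good) "\<forall>i\<in>{1..n}. side (p i) = side i"
      "\<And>i j. i \<in> {1..n} \<Longrightarrow> j \<in> {1..n} \<Longrightarrow> side i = side j \<Longrightarrow> cl i = cl j \<Longrightarrow>
        rw (inv_into UNIV p i) = rw (inv_into UNIV p j) \<Longrightarrow> i = j"
    by blast
  then show ?goal
  proof cases
    case mix
    have pi: "p i \<in> {1..n}" using permutes_in_image[OF p, of i] mix(1) by simp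
    have e: "?cj (flip_at i) = flip_at (p i)"
      unfolding g(1) by (rule conj_flip_at[OF g(2) mix(1)])
    have "?cj (flip_at i) \<in> ?C" "chi n side (flip_at i) \<noteq> chi_sign n side (?cj (flip_at i))"
      unfolding e using mix flip_at_stab[OF pi] chi_flip_at[OF pi] chi_flip_at[OF mix(1)]
      by (auto simp: chi_sign_def flip_at_def)
    then show ?thesis using flip_at_stab[OF mix(1)] by blast
  next
    case clash
    define a b where "a = inv_into UNIV p i" and "b = inv_into UNIV p j"
    have pab: "p a = i" "p b = j" by (simp_all add: a_def b_def permutes_inverses[OF p])
    have ab: "a \<in> {1..n}" "b \<in> {1..n}"
      using permutes_in_image[OF permutes_inv[OF p]] clash(2,3) by (auto simp: a_def b_def)
    have "side a = side i" "side b = side j"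
      using clash(1) ab pab by metis+
    then have sab: "side a = side b" "rw a = rw b" "a \<noteq> b"
      using clash(4,6,7) pab by (auto simp: a_def b_def)
    let ?t = "Transposition.transpose a b" and ?u = "Transposition.transpose i j"
    let ?r = "(\<lambda>_. 1, ?t) :: signed_perm"
    have t: "?t permutes {1..n}" using ab by (rule permutes_swap_id)
    have r: "?r \<in> ?R"
      using sab perm_carrier[OF t] by (auto simp: stab_def Transposition.transpose_def)
    have side_t: "\<forall>l\<in>{1..n}. side (?t l) = side l" using sab by (auto simp: Transposition.transpose_def)
    have "p \<circ> ?t \<circ> inv_into UNIV p = ?u"
    proof
      fix l
      have "p (inv_into UNIV p l) = l" by (rule permutes_inverses(1)[OF p])
      then show "(p \<circ> ?t \<circ> inv_into UNIV p) l = ?u l"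
        using pab permutes_inv_eq[OF p] by (auto simp: Transposition.transpose_def)
    qed
    then have snd: "snd (?cj ?r) = ?u"
      by (simp add: g(1) inv_hyperoct[OF g(2)] hyperoct_simps)
    have "?cj ?r \<in> carrier (hyperoct n)"
      using g perm_carrier[OF t] group.inv_closed[OF group_hyperoct] monoid.m_closed[OF group.is_monoid[OF group_hyperoct]] by metis
    then have C: "?cj ?r \<in> ?C"
      using snd clash(4,5) by (cases "?cj ?r") (auto simp: stab_def Transposition.transpose_def)
    have "chi n side (?cj ?r) = 1"
      unfolding g(1) by (rule chi_conj[OF g(2) clash(1) t side_t])
    then have "chi_sign n side (?cj ?r) = -1"
      using clash(7) by (simp add: chi_sign_def snd sign_swap_id)
    then show ?thesis using r C by (intro disjI2 bexI[of _ ?r]) simp_all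
  next
    case good
    obtain \<sigma> where \<sigma>: "\<sigma> permutes {1..n}"
      "\<And>i. i \<in> {1..n} \<Longrightarrow> side (\<sigma> i) = side i \<and> cl (\<sigma> i) = cl i \<and> rw (\<sigma> i) = rw (inv_into UNIV p i)"
      using labelling_column_perm[OF L p good] by blast
    let ?c = "(s, inv_into UNIV \<sigma>)" and ?r = "(\<lambda>_. 1, \<sigma> \<circ> p) :: signed_perm"
    have "side (inv_into UNIV \<sigma> i) = side i \<and> cl (inv_into UNIV \<sigma> i) = cl i" if i: "i \<in> {1..n}" for i
      using \<sigma>(2)[of "inv_into UNIV \<sigma> i"] permutes_in_image[OF permutes_inv[OF \<sigma>(1)], of i] i
      by (simp add: permutes_inverses(1)[OF \<sigma>(1)])
    then have "?c \<in> ?C"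
      using g(2) permutes_inv[OF \<sigma>(1)] by (simp add: stab_def hyperoct_simps)
    moreover have "side (\<sigma> (p i)) = side i \<and> rw (\<sigma> (p i)) = rw i" if i: "i \<in> {1..n}" for i
      using \<sigma>(2)[of "p i"] good(1) permutes_in_image[OF p, of i] i
      by (simp add: permutes_inverses(2)[OF p])
    then have "?r \<in> ?R"
      using perm_carrier[OF permutes_compose[OF p \<sigma>(1)]] by (simp add: stab_def)
    moreover have "g = ?c \<otimes>\<^bsub>hyperoct n\<^esub> ?r"
      by (simp add: g(1) hyperoct_simps permutes_inv_o(2)[OF \<sigma>(1)] flip: comp_assoc)
    ultimately show ?thesis by blast
  qed
qed

section \<open>Block permutations\<close>

definition bl :: "nat \<Rightarrow> (nat \<Rightarrow> nat) \<Rightarrow> (nat \<Rightarrow> nat) \<Rightarrow> nat \<Rightarrow> nat" where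
  "bl k x y = (\<lambda>i. if i \<le> k then x i else y (i - k) + k)"

lemma permutes_le: "x permutes {1..k} \<Longrightarrow> x i \<le> k \<longleftrightarrow> i \<le> k" for x :: "nat \<Rightarrow> nat"
  using permutes_in_image[of x "{1..k}" i] permutes_not_in[of x "{1..k}" i]
  by (cases "i \<in> {1..k}") auto

lemma permutes_pos: "y permutes {1..m} \<Longrightarrow> 0 < j \<Longrightarrow> 0 < y j" for y :: "nat \<Rightarrow> nat"
  using permutes_in_image[of y "{1..m}" j] permutes_not_in[of y "{1..m}" j]
  by (cases "j \<in> {1..m}") auto

lemma bl_le: "x permutes {1..k} \<Longrightarrow> y permutes {1..m} \<Longrightarrow> bl k x y i \<le> k \<longleftrightarrow> i \<le> k"
  using permutes_le[of x k i] permutes_pos[of y m "i - k"] by (auto simp: bl_def)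

lemma bl_comp:
  assumes "x permutes {1..k}" "y permutes {1..m}"
  shows "bl k x' y' \<circ> bl k x y = bl k (x' \<circ> x) (y' \<circ> y)"
proof
  fix i
  show "(bl k x' y' \<circ> bl k x y) i = bl k (x' \<circ> x) (y' \<circ> y) i"
    using bl_le[OF assms, of i] by (auto simp: bl_def)
qed

lemma bl_id [simp]: "bl k id id = id"
  by (auto simp: bl_def)

lemma bl_inverse:
  assumes "x permutes {1..k}" "y permutes {1..m}"
  shows "bl k x y \<circ> bl k (inv_into UNIV x) (inv_into UNIV y) = id"
    "bl k (inv_into UNIV x) (inv_into UNIV y) \<circ> bl k x y = id"
  using bl_comp[OF assms] bl_comp[OF permutes_inv[OF assms(1)] permutes_inv[OF assms(2)]]
  by (simp_all add: permutes_inv_o[OF assms(1)] permutes_inv_o[OF assms(2)])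

lemma bl_permutes:
  assumes x: "x permutes {1..k}" and y: "y permutes {1..m}"
  shows "bl k x y permutes {1..k + m}"
proof -
  have "bij (bl k x y)" by (rule o_bij[OF bl_inverse(2)[OF assms] bl_inverse(1)[OF assms]])
  moreover have "bl k x y i = i" if "i \<notin> {1..k + m}" for i
  proof (cases "i \<le> k")
    case True
    then show ?thesis using that permutes_not_in[OF x, of i] by (auto simp: bl_def)
  next
    case False
    then have "i - k \<notin> {1..m}" using that by auto
    from permutes_not_in[OF y this] show ?thesis using False by (simp add: bl_def)
  qed
  ultimately show ?thesis by (simp add: permutes_def bij_iff)
qed

lemma inv_bl:
  assumes "x permutes {1..k}" "y permutes {1..m}"
  shows "inv_into UNIV (bl k x y) = bl k (inv_into UNIV x) (inv_into UNIV y)"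
  by (rule inv_unique_comp[OF bl_inverse[OF assms]])

lemma bl_inj:
  assumes "x permutes {1..k}" "y permutes {1..m}" "x' permutes {1..k}" "y' permutes {1..m}"
    and e: "bl k x y = bl k x' y'"
  shows "x = x'" "y = y'"
proof -
  show "x = x'"
  proof
    fix i show "x i = x' i"
      using fun_cong[OF e, of i] permutes_not_in[OF assms(1), of i] permutes_not_in[OF assms(3), of i]
      by (cases "i \<le> k") (auto simp: bl_def)
  qed
  show "y = y'"
  proof
    fix j show "y j = y' j"
      using fun_cong[OF e, of "j + k"] permutes_not_in[OF assms(2), of j] permutes_not_in[OF assms(4), of j]
      by (cases "j = 0") (auto simp: bl_def)
  qed
qed

lemma sign_bl:
  assumes x: "x permutes {1..k}" and y: "y permutes {1..m}"
  shows "sign (bl k x y) = sign x * sign y"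
proof -
  have id: "id permutes {1..k}" "id permutes {1..m}" by (simp_all add: permutes_id)
  have 1: "bl k x id = x"
  proof
    fix i show "bl k x id i = x i" using permutes_not_in[OF x, of i] by (auto simp: bl_def)
  qed
  have inj: "inj_on (\<lambda>j. j + k) {1..m}" by simp
  have 2: "bl k id y = map_permutation {1..m} (\<lambda>j. j + k) y"
  proof
    fix i
    show "bl k id y i = map_permutation {1..m} (\<lambda>j. j + k) y i"
    proof (cases "i \<in> (\<lambda>j. j + k) ` {1..m}")
      case True
      then obtain j where j: "j \<in> {1..m}" "i = j + k" by blast
      then show ?thesis using map_permutation_apply[OF inj j(1), of y] by (simp add: bl_def)
    next
      case False
      have "bl k id y i = i"
      proof (cases "i \<le> k")
        case nk: False
        then have "i - k \<notin> {1..m}" using False by (auto simp: image_iff dest: bspec[of _ _ "i - k"])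
        then show ?thesis using permutes_not_in[OF y] nk by (simp add: bl_def)
      qed (simp add: bl_def)
      then show ?thesis using False by (simp only: map_permutation_def restrict_id_def if_False)
    qed
  qed
  have "sign (bl k x y) = sign (bl k x id \<circ> bl k id y)"
    by (simp add: bl_comp[OF id(1) y])
  also have "\<dots> = sign (bl k x id) * sign (bl k id y)"
    using bl_permutes[OF x id(2)] bl_permutes[OF id(1) y]
    by (intro sign_compose) (auto intro: permutes_imp_permutation[of "{1..k + m}"])
  also have "\<dots> = sign x * sign y"
    unfolding 1 2 sign_map_permutation[OF inj y finite_atLeastAtMost] ..
  finally show ?thesis .
qed

lemma bl_cases:
  assumes p: "p permutes {1..k + m}" and side: "\<forall>i\<in>{1..k + m}. (k < p i) = (k < i)"
  obtains x y where "x permutes {1..k}" "y permutes {1..m}" "p = bl k x y"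
proof -
  have inj: "p i = p j \<longleftrightarrow> i = j" for i j using permutes_inj[OF p] by (auto simp: inj_def)
  have mem: "p i \<in> {1..k + m} \<longleftrightarrow> i \<in> {1..k + m}" for i by (rule permutes_in_image[OF p])
  define x where "x i = (if i \<in> {1..k} then p i else i)" for i
  define y where "y j = (if j \<in> {1..m} then p (j + k) - k else j)" for j
  have xr: "p i \<in> {1..k}" if "i \<in> {1..k}" for i
  proof -
    have "i \<in> {1..k + m}" using that by simp
    then have "p i \<in> {1..k + m}" "(k < p i) = (k < i)" using mem side by blast+
    then show ?thesis using that by simp
  qed
  have yr: "k < p (j + k) \<and> p (j + k) \<le> k + m" if "j \<in> {1..m}" for j
  proof -
    have "j + k \<in> {1..k + m}" using that by simp
    then have "p (j + k) \<in> {1..k + m}" "(k < p (j + k)) = (k < j + k)" using mem side by blast+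
    then show ?thesis using that by simp
  qed
  have "inj_on x {1..k}" by (auto simp: inj_on_def x_def inj)
  moreover have "x ` {1..k} \<subseteq> {1..k}" using xr by (auto simp: x_def)
  ultimately have "bij_betw x {1..k} {1..k}" by (simp add: bij_betw_def endo_inj_surj)
  then have xp: "x permutes {1..k}" by (rule bij_imp_permutes) (auto simp: x_def)
  have "inj_on y {1..m}"
  proof (rule inj_onI)
    fix i j assume "i \<in> {1..m}" "j \<in> {1..m}" "y i = y j"
    moreover from this have "p (i + k) - k = p (j + k) - k" by (simp add: y_def)
    ultimately have "p (i + k) = p (j + k)" using yr[of i] yr[of j] by linarith
    then show "i = j" by (simp add: inj)
  qed
  moreover have "y ` {1..m} \<subseteq> {1..m}" using yr by (fastforce simp: y_def)
  ultimately have "bij_betw y {1..m} {1..m}" by (simp add: bij_betw_def endo_inj_surj)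
  then have yp: "y permutes {1..m}" by (rule bij_imp_permutes) (auto simp: y_def)
  have "p i = bl k x y i" for i
  proof (cases "i \<in> {1..k + m}")
    case True
    then show ?thesis using yr[of "i - k"] by (auto simp: bl_def x_def y_def)
  next
    case False
    then show ?thesis using permutes_not_in[OF p False] by (auto simp: bl_def x_def y_def)
  qed
  then show thesis using that[OF xp yp] by blast
qed

section \<open>The product of the weighted sums in terms of Young symmetrizers\<close>

definition fix_perms :: "nat \<Rightarrow> (nat \<Rightarrow> nat) \<Rightarrow> (nat \<Rightarrow> nat) set" where
  "fix_perms k f = {x. x permutes {1..k} \<and> (\<forall>i\<in>{1..k}. f (x i) = f i)}"

definition signed_term :: "nat \<Rightarrow> (nat \<Rightarrow> nat) \<Rightarrow> (nat \<Rightarrow> nat) \<Rightarrow> rat" where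
  "signed_term k f x = (if x \<in> fix_perms k f then of_int (sign x) else 0)"

text \<open>
  The coefficient of \<open>w\<close> in the product of the row sum and the signed column sum of a tableau.
\<close>

definition row_col :: "nat \<Rightarrow> (nat \<Rightarrow> nat) \<Rightarrow> (nat \<Rightarrow> nat) \<Rightarrow> (nat \<Rightarrow> nat) \<Rightarrow> rat" where
  "row_col k f g p = (\<Sum>x\<in>fix_perms k f. signed_term k g (inv_into UNIV x \<circ> p))"

lemma young_symmetrizer_eq:
  assumes "k = sum_list l"
  shows "young_symmetrizer l p = (if p permutes {1..k} then row_col k (tableau_row l) (tableau_col l) p else 0)"
proof (cases "p permutes {1..k}")
  case True
  have "young_symmetrizer l p = (\<Sum>x\<in>{x. x permutes {1..k}}. row_sum l x * col_signed_sum l (inv_into UNIV x \<circ> p))"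
  proof -
    have car: "carrier (sym_group k) = {x. x permutes {1..k}}" by (simp add: sym_group_def)
    have "(\<Sum>x\<in>carrier (sym_group k). row_sum l x * col_signed_sum l (inv\<^bsub>sym_group k\<^esub> x \<circ> p)) =
      (\<Sum>x\<in>{x. x permutes {1..k}}. row_sum l x * col_signed_sum l (inv_into UNIV x \<circ> p))"
      unfolding car by (intro sum.cong refl) (simp add: sym_group_inv_equality[unfolded sym_group_carrier])
    then show ?thesis
      using True by (simp add: young_symmetrizer_def conv_def sym_group_mult sym_group_carrier flip: assms)
  qed
  also have "\<dots> = (\<Sum>x\<in>fix_perms k (tableau_row l). signed_term k (tableau_col l) (inv_into UNIV x \<circ> p))"
    by (rule sum.mono_neutral_cong_right)
      (auto simp: fix_perms_def finite_permutations row_sum_def col_signed_sum_def signed_term_def assms)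
  finally show ?thesis using True by (simp add: row_col_def)
next
  case False
  then show ?thesis using assms by (simp add: young_symmetrizer_def conv_def sym_group_def)
qed

definition sign_vectors :: "nat \<Rightarrow> (nat \<Rightarrow> int) set" where
  "sign_vectors n = {s. (\<forall>i\<in>{1..n}. s i \<in> {1, -1}) \<and> (\<forall>i. i \<notin> {1..n} \<longrightarrow> s i = 1)}"

lemma hyperoct_carrier_eq: "carrier (hyperoct n) = sign_vectors n \<times> {p. p permutes {1..n}}"
  by (auto simp: hyperoct_def sign_vectors_def)

lemma finite_sign_vectors: "finite (sign_vectors n)"
proof -
  have "finite (sign_vectors n \<times> {p. p permutes {1..n}})"
    using finite_hyperoct[of n] by (simp add: hyperoct_carrier_eq)
  then show ?thesis using finite_cartesian_productD1 permutes_id by blast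
qed

lemma card_sign_vectors: "card (sign_vectors n) \<noteq> 0"
proof -
  have "(\<lambda>_. 1) \<in> sign_vectors n" by (simp add: sign_vectors_def)
  then show ?thesis using finite_sign_vectors by auto
qed

text \<open>
  A pair of fillings, of the numbers \<open>1..k\<close> and \<open>k + 1..k + m\<close>. The row and column groups split as
  products of the groups of the two fillings, together with all sign changes.
\<close>

locale two_blocks =
  fixes k m n :: nat and rk rm ck cm :: "nat \<Rightarrow> nat" and side rw cl
  assumes n: "n = k + m"
    and side: "side = (\<lambda>i. k < i)"
    and rw: "rw = (\<lambda>i. if i \<le> k then rk i else rm (i - k))"
    and cl: "cl = (\<lambda>i. if i \<le> k then ck i else cm (i - k))"
begin

abbreviation "W \<equiv> hyperoct n"
abbreviation "R \<equiv> stab n side rw"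
abbreviation "C \<equiv> stab n side cl"

lemma bl_preserves_iff:
  assumes "x permutes {1..k}" "y permutes {1..m}"
  shows "(\<forall>i\<in>{1..n}. side (bl k x y i) = side i \<and>
      (if bl k x y i \<le> k then f (bl k x y i) else h (bl k x y i - k)) = (if i \<le> k then f i else h (i - k)))
    \<longleftrightarrow> x \<in> fix_perms k f \<and> y \<in> fix_perms m h"
proof -
  have s: "side (bl k x y i) = side i" for i using bl_le[OF assms, of i] by (auto simp: side)
  have "(\<forall>i\<in>{1..n}. (if bl k x y i \<le> k then f (bl k x y i) else h (bl k x y i - k)) = (if i \<le> k then f i else h (i - k)))
    \<longleftrightarrow> (\<forall>i\<in>{1..k}. f (x i) = f i) \<and> (\<forall>j\<in>{1..m}. h (y j) = h j)" (is "?L \<longleftrightarrow> ?Q")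
  proof
    assume L: ?L
    show ?Q
    proof (intro conjI ballI)
      fix i assume "i \<in> {1..k}"
      then show "f (x i) = f i" using bspec[OF L, of i] bl_le[OF assms, of i] by (simp add: bl_def n)
    next
      fix j assume "j \<in> {1..m}"
      then show "h (y j) = h j" using bspec[OF L, of "j + k"] bl_le[OF assms, of "j + k"] by (simp add: bl_def n)
    qed
  next
    assume ?Q
    show ?L
    proof
      fix i assume "i \<in> {1..n}"
      then have "i \<le> k \<Longrightarrow> i \<in> {1..k}" "\<not> i \<le> k \<Longrightarrow> i - k \<in> {1..m}" by (auto simp: n)
      then show "(if bl k x y i \<le> k then f (bl k x y i) else h (bl k x y i - k)) = (if i \<le> k then f i else h (i - k))"
        using \<open>?Q\<close> bl_le[OF assms, of i] by (cases "i \<le> k") (simp_all add: bl_def)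
    qed
  qed
  then show ?thesis using assms s by (simp add: fix_perms_def)
qed

lemma mem_R: "x permutes {1..k} \<Longrightarrow> y permutes {1..m} \<Longrightarrow> t \<in> sign_vectors n \<Longrightarrow>
    (t, bl k x y) \<in> R \<longleftrightarrow> x \<in> fix_perms k rk \<and> y \<in> fix_perms m rm"
  using bl_permutes[of x k y m] bl_preserves_iff[of x y rk rm]
  by (simp add: stab_def hyperoct_carrier_eq rw n)

lemma mem_C: "x permutes {1..k} \<Longrightarrow> y permutes {1..m} \<Longrightarrow> t \<in> sign_vectors n \<Longrightarrow>
    (t, bl k x y) \<in> C \<longleftrightarrow> x \<in> fix_perms k ck \<and> y \<in> fix_perms m cm"
  using bl_permutes[of x k y m] bl_preserves_iff[of x y ck cm]
  by (simp add: stab_def hyperoct_carrier_eq cl n)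

lemma R_eq: "R = (\<lambda>(t, x, y). (t, bl k x y)) ` (sign_vectors n \<times> fix_perms k rk \<times> fix_perms m rm)"
proof
  show "R \<subseteq> (\<lambda>(t, x, y). (t, bl k x y)) ` (sign_vectors n \<times> fix_perms k rk \<times> fix_perms m rm)"
  proof
    fix g assume g: "g \<in> R"
    obtain t p where tp: "g = (t, p)" by (cases g)
    have t: "t \<in> sign_vectors n" "p permutes {1..k + m}" "\<forall>i\<in>{1..k + m}. (k < p i) = (k < i)"
      using g by (auto simp: tp stab_def hyperoct_carrier_eq n side)
    obtain x y where xy: "x permutes {1..k}" "y permutes {1..m}" "p = bl k x y"
      by (rule bl_cases[OF t(2,3)])
    then have "x \<in> fix_perms k rk" "y \<in> fix_perms m rm" using mem_R[OF xy(1,2) t(1)] g tp by auto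
    then show "g \<in> (\<lambda>(t, x, y). (t, bl k x y)) ` (sign_vectors n \<times> fix_perms k rk \<times> fix_perms m rm)"
      using tp xy t(1) by (intro image_eqI[of _ _ "(t, x, y)"]) auto
  qed
qed (auto simp: mem_R fix_perms_def)

text \<open>
  The generator \<open>A B\<close> of the left ideal. On block permutations it is the product of the two Young
  symmetrizers, up to a factor from the signs, and it vanishes on permutations that mix the
  blocks.
\<close>

definition v0 :: "signed_perm \<Rightarrow> rat" where
  "v0 = wsum W (reg_act W) R (chi n side) (wsum W (reg_act W) C (chi_sign n side) (delta \<one>\<^bsub>W\<^esub>))"

lemma v0_eq_sum:
  assumes g: "g \<in> carrier W"
  shows "v0 g = (\<Sum>r\<in>R. chi n side r * (if inv\<^bsub>W\<^esub> r \<otimes>\<^bsub>W\<^esub> g \<in> C then chi_sign n side (inv\<^bsub>W\<^esub> r \<otimes>\<^bsub>W\<^esub> g) else 0))"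
proof -
  interpret W: group W by (rule group_hyperoct)
  interpret R: sign_char W R "chi n side" by (rule sign_char_chi)
  interpret C: sign_char W C "chi_sign n side" by (rule sign_char_chi_sign)
  have finC: "finite C" by (rule finite_subset[OF subgroup.subset[OF C.sub] finite_hyperoct])
  have C: "wsum W (reg_act W) C (chi_sign n side) (delta \<one>\<^bsub>W\<^esub>) x = (if x \<in> C then chi_sign n side x else 0)"
    if x: "x \<in> carrier W" for x
  proof -
    have "wsum W (reg_act W) C (chi_sign n side) (delta \<one>\<^bsub>W\<^esub>) x =
      (\<Sum>c\<in>C. chi_sign n side c * (if inv\<^bsub>W\<^esub> c \<otimes>\<^bsub>W\<^esub> x = \<one>\<^bsub>W\<^esub> then 1 else 0))"
      using x by (simp add: wsum_def sum_fun_apply pointwise pact_def reg_act_def delta_def)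
    also have "\<dots> = (\<Sum>c\<in>C. if c = x then chi_sign n side c else 0)"
    proof (intro sum.cong refl)
      fix c assume "c \<in> C"
      then have "inv\<^bsub>W\<^esub> c \<otimes>\<^bsub>W\<^esub> x = \<one>\<^bsub>W\<^esub> \<longleftrightarrow> c = x"
        using x C.mem_carrier W.inv_solve_left'[of "\<one>\<^bsub>W\<^esub>" c x] by auto
      then show "chi_sign n side c * (if inv\<^bsub>W\<^esub> c \<otimes>\<^bsub>W\<^esub> x = \<one>\<^bsub>W\<^esub> then 1 else 0) = (if c = x then chi_sign n side c else 0)"
        by simp
    qed
    also have "\<dots> = (if x \<in> C then chi_sign n side x else 0)" using finC by simp
    finally show ?thesis .
  qed
  show ?thesis
    unfolding v0_def
    by (subst wsum_def, simp add: sum_fun_apply pointwise pact_def reg_act_def g)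
      (intro sum.cong refl, simp add: C R.mem_carrier g)
qed

lemma v0_outside: "g \<notin> carrier W \<Longrightarrow> v0 g = 0"
proof -
  assume g: "g \<notin> carrier W"
  have "\<one>\<^bsub>W\<^esub> \<in> carrier W" using group_hyperoct by (rule monoid.one_closed[OF group.is_monoid])
  then have "g \<noteq> \<one>\<^bsub>W\<^esub>" using g by blast
  then have "delta \<one>\<^bsub>W\<^esub> g = 0" by (simp only: delta_def if_False)
  moreover have "pact W (reg_act W) r f g = f g" for r f using g by (simp add: pact_def reg_act_def)
  ultimately show ?thesis by (simp add: v0_def wsum_def sum_fun_apply pointwise)
qed

lemma v0_not_side:
  assumes g: "(s, p) \<in> carrier W" and ns: "\<not> (\<forall>i\<in>{1..n}. side (p i) = side i)"
  shows "v0 (s, p) = 0"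
proof -
  interpret W: group W by (rule group_hyperoct)
  interpret B: sign_char W "stab n side (\<lambda>_. 0)" "chi n side" by (rule sign_char_chi)
  have "inv\<^bsub>W\<^esub> r \<otimes>\<^bsub>W\<^esub> (s, p) \<notin> C" if r: "r \<in> R" for r
  proof
    assume "inv\<^bsub>W\<^esub> r \<otimes>\<^bsub>W\<^esub> (s, p) \<in> C"
    moreover have "C \<subseteq> stab n side (\<lambda>_. 0)" "R \<subseteq> stab n side (\<lambda>_. 0)"
      by (auto simp: stab_def)
    ultimately have "inv\<^bsub>W\<^esub> r \<otimes>\<^bsub>W\<^esub> (s, p) \<in> stab n side (\<lambda>_. 0)" "r \<in> stab n side (\<lambda>_. 0)"
      using r by blast+
    then have "r \<otimes>\<^bsub>W\<^esub> (inv\<^bsub>W\<^esub> r \<otimes>\<^bsub>W\<^esub> (s, p)) \<in> stab n side (\<lambda>_. 0)" by (rule B.mult_mem[rotated])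
    moreover have "r \<in> carrier W" using r by (auto simp: stab_def)
    ultimately have "(s, p) \<in> stab n side (\<lambda>_. 0)" using g by (simp flip: W.m_assoc)
    then show False using ns by (auto simp: stab_def)
  qed
  then show ?thesis by (simp add: v0_eq_sum[OF g])
qed

lemma v0_block:
  assumes s: "s \<in> sign_vectors n" and x: "x permutes {1..k}" and y: "y permutes {1..m}"
  shows "v0 (s, bl k x y) = of_nat (card (sign_vectors n)) * chi n side (s, bl k x y) *
    (row_col k rk ck x * row_col m rm cm y)"
proof -
  interpret W: group W by (rule group_hyperoct)
  interpret R: sign_char W R "chi n side" by (rule sign_char_chi)
  let ?p = "bl k x y" and ?A = "fix_perms k rk" and ?A' = "fix_perms m rm"
  let ?X = "chi n side (s, ?p)"
  have g: "(s, ?p) \<in> carrier W" using s bl_permutes[OF x y] by (simp add: hyperoct_carrier_eq n)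
  have summand: "chi n side r * (if inv\<^bsub>W\<^esub> r \<otimes>\<^bsub>W\<^esub> (s, ?p) \<in> C then chi_sign n side (inv\<^bsub>W\<^esub> r \<otimes>\<^bsub>W\<^esub> (s, ?p)) else 0) =
      ?X * (signed_term k ck (inv_into UNIV x' \<circ> x) * signed_term m cm (inv_into UNIV y' \<circ> y))"
    if r: "r = (t, bl k x' y')" "t \<in> sign_vectors n" "x' \<in> ?A" "y' \<in> ?A'" for r t x' y'
  proof -
    have x': "x' permutes {1..k}" and y': "y' permutes {1..m}" using r by (auto simp: fix_perms_def)
    have rR: "r \<in> R" using r mem_R[OF x' y' r(2)] by simp
    have ix: "inv_into UNIV x' permutes {1..k}" "inv_into UNIV y' permutes {1..m}"
      using permutes_inv x' y' by blast+
    let ?x = "inv_into UNIV x' \<circ> x" and ?y = "inv_into UNIV y' \<circ> y"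
    have xy: "?x permutes {1..k}" "?y permutes {1..m}" using permutes_compose x y ix by blast+
    have irg: "inv\<^bsub>W\<^esub> r \<otimes>\<^bsub>W\<^esub> (s, ?p) \<in> carrier W" using R.mem_carrier[OF rR] g by simp
    obtain u where u: "inv\<^bsub>W\<^esub> r \<otimes>\<^bsub>W\<^esub> (s, ?p) = (u, bl k ?x ?y)"
      using R.mem_carrier[OF rR] by (simp add: r(1) inv_hyperoct hyperoct_simps(2) inv_bl[OF x' y'] bl_comp[OF x y])
    then have us: "u \<in> sign_vectors n" using irg by (simp add: hyperoct_carrier_eq)
    have ir: "inv\<^bsub>W\<^esub> r \<in> R" by (rule R.inv_mem[OF rR])
    obtain a b where ab: "inv\<^bsub>W\<^esub> r = (a, b)" by (cases "inv\<^bsub>W\<^esub> r")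
    have "chi n side (inv\<^bsub>W\<^esub> r \<otimes>\<^bsub>W\<^esub> (s, ?p)) = chi n side (inv\<^bsub>W\<^esub> r) * ?X"
      using ir unfolding ab by (intro chi_mult) (auto simp: stab_def)
    then have cu: "chi n side r * chi n side (u, bl k ?x ?y) = ?X"
      using R.char_inv[OF rR] R.sq[OF rR] by (simp add: u flip: mult.assoc)
    show ?thesis
      unfolding u mem_C[OF xy us] signed_term_def chi_sign_def
      using cu by (simp add: sign_bl[OF xy])
  qed
  have inj: "inj_on (\<lambda>(t, x, y). (t, bl k x y)) (sign_vectors n \<times> ?A \<times> ?A')"
  proof (rule inj_onI)
    fix a b assume ab: "a \<in> sign_vectors n \<times> ?A \<times> ?A'" "b \<in> sign_vectors n \<times> ?A \<times> ?A'"
      and e: "(\<lambda>(t, x, y). (t, bl k x y)) a = (\<lambda>(t, x, y). (t, bl k x y)) b"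
    obtain t u v t' u' v' where [simp]: "a = (t, u, v)" "b = (t', u', v')" by (cases a, cases b) auto
    have "u permutes {1..k}" "v permutes {1..m}" "u' permutes {1..k}" "v' permutes {1..m}"
      using ab by (auto simp: fix_perms_def)
    from bl_inj[OF this] show "a = b" using e by auto
  qed
  have "v0 (s, ?p) = (\<Sum>a\<in>sign_vectors n \<times> ?A \<times> ?A'. case a of (t, x', y') \<Rightarrow>
      ?X * (signed_term k ck (inv_into UNIV x' \<circ> x) * signed_term m cm (inv_into UNIV y' \<circ> y)))"
    unfolding v0_eq_sum[OF g]
    by (subst R_eq, subst sum.reindex[OF inj]) (intro sum.cong refl, clarify, simp only: comp_apply prod.case, rule summand[OF refl]; simp)
  also have "\<dots> = (\<Sum>t\<in>sign_vectors n. \<Sum>x'\<in>?A. \<Sum>y'\<in>?A'.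
      ?X * (signed_term k ck (inv_into UNIV x' \<circ> x) * signed_term m cm (inv_into UNIV y' \<circ> y)))"
    by (simp only: sum.cartesian_product)
  also have "\<dots> = of_nat (card (sign_vectors n)) * ?X * (row_col k rk ck x * row_col m rm cm y)"
    unfolding row_col_def sum_product by (simp add: mult.assoc flip: sum_distrib_left)
  finally show ?thesis .
qed

end

section \<open>Induced irreducible representations as left ideals\<close>

definition chi_vec :: "nat \<Rightarrow> (nat \<Rightarrow> bool) \<Rightarrow> (nat \<Rightarrow> int) \<Rightarrow> rat" where
  "chi_vec n side s = (\<Prod>i\<in>{i\<in>{1..n}. side i}. of_int (s i))"

lemma chi_pair: "chi n side (s, p) = chi_vec n side s"
  by (simp add: chi_def chi_vec_def)

text \<open>
  The pair of standard fillings of the shapes \<open>lp\<close> and \<open>lm\<close>, as they occur in the definition of the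
  irreducible representations.
\<close>

locale irrep_blocks =
  two_blocks k m n "tableau_row lp" "tableau_row lm" "tableau_col lp" "tableau_col lm" side rw cl
  for k m n :: nat and lp lm :: "nat list" and side rw cl +
  assumes k: "k = sum_list lp" and m: "m = sum_list lm"
    and pair: "char_pair (hyperoct n) (stab n side rw) (chi n side) (stab n side cl) (chi_sign n side)"
begin

abbreviation "per x y \<equiv> x permutes {1..k} \<and> y permutes {1..m}"
abbreviation "pt x y \<equiv> ((\<lambda>_. 1, bl k x y) :: signed_perm)"
abbreviation "HH \<equiv> hyperoct k \<times>\<times> hyperoct m"
abbreviation "M \<equiv> ext_tensor (hyperoct_plus lp) (hyperoct_minus lm)"
abbreviation "PW \<equiv> pact W (reg_act W)"
abbreviation "N \<equiv> rat_of_nat (card (sign_vectors n))"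

sublocale W: group W by (rule group_hyperoct)
sublocale a: char_pair_action W R "chi n side" C "chi_sign n side" "reg_act W"
  by (rule char_pair.char_pair_actionI[OF pair char_pair.finite_action_reg[OF pair]])

lemma bl_comp': "per x y \<Longrightarrow> bl k x' y' \<circ> bl k x y = bl k (x' \<circ> x) (y' \<circ> y)"
  using bl_comp[of x k y m] by blast

lemma carrier_plus:
  "carrier (hyperoct_plus l) = {conv (sym_group (sum_list l)) b (young_symmetrizer l) | b. True}"
  by (simp add: hyperoct_plus_def pullback_rep_def change_act_def sym_irrep_def Let_def)

lemma carrier_minus: "carrier (hyperoct_minus l) = carrier (hyperoct_plus l)"
  by (simp add: hyperoct_minus_def twist_rep_def change_act_def)

lemma conv_sym:
  "conv (sym_group l) b c x = (if x permutes {1..l} then \<Sum>w\<in>{w. w permutes {1..l}}. b w * c (inv_into UNIV w \<circ> x) else 0)"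
proof -
  have car: "carrier (sym_group l) = {w. w permutes {1..l}}" by (simp add: sym_group_def)
  have "(\<Sum>w\<in>carrier (sym_group l). b w * c (inv\<^bsub>sym_group l\<^esub> w \<circ> x)) =
      (\<Sum>w\<in>{w. w permutes {1..l}}. b w * c (inv_into UNIV w \<circ> x))"
    unfolding car by (intro sum.cong refl) (simp add: sym_group_inv_equality[unfolded sym_group_carrier])
  then show ?thesis by (simp add: conv_def sym_group_mult sym_group_carrier)
qed

lemma plus_vanish: "u \<in> carrier (hyperoct_plus l) \<Longrightarrow> \<not> x permutes {1..sum_list l} \<Longrightarrow> u x = 0"
  by (auto simp: carrier_plus conv_sym)

lemma plus_translate:
  assumes w: "w permutes {1..sum_list l}"
  shows "(\<lambda>x. if x permutes {1..sum_list l} then c * young_symmetrizer l (w \<circ> x) else 0) \<in> carrier (hyperoct_plus l)"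
proof -
  let ?b = "\<lambda>z. if z = inv_into UNIV w then c else 0"
  have "conv (sym_group (sum_list l)) ?b (young_symmetrizer l) =
    (\<lambda>x. if x permutes {1..sum_list l} then c * young_symmetrizer l (w \<circ> x) else 0)"
  proof
    fix x
    have "(\<Sum>z\<in>{z. z permutes {1..sum_list l}}. ?b z * young_symmetrizer l (inv_into UNIV z \<circ> x)) =
      (\<Sum>z\<in>{z. z permutes {1..sum_list l}}. if z = inv_into UNIV w then c * young_symmetrizer l (w \<circ> x) else 0)"
      by (intro sum.cong refl) (simp add: permutes_inv_inv[OF w])
    also have "\<dots> = c * young_symmetrizer l (w \<circ> x)"
      using permutes_inv[OF w] by (simp add: finite_permutations)
    finally show "conv (sym_group (sum_list l)) ?b (young_symmetrizer l) x =
      (if x permutes {1..sum_list l} then c * young_symmetrizer l (w \<circ> x) else 0)"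
      by (simp only: conv_sym)
  qed
  then show ?thesis unfolding carrier_plus by (metis (mono_tags, lifting) mem_Collect_eq)
qed

lemma carrier_M:
  "carrier M = {(\<lambda>(x, y). \<Sum>i<r. u i x * v i y) | (r :: nat) u v.
     (\<forall>i<r. u i \<in> carrier (hyperoct_plus lp)) \<and> (\<forall>i<r. v i \<in> carrier (hyperoct_plus lm))}"
  by (simp add: ext_tensor_def carrier_minus)

lemma M_simps: "F \<oplus>\<^bsub>M\<^esub> F' = F + F'" "c \<odot>\<^bsub>M\<^esub> F = fscale c F"
  by (simp_all add: ext_tensor_def)

lemma carrier_MI:
  fixes r :: nat
  assumes "\<And>x y. F (x, y) = (\<Sum>i<r. u i x * v i y)"
    and "\<And>i. i < r \<Longrightarrow> u i \<in> carrier (hyperoct_plus lp)" "\<And>i. i < r \<Longrightarrow> v i \<in> carrier (hyperoct_plus lm)"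
  shows "F \<in> carrier M"
proof -
  have "F = (\<lambda>(x, y). \<Sum>i<r. u i x * v i y)" using assms(1) by (simp add: fun_eq_iff)
  then show ?thesis unfolding carrier_M using assms(2,3) by blast
qed

lemma carrier_ME:
  assumes "F \<in> carrier M"
  obtains r :: nat and u v where "\<And>x y. F (x, y) = (\<Sum>i<r. u i x * v i y)"
    "\<And>i. i < r \<Longrightarrow> u i \<in> carrier (hyperoct_plus lp)" "\<And>i. i < r \<Longrightarrow> v i \<in> carrier (hyperoct_plus lm)"
  using assms unfolding carrier_M by auto

lemma M_vanish: "F \<in> carrier M \<Longrightarrow> \<not> per x y \<Longrightarrow> F (x, y) = 0"
proof -
  assume F: "F \<in> carrier M" and xy: "\<not> per x y"
  obtain r :: nat and u v where 1: "\<And>x y. F (x, y) = (\<Sum>i<r. u i x * v i y)"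
    "\<And>i. i < r \<Longrightarrow> u i \<in> carrier (hyperoct_plus lp)" "\<And>i. i < r \<Longrightarrow> v i \<in> carrier (hyperoct_plus lm)"
    by (rule carrier_ME[OF F]) (rule that)
  have z: "u i x * v i y = 0" if "i < r" for i
    using plus_vanish[OF 1(2)[OF that], of x] plus_vanish[OF 1(3)[OF that], of y] xy k m by auto
  show ?thesis unfolding 1(1) by (rule sum.neutral, rule ballI, rule z, simp)
qed

lemma plus_scale: assumes "u \<in> carrier (hyperoct_plus l)" shows "fscale c u \<in> carrier (hyperoct_plus l)"
proof -
  obtain b where b: "u = conv (sym_group (sum_list l)) b (young_symmetrizer l)"
    using assms by (auto simp: carrier_plus)
  have "fscale c u = conv (sym_group (sum_list l)) (fscale c b) (young_symmetrizer l)"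
    by (rule ext) (simp add: b conv_sym pointwise sum_distrib_left mult.assoc)
  then show ?thesis unfolding carrier_plus by blast
qed

lemma subspace_M: "fs.subspace (carrier M)"
  unfolding fs.subspace_def
proof (intro conjI ballI allI)
  show "0 \<in> carrier M" by (rule carrier_MI[where r = 0]) (simp_all add: pointwise)
next
  fix F F' assume F: "F \<in> carrier M" and F': "F' \<in> carrier M"
  obtain r :: nat and u v where 1: "\<And>x y. F (x, y) = (\<Sum>i<r. u i x * v i y)"
    "\<And>i. i < r \<Longrightarrow> u i \<in> carrier (hyperoct_plus lp)" "\<And>i. i < r \<Longrightarrow> v i \<in> carrier (hyperoct_plus lm)"
    by (rule carrier_ME[OF F]) (rule that)
  obtain r' :: nat and u' v' where 2: "\<And>x y. F' (x, y) = (\<Sum>i<r'. u' i x * v' i y)"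
    "\<And>i. i < r' \<Longrightarrow> u' i \<in> carrier (hyperoct_plus lp)" "\<And>i. i < r' \<Longrightarrow> v' i \<in> carrier (hyperoct_plus lm)"
    by (rule carrier_ME[OF F']) (rule that)
  let ?u = "\<lambda>i. if i < r then u i else u' (i - r)" and ?v = "\<lambda>i. if i < r then v i else v' (i - r)"
  show "F + F' \<in> carrier M"
  proof (rule carrier_MI[where r = "r + r'" and u = ?u and v = ?v])
    fix x y
    have "(\<Sum>i<r + r'. ?u i x * ?v i y) = (\<Sum>i<r. ?u i x * ?v i y) + (\<Sum>i\<in>{r..<r + r'}. ?u i x * ?v i y)"
      by (subst lessThan_atLeast0, subst sum.atLeastLessThan_concat[symmetric, of 0 r "r + r'"])
        (auto simp: lessThan_atLeast0)
    also have "(\<Sum>i\<in>{r..<r + r'}. ?u i x * ?v i y) = (\<Sum>i<r'. u' i x * v' i y)"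
      by (rule sum.reindex_bij_witness[of _ "\<lambda>i. i + r" "\<lambda>i. i - r"]) auto
    finally show "(F + F') (x, y) = (\<Sum>i<r + r'. ?u i x * ?v i y)"
      by (simp add: pointwise 1(1) 2(1))
  qed (use 1 2 in auto)
next
  fix c F assume F: "F \<in> carrier M"
  obtain r :: nat and u v where 1: "\<And>x y. F (x, y) = (\<Sum>i<r. u i x * v i y)"
    "\<And>i. i < r \<Longrightarrow> u i \<in> carrier (hyperoct_plus lp)" "\<And>i. i < r \<Longrightarrow> v i \<in> carrier (hyperoct_plus lm)"
    by (rule carrier_ME[OF F]) (rule that)
  show "fscale c F \<in> carrier M"
    by (rule carrier_MI[where r = r and u = "\<lambda>i. fscale c (u i)" and v = v])
      (simp_all add: pointwise 1 plus_scale sum_distrib_left mult.assoc)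
qed

lemma act_M:
  assumes "per p1 p2"
  shows "act M ((s1, p1), (s2, p2)) F = (\<lambda>(x, y). nu m (s2, p2) *
    (if per x y then F (inv_into UNIV p1 \<circ> x, inv_into UNIV p2 \<circ> y) else 0))"
proof -
  have i: "inv\<^bsub>sym_group (sum_list lp)\<^esub> p1 = inv_into UNIV p1" "inv\<^bsub>sym_group (sum_list lm)\<^esub> p2 = inv_into UNIV p2"
    using assms k m by (simp_all add: sym_group_inv_equality[unfolded sym_group_carrier])
  show ?thesis
    by (rule ext)
      (simp add: ext_tensor_def hyperoct_minus_def hyperoct_plus_def twist_rep_def pullback_rep_def
        change_act_def sym_irrep_def Let_def fun_rep_def i sym_group_carrier sym_group_mult k m split: prod.split)
qed

definition join :: "(nat \<Rightarrow> int) \<Rightarrow> (nat \<Rightarrow> int) \<Rightarrow> nat \<Rightarrow> int" where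
  "join s1 s2 = (\<lambda>i. if i \<le> k then s1 i else s2 (i - k))"

lemma block_incl_eq: "block_incl k ((s1, p1), (s2, p2)) = (join s1 s2, bl k p1 p2)"
  by (simp add: block_incl_def join_def bl_def)

lemma join_sign:
  assumes "s1 \<in> sign_vectors k" "s2 \<in> sign_vectors m"
  shows "join s1 s2 \<in> sign_vectors n"
proof -
  have "join s1 s2 i \<in> {1, -1}" if "i \<in> {1..n}" for i
  proof (cases "i \<le> k")
    case True
    then show ?thesis using assms(1) that by (auto simp: sign_vectors_def join_def)
  next
    case False
    then have "i - k \<in> {1..m}" using that by (auto simp: n)
    then show ?thesis using assms(2) False by (auto simp: sign_vectors_def join_def)
  qed
  moreover have "join s1 s2 i = 1" if "i \<notin> {1..n}" for i
  proof (cases "i \<le> k")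
    case True
    then have "i \<notin> {1..k}" using that by (auto simp: n)
    then show ?thesis using assms(1) True by (simp add: sign_vectors_def join_def)
  next
    case False
    then have "i - k \<notin> {1..m}" using that by (auto simp: n)
    then show ?thesis using assms(2) False by (simp add: sign_vectors_def join_def)
  qed
  ultimately show ?thesis by (simp add: sign_vectors_def)
qed

lemma pt_carrier: "per x y \<Longrightarrow> pt x y \<in> carrier W"
  using bl_permutes[of x k y m] by (simp add: hyperoct_carrier_eq sign_vectors_def n)

lemma block_carrier: "h \<in> carrier HH \<Longrightarrow> block_incl k h \<in> carrier W"
  using bl_permutes[of "snd (fst h)" k "snd (snd h)" m] join_sign[of "fst (fst h)" "fst (snd h)"]
  by (cases h) (auto simp: block_incl_eq hyperoct_carrier_eq n)

lemma chi_join: "chi n side (join s1 s2, p) = nu m (s2, q)"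
proof -
  have "(\<Prod>i\<in>{i \<in> {1..n}. side i}. rat_of_int (join s1 s2 i)) = (\<Prod>j\<in>{1..m}. of_int (s2 j))"
    by (rule prod.reindex_bij_witness[of _ "\<lambda>j. j + k" "\<lambda>i. i - k"])
      (auto simp: n side join_def)
  then show ?thesis by (simp add: chi_def nu_def)
qed

lemma nu_inv:
  assumes "p permutes {1..m}"
  shows "nu m (\<lambda>i. s (p i), q) = nu m (s, q')"
  unfolding nu_def prod.case
  by (simp only: prod.reindex_bij_betw[OF permutes_imp_bij[OF assms], of s])

text \<open>
  An element of the group algebra, read on the coset of \<open>g\<close> as a function of pairs of permutations.
\<close>

definition sec :: "(signed_perm \<Rightarrow> rat) \<Rightarrow> signed_perm \<Rightarrow> (nat \<Rightarrow> nat) \<times> (nat \<Rightarrow> nat) \<Rightarrow> rat" where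
  "sec f g = (\<lambda>(x, y). if per x y then f (g \<otimes>\<^bsub>W\<^esub> pt x y) else 0)"

text \<open>
  The functions that transform under the sign changes of the block subgroup as an element of the
  induced representation does, and whose restriction to every coset lies in the inducing one. This
  space is invariant and contains the generator, so it contains the left ideal.
\<close>

definition good :: "(signed_perm \<Rightarrow> rat) set" where
  "good = {f. (\<forall>g. g \<notin> carrier W \<longrightarrow> f g = 0) \<and>
     (\<forall>g\<in>carrier W. \<forall>s1\<in>sign_vectors k. \<forall>s2\<in>sign_vectors m. \<forall>x y. per x y \<longrightarrow>
        f (g \<otimes>\<^bsub>W\<^esub> (join s1 s2, bl k x y)) = nu m (s2, id) * f (g \<otimes>\<^bsub>W\<^esub> pt x y)) \<and>
     (\<forall>g\<in>carrier W. sec f g \<in> carrier M)}"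

lemma good_outside: "f \<in> good \<Longrightarrow> g \<notin> carrier W \<Longrightarrow> f g = 0"
  unfolding good_def by blast

lemma sec_lin: "sec (f + f') g = sec f g + sec f' g" "sec (fscale c f) g = fscale c (sec f g)"
  "sec 0 g = 0"
  by (auto simp: sec_def pointwise fun_eq_iff)

lemma gsub_good: "gsub W PW good"
  unfolding gsub_def fs.subspace_def
proof (intro conjI ballI allI)
  note sM = subspace_M
  show "0 \<in> good" by (simp add: good_def sec_lin fs.subspace_0[OF sM]) (simp add: pointwise)
  show "f + f' \<in> good" if "f \<in> good" "f' \<in> good" for f f'
    using that unfolding good_def by (simp add: sec_lin fs.subspace_add[OF sM]) (simp add: pointwise distrib_left)
  show "fscale c f \<in> good" if "f \<in> good" for c f
    using that unfolding good_def by (simp add: sec_lin fs.subspace_scale[OF sM]) (simp add: pointwise)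
  fix g0 f assume g0: "g0 \<in> carrier W" and f: "f \<in> good"
  have e: "PW g0 f (g \<otimes>\<^bsub>W\<^esub> h) = f ((inv\<^bsub>W\<^esub> g0 \<otimes>\<^bsub>W\<^esub> g) \<otimes>\<^bsub>W\<^esub> h)"
    if "g \<in> carrier W" "h \<in> carrier W" for g h
    using that g0 by (simp add: pact_def reg_act_def W.m_assoc)
  have "sec (PW g0 f) g = sec f (inv\<^bsub>W\<^esub> g0 \<otimes>\<^bsub>W\<^esub> g)" if "g \<in> carrier W" for g
    by (rule ext) (auto simp: sec_def e[OF that] pt_carrier)
  moreover have "PW g0 f (g \<otimes>\<^bsub>W\<^esub> (join s1 s2, bl k x y)) = nu m (s2, id) * PW g0 f (g \<otimes>\<^bsub>W\<^esub> pt x y)"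
    if "g \<in> carrier W" "s1 \<in> sign_vectors k" "s2 \<in> sign_vectors m" "per x y" for g s1 s2 x y
  proof -
    have "(join s1 s2, bl k x y) \<in> carrier W"
      using that join_sign bl_permutes by (simp add: hyperoct_carrier_eq n)
    then show ?thesis using f that g0 by (simp add: e pt_carrier good_def)
  qed
  moreover have "PW g0 f g = 0" if "g \<notin> carrier W" for g
    using good_outside[OF f that] that by (simp only: pact_def reg_act_def if_False)
  ultimately show "PW g0 f \<in> good" using f g0 by (simp add: good_def)
qed

lemma v0_mult_pt:
  assumes g: "(t, w) \<in> carrier W" and xy: "per x y" and s: "s \<in> sign_vectors n"
  shows "v0 ((t, w) \<otimes>\<^bsub>W\<^esub> (s, bl k x y)) = (if \<forall>i\<in>{1..n}. side (w i) = side i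
    then chi n side (s, id) * v0 ((t, w) \<otimes>\<^bsub>W\<^esub> pt x y) else 0)"
proof -
  have wp: "w permutes {1..k + m}" using g by (simp add: hyperoct_carrier_eq n)
  have b: "(s, bl k x y) \<in> carrier W" using s bl_permutes[of x k y m] xy by (simp add: hyperoct_carrier_eq n)
  have c: "(t, w) \<otimes>\<^bsub>W\<^esub> (s, bl k x y) \<in> carrier W" "(t, w) \<otimes>\<^bsub>W\<^esub> pt x y \<in> carrier W"
    using g b pt_carrier[OF xy] by simp_all
  obtain u where u: "(t, w) \<otimes>\<^bsub>W\<^esub> (s, bl k x y) = (u, w \<circ> bl k x y)" by (simp add: hyperoct_simps)
  have u': "(t, w) \<otimes>\<^bsub>W\<^esub> pt x y = (t, w \<circ> bl k x y)" by (simp add: hyperoct_simps)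
  have uS: "u \<in> sign_vectors n" "t \<in> sign_vectors n"
    using c unfolding u u' by (simp_all add: hyperoct_carrier_eq)
  show ?thesis
  proof (cases "\<forall>i\<in>{1..n}. side (w i) = side i")
    case True
    then have "\<forall>i\<in>{1..k + m}. (k < w i) = (k < i)" by (simp add: side n)
    then obtain w1 w2 where w: "w1 permutes {1..k}" "w2 permutes {1..m}" "w = bl k w1 w2"
      by (rule bl_cases[OF wp])
    have w': "w \<circ> bl k x y = bl k (w1 \<circ> x) (w2 \<circ> y)" unfolding w(3) by (rule bl_comp'[OF xy])
    have p: "w1 \<circ> x permutes {1..k}" "w2 \<circ> y permutes {1..m}" using xy w permutes_compose by blast+
    have "chi n side (u, w \<circ> bl k x y) = chi n side (t, w) * chi n side (s, bl k x y)"
      unfolding u[symmetric] by (rule chi_mult[OF g True])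
    then have "chi n side (u, bl k (w1 \<circ> x) (w2 \<circ> y)) = chi n side (s, id) * chi n side (t, bl k (w1 \<circ> x) (w2 \<circ> y))"
      by (simp add: w' chi_pair mult.commute)
    then show ?thesis using True unfolding u u' w' v0_block[OF uS(1) p] v0_block[OF uS(2) p] by simp
  next
    case False
    then obtain i where i: "i \<in> {1..n}" "side (w i) \<noteq> side i" by blast
    have bp: "bl k x y permutes {1..n}" using bl_permutes xy n by simp
    let ?j = "inv_into UNIV (bl k x y) i"
    have bj: "bl k x y ?j = i" by (rule permutes_inverses(1)[OF bp])
    have j: "?j \<in> {1..n}" using permutes_in_image[OF permutes_inv[OF bp], of i] i(1) by blast
    have "side ?j = side i"
      using bl_le[of x k y m ?j] xy bj by (auto simp: side)
    then have "side ((w \<circ> bl k x y) ?j) \<noteq> side ?j" using i bj by simp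
    then have "\<not> (\<forall>i\<in>{1..n}. side ((w \<circ> bl k x y) i) = side i)" using j by blast
    then have "v0 (u, w \<circ> bl k x y) = 0" by (rule v0_not_side[OF c(1)[unfolded u]])
    then show ?thesis unfolding u using False by (simp only: if_False)
  qed
qed

lemma row_col_young:
  "x permutes {1..k} \<Longrightarrow> row_col k (tableau_row lp) (tableau_col lp) x = young_symmetrizer lp x"
  "y permutes {1..m} \<Longrightarrow> row_col m (tableau_row lm) (tableau_col lm) y = young_symmetrizer lm y"
  by (simp_all add: young_symmetrizer_eq[OF k] young_symmetrizer_eq[OF m])

lemma v0_good: "v0 \<in> good"
proof -
  have one: "(\<lambda>_. 1) \<in> sign_vectors n" by (simp add: sign_vectors_def)
  have "sec v0 g \<in> carrier M" if g: "g \<in> carrier W" for g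
  proof -
    obtain t w where tw: "g = (t, w)" by (cases g)
    have t: "t \<in> sign_vectors n" "w permutes {1..k + m}" using g by (auto simp: tw hyperoct_carrier_eq n)
    show ?thesis
    proof (cases "\<forall>i\<in>{1..n}. side (w i) = side i")
      case True
      then have "\<forall>i\<in>{1..k + m}. (k < w i) = (k < i)" by (simp add: side n)
      then obtain w1 w2 where w: "w1 permutes {1..k}" "w2 permutes {1..m}" "w = bl k w1 w2"
        by (rule bl_cases[OF t(2)])
      let ?c = "N * chi n side (t, id)"
      let ?u = "\<lambda>x. if x permutes {1..k} then ?c * young_symmetrizer lp (w1 \<circ> x) else 0"
      let ?v = "\<lambda>y. if y permutes {1..m} then 1 * young_symmetrizer lm (w2 \<circ> y) else 0"
      have "sec v0 g (x, y) = (\<Sum>i<Suc 0. ?u x * ?v y)" for x y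
      proof (cases "per x y")
        case True
        have p: "w1 \<circ> x permutes {1..k}" "w2 \<circ> y permutes {1..m}" using True w permutes_compose by blast+
        have "g \<otimes>\<^bsub>W\<^esub> pt x y = (t, bl k (w1 \<circ> x) (w2 \<circ> y))"
          unfolding tw w(3) using True by (simp add: hyperoct_simps bl_comp')
        then show ?thesis
          using True by (simp add: sec_def v0_block[OF t(1) p] row_col_young(1)[OF p(1)] row_col_young(2)[OF p(2)] chi_pair)
      qed (auto simp: sec_def)
      then show ?thesis
        by (rule carrier_MI[where u = "\<lambda>_. ?u" and v = "\<lambda>_. ?v"])
          (use plus_translate w k m in auto)
    next
      case False
      have "sec v0 g = 0"
      proof (rule ext, clarify)
        fix x y show "sec v0 g (x, y) = 0 (x, y)"
        proof (cases "per x y")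
          case True
          have "v0 (g \<otimes>\<^bsub>W\<^esub> pt x y) = 0"
            unfolding tw by (rule trans[OF v0_mult_pt[OF g[unfolded tw] True one] if_not_P[OF False]])
          then show ?thesis by (simp add: sec_def zero_fun_apply)
        qed (auto simp: sec_def zero_fun_apply)
      qed
      then show ?thesis using fs.subspace_0[OF subspace_M] by simp
    qed
  qed
  moreover have "v0 (g \<otimes>\<^bsub>W\<^esub> (join s1 s2, bl k x y)) = nu m (s2, id) * v0 (g \<otimes>\<^bsub>W\<^esub> pt x y)"
    if "g \<in> carrier W" "s1 \<in> sign_vectors k" "s2 \<in> sign_vectors m" "per x y" for g s1 s2 x y
  proof -
    obtain t w where tw: "g = (t, w)" by (cases g)
    have c: "chi n side (join s1 s2, id) = nu m (s2, id)" by (rule chi_join)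
    show ?thesis
      using v0_mult_pt[OF that(1)[unfolded tw] that(4) join_sign[OF that(2,3)]]
        v0_mult_pt[OF that(1)[unfolded tw] that(4) one]
      by (auto simp: tw c split: if_splits)
  qed
  ultimately show ?thesis by (simp add: good_def v0_outside)
qed

abbreviation "V \<equiv> pair_ideal W R (chi n side) C (chi_sign n side)"

lemma V_eq: "V = range (\<lambda>b. a.comb b v0)"
  by (simp add: pair_ideal_def v0_def)

lemma V_good: "V \<subseteq> good"
  using a.gsub_comb[OF gsub_good v0_good] by (auto simp: V_eq)

lemma gsub_V: "gsub W PW V"
  unfolding V_eq by (rule a.gsub_range_comb)

lemma v0_V: "v0 \<in> V"
  unfolding V_eq using a.self_eq_comb[of v0] by (metis rangeI)

abbreviation "Ind \<equiv> ind_rep W HH (block_incl k) M"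

lemma split_sign:
  assumes "t \<in> sign_vectors n"
  obtains s1 s2 where "s1 \<in> sign_vectors k" "s2 \<in> sign_vectors m" "t = join s1 s2"
proof
  let ?s1 = "\<lambda>i. if i \<le> k then t i else 1" and ?s2 = "\<lambda>j. if j = 0 then 1 else t (j + k)"
  have t: "t i \<in> {1, -1}" for i
    using assms by (cases "i \<in> {1..n}") (auto simp: sign_vectors_def)
  have t1: "t i = 1" if "i \<notin> {1..n}" for i using assms that by (simp add: sign_vectors_def)
  have "?s1 i = 1" if "i \<notin> {1..k}" for i using t1[of i] that by (auto simp: n)
  then show "?s1 \<in> sign_vectors k" using t unfolding sign_vectors_def by auto
  have "?s2 j = 1" if "j \<notin> {1..m}" for j using t1[of "j + k"] that by (auto simp: n)
  then show "?s2 \<in> sign_vectors m" using t unfolding sign_vectors_def by auto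
  show "t = join ?s1 ?s2" by (auto simp: join_def)
qed

lemma inv_HH:
  assumes "((s1, p1), (s2, p2)) \<in> carrier HH"
  shows "inv\<^bsub>HH\<^esub> ((s1, p1), (s2, p2)) = ((\<lambda>i. s1 (p1 i), inv_into UNIV p1), (\<lambda>i. s2 (p2 i), inv_into UNIV p2))"
  using assms by (simp add: inv_DirProd[OF group_hyperoct group_hyperoct] inv_hyperoct)

lemma act_inv_HH:
  assumes "((s1, p1), (s2, p2)) \<in> carrier HH" and "per x y"
  shows "act M (inv\<^bsub>HH\<^esub> ((s1, p1), (s2, p2))) F (x, y) = nu m (s2, id) * F (p1 \<circ> x, p2 \<circ> y)"
proof -
  have p: "p1 permutes {1..k}" "p2 permutes {1..m}" using assms by (auto simp: hyperoct_simps)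
  show ?thesis
    using act_M[of "inv_into UNIV p1" "inv_into UNIV p2"] permutes_inv[OF p(1)] permutes_inv[OF p(2)] assms(2)
    by (simp add: inv_HH[OF assms(1)] permutes_inv_inv[OF p(1)] permutes_inv_inv[OF p(2)] nu_inv[OF p(2), of s2 _ id])
qed

text \<open>
  The isomorphism from the left ideal to the induced representation. Evaluation at the identity pair
  recovers \<open>f\<close>, which gives injectivity.
\<close>

definition \<Phi> :: "(signed_perm \<Rightarrow> rat) \<Rightarrow> signed_perm \<Rightarrow> (nat \<Rightarrow> nat) \<times> (nat \<Rightarrow> nat) \<Rightarrow> rat" where
  "\<Phi> f = (\<lambda>g\<in>carrier W. sec f g)"

lemma \<Phi>_carrier:
  assumes f: "f \<in> good"
  shows "\<Phi> f \<in> carrier Ind"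
proof -
  have eq: "sec f (g \<otimes>\<^bsub>W\<^esub> block_incl k h) = act M (inv\<^bsub>HH\<^esub> h) (sec f g)"
    if g: "g \<in> carrier W" and h: "h \<in> carrier HH" for g h
  proof (rule ext, clarify)
    fix x y
    obtain s1 p1 s2 p2 where h': "h = ((s1, p1), (s2, p2))" by (metis prod.collapse)
    have hc: "((s1, p1), (s2, p2)) \<in> carrier HH" using h h' by simp
    have p: "p1 permutes {1..k}" "p2 permutes {1..m}" "s1 \<in> sign_vectors k" "s2 \<in> sign_vectors m"
      using hc by (auto simp: hyperoct_carrier_eq)
    show "sec f (g \<otimes>\<^bsub>W\<^esub> block_incl k h) (x, y) = act M (inv\<^bsub>HH\<^esub> h) (sec f g) (x, y)"
    proof (cases "per x y")
      case True
      have p': "per (p1 \<circ> x) (p2 \<circ> y)" using p True permutes_compose by blast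
      have "block_incl k h \<otimes>\<^bsub>W\<^esub> pt x y = (join s1 s2, bl k (p1 \<circ> x) (p2 \<circ> y))"
        unfolding h' block_incl_eq using True by (simp add: hyperoct_simps bl_comp')
      then have "sec f (g \<otimes>\<^bsub>W\<^esub> block_incl k h) (x, y) = f (g \<otimes>\<^bsub>W\<^esub> (join s1 s2, bl k (p1 \<circ> x) (p2 \<circ> y)))"
        using True g block_carrier[OF h] pt_carrier[OF True] by (simp add: sec_def W.m_assoc)
      also have "\<dots> = nu m (s2, id) * f (g \<otimes>\<^bsub>W\<^esub> pt (p1 \<circ> x) (p2 \<circ> y))"
        using f g p p' unfolding good_def by blast
      also have "\<dots> = act M (inv\<^bsub>HH\<^esub> h) (sec f g) (x, y)"
        unfolding h' act_inv_HH[OF hc True] using p' by (simp add: sec_def)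
      finally show ?thesis .
    next
      case False
      have "act M (inv\<^bsub>HH\<^esub> h) (sec f g) (x, y) = 0"
        using act_M[of "inv_into UNIV p1" "inv_into UNIV p2"] permutes_inv[OF p(1)] permutes_inv[OF p(2)] False
        by (auto simp: h' inv_HH[OF hc])
      then show ?thesis using False by (auto simp: sec_def)
    qed
  qed
  have "\<Phi> f \<in> carrier W \<rightarrow>\<^sub>E carrier M" using f by (auto simp: \<Phi>_def good_def)
  moreover have "\<Phi> f (g \<otimes>\<^bsub>W\<^esub> block_incl k h) = act M (inv\<^bsub>HH\<^esub> h) (\<Phi> f g)"
    if "g \<in> carrier W" "h \<in> carrier HH" for g h
    using eq[OF that] that block_carrier[OF that(2)] by (simp add: \<Phi>_def)
  ultimately show ?thesis unfolding ind_rep_def by simp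
qed

lemma \<Phi>_at_id: "g \<in> carrier W \<Longrightarrow> \<Phi> f g (id, id) = f g"
proof -
  assume g: "g \<in> carrier W"
  have "pt id id = \<one>\<^bsub>W\<^esub>" by (simp add: hyperoct_simps)
  then show ?thesis using g by (simp add: \<Phi>_def sec_def permutes_id)
qed

text \<open>
  Surjectivity: the part of \<open>f\<close> on one coset is a combination of translates of the generator, because
  the value of \<open>F\<close> there is a combination of translates of the two Young symmetrizers.
\<close>

lemma \<Phi>_surj:
  assumes F: "F \<in> carrier Ind"
  shows "\<exists>f\<in>V. \<Phi> f = F"
proof -
  have Fext: "F \<in> carrier W \<rightarrow>\<^sub>E carrier M"
    and Feq: "\<And>g h. g \<in> carrier W \<Longrightarrow> h \<in> carrier HH \<Longrightarrow> F (g \<otimes>\<^bsub>W\<^esub> block_incl k h) = act M (inv\<^bsub>HH\<^esub> h) (F g)"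
    using F by (auto simp: ind_rep_def)
  have FM: "F g \<in> carrier M" if "g \<in> carrier W" for g using Fext that by auto
  define f where "f = (\<lambda>g. if g \<in> carrier W then F g (id, id) else 0)"
  have fblock: "f (g \<otimes>\<^bsub>W\<^esub> (join s1 s2, bl k x y)) = nu m (s2, id) * F g (x, y)"
    if "g \<in> carrier W" "s1 \<in> sign_vectors k" "s2 \<in> sign_vectors m" "per x y" for g s1 s2 x y
  proof -
    have h: "((s1, x), (s2, y)) \<in> carrier HH" using that by (simp add: hyperoct_carrier_eq)
    have "f (g \<otimes>\<^bsub>W\<^esub> (join s1 s2, bl k x y)) = F (g \<otimes>\<^bsub>W\<^esub> block_incl k ((s1, x), (s2, y))) (id, id)"
      using that(1) block_carrier[OF h] by (simp add: f_def block_incl_eq)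
    also have "\<dots> = nu m (s2, id) * F g (x, y)"
      unfolding Feq[OF that(1) h] using act_inv_HH[OF h, of id id "F g"] by (simp add: permutes_id)
    finally show ?thesis .
  qed
  have \<Phi>f: "\<Phi> f = F"
  proof (rule ext)
    fix g
    show "\<Phi> f g = F g"
    proof (cases "g \<in> carrier W")
      case True
      have s: "(\<lambda>_. 1) \<in> sign_vectors l" for l by (simp add: sign_vectors_def)
      have j: "join (\<lambda>_. 1) (\<lambda>_. 1) = (\<lambda>_. 1)" by (simp add: join_def)
      have nu1: "nu m (\<lambda>_. 1, id) = 1" by (simp add: nu_def)
      have "sec f g (x, y) = F g (x, y)" for x y
        using fblock[OF True s s, of x y] M_vanish[OF FM[OF True], of x y]
        by (auto simp: sec_def j nu1)
      then show ?thesis using True by (auto simp: \<Phi>_def)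
    next
      case False
      then show ?thesis using PiE_arb[OF Fext False] by (simp add: \<Phi>_def)
    qed
  qed
  define B where "B = stab n side (\<lambda>_. 0)"
  define part where "part g = (\<lambda>y. if y \<in> carrier W \<and> inv\<^bsub>W\<^esub> g \<otimes>\<^bsub>W\<^esub> y \<in> B then f y else 0)" for g
  have part: "part g \<in> V" if g: "g \<in> carrier W" for g
  proof -
    obtain r :: nat and u v where Fg: "\<And>x y. F g (x, y) = (\<Sum>i<r. u i x * v i y)"
      "\<And>i. i < r \<Longrightarrow> u i \<in> carrier (hyperoct_plus lp)" "\<And>i. i < r \<Longrightarrow> v i \<in> carrier (hyperoct_plus lm)"
      by (rule carrier_ME[OF FM[OF g]]) (rule that)
    have "\<forall>i. \<exists>b. i < r \<longrightarrow> u i = conv (sym_group k) b (young_symmetrizer lp)"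
      using Fg(2) by (auto simp: carrier_plus k)
    then obtain b where b: "\<And>i. i < r \<Longrightarrow> u i = conv (sym_group k) (b i) (young_symmetrizer lp)" by metis
    have "\<forall>i. \<exists>c. i < r \<longrightarrow> v i = conv (sym_group m) c (young_symmetrizer lm)"
      using Fg(3) by (auto simp: carrier_plus m)
    then obtain c where c: "\<And>i. i < r \<Longrightarrow> v i = conv (sym_group m) (c i) (young_symmetrizer lm)" by metis
    let ?K = "{w. w permutes {1..k}}" and ?L = "{w. w permutes {1..m}}"
    define S where "S = (\<Sum>i<r. \<Sum>w1\<in>?K. \<Sum>w2\<in>?L. fscale (b i w1 * c i w2 / N) (PW (g \<otimes>\<^bsub>W\<^esub> pt w1 w2) v0))"
    have SV: "S \<in> V"
      unfolding S_def using gsub_V v0_V g pt_carrier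
      by (intro fs.subspace_sum fs.subspace_scale gsub_subspace[OF gsub_V]) (auto intro!: gsub_act[OF gsub_V])
    have "part g y = S y" for y
    proof (cases "y \<in> carrier W")
      case False
      then have "S y = 0" using good_outside[of S y] SV V_good by blast
      then show ?thesis using False by (simp add: part_def)
    next
      case y: True
      obtain t q where z: "inv\<^bsub>W\<^esub> g \<otimes>\<^bsub>W\<^esub> y = (t, q)" by (cases "inv\<^bsub>W\<^esub> g \<otimes>\<^bsub>W\<^esub> y")
      have zc: "(t, q) \<in> carrier W" unfolding z[symmetric] using g y by simp
      have tS: "t \<in> sign_vectors n" "q permutes {1..k + m}" using zc by (auto simp: hyperoct_carrier_eq n)
      have Bz: "(t, q) \<in> B \<longleftrightarrow> (\<forall>i\<in>{1..n}. side (q i) = side i)" using zc by (simp add: B_def stab_def)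
      have tr: "PW (g \<otimes>\<^bsub>W\<^esub> pt w1 w2) v0 y = v0 (pt (inv_into UNIV w1) (inv_into UNIV w2) \<otimes>\<^bsub>W\<^esub> (t, q))"
        if w: "per w1 w2" for w1 w2
      proof -
        have "inv\<^bsub>W\<^esub> (pt w1 w2) = pt (inv_into UNIV w1) (inv_into UNIV w2)"
          using inv_hyperoct[OF pt_carrier[OF w]] inv_bl[of w1 k w2 m] w by simp
        moreover have "pt (inv_into UNIV w1) (inv_into UNIV w2) \<in> carrier W"
          using w permutes_inv by (intro pt_carrier) blast
        ultimately show ?thesis
          using g y pt_carrier[OF w] by (simp add: pact_def reg_act_def W.inv_mult_group W.m_assoc flip: z)
      qed
      have Sy: "S y = (\<Sum>i<r. \<Sum>w1\<in>?K. \<Sum>w2\<in>?L. b i w1 * c i w2 / N * v0 (pt (inv_into UNIV w1) (inv_into UNIV w2) \<otimes>\<^bsub>W\<^esub> (t, q)))"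
        unfolding S_def sum_fun_apply pointwise by (intro sum.cong refl) (simp add: tr)
      show ?thesis
      proof (cases "\<forall>i\<in>{1..n}. side (q i) = side i")
        case True
        then have "\<forall>i\<in>{1..k + m}. (k < q i) = (k < i)" by (simp add: side n)
        then obtain q1 q2 where q: "q1 permutes {1..k}" "q2 permutes {1..m}" "q = bl k q1 q2"
          by (rule bl_cases[OF tS(2)])
        obtain s1 s2 where s: "s1 \<in> sign_vectors k" "s2 \<in> sign_vectors m" "t = join s1 s2"
          by (rule split_sign[OF tS(1)])
        have v: "v0 (pt (inv_into UNIV w1) (inv_into UNIV w2) \<otimes>\<^bsub>W\<^esub> (t, q)) =
            N * nu m (s2, id) * (young_symmetrizer lp (inv_into UNIV w1 \<circ> q1) * young_symmetrizer lm (inv_into UNIV w2 \<circ> q2))"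
          if w: "per w1 w2" for w1 w2
        proof -
          have iw: "per (inv_into UNIV w1) (inv_into UNIV w2)" using w permutes_inv by blast
          have p: "inv_into UNIV w1 \<circ> q1 permutes {1..k}" "inv_into UNIV w2 \<circ> q2 permutes {1..m}"
            using iw q permutes_compose by blast+
          obtain t' where t': "pt (inv_into UNIV w1) (inv_into UNIV w2) \<otimes>\<^bsub>W\<^esub> (t, q) =
              (t', bl k (inv_into UNIV w1 \<circ> q1) (inv_into UNIV w2 \<circ> q2))"
            unfolding q(3) by (simp add: hyperoct_simps bl_comp[OF q(1,2)])
          have "pt (inv_into UNIV w1) (inv_into UNIV w2) \<otimes>\<^bsub>W\<^esub> (t, q) \<in> carrier W"
            using pt_carrier[OF iw] zc by simp
          then have t's: "t' \<in> sign_vectors n" by (simp add: t' hyperoct_carrier_eq)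
          have "\<forall>i\<in>{1..n}. side (bl k (inv_into UNIV w1) (inv_into UNIV w2) i) = side i"
            using bl_le[of "inv_into UNIV w1" k "inv_into UNIV w2" m] iw by (auto simp: side not_le[symmetric])
          from chi_mult[OF pt_carrier[OF iw] this, of t q]
          have "chi_vec n side t' = nu m (s2, id)"
            unfolding t' chi_perm using chi_join[of s1 s2 q id] by (simp add: chi_pair s(3))
          then show ?thesis
            unfolding t' v0_block[OF t's p] row_col_young(1)[OF p(1)] row_col_young(2)[OF p(2)]
            by (simp add: chi_pair)
        qed
        have Nz: "N \<noteq> 0" using card_sign_vectors[of n] by simp
        have "y = g \<otimes>\<^bsub>W\<^esub> (join s1 s2, bl k q1 q2)"
          using z g y zc unfolding s(3) q(3) by (simp flip: z[unfolded s(3) q(3)] W.m_assoc)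
        then have "f y = nu m (s2, id) * F g (q1, q2)" using fblock[OF g s(1,2), of q1 q2] q by simp
        also have "\<dots> = (\<Sum>i<r. nu m (s2, id) * (u i q1 * v i q2))" by (simp add: Fg(1) sum_distrib_left)
        also have "\<dots> = S y"
          unfolding Sy
        proof (intro sum.cong refl)
          fix i assume i: "i \<in> {..<r}"
          have "u i q1 * v i q2 = (\<Sum>w1\<in>?K. \<Sum>w2\<in>?L. (b i w1 * young_symmetrizer lp (inv_into UNIV w1 \<circ> q1)) *
              (c i w2 * young_symmetrizer lm (inv_into UNIV w2 \<circ> q2)))"
            using i q by (simp add: b c conv_sym sum_product)
          then show "nu m (s2, id) * (u i q1 * v i q2) = (\<Sum>w1\<in>?K. \<Sum>w2\<in>?L. b i w1 * c i w2 / N *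
              v0 (pt (inv_into UNIV w1) (inv_into UNIV w2) \<otimes>\<^bsub>W\<^esub> (t, q)))"
            using Nz by (simp add: v sum_distrib_left field_simps)
        qed
        finally show ?thesis using True y z Bz by (simp add: part_def)
      next
        case False
        have "v0 (pt (inv_into UNIV w1) (inv_into UNIV w2) \<otimes>\<^bsub>W\<^esub> (t, q)) = 0" if w: "per w1 w2" for w1 w2
        proof -
          have iw: "per (inv_into UNIV w1) (inv_into UNIV w2)" using w permutes_inv by blast
          obtain t' where t': "pt (inv_into UNIV w1) (inv_into UNIV w2) \<otimes>\<^bsub>W\<^esub> (t, q) =
              (t', bl k (inv_into UNIV w1) (inv_into UNIV w2) \<circ> q)"
            by (simp add: hyperoct_simps)
          have "pt (inv_into UNIV w1) (inv_into UNIV w2) \<otimes>\<^bsub>W\<^esub> (t, q) \<in> carrier W"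
            using pt_carrier[OF iw] zc by simp
          moreover have "side ((bl k (inv_into UNIV w1) (inv_into UNIV w2) \<circ> q) i) = side (q i)" for i
            using bl_le[of "inv_into UNIV w1" k "inv_into UNIV w2" m "q i"] iw by (auto simp: side)
          ultimately show ?thesis unfolding t' using False by (intro v0_not_side) auto
        qed
        then have "S y = 0" unfolding Sy by simp
        moreover have "part g y = 0" using False Bz by (auto simp: part_def z)
        ultimately show ?thesis by simp
      qed
    qed
    then have "part g = S" by (rule ext)
    then show ?thesis using SV by simp
  qed
  have finW: "finite (carrier W)" by (rule finite_hyperoct)
  have BW: "B \<subseteq> carrier W" "\<one>\<^bsub>W\<^esub> \<in> B"
    using subgroup.subset[OF subgroup_stab] subgroup.one_closed[OF subgroup_stab] by (auto simp: B_def)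
  have finB: "finite B" using finite_subset[OF BW(1) finW] .
  have sum: "(\<Sum>g\<in>carrier W. part g) = fscale (of_nat (card B)) f"
  proof (rule ext)
    fix y
    show "(\<Sum>g\<in>carrier W. part g) y = fscale (of_nat (card B)) f y"
    proof (cases "y \<in> carrier W")
      case True
      have "(\<Sum>g\<in>carrier W. part g) y = (\<Sum>g\<in>carrier W. if inv\<^bsub>W\<^esub> g \<otimes>\<^bsub>W\<^esub> y \<in> B then f y else 0)"
        using True by (simp add: sum_fun_apply part_def)
      also have "\<dots> = (\<Sum>h\<in>carrier W. if h \<in> B then f y else 0)"
      proof (rule sum.reindex_bij_witness[of _ "\<lambda>h. y \<otimes>\<^bsub>W\<^esub> inv\<^bsub>W\<^esub> h" "\<lambda>g. inv\<^bsub>W\<^esub> g \<otimes>\<^bsub>W\<^esub> y"])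
        fix g assume g: "g \<in> carrier W"
        show "y \<otimes>\<^bsub>W\<^esub> inv\<^bsub>W\<^esub> (inv\<^bsub>W\<^esub> g \<otimes>\<^bsub>W\<^esub> y) = g"
          using True g by (simp add: W.inv_mult_group flip: W.m_assoc)
        show "inv\<^bsub>W\<^esub> (y \<otimes>\<^bsub>W\<^esub> inv\<^bsub>W\<^esub> g) \<otimes>\<^bsub>W\<^esub> y = g"
          using True g by (simp add: W.inv_mult_group W.m_assoc)
        show "inv\<^bsub>W\<^esub> g \<otimes>\<^bsub>W\<^esub> y \<in> carrier W" "y \<otimes>\<^bsub>W\<^esub> inv\<^bsub>W\<^esub> g \<in> carrier W"
          using True g by (intro W.m_closed W.inv_closed; simp)+
      qed simp
      also have "\<dots> = of_nat (card B) * f y"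
        using BW finW by (simp add: sum.If_cases Int_absorb1)
      finally show ?thesis by (simp add: pointwise)
    next
      case False
      then show ?thesis by (simp add: sum_fun_apply part_def pointwise f_def)
    qed
  qed
  have "card B \<noteq> 0" using finB BW(2) by auto
  then have "f = fscale (inverse (of_nat (card B))) (\<Sum>g\<in>carrier W. part g)" unfolding sum by simp
  then have "f \<in> V"
    using part fs.subspace_scale[OF gsub_subspace[OF gsub_V] fs.subspace_sum[OF gsub_subspace[OF gsub_V]]]
    by metis
  then show ?thesis using \<Phi>f by blast
qed

theorem pair_ideal_iso_Ind: "is_iso W (fun_rep V PW) Ind \<Phi>"
  unfolding is_iso_def fun_rep_simps
proof (intro conjI ballI allI)
  show "bij_betw \<Phi> V (carrier Ind)"
    unfolding bij_betw_def
  proof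
    show "inj_on \<Phi> V"
    proof (rule inj_onI)
      fix f f' assume f: "f \<in> V" "f' \<in> V" "\<Phi> f = \<Phi> f'"
      show "f = f'"
      proof
        fix g
        have "f \<in> good" "f' \<in> good" using f V_good by blast+
        then have "g \<notin> carrier W \<Longrightarrow> f g = 0 \<and> f' g = 0" using good_outside by blast
        then show "f g = f' g"
          using f(3) \<Phi>_at_id[of g f] \<Phi>_at_id[of g f'] by (cases "g \<in> carrier W") auto
      qed
    qed
    show "\<Phi> ` V = carrier Ind" using \<Phi>_carrier V_good \<Phi>_surj by blast
  qed
  show "\<Phi> (f + f') = \<Phi> f \<oplus>\<^bsub>Ind\<^esub> \<Phi> f'" for f f'
    by (simp add: \<Phi>_def ind_rep_def sec_lin M_simps fun_eq_iff)
  show "\<Phi> (fscale c f) = c \<odot>\<^bsub>Ind\<^esub> \<Phi> f" for c f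
    by (simp add: \<Phi>_def ind_rep_def sec_lin M_simps fun_eq_iff)
  fix g0 f assume g0: "g0 \<in> carrier W"
  have "sec (PW g0 f) g = sec f (inv\<^bsub>W\<^esub> g0 \<otimes>\<^bsub>W\<^esub> g)" if "g \<in> carrier W" for g
    by (rule ext) (use that g0 in \<open>auto simp: sec_def pact_def reg_act_def pt_carrier W.m_assoc\<close>)
  then show "\<Phi> (PW g0 f) = act Ind g0 (\<Phi> f)"
    using g0 by (auto simp: \<Phi>_def ind_rep_def)
qed

lemma rep_multiplicity_hyperoct_irrep:
  "rep_multiplicity W (hyperoct_irrep lp lm) Q = rep_multiplicity W (fun_rep V PW) Q"
proof -
  have "rep_iso W (fun_rep V PW) (hyperoct_irrep lp lm)"
    using pair_ideal_iso_Ind k m n by (auto simp: rep_iso_iff_is_iso hyperoct_irrep_def Let_def)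
  moreover from this have "rep_iso W (hyperoct_irrep lp lm) (fun_rep V PW)"
    by (rule rep_iso_sym[OF _ is_rep_fun_rep[OF gsub_V]])
  ultimately show ?thesis by (intro rep_multiplicity_cong)
qed

end

section \<open>Stability of the dimensions\<close>

lemma hyperoct_mono: "g \<in> carrier (hyperoct n) \<Longrightarrow> g \<in> carrier (hyperoct (Suc n))"
proof -
  assume g: "g \<in> carrier (hyperoct n)"
  obtain s p where sp: "g = (s, p)" by (cases g)
  have "p permutes {1..Suc n}" using permutes_subset[of p "{1..n}" "{1..Suc n}"] g by (auto simp: sp hyperoct_simps)
  then show ?thesis using g by (auto simp: sp hyperoct_simps le_Suc_eq)
qed

lemma hyperoct_restrict:
  assumes "(s, p) \<in> carrier (hyperoct (Suc n))" "p (Suc n) = Suc n" "s (Suc n) = 1"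
  shows "(s, p) \<in> carrier (hyperoct n)"
proof -
  have p: "p permutes {1..Suc n}" using assms by (simp add: hyperoct_simps)
  have "{1..n} = {1..Suc n} - {Suc n}" by auto
  moreover have "p permutes ({1..Suc n} - {Suc n})"
    using p assms(2) unfolding permutes_def by auto
  ultimately show ?thesis using assms by (auto simp: hyperoct_simps le_Suc_eq)
qed

lemma inv_hyperoct_Suc:
  assumes "g \<in> carrier (hyperoct n)"
  shows "inv\<^bsub>hyperoct (Suc n)\<^esub> g = inv\<^bsub>hyperoct n\<^esub> g"
  using hyperoct_mono[OF assms] assms by (cases g) (simp add: inv_hyperoct)

lemma pact_hyperoct_Suc:
  "g \<in> carrier (hyperoct n) \<Longrightarrow> pact (hyperoct (Suc n)) \<rho> g = pact (hyperoct n) \<rho> g"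
  by (rule ext) (simp add: pact_def inv_hyperoct_Suc)

text \<open>The operator \<open>E\<close> for the row and column groups of a labelling.\<close>

definition lab_op :: "(signed_perm \<Rightarrow> 'x \<Rightarrow> 'x) \<Rightarrow> nat \<Rightarrow> (nat \<Rightarrow> bool) \<Rightarrow> (nat \<Rightarrow> nat) \<Rightarrow> (nat \<Rightarrow> nat) \<Rightarrow>
    ('x \<Rightarrow> rat) \<Rightarrow> ('x \<Rightarrow> rat)" where
  "lab_op \<rho> n side rw cl f = wsum (hyperoct n) \<rho> (stab n side cl) (chi_sign n side)
     (wsum (hyperoct n) \<rho> (stab n side rw) (chi n side) f)"

text \<open>
  A family of sets with actions of the hyperoctahedral groups, whose elements involve at most \<open>d\<close>
  coordinates, together with a labelling of all positive numbers which beyond \<open>b\<close> only continues the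
  first row by columns of length one.
\<close>

locale stable_family =
  fixes \<rho> :: "signed_perm \<Rightarrow> 'x \<Rightarrow> 'x" and X' :: "nat \<Rightarrow> 'x set" and supp :: "'x \<Rightarrow> nat set" and d :: nat
    and side :: "nat \<Rightarrow> bool" and rw cl :: "nat \<Rightarrow> nat" and b :: nat
  assumes action: "finite_action (hyperoct n) \<rho>"
    and finX: "finite (X' n)"
    and stableX: "g \<in> carrier (hyperoct n) \<Longrightarrow> x \<in> X' n \<Longrightarrow> \<rho> g x \<in> X' n"
    and X_Suc: "X' n = {x \<in> X' (Suc n). Suc n \<notin> supp x}"
    and local_act: "(s, p) \<in> carrier (hyperoct n) \<Longrightarrow> (t, q) \<in> carrier (hyperoct n) \<Longrightarrow> x \<in> X' n \<Longrightarrow>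
      (\<And>i. i \<in> supp x \<Longrightarrow> p i = q i \<and> s (p i) = t (q i)) \<Longrightarrow> \<rho> (s, p) x = \<rho> (t, q) x"
    and supp_act: "(s, p) \<in> carrier (hyperoct n) \<Longrightarrow> x \<in> X' n \<Longrightarrow> supp (\<rho> (s, p) x) = p ` supp x"
    and supp_card: "x \<in> X' n \<Longrightarrow> finite (supp x) \<and> card (supp x) \<le> d"
    and tail: "b < i \<Longrightarrow> \<not> side i \<and> rw i = 0"
    and single: "b < i \<Longrightarrow> 0 < j \<Longrightarrow> side j = side i \<Longrightarrow> cl j = cl i \<Longrightarrow> j = i"
begin

context
  fixes n :: nat
  assumes n: "b + d \<le> n"
begin

abbreviation "z \<equiv> Suc n"
abbreviation "G \<equiv> hyperoct n"
abbreviation "G' \<equiv> hyperoct z"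
abbreviation "R \<equiv> stab n side rw"
abbreviation "R' \<equiv> stab z side rw"
abbreviation "C \<equiv> stab n side cl"
abbreviation "C' \<equiv> stab z side cl"
abbreviation "A \<equiv> wsum G \<rho> R (chi n side)"
abbreviation "A' \<equiv> wsum G' \<rho> R' (chi z side)"
abbreviation "B \<equiv> wsum G \<rho> C (chi_sign n side)"
abbreviation "B' \<equiv> wsum G' \<rho> C' (chi_sign z side)"

interpretation G': group G' by (rule group_hyperoct)
interpretation R: sign_char_action G R "chi n side" \<rho>
  by (intro sign_char_action.intro sign_char_chi action)
interpretation C: sign_char_action G C "chi_sign n side" \<rho>
  by (intro sign_char_action.intro sign_char_chi_sign action)
interpretation R': sign_char_action G' R' "chi z side" \<rho>
  by (intro sign_char_action.intro sign_char_chi action)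
interpretation C': sign_char_action G' C' "chi_sign z side" \<rho>
  by (intro sign_char_action.intro sign_char_chi_sign action)
interpretation S': sign_char G' "stab z side (\<lambda>_. 0)" "chi_sign z side" by (rule sign_char_chi_sign)

lemma z_tail: "\<not> side z" "rw z = 0"
  using tail[of z] n by auto

lemma chi_Suc: "chi z side g = chi n side g"
proof -
  have "{i \<in> {1..z}. side i} = {i \<in> {1..n}. side i}" using z_tail by (auto simp: le_Suc_eq)
  then show ?thesis by (simp add: chi_def)
qed

lemma chi_sign_Suc: "chi_sign z side g = chi_sign n side g"
  by (simp add: chi_sign_def chi_Suc)

lemma stab_Suc: "stab n side f \<subseteq> stab z side f"
proof
  fix g assume g: "g \<in> stab n side f"
  obtain s p where sp: "g = (s, p)" by (cases g)
  have gc: "g \<in> carrier G" using g by (auto simp: stab_def)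
  have "p z = z" using permutes_not_in[OF hyperoct_permutes[OF gc[unfolded sp]], of z] by simp
  then show "g \<in> stab z side f" using g hyperoct_mono[OF gc] by (auto simp: sp stab_def le_Suc_eq)
qed

lemma stab_restrict:
  assumes "(s, p) \<in> stab z side f" "p z = z" "s z = 1"
  shows "(s, p) \<in> stab n side f"
  using assms hyperoct_restrict[of s p n] by (auto simp: stab_def)

lemma C'_fix: assumes "(s, p) \<in> C'" "b < i" "i \<le> z" shows "p i = i"
proof (rule single[OF assms(2)])
  have p: "p permutes {1..z}" using assms(1) by (auto simp: stab_def hyperoct_simps)
  have i: "i \<in> {1..z}" using assms by auto
  show "0 < p i" using permutes_in_image[OF p, of i] i by auto
  show "side (p i) = side i" "cl (p i) = cl i" using assms(1) i by (auto simp: stab_def)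
qed

lemma X_mono: "x \<in> X' n \<Longrightarrow> x \<in> X' z"
  using X_Suc[of n] by auto

lemma stable_X: "R.stable (X' n)" "R'.stable (X' z)"
  by (auto simp: R.stable_def R'.stable_def stableX)

definition res :: "('x \<Rightarrow> rat) \<Rightarrow> ('x \<Rightarrow> rat)" where
  "res f = (\<lambda>x. if x \<in> X' n then f x else 0)"

lemma flinear_res: "flinear res"
  by (auto simp: flinear_def res_def pointwise fun_eq_iff)

text \<open>The image of \<open>A\<close> consists of the semi-invariants of the row group.\<close>

definition SI :: "('x \<Rightarrow> rat) set" where
  "SI = {f \<in> supp_on (X' n). \<forall>r\<in>R. pact G \<rho> r f = fscale (chi n side r) f}"

definition SI' :: "('x \<Rightarrow> rat) set" where
  "SI' = {f \<in> supp_on (X' z). \<forall>r\<in>R'. pact G' \<rho> r f = fscale (chi z side r) f}"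

lemma A_image: "A ` supp_on (X' n) = SI"
proof
  show "A ` supp_on (X' n) \<subseteq> SI"
    using R.gsub_A[OF R.gsub_supp_on[OF stable_X(1)]] R.P_A by (auto simp: SI_def)
  show "SI \<subseteq> A ` supp_on (X' n)"
  proof
    fix f assume f: "f \<in> SI"
    let ?k = "rat_of_nat (card R)"
    have k: "?k \<noteq> 0" using R.finR R.one_mem by auto
    have "A f = (\<Sum>r\<in>R. f)" unfolding wsum_def using f R.sq by (intro sum.cong) (auto simp: SI_def)
    also have "\<dots> = fscale ?k f" by (rule ext) (simp add: sum_fun_apply pointwise)
    finally have "A (fscale (inverse ?k) f) = f" using k by (simp add: flinear_scale[OF R.flinear_A])
    moreover have "fscale (inverse ?k) f \<in> supp_on (X' n)"
      using f fs.subspace_scale[OF subspace_supp_on] by (auto simp: SI_def)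
    ultimately show "f \<in> A ` supp_on (X' n)" by (metis imageI)
  qed
qed

lemma A'_image: "A' ` supp_on (X' z) = SI'"
proof
  show "A' ` supp_on (X' z) \<subseteq> SI'"
    using R'.gsub_A[OF R'.gsub_supp_on[OF stable_X(2)]] R'.P_A by (auto simp: SI'_def)
  show "SI' \<subseteq> A' ` supp_on (X' z)"
  proof
    fix f assume f: "f \<in> SI'"
    let ?k = "rat_of_nat (card R')"
    have k: "?k \<noteq> 0" using R'.finR R'.one_mem by auto
    have "A' f = (\<Sum>r\<in>R'. f)" unfolding wsum_def using f R'.sq by (intro sum.cong) (auto simp: SI'_def)
    also have "\<dots> = fscale ?k f" by (rule ext) (simp add: sum_fun_apply pointwise)
    finally have "A' (fscale (inverse ?k) f) = f" using k by (simp add: flinear_scale[OF R'.flinear_A])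
    moreover have "fscale (inverse ?k) f \<in> supp_on (X' z)"
      using f fs.subspace_scale[OF subspace_supp_on] by (auto simp: SI'_def)
    ultimately show "f \<in> A' ` supp_on (X' z)" by (metis imageI)
  qed
qed

lemma swap_R':
  assumes y: "0 < y" "y \<le> n" "\<not> side y" "rw y = 0"
  shows "((\<lambda>_. 1), Transposition.transpose y z) \<in> R'"
    and "chi z side ((\<lambda>_. 1), Transposition.transpose y z) = 1"
proof -
  have "Transposition.transpose y z permutes {1..z}" using y by (intro permutes_swap_id) auto
  then show "((\<lambda>_. 1), Transposition.transpose y z) \<in> R'"
    using y z_tail perm_carrier by (auto simp: stab_def Transposition.transpose_def)
qed (simp add: chi_def)

lemma swap_act:
  assumes y: "0 < y" "y \<le> n" and x: "x \<in> X' z" "y \<notin> supp x" "z \<notin> supp x"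
  shows "\<rho> ((\<lambda>_. 1), Transposition.transpose y z) x = x"
proof -
  have "Transposition.transpose y z permutes {1..z}" using y by (intro permutes_swap_id) auto
  then have "((\<lambda>_. 1), Transposition.transpose y z) \<in> carrier G'" by (rule perm_carrier)
  moreover have "(\<lambda>_. 1, id) \<in> carrier G'" by (rule perm_carrier[OF permutes_id])
  ultimately have "\<rho> ((\<lambda>_. 1), Transposition.transpose y z) x = \<rho> (\<lambda>_. 1, id) x"
    using x by (intro local_act) (auto simp: Transposition.transpose_def)
  then show ?thesis using R'.act_one[of x] by (simp add: hyperoct_simps)
qed

text \<open>
  Two elements of \<open>X' n\<close> that are related by the larger row group are related by the smaller one:
  the new coordinate is free in both, so a transposition can return it to its place.
\<close>

lemma row_group_descent:
  assumes x: "x \<in> X' n" "x' \<in> X' n" and r: "r \<in> R'" "\<rho> r x' = x"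
  shows "\<exists>r0\<in>R. \<rho> r0 x' = x \<and> chi n side r0 = chi z side r"
proof -
  have zx: "z \<notin> supp x" "z \<notin> supp x'" using x X_Suc[of n] by auto
  have fixed: "\<exists>r0\<in>R. \<rho> r0 x' = x \<and> chi n side r0 = chi z side r"
    if r: "r \<in> R'" "\<rho> r x' = x" "snd r z = z" for r
  proof -
    obtain s p where sp: "r = (s, p)" by (cases r)
    have rc: "(s, p) \<in> carrier G'" using R'.mem_carrier[OF r(1)] by (simp add: sp)
    have p: "p permutes {1..z}" by (rule hyperoct_permutes[OF rc])
    have pz: "p z = z" using r(3) by (simp add: sp)
    let ?s = "s(z := 1)"
    have "(?s, p) \<in> carrier G'" using rc by (auto simp: hyperoct_simps)
    then have c: "(?s, p) \<in> R'" using r(1) by (simp add: sp stab_def)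
    have "\<rho> (?s, p) x' = \<rho> (s, p) x'"
    proof (rule local_act[OF R'.mem_carrier[OF c] rc X_mono[OF x(2)]])
      fix i assume "i \<in> supp x'"
      then have "i \<noteq> z" using zx by blast
      then have "p i \<noteq> z" using pz permutes_inj[OF p] by (metis injD)
      then show "p i = p i \<and> ?s (p i) = s (p i)" by simp
    qed
    moreover have "(?s, p) \<in> R" by (rule stab_restrict[OF c pz]) simp
    moreover have "chi n side (?s, p) = chi n side (s, p)"
      unfolding chi_def prod.case by (rule prod.cong) auto
    then have "chi n side (?s, p) = chi z side r" by (simp add: chi_Suc sp)
    ultimately show ?thesis using r(2) sp by metis
  qed
  show ?thesis
  proof (cases "snd r z = z")
    case False
    obtain s p where sp: "r = (s, p)" by (cases r)
    have rc: "(s, p) \<in> carrier G'" using R'.mem_carrier[OF r(1)] by (simp add: sp)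
    have p: "p permutes {1..z}" by (rule hyperoct_permutes[OF rc])
    define y where "y = p z"
    have yz: "y \<noteq> z" using False by (simp add: y_def sp)
    have "y \<in> {1..z}" unfolding y_def using permutes_in_image[OF p, of z] by simp
    then have y: "0 < y" "y \<le> n" using yz by auto
    have y': "\<not> side y" "rw y = 0" using r(1) z_tail unfolding y_def sp by (auto simp: stab_def)
    have "supp x = p ` supp x'" using supp_act[OF rc X_mono[OF x(2)]] r(2) sp by simp
    then have ysupp: "y \<notin> supp x" using zx permutes_inj[OF p] by (auto simp: y_def inj_def)
    let ?t = "((\<lambda>_. 1), Transposition.transpose y z) :: signed_perm"
    note t = swap_R'[OF y y']
    let ?r = "?t \<otimes>\<^bsub>G'\<^esub> r"
    have "?r \<in> R'" using R'.mult_mem t(1) r(1) by blast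
    moreover have "\<rho> ?r x' = x"
      using R'.act_mult[OF R'.mem_carrier[OF t(1)] R'.mem_carrier[OF r(1)]] r(2)
        swap_act[OF y X_mono[OF x(1)] ysupp zx(1)] by simp
    moreover have "snd ?r z = z" by (simp add: sp hyperoct_simps flip: y_def)
    moreover have "chi z side ?r = chi z side r" using R'.mult[OF t(1) r(1)] t(2) by simp
    ultimately show ?thesis using fixed[of ?r] by simp
  qed (use fixed r in blast)
qed

lemma res_SI': assumes "f \<in> SI'" shows "res f \<in> SI"
proof -
  have "pact G \<rho> r (res f) = fscale (chi n side r) (res f)" if r: "r \<in> R" for r
  proof
    fix x
    have rc: "inv\<^bsub>G\<^esub> r \<in> carrier G" using R.mem_carrier[OF R.inv_mem[OF r]] .
    have "pact G' \<rho> r f x = chi z side r * f x"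
      using assms r stab_Suc[of rw] by (auto simp: SI'_def pointwise)
    then have "f (\<rho> (inv\<^bsub>G\<^esub> r) x) = chi n side r * f x"
      unfolding pact_hyperoct_Suc[OF R.mem_carrier[OF r]] chi_Suc by (simp add: pact_def)
    then show "pact G \<rho> r (res f) x = fscale (chi n side r) (res f) x"
      using R.stable_iff[OF stable_X(1) rc, of x] by (simp add: pact_def res_def pointwise)
  qed
  moreover have "res f \<in> supp_on (X' n)" by (simp add: res_def supp_on_def)
  ultimately show ?thesis by (simp add: SI_def)
qed

text \<open>
  A semi-invariant function extends to the larger set by averaging over the larger row group, with
  a weight that compensates for the number of ways to move an element into \<open>X' n\<close>.
\<close>

lemma SI_extends: assumes f: "f \<in> SI" shows "\<exists>f'\<in>SI'. res f' = f"
proof -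
  define M where "M x = {r \<in> R'. \<rho> (inv\<^bsub>G'\<^esub> r) x \<in> X' n}" for x
  have M_inv: "card (M (\<rho> (inv\<^bsub>G'\<^esub> r) x)) = card (M x)" if r: "r \<in> R'" for r x
  proof -
    have rc: "r \<in> carrier G'" by (rule R'.mem_carrier[OF r])
    have "bij_betw (\<lambda>q. r \<otimes>\<^bsub>G'\<^esub> q) (M (\<rho> (inv\<^bsub>G'\<^esub> r) x)) (M x)"
    proof (rule bij_betwI[where g = "\<lambda>q. inv\<^bsub>G'\<^esub> r \<otimes>\<^bsub>G'\<^esub> q"])
      show "(\<lambda>q. r \<otimes>\<^bsub>G'\<^esub> q) \<in> M (\<rho> (inv\<^bsub>G'\<^esub> r) x) \<rightarrow> M x"
        using r rc by (auto simp: M_def R'.mult_mem G'.inv_mult_group R'.mem_carrier R'.act_mult)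
      show "(\<lambda>q. inv\<^bsub>G'\<^esub> r \<otimes>\<^bsub>G'\<^esub> q) \<in> M x \<rightarrow> M (\<rho> (inv\<^bsub>G'\<^esub> r) x)"
        using r rc by (auto simp: M_def R'.mult_mem R'.inv_mem G'.inv_mult_group R'.mem_carrier R'.act_mult)
    qed (auto simp: M_def rc R'.mem_carrier simp flip: G'.m_assoc)
    then show ?thesis by (rule bij_betw_same_card)
  qed
  define h where "h = (\<lambda>x. if x \<in> X' n then f x / of_nat (card (M x)) else 0)"
  have hs: "h \<in> supp_on (X' z)" using X_mono by (auto simp: h_def supp_on_def)
  have "res (A' h) = f"
  proof
    fix x
    show "res (A' h) x = f x"
    proof (cases "x \<in> X' n")
      case True
      have "\<one>\<^bsub>G'\<^esub> \<in> M x" using True R'.one_mem by (simp add: M_def R'.act_one)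
      moreover have finM: "finite (M x)" using R'.finR by (simp add: M_def)
      ultimately have c0: "card (M x) \<noteq> 0" by auto
      have "A' h x = (\<Sum>r\<in>R'. chi z side r * h (\<rho> (inv\<^bsub>G'\<^esub> r) x))"
        by (simp add: wsum_def sum_fun_apply pointwise pact_def)
      also have "\<dots> = (\<Sum>r\<in>M x. chi z side r * h (\<rho> (inv\<^bsub>G'\<^esub> r) x))"
        by (rule sum.mono_neutral_right) (auto simp: R'.finR M_def h_def)
      also have "\<dots> = (\<Sum>r\<in>M x. f x / of_nat (card (M x)))"
      proof (intro sum.cong refl)
        fix r assume "r \<in> M x"
        then have r: "r \<in> R'" "\<rho> (inv\<^bsub>G'\<^esub> r) x \<in> X' n" by (auto simp: M_def)
        have rc: "r \<in> carrier G'" by (rule R'.mem_carrier[OF r(1)])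
        let ?x = "\<rho> (inv\<^bsub>G'\<^esub> r) x"
        obtain r0 where r0: "r0 \<in> R" "\<rho> r0 ?x = x" "chi n side r0 = chi z side r"
          using row_group_descent[OF True r(2) r(1)] rc by auto
        have r0c: "r0 \<in> carrier G" by (rule R.mem_carrier[OF r0(1)])
        have "?x = \<rho> (inv\<^bsub>G\<^esub> r0) x" using r0(2) R.\<rho>_inv_\<rho>[OF r0c, of ?x] by simp
        then have "f ?x = pact G \<rho> r0 f x" by (simp add: pact_def)
        also have "\<dots> = chi n side r0 * f x" using f r0(1) by (auto simp: SI_def pointwise)
        finally have "chi z side r * f ?x = f x"
          using r0(3) R'.sq[OF r(1)] by (simp flip: mult.assoc)
        moreover have "h ?x = f ?x / of_nat (card (M x))" using r(2) by (simp add: h_def M_inv[OF r(1)])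
        ultimately show "chi z side r * h ?x = f x / of_nat (card (M x))"
          by (simp only: times_divide_eq_right)
      qed
      also have "\<dots> = f x" using c0 by simp
      finally show ?thesis using True by (simp add: res_def)
    next
      case False
      then show ?thesis using f by (auto simp: res_def SI_def supp_on_def)
    qed
  qed
  moreover have "A' h \<in> SI'" using A'_image hs by blast
  ultimately show ?thesis by blast
qed

lemma flip_z: "flip_at z \<in> C'" "flip_at z \<in> R'" "chi_sign z side (flip_at z) = 1" "chi z side (flip_at z) = 1"
  using flip_at_stab[of z z] chi_flip_at[of z z side] z_tail by (auto simp: chi_sign_def flip_at_def)

lemma mult_flip_z: "p z = z \<Longrightarrow> p permutes {1..z} \<Longrightarrow> (s, p) \<otimes>\<^bsub>G'\<^esub> flip_at z = (s(z := - s z), p)"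
  by (auto simp: flip_at_def hyperoct_simps fun_eq_iff permutes_inv_eq)

text \<open>
  The new number is alone in its column, so the larger column group is generated by the smaller one and
  one sign change, under which semi-invariants of the row group are fixed.
\<close>

lemma res_B':
  assumes f: "f \<in> SI'"
  shows "res (B' f) = fscale 2 (B (res f))"
proof -
  let ?fl = "\<lambda>c. c \<otimes>\<^bsub>G'\<^esub> flip_at z"
  have flip_f: "pact G' \<rho> (flip_at z) f = f" using f flip_z by (auto simp: SI'_def)
  have CC: "C \<subseteq> C'" by (rule stab_Suc)
  have Cs: "s z = 1 \<and> p z = z \<and> p permutes {1..z}" if "(s, p) \<in> C" for s p
  proof -
    have "(s, p) \<in> carrier G" using that by (simp add: stab_def)
    then show ?thesis using C'_fix[of s p z] CC that n hyperoct_permutes[of s p z] hyperoct_mono[of "(s, p)" n]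
      by (auto simp: hyperoct_simps)
  qed
  have eq: "C' = C \<union> ?fl ` C"
  proof
    show "C \<union> ?fl ` C \<subseteq> C'" using CC C'.mult_mem flip_z(1) by blast
    show "C' \<subseteq> C \<union> ?fl ` C"
    proof
      fix c assume c: "c \<in> C'"
      obtain s p where sp: "c = (s, p)" by (cases c)
      have cc: "(s, p) \<in> carrier G'" using c by (simp add: sp stab_def)
      have p: "p z = z" "p permutes {1..z}" using C'_fix[of s p z] c n hyperoct_permutes[OF cc] by (auto simp: sp)
      show "c \<in> C \<union> ?fl ` C"
      proof (cases "s z = 1")
        case True
        then show ?thesis using stab_restrict[of s p cl] c p by (simp add: sp)
      next
        case False
        then have sz: "s z = -1" using hyperoct_sign[OF cc, of z] by simp
        have "?fl c \<in> C'" using C'.mult_mem c flip_z(1) by blast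
        then have "(s(z := 1), p) \<in> C'" using mult_flip_z[OF p] sz by (simp add: sp)
        then have "(s(z := 1), p) \<in> C" using p by (intro stab_restrict) auto
        moreover have "?fl (s(z := 1), p) = c" using mult_flip_z[OF p] sz by (simp add: sp fun_upd_idem)
        ultimately show ?thesis by (metis UnI2 imageI)
      qed
    qed
  qed
  have disj: "C \<inter> ?fl ` C = {}"
  proof -
    have "fst (?fl c) z = -1" if "c \<in> C" for c
      using Cs[of "fst c" "snd c"] that mult_flip_z[of "snd c" "fst c"] by simp
    moreover have "fst c z = 1" if "c \<in> C" for c using Cs[of "fst c" "snd c"] that by simp
    ultimately have "?fl c \<notin> C" if "c \<in> C" for c using that by fastforce
    then show ?thesis by blast
  qed
  have inj: "inj_on ?fl C"
  proof (rule inj_onI)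
    fix c c' assume "c \<in> C" "c' \<in> C" "?fl c = ?fl c'"
    moreover have "c \<in> carrier G'" "c' \<in> carrier G'" "flip_at z \<in> carrier G'"
      using calculation(1,2) CC C'.mem_carrier flip_z(1) by (meson subsetD)+
    ultimately show "c = c'" using G'.right_cancel[of "flip_at z" c c'] by simp
  qed
  have t: "fscale (chi_sign z side (?fl c)) (pact G' \<rho> (?fl c) f) = fscale (chi_sign n side c) (pact G \<rho> c f)"
    if c: "c \<in> C" for c
  proof -
    have c': "c \<in> C'" by (rule subsetD[OF CC c])
    note cc = C.mem_carrier[OF c] c' C'.mem_carrier[OF c']
    show ?thesis
      using C'.mult[OF cc(2) flip_z(1)] flip_z(3) R'.P_mult[OF cc(3) C'.mem_carrier[OF flip_z(1)], of f] flip_f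
      by (simp add: chi_sign_Suc pact_hyperoct_Suc[OF cc(1)])
  qed
  have "B' f = (\<Sum>c\<in>C. fscale (chi_sign z side c) (pact G' \<rho> c f)) +
      (\<Sum>c\<in>C. fscale (chi_sign z side (?fl c)) (pact G' \<rho> (?fl c) f))"
    unfolding wsum_def using C.finR disj
    by (subst eq) (simp add: sum.union_disjoint sum.reindex[OF inj])
  also have "\<dots> = B f + B f"
    unfolding wsum_def
    by (intro arg_cong2[where f = "(+)"] sum.cong refl t)
      (auto simp: chi_sign_Suc pact_hyperoct_Suc C.mem_carrier)
  finally have B': "B' f = B f + B f" .
  have "res (B f) = B (res f)"
    unfolding wsum_def flinear_sum[OF flinear_res] flinear_scale[OF flinear_res]
  proof (intro sum.cong refl arg_cong2[where f = fscale])
    fix c assume c: "c \<in> C"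
    have "inv\<^bsub>G\<^esub> c \<in> carrier G" by (rule C.mem_carrier[OF C.inv_mem[OF c]])
    then show "res (pact G \<rho> c f) = pact G \<rho> c (res f)"
      by (auto simp: res_def pact_def R.stable_iff[OF stable_X(1)])
  qed
  then show ?thesis unfolding B' flinear_add[OF flinear_res]
    by (rule_tac ext) (simp add: pointwise)
qed

text \<open>
  Every element of the larger set leaves some number \<open>y\<close> beyond \<open>b\<close> free, as there are more than \<open>d\<close> of
  them. The transposition of \<open>y\<close> with the new number lies in the row group and normalizes the column
  group, which fixes both. So \<open>B' f\<close> is invariant under it, and the transposition moves the element
  into the smaller set, where \<open>B' f\<close> vanishes.
\<close>

lemma res_inj:
  assumes f: "f \<in> SI'" and r0: "res (B' f) = 0"
  shows "B' f = 0"
proof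
  fix x
  show "B' f x = 0 x"
  proof (cases "x \<in> X' z")
    case False
    have "f \<in> supp_on (X' z)" using f by (simp add: SI'_def)
    then have "B' f \<in> supp_on (X' z)" by (rule C'.gsub_A[OF R'.gsub_supp_on[OF stable_X(2)]])
    then show ?thesis using False by (simp add: supp_on_def pointwise)
  next
    case x: True
    have zero: "B' f x = 0" if "x \<in> X' n" for x
      using fun_cong[OF r0, of x] that by (simp add: res_def pointwise)
    have "card {Suc b..z} = z - b" by simp
    then have "card (supp x) < card {Suc b..z}" using conjunct2[OF supp_card[OF x]] n by linarith
    then have "\<not> {Suc b..z} \<subseteq> supp x" using supp_card[OF x] card_mono[of "supp x" "{Suc b..z}"] by auto
    then obtain y where y0: "y \<in> {Suc b..z}" "y \<notin> supp x" by blast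
    then have y: "b < y" "y \<le> z" "y \<notin> supp x" by auto
    show ?thesis
    proof (cases "y = z")
      case True
      then have "x \<in> X' n" using x y X_Suc[of n] by blast
      then show ?thesis using zero by (simp add: pointwise)
    next
      case False
      then have yn: "0 < y" "y \<le> n" using y by auto
      let ?\<tau> = "Transposition.transpose y z"
      let ?t = "((\<lambda>_. 1), ?\<tau>) :: signed_perm"
      have t: "?t \<in> R'" "chi z side ?t = 1" using swap_R'[OF yn] tail[OF y(1)] by auto
      have tc: "?t \<in> carrier G'" by (rule R'.mem_carrier[OF t(1)])
      have tt: "?t \<otimes>\<^bsub>G'\<^esub> ?t = \<one>\<^bsub>G'\<^esub>" by (simp add: hyperoct_simps)
      have ti: "inv\<^bsub>G'\<^esub> ?t = ?t" by (rule G'.inv_equality[OF tt tc tc])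
      let ?cj = "\<lambda>c. ?t \<otimes>\<^bsub>G'\<^esub> c \<otimes>\<^bsub>G'\<^esub> ?t"
      have S: "?t \<in> stab z side (\<lambda>_. 0)" "C' \<subseteq> stab z side (\<lambda>_. 0)" using t(1) by (auto simp: stab_def)
      have cj: "?cj c \<in> C'" if c: "c \<in> C'" for c
      proof -
        obtain s p where sp: "c = (s, p)" by (cases c)
        have cs: "(s, p) \<in> C'" using c unfolding sp .
        have "b < z" using n by simp
        note p = hyperoct_permutes[OF C'.mem_carrier[OF cs]] C'_fix[OF cs y(1,2)] C'_fix[OF cs this le_refl]
        have pi: "p i \<noteq> y" "p i \<noteq> z" if "i \<noteq> y" "i \<noteq> z" for i
          using p permutes_inj[OF p(1)] that by (metis injD)+
        have "snd (?cj c) i = p i" for i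
          using p pi[of i] by (auto simp: sp hyperoct_simps Transposition.transpose_def)
        then have "snd (?cj c) = p" by blast
        moreover have "?cj c \<in> carrier G'" using tc C'.mem_carrier[OF c] by simp
        ultimately show ?thesis using c by (cases "?cj c") (auto simp: sp stab_def)
      qed
      have cjs: "chi_sign z side (?cj c) = chi_sign z side c" if c: "c \<in> C'" for c
      proof -
        have cS: "c \<in> stab z side (\<lambda>_. 0)" using c S(2) by blast
        show ?thesis
          using S'.mult[OF S'.mult_mem[OF S(1) cS] S(1)] S'.mult[OF S(1) cS] S'.sq[OF S(1)] by simp
      qed
      have cjcj: "?cj (?cj c) = c" if "c \<in> carrier G'" for c
        using that tc tt by (simp add: G'.m_assoc) (simp flip: G'.m_assoc)
      have ft: "pact G' \<rho> ?t f = f" using f t by (auto simp: SI'_def)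
      have "pact G' \<rho> ?t (B' f) = (\<Sum>c\<in>C'. fscale (chi_sign z side c) (pact G' \<rho> (?t \<otimes>\<^bsub>G'\<^esub> c) f))"
        unfolding wsum_def flinear_sum[OF R'.flinear_P] flinear_scale[OF R'.flinear_P]
        by (intro sum.cong refl) (simp add: R'.P_mult tc C'.mem_carrier)
      also have "\<dots> = (\<Sum>c\<in>C'. fscale (chi_sign z side (?cj c)) (pact G' \<rho> (?cj c) f))"
      proof (intro sum.cong refl)
        fix c assume c: "c \<in> C'"
        have cc: "c \<in> carrier G'" by (rule C'.mem_carrier[OF c])
        have "pact G' \<rho> (?cj c) f = pact G' \<rho> (?t \<otimes>\<^bsub>G'\<^esub> c) (pact G' \<rho> ?t f)"
          using tc cc by (intro R'.P_mult) auto
        then show "fscale (chi_sign z side c) (pact G' \<rho> (?t \<otimes>\<^bsub>G'\<^esub> c) f) =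
          fscale (chi_sign z side (?cj c)) (pact G' \<rho> (?cj c) f)"
          by (simp only: cjs[OF c] ft)
      qed
      also have "\<dots> = B' f"
        unfolding wsum_def
        by (rule sum.reindex_bij_witness[of _ ?cj ?cj]) (simp_all only: cjcj[OF C'.mem_carrier] cj)
      finally have "pact G' \<rho> ?t (B' f) x = B' f x" by simp
      then have e: "B' f (\<rho> ?t x) = B' f x" by (simp add: pact_def ti)
      have "supp (\<rho> ?t x) = ?\<tau> ` supp x" by (rule supp_act[OF tc x])
      then have "z \<notin> supp (\<rho> ?t x)" using y(3) by (auto simp: Transposition.transpose_def split: if_splits)
      then have "\<rho> ?t x \<in> X' n" using stableX[OF tc x] X_Suc[of n] by blast
      then show ?thesis using zero e by (simp add: pointwise)
    qed
  qed
qed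

lemma subspace_SI: "fs.subspace SI" "fs.subspace SI'"
  unfolding A_image[symmetric] A'_image[symmetric]
  by (intro flinear_image_subspace R.flinear_A R'.flinear_A subspace_supp_on)+

text \<open>
  Restriction commutes with the column sums up to the factor 2, maps semi-invariants onto
  semi-invariants, and is injective on the image of the larger operator.
\<close>

theorem dim_lab_op_Suc:
  "fs.dim (lab_op \<rho> z side rw cl ` supp_on (X' z)) = fs.dim (lab_op \<rho> n side rw cl ` supp_on (X' n))"
proof -
  have 1: "lab_op \<rho> z side rw cl ` supp_on (X' z) = B' ` SI'"
    unfolding A'_image[symmetric] by (simp add: lab_op_def image_image)
  have 2: "lab_op \<rho> n side rw cl ` supp_on (X' n) = B ` SI"
    unfolding A_image[symmetric] by (simp add: lab_op_def image_image)
  have "res ` B' ` SI' = B ` SI"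
  proof
    show "res ` B' ` SI' \<subseteq> B ` SI"
    proof clarify
      fix f assume f: "f \<in> SI'"
      have "res (B' f) = B (fscale 2 (res f))" by (simp only: res_B'[OF f] flinear_scale[OF C.flinear_A])
      moreover have "fscale 2 (res f) \<in> SI" by (rule fs.subspace_scale[OF subspace_SI(1) res_SI'[OF f]])
      ultimately show "res (B' f) \<in> B ` SI" by (metis imageI)
    qed
    show "B ` SI \<subseteq> res ` B' ` SI'"
    proof clarify
      fix f assume "f \<in> SI"
      then have "fscale (1/2) f \<in> SI" by (rule fs.subspace_scale[OF subspace_SI(1)])
      then obtain f' where f': "f' \<in> SI'" "res f' = fscale (1/2) f" using SI_extends by blast
      then have "res (B' f') = B f" by (simp add: res_B' flinear_scale[OF C.flinear_A])
      then show "B f \<in> res ` B' ` SI'" using f'(1) by (metis imageI)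
    qed
  qed
  moreover have "inj_on res (B' ` SI')"
  proof (rule inj_onI)
    fix u v assume "u \<in> B' ` SI'" "v \<in> B' ` SI'" and e: "res u = res v"
    then obtain f g where fg: "f \<in> SI'" "u = B' f" "g \<in> SI'" "v = B' g" by blast
    have "f - g \<in> SI'" by (rule fs.subspace_diff[OF subspace_SI(2) fg(1,3)])
    moreover have "B' (f - g) = u - v" unfolding fg(2,4) by (rule flinear_diff[OF C'.flinear_A])
    moreover have "res (u - v) = 0" unfolding flinear_diff[OF flinear_res] e by simp
    ultimately have "u - v = 0" using res_inj by metis
    then show "u = v" by simp
  qed
  ultimately have "fs.dim (B ` SI) = fs.dim (B' ` SI')"
    using dim_inj_image[OF flinear_res _ flinear_image_subspace[OF C'.flinear_A subspace_SI(2)]] by metis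
  then show ?thesis unfolding 1 2 by simp
qed

end

end

section \<open>Standard fillings and their rotation\<close>

lemma tableau_row_Cons:
  assumes "m \<le> sum_list (a # l)"
  shows "tableau_row (a # l) m = (if m \<le> a then 0 else Suc (tableau_row l (m - a)))"
proof (cases "m \<le> a")
  case True
  then show ?thesis by (auto simp: tableau_row_def intro: Least_equality)
next
  case False
  let ?P = "\<lambda>i. m \<le> sum_list (take (Suc i) (a # l))"
  have "(LEAST i. ?P i) = Suc (LEAST i. ?P (Suc i))"
    by (rule Least_Suc[of ?P "length l"]) (use assms False in auto)
  also have "(LEAST i. ?P (Suc i)) = tableau_row l (m - a)"
    unfolding tableau_row_def by (rule arg_cong[of _ _ Least]) (use False in auto)
  finally show ?thesis using False by (simp add: tableau_row_def)
qed

lemma tableau_col_Cons: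
  assumes "m \<le> sum_list (a # l)"
  shows "tableau_col (a # l) m = (if m \<le> a then m else tableau_col l (m - a))"
  unfolding tableau_col_def tableau_row_Cons[OF assms] by simp

lemma tableau_bounds:
  assumes "m \<in> {1..sum_list l}"
  shows "tableau_row l m < length l \<and> 1 \<le> tableau_col l m \<and> tableau_col l m \<le> l ! tableau_row l m"
  using assms
proof (induction l arbitrary: m)
  case (Cons a l)
  show ?case
  proof (cases "m \<le> a")
    case False
    then have "m - a \<in> {1..sum_list l}" using Cons.prems by auto
    from Cons.IH[OF this] show ?thesis
      using False Cons.prems by (simp add: tableau_row_Cons tableau_col_Cons)
  qed (use Cons.prems in \<open>simp add: tableau_row_Cons tableau_col_Cons\<close>)
qed simp

lemma tableau_inj:
  assumes "m \<in> {1..sum_list l}" "m' \<in> {1..sum_list l}"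
    "tableau_row l m = tableau_row l m'" "tableau_col l m = tableau_col l m'"
  shows "m = m'"
proof -
  let ?S = "sum_list (take (tableau_row l m') l)"
  have "m - ?S = m' - ?S" using assms(3,4) by (simp add: tableau_col_def)
  moreover have "1 \<le> m' - ?S" using tableau_bounds[OF assms(2)] by (simp add: tableau_col_def)
  ultimately show ?thesis by linarith
qed

lemma tableau_cell:
  assumes "r < length l" "1 \<le> c" "c \<le> l ! r"
  shows "\<exists>m\<in>{1..sum_list l}. tableau_row l m = r \<and> tableau_col l m = c"
  using assms
proof (induction l arbitrary: r)
  case (Cons a l)
  show ?case
  proof (cases r)
    case 0
    then have "c \<in> {1..sum_list (a # l)}" "c \<le> a" using Cons.prems by auto
    then show ?thesis using 0
      by (intro bexI[of _ c]) (auto simp: tableau_row_Cons tableau_col_Cons)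
  next
    case (Suc r')
    then obtain m where m: "m \<in> {1..sum_list l}" "tableau_row l m = r'" "tableau_col l m = c"
      using Cons.IH[of r'] Cons.prems by auto
    then have "m + a \<in> {1..sum_list (a # l)}" "\<not> m + a \<le> a" by auto
    then show ?thesis using m Suc
      by (intro bexI[of _ "m + a"]) (auto simp: tableau_row_Cons tableau_col_Cons)
  qed
qed simp

lemma tableau_down:
  assumes "sorted_wrt (\<ge>) l" "m \<in> {1..sum_list l}" "r < tableau_row l m"
  shows "\<exists>m'\<in>{1..sum_list l}. tableau_row l m' = r \<and> tableau_col l m' = tableau_col l m"
proof (rule tableau_cell)
  show "r < length l" "1 \<le> tableau_col l m" using tableau_bounds[OF assms(2)] assms(3) by auto
  have "l ! tableau_row l m \<le> l ! r"
    using sorted_wrt_nth_less[OF assms(1,3)] tableau_bounds[OF assms(2)] by simp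
  then show "tableau_col l m \<le> l ! r" using tableau_bounds[OF assms(2)] by simp
qed

lemma labelling_blocks:
  assumes s: "sorted_wrt (\<ge>) lp" "sorted_wrt (\<ge>) lm" and k: "k = sum_list lp" "n = k + sum_list lm"
  shows "labelling n (\<lambda>i. k < i) (\<lambda>i. if i \<le> k then tableau_row lp i else tableau_row lm (i - k))
    (\<lambda>i. if i \<le> k then tableau_col lp i else tableau_col lm (i - k))"
  unfolding labelling_def
proof (intro conjI ballI allI impI)
  let ?rw = "\<lambda>i. if i \<le> k then tableau_row lp i else tableau_row lm (i - k)"
  let ?cl = "\<lambda>i. if i \<le> k then tableau_col lp i else tableau_col lm (i - k)"
  fix i assume i: "i \<in> {1..n}"
  {
    fix j assume j: "j \<in> {1..n}" and e: "(k < i) = (k < j) \<and> ?rw i = ?rw j \<and> ?cl i = ?cl j"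
    show "i = j"
    proof (cases "i \<le> k")
      case True
      then have "j \<le> k" using e by auto
      then show ?thesis using True e i j k by (intro tableau_inj[of i lp j]) auto
    next
      case False
      then have jk: "\<not> j \<le> k" using e by auto
      have "i - k = j - k"
        by (rule tableau_inj[of _ lm]) (use False jk e i j k in auto)
      then show ?thesis using False jk by simp
    qed
  }
  fix r assume r: "r < ?rw i"
  show "\<exists>j\<in>{1..n}. (k < j) = (k < i) \<and> ?cl j = ?cl i \<and> ?rw j = r"
  proof (cases "i \<le> k")
    case True
    then have "i \<in> {1..sum_list lp}" using i k by auto
    moreover have "r < tableau_row lp i" using r True by simp
    ultimately obtain j
      where "j \<in> {1..sum_list lp}" "tableau_row lp j = r" "tableau_col lp j = tableau_col lp i"
      using tableau_down[OF s(1)] by blast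
    then show ?thesis using True k by (intro bexI[of _ j]) auto
  next
    case False
    then have "i - k \<in> {1..sum_list lm}" using i k by auto
    moreover have "r < tableau_row lm (i - k)" using r False by simp
    ultimately obtain j
      where "j \<in> {1..sum_list lm}" "tableau_row lm j = r" "tableau_col lm j = tableau_col lm (i - k)"
      using tableau_down[OF s(2)] by blast
    then show ?thesis using False k by (intro bexI[of _ "j + k"]) auto
  qed
qed

text \<open>
  The rotation of \<open>1..K + t\<close> that moves the last \<open>t\<close> numbers to the front. It turns the filling in
  which the long first row comes first into one that does not depend on \<open>t\<close>.
\<close>

definition rotation :: "nat \<Rightarrow> nat \<Rightarrow> nat \<Rightarrow> nat" where
  "rotation K t i = (if i = 0 \<or> K + t < i then i else if i \<le> K then i + t else i - K)"

lemma rotation_permutes: "rotation K t permutes {1..K + t}"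
proof (rule bij_imp_permutes)
  show "bij_betw (rotation K t) {1..K + t} {1..K + t}"
    by (rule bij_betwI[where g = "\<lambda>i. if i \<le> t then i + K else i - t"]) (auto simp: rotation_def)
qed (auto simp: rotation_def)

text \<open>
  The filling with the first shape in \<open>1..sum_list lp\<close>, pushed down by one row, then the second
  shape, and then the first row of the first shape, which takes all further numbers.
\<close>

definition side_label :: "nat list \<Rightarrow> nat list \<Rightarrow> nat \<Rightarrow> bool" where
  "side_label lp lm i \<longleftrightarrow> sum_list lp < i \<and> i \<le> sum_list lp + sum_list lm"

definition row_label :: "nat list \<Rightarrow> nat list \<Rightarrow> nat \<Rightarrow> nat" where
  "row_label lp lm i = (if i \<le> sum_list lp then Suc (tableau_row lp i)
     else if i \<le> sum_list lp + sum_list lm then tableau_row lm (i - sum_list lp) else 0)"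

definition col_label :: "nat list \<Rightarrow> nat list \<Rightarrow> nat \<Rightarrow> nat" where
  "col_label lp lm i = (if i \<le> sum_list lp then tableau_col lp i
     else if i \<le> sum_list lp + sum_list lm then tableau_col lm (i - sum_list lp)
     else i - (sum_list lp + sum_list lm))"

lemma rotation_labels:
  fixes lp lm t defines "k \<equiv> t + sum_list lp" and "K \<equiv> sum_list lp + sum_list lm"
  assumes i: "i \<in> {1..K + t}"
  shows "side_label lp lm i \<longleftrightarrow> k < rotation K t i"
    and "row_label lp lm i = (if rotation K t i \<le> k then tableau_row (t # lp) (rotation K t i)
      else tableau_row lm (rotation K t i - k))"
    and "col_label lp lm i = (if rotation K t i \<le> k then tableau_col (t # lp) (rotation K t i)
      else tableau_col lm (rotation K t i - k))"
proof -
  consider "i \<le> sum_list lp" | "sum_list lp < i" "i \<le> K" | "K < i" by linarith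
  then have "(side_label lp lm i \<longleftrightarrow> k < rotation K t i) \<and>
    row_label lp lm i = (if rotation K t i \<le> k then tableau_row (t # lp) (rotation K t i)
      else tableau_row lm (rotation K t i - k)) \<and>
    col_label lp lm i = (if rotation K t i \<le> k then tableau_col (t # lp) (rotation K t i)
      else tableau_col lm (rotation K t i - k))"
  proof cases
    case 1
    then have r: "rotation K t i = i + t" using i by (auto simp: rotation_def K_def)
    show ?thesis unfolding r using 1 i
      by (auto simp: side_label_def row_label_def col_label_def k_def tableau_row_Cons tableau_col_Cons)
  next
    case 2
    then have r: "rotation K t i = i + t" using i by (auto simp: rotation_def)
    show ?thesis unfolding r using 2 i
      by (auto simp: side_label_def row_label_def col_label_def k_def K_def)
  next
    case 3
    then have r: "rotation K t i = i - K" using i by (auto simp: rotation_def)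
    show ?thesis unfolding r using 3 i
      by (auto simp: side_label_def row_label_def col_label_def k_def K_def tableau_row_Cons tableau_col_Cons)
  qed
  then show "side_label lp lm i \<longleftrightarrow> k < rotation K t i"
    and "row_label lp lm i = (if rotation K t i \<le> k then tableau_row (t # lp) (rotation K t i)
      else tableau_row lm (rotation K t i - k))"
    and "col_label lp lm i = (if rotation K t i \<le> k then tableau_col (t # lp) (rotation K t i)
      else tableau_col lm (rotation K t i - k))" by blast+
qed

section \<open>Transport of symmetrizers\<close>

text \<open>
  A bijection of \<open>G\<close>-sets that is equivariant up to a change \<open>\<kappa>\<close> of the group turns the symmetrizers
  of one set into those of the other.
\<close>

lemma dim_transport:
  assumes X: "finite_action G \<rho>" "\<And>g x. g \<in> carrier G \<Longrightarrow> x \<in> X' \<Longrightarrow> \<rho> g x \<in> X'"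
    and Y: "finite_action G \<rho>'" "\<And>g x. g \<in> carrier G \<Longrightarrow> x \<in> Y \<Longrightarrow> \<rho>' g x \<in> Y"
    and \<kappa>: "\<And>g. g \<in> carrier G \<Longrightarrow> \<kappa> g \<in> carrier G"
      "\<And>g. g \<in> carrier G \<Longrightarrow> \<kappa> (inv\<^bsub>G\<^esub> g) = inv\<^bsub>G\<^esub> (\<kappa> g)" "inj_on \<kappa> (carrier G)"
    and h: "bij_betw h X' Y"
      "\<And>g x. g \<in> carrier G \<Longrightarrow> x \<in> X' \<Longrightarrow> h (\<rho> g x) = \<rho>' (\<kappa> g) (h x)"
    and RC: "R \<subseteq> carrier G" "C \<subseteq> carrier G" "R' = \<kappa> ` R" "C' = \<kappa> ` C"
      "\<And>g. g \<in> carrier G \<Longrightarrow> \<alpha>' (\<kappa> g) = \<alpha> g" "\<And>g. g \<in> carrier G \<Longrightarrow> \<beta>' (\<kappa> g) = \<beta> g"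
  shows "fs.dim ((\<lambda>f. wsum G \<rho> C \<beta> (wsum G \<rho> R \<alpha> f)) ` supp_on X') =
    fs.dim ((\<lambda>f. wsum G \<rho>' C' \<beta>' (wsum G \<rho>' R' \<alpha>' f)) ` supp_on Y)"
proof -
  interpret a: finite_action G \<rho> by (rule X)
  interpret b: finite_action G \<rho>' by (rule Y)
  define T where "T f = (\<lambda>x. if x \<in> X' then f (h x) else 0)" for f :: "_ \<Rightarrow> rat"
  have T: "flinear T" by (auto simp: flinear_def T_def pointwise fun_eq_iff)
  have iff: "\<rho> g x \<in> X' \<longleftrightarrow> x \<in> X'" if "g \<in> carrier G" for g x
    using a.stable_iff[OF _ that] X(2) by (simp add: a.stable_def)
  have iff': "\<rho>' g x \<in> Y \<longleftrightarrow> x \<in> Y" if "g \<in> carrier G" for g x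
    using b.stable_iff[OF _ that] Y(2) by (simp add: b.stable_def)
  have P: "T (pact G \<rho>' (\<kappa> g) f) = pact G \<rho> g (T f)" if "g \<in> carrier G" for g f
    using that by (auto simp: T_def pact_def fun_eq_iff iff h(2) \<kappa>)
  have W: "T (wsum G \<rho>' (\<kappa> ` Z) w' f) = wsum G \<rho> Z w (T f)"
    if Z: "Z \<subseteq> carrier G" and w: "\<And>g. g \<in> carrier G \<Longrightarrow> w' (\<kappa> g) = w g" for Z w w' f
  proof -
    have "wsum G \<rho>' (\<kappa> ` Z) w' f = (\<Sum>r\<in>Z. fscale (w' (\<kappa> r)) (pact G \<rho>' (\<kappa> r) f))"
      unfolding wsum_def using inj_on_subset[OF \<kappa>(3) Z] by (simp add: sum.reindex)
    then have "T (wsum G \<rho>' (\<kappa> ` Z) w' f) = (\<Sum>r\<in>Z. T (fscale (w' (\<kappa> r)) (pact G \<rho>' (\<kappa> r) f)))"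
      by (simp add: flinear_sum[OF T])
    also have "\<dots> = wsum G \<rho> Z w (T f)"
      unfolding wsum_def using Z by (intro sum.cong) (auto simp: flinear_scale[OF T] P w subset_iff)
    finally show ?thesis .
  qed
  have S: "wsum G \<rho>' Z w f \<in> supp_on Y" if "Z \<subseteq> carrier G" "f \<in> supp_on Y" for Z w f
    unfolding wsum_def
    by (intro fs.subspace_sum[OF subspace_supp_on] fs.subspace_scale[OF subspace_supp_on])
      (use that iff' in \<open>auto simp: supp_on_def pact_def subset_iff\<close>)
  have TS: "T ` supp_on Y = supp_on X'"
  proof
    show "T ` supp_on Y \<subseteq> supp_on X'" by (auto simp: T_def supp_on_def)
    show "supp_on X' \<subseteq> T ` supp_on Y"
    proof
      fix f assume f: "f \<in> supp_on X'"
      define f' where "f' = (\<lambda>y. if y \<in> Y then f (inv_into X' h y) else 0)"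
      have "f' \<in> supp_on Y" by (simp add: f'_def supp_on_def)
      moreover have "T f' = f"
        using f bij_betw_apply[OF h(1)] bij_betw_inv_into_left[OF h(1)]
        by (auto simp: T_def f'_def supp_on_def fun_eq_iff)
      ultimately show "f \<in> T ` supp_on Y" by blast
    qed
  qed
  have inj: "inj_on T (supp_on Y)"
  proof (rule inj_onI, rule ext)
    fix f g y assume fg: "f \<in> supp_on Y" "g \<in> supp_on Y" "T f = T g"
    show "f y = g y"
    proof (cases "y \<in> Y")
      case True
      then obtain x where "x \<in> X'" "y = h x" using h(1) by (auto simp: bij_betw_def)
      then show ?thesis using fun_cong[OF fg(3), of x] by (simp add: T_def)
    qed (use fg in \<open>simp add: supp_on_def\<close>)
  qed
  let ?E = "\<lambda>f. wsum G \<rho>' C' \<beta>' (wsum G \<rho>' R' \<alpha>' f)"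
  have R': "R' \<subseteq> carrier G" "C' \<subseteq> carrier G" using RC \<kappa>(1) by auto
  have "flinear (wsum G \<rho>' Z w)" for Z w
    unfolding wsum_def flinear_def
    by (auto simp: pact_def fun_eq_iff sum_fun_apply pointwise sum.distrib sum_distrib_left algebra_simps)
  then have "flinear ?E" by (simp add: flinear_def)
  then have sub: "fs.subspace (?E ` supp_on Y)" by (rule flinear_image_subspace[OF _ subspace_supp_on])
  have "?E ` supp_on Y \<subseteq> supp_on Y" using S R' by blast
  then have i: "inj_on T (?E ` supp_on Y)" using inj inj_on_subset by blast
  have "T ` ?E ` supp_on Y = (\<lambda>f. wsum G \<rho> C \<beta> (wsum G \<rho> R \<alpha> f)) ` T ` supp_on Y"
    unfolding image_image RC(3,4) using RC by (intro image_cong) (simp_all add: W)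
  then show ?thesis using dim_inj_image[OF T i sub] by (simp add: TS)
qed

text \<open>Conjugation by the permutation carries the groups of one labelling to those of the other.\<close>

lemma dim_relabel:
  assumes act: "finite_action (hyperoct n) \<rho>" "\<And>g x. g \<in> carrier (hyperoct n) \<Longrightarrow> x \<in> X' \<Longrightarrow> \<rho> g x \<in> X'"
    and \<pi>: "\<pi> permutes {1..n}"
    and lab: "\<And>i. i \<in> {1..n} \<Longrightarrow> side (\<pi> i) = side' i \<and> rw (\<pi> i) = rw' i \<and> cl (\<pi> i) = cl' i"
  shows "fs.dim ((\<lambda>f. wsum (hyperoct n) \<rho> (stab n side' cl') (chi_sign n side')
      (wsum (hyperoct n) \<rho> (stab n side' rw') (chi n side') f)) ` supp_on X') =
    fs.dim ((\<lambda>f. wsum (hyperoct n) \<rho> (stab n side cl) (chi_sign n side)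
      (wsum (hyperoct n) \<rho> (stab n side rw) (chi n side) f)) ` supp_on X')"
proof -
  let ?G = "hyperoct n"
  let ?\<pi> = "((\<lambda>_. 1), \<pi>) :: signed_perm"
  interpret a: finite_action ?G \<rho> by (rule act)
  have \<pi>c: "?\<pi> \<in> carrier ?G" by (rule perm_carrier[OF \<pi>])
  define \<kappa> where "\<kappa> g = ?\<pi> \<otimes>\<^bsub>?G\<^esub> g \<otimes>\<^bsub>?G\<^esub> inv\<^bsub>?G\<^esub> ?\<pi>" for g
  define \<kappa>' where "\<kappa>' g = inv\<^bsub>?G\<^esub> ?\<pi> \<otimes>\<^bsub>?G\<^esub> g \<otimes>\<^bsub>?G\<^esub> ?\<pi>" for g
  have \<kappa>_eq: "\<kappa> (s, p) = (\<lambda>i. s (inv_into UNIV \<pi> i), \<pi> \<circ> p \<circ> inv_into UNIV \<pi>)" for s p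
    by (simp add: \<kappa>_def inv_hyperoct[OF \<pi>c]) (simp add: hyperoct_simps)
  have \<kappa>c: "\<kappa> g \<in> carrier ?G" "\<kappa>' g \<in> carrier ?G" if "g \<in> carrier ?G" for g
    using that \<pi>c unfolding \<kappa>_def \<kappa>'_def by (auto intro!: a.m_closed a.inv_closed simp del: split_paired_All)
  have \<kappa>\<kappa>: "\<kappa> (\<kappa>' g) = g" "\<kappa>' (\<kappa> g) = g" if "g \<in> carrier ?G" for g
  proof -
    have ic: "inv\<^bsub>?G\<^esub> ?\<pi> \<in> carrier ?G" by (rule a.inv_closed[OF \<pi>c])
    have 1: "?\<pi> \<otimes>\<^bsub>?G\<^esub> (inv\<^bsub>?G\<^esub> ?\<pi> \<otimes>\<^bsub>?G\<^esub> x) = x" "inv\<^bsub>?G\<^esub> ?\<pi> \<otimes>\<^bsub>?G\<^esub> (?\<pi> \<otimes>\<^bsub>?G\<^esub> x) = x"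
      if "x \<in> carrier ?G" for x
      using a.m_assoc[OF \<pi>c ic that] a.m_assoc[OF ic \<pi>c that] a.r_inv[OF \<pi>c] a.l_inv[OF \<pi>c]
        a.l_one[OF that] by metis+
    show "\<kappa> (\<kappa>' g) = g" "\<kappa>' (\<kappa> g) = g"
      unfolding \<kappa>_def \<kappa>'_def
      by (simp_all only: a.m_assoc \<pi>c ic that a.m_closed 1 a.r_inv a.l_inv a.r_one)
  qed
  have \<kappa>m: "?\<pi> \<otimes>\<^bsub>?G\<^esub> g = \<kappa> g \<otimes>\<^bsub>?G\<^esub> ?\<pi>" if "g \<in> carrier ?G" for g
    unfolding \<kappa>_def by (simp only: a.m_assoc \<pi>c that a.m_closed a.inv_closed a.l_inv a.r_one)
  have \<pi>i: "\<pi> (inv_into UNIV \<pi> i) = i" "inv_into UNIV \<pi> (\<pi> i) = i" for i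
    by (rule permutes_inverses[OF \<pi>])+
  have st: "\<kappa> g \<in> stab n side f \<longleftrightarrow> g \<in> stab n side' f'"
    if g: "g \<in> carrier ?G" and f: "\<And>i. i \<in> {1..n} \<Longrightarrow> f (\<pi> i) = f' i" for g f f'
  proof -
    obtain s p where sp: "g = (s, p)" by (cases g)
    have p: "p permutes {1..n}" by (rule hyperoct_permutes[OF g[unfolded sp]])
    have pi: "p i \<in> {1..n}" if "i \<in> {1..n}" for i using permutes_in_image[OF p] that by blast
    have "(\<forall>i\<in>{1..n}. side (\<pi> (p (inv_into UNIV \<pi> i))) = side i \<and> f (\<pi> (p (inv_into UNIV \<pi> i))) = f i) \<longleftrightarrow>
      (\<forall>i\<in>\<pi> ` {1..n}. side (\<pi> (p (inv_into UNIV \<pi> i))) = side i \<and> f (\<pi> (p (inv_into UNIV \<pi> i))) = f i)"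
      by (simp only: permutes_image[OF \<pi>])
    also have "\<dots> \<longleftrightarrow> (\<forall>i\<in>{1..n}. side (\<pi> (p i)) = side (\<pi> i) \<and> f (\<pi> (p i)) = f (\<pi> i))"
      by (simp only: ball_simps \<pi>i)
    also have "\<dots> \<longleftrightarrow> (\<forall>i\<in>{1..n}. side' (p i) = side' i \<and> f' (p i) = f' i)"
      using lab f pi by (intro ball_cong refl) simp
    finally show ?thesis
      using \<kappa>c(1)[OF g] g unfolding sp \<kappa>_eq by (simp add: stab_def)
  qed
  have im: "stab n side f = \<kappa> ` stab n side' f'" if f: "\<And>i. i \<in> {1..n} \<Longrightarrow> f (\<pi> i) = f' i" for f f'
  proof
    show "\<kappa> ` stab n side' f' \<subseteq> stab n side f"
    proof (rule image_subsetI)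
      fix g assume g: "g \<in> stab n side' f'"
      then have "g \<in> carrier ?G" by (auto simp: stab_def)
      then show "\<kappa> g \<in> stab n side f" using st[where f = f and f' = f', OF _ f] g by blast
    qed
    show "stab n side f \<subseteq> \<kappa> ` stab n side' f'"
    proof
      fix g assume g: "g \<in> stab n side f"
      then have gc: "g \<in> carrier ?G" by (auto simp: stab_def)
      show "g \<in> \<kappa> ` stab n side' f'"
        using st[where f = f and f' = f', OF \<kappa>c(2)[OF gc] f] \<kappa>\<kappa>(1)[OF gc] g by (intro image_eqI[of _ _ "\<kappa>' g"]) auto
    qed
  qed
  have chi: "chi n side (\<kappa> g) = chi n side' g" if "g \<in> carrier ?G" for g
  proof -
    obtain s p where sp: "g = (s, p)" by (cases g)
    have "bij_betw \<pi> {i\<in>{1..n}. side' i} {i\<in>{1..n}. side i}"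
    proof (rule bij_betw_imageI)
      show "inj_on \<pi> {i\<in>{1..n}. side' i}" using permutes_inj[OF \<pi>] inj_on_subset by blast
      have "{i\<in>{1..n}. side i} \<subseteq> \<pi> ` {i\<in>{1..n}. side' i}"
      proof
        fix i assume i: "i \<in> {i\<in>{1..n}. side i}"
        then have "inv_into UNIV \<pi> i \<in> {1..n}" using permutes_in_image[OF permutes_inv[OF \<pi>]] by blast
        then show "i \<in> \<pi> ` {i\<in>{1..n}. side' i}"
          using lab[of "inv_into UNIV \<pi> i"] i \<pi>i by (intro image_eqI[of _ _ "inv_into UNIV \<pi> i"]) auto
      qed
      then show "\<pi> ` {i\<in>{1..n}. side' i} = {i\<in>{1..n}. side i}"
        using lab permutes_in_image[OF \<pi>] by auto
    qed
    from prod.reindex_bij_betw[OF this, of "\<lambda>i. rat_of_int (s (inv_into UNIV \<pi> i))"]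
    show ?thesis unfolding sp \<kappa>_eq by (simp add: chi_def \<pi>i)
  qed
  have sgn: "chi_sign n side (\<kappa> g) = chi_sign n side' g" if g: "g \<in> carrier ?G" for g
  proof -
    obtain s p where sp: "g = (s, p)" by (cases g)
    have p: "p permutes {1..n}" by (rule hyperoct_permutes[OF g[unfolded sp]])
    have "permutation p" "permutation \<pi>" "permutation (inv_into UNIV \<pi>)"
      using p \<pi> permutes_inv[OF \<pi>] finite_atLeastAtMost permutes_imp_permutation by blast+
    then have "sign (\<pi> \<circ> p \<circ> inv_into UNIV \<pi>) = sign p"
      by (simp add: sign_compose permutation_compose sign_inverse)
    then show ?thesis using chi[OF g] unfolding sp \<kappa>_eq by (simp add: chi_sign_def)
  qed
  show ?thesis
  proof (rule dim_transport[where \<kappa> = \<kappa> and h = "\<rho> ?\<pi>", OF act act])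
    show "inj_on \<kappa> (carrier ?G)" using \<kappa>\<kappa>(2) by (metis inj_onI)
    show "\<kappa> (inv\<^bsub>?G\<^esub> g) = inv\<^bsub>?G\<^esub> (\<kappa> g)" if "g \<in> carrier ?G" for g
      unfolding \<kappa>_def
      by (simp only: a.inv_mult_group a.m_assoc \<pi>c that a.m_closed a.inv_closed a.inv_inv)
    show "\<rho> ?\<pi> (\<rho> g x) = \<rho> (\<kappa> g) (\<rho> ?\<pi> x)" if "g \<in> carrier ?G" for g x
      using a.act_mult[OF \<pi>c that, of x] a.act_mult[OF \<kappa>c(1)[OF that] \<pi>c, of x] \<kappa>m[OF that] by simp
    have "\<rho> (inv\<^bsub>?G\<^esub> ?\<pi>) (\<rho> ?\<pi> x) = x" "\<rho> ?\<pi> (\<rho> (inv\<^bsub>?G\<^esub> ?\<pi>) x) = x" for x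
      using a.act_mult[OF \<pi>c a.inv_closed[OF \<pi>c], of x] a.act_mult[OF a.inv_closed[OF \<pi>c] \<pi>c, of x]
        a.r_inv[OF \<pi>c] a.l_inv[OF \<pi>c] a.act_one[of x] by simp_all
    then show "bij_betw (\<rho> ?\<pi>) X' X'"
      by (intro bij_betwI[where g = "\<rho> (inv\<^bsub>?G\<^esub> ?\<pi>)"]) (use act(2) \<pi>c a.inv_closed[OF \<pi>c] in auto)
    show "stab n side rw = \<kappa> ` stab n side' rw'" "stab n side cl = \<kappa> ` stab n side' cl'"
      by (rule im, use lab in blast)+
  qed (use \<kappa>c chi sgn in \<open>auto simp: stab_def\<close>)
qed

section \<open>Faces of cross-polytopes\<close>

type_synonym vec = "nat \<Rightarrow>\<^sub>0 real"

abbreviation "coord \<equiv> Poly_Mapping.lookup"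

definition verts :: "nat \<Rightarrow> vec set" where
  "verts n = (\<lambda>i. Poly_Mapping.single i 1) ` {1..n} \<union> (\<lambda>i. - Poly_Mapping.single i 1) ` {1..n}"

text \<open>The vertex sets of the proper faces.\<close>

definition afaces :: "nat \<Rightarrow> vec set set" where
  "afaces n = {A. A \<subseteq> verts n \<and> (\<forall>a\<in>A. - a \<notin> A)}"

lemma cross_polytope_eq: "cross_polytope n = convex hull (verts n)"
  by (simp add: cross_polytope_def verts_def)

lemma finite_verts: "finite (verts n)"
  by (simp add: verts_def)

lemma coord_scaleR: "coord (c *\<^sub>R x) i = c * coord x i" for x :: vec
proof -
  have "finite {i. c * coord x i \<noteq> 0}"
    by (rule finite_subset[OF _ finite_keys[of x]]) (auto simp: in_keys_iff)
  then show ?thesis by (simp add: scaleR_poly_mapping_def Abs_poly_mapping_inverse)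
qed

lemmas coord_simps = coord_scaleR lookup_add lookup_minus lookup_uminus lookup_single when_def

lemma vertsE:
  assumes "v \<in> verts n"
  obtains i e where "i \<in> {1..n}" "e = 1 \<or> e = -1" "v = Poly_Mapping.single i e"
proof -
  from assms consider i where "i \<in> {1..n}" "v = Poly_Mapping.single i 1"
    | i where "i \<in> {1..n}" "v = Poly_Mapping.single i (- 1)"
    by (auto simp: verts_def single_uminus)
  then show ?thesis
  proof cases
    case (1 i)
    then show ?thesis using that[of i 1] by simp
  next
    case (2 i)
    then show ?thesis using that[of i "-1"] by simp
  qed
qed

lemma verts_uminus: "v \<in> verts n \<Longrightarrow> - v \<in> verts n"
  by (auto simp: verts_def)

text \<open>
  The linear form with value \<open>1\<close> on \<open>A\<close>, \<open>-1\<close> on the antipodes of \<open>A\<close> and \<open>0\<close> on all other vertices. It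
  supports the cross-polytope along the face spanned by \<open>A\<close>.
\<close>

definition face_form :: "nat \<Rightarrow> vec set \<Rightarrow> vec \<Rightarrow> real" where
  "face_form n A x = (\<Sum>i\<in>{1..n}. ((if Poly_Mapping.single i 1 \<in> A then 1 else 0) -
     (if - Poly_Mapping.single i 1 \<in> A then 1 else 0)) * coord x i)"

lemma face_form_linear:
  "face_form n A (x + y) = face_form n A x + face_form n A y"
  "face_form n A (c *\<^sub>R x) = c * face_form n A x"
proof -
  show "face_form n A (x + y) = face_form n A x + face_form n A y"
    unfolding face_form_def sum.distrib[symmetric] by (intro sum.cong refl) (simp add: lookup_add distrib_left)
  show "face_form n A (c *\<^sub>R x) = c * face_form n A x"
    unfolding face_form_def sum_distrib_left by (intro sum.cong refl) (simp add: coord_scaleR)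
qed

lemma face_form_vertex:
  assumes A: "A \<in> afaces n" and v: "v \<in> verts n"
  shows "face_form n A v = (if v \<in> A then 1 else if - v \<in> A then -1 else 0)"
proof -
  obtain i e where i: "i \<in> {1..n}" "e = 1 \<or> e = -1" "v = Poly_Mapping.single i e" by (rule vertsE[OF v])
  let ?e = "Poly_Mapping.single i (1::real)"
  have "face_form n A v = (\<Sum>j\<in>{1..n}. if j = i then ((if ?e \<in> A then 1 else 0) -
     (if - ?e \<in> A then 1 else 0)) * e else 0)"
    unfolding face_form_def i(3) by (intro sum.cong) (auto simp: lookup_single when_def)
  also have "\<dots> = ((if ?e \<in> A then 1 else 0) - (if - ?e \<in> A then 1 else 0)) * e"
    using i(1) by simp
  finally have f: "face_form n A v = ((if ?e \<in> A then 1 else 0) - (if - ?e \<in> A then 1 else 0)) * e" .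
  have "\<not> (?e \<in> A \<and> - ?e \<in> A)" using A by (auto simp: afaces_def)
  moreover have "v = ?e \<and> e = 1 \<or> v = - ?e \<and> e = -1" using i(2,3) by (auto simp: single_uminus)
  ultimately show ?thesis unfolding f by auto
qed

lemma face_form_hull:
  assumes "A \<in> afaces n" "x \<in> affine hull A" shows "face_form n A x = 1"
proof -
  have "affine {x. face_form n A x = 1}" by (auto simp: affine_def face_form_linear)
  moreover have "A \<subseteq> {x. face_form n A x = 1}"
    using assms(1) face_form_vertex[OF assms(1)] by (auto simp: afaces_def)
  ultimately have "affine hull A \<subseteq> {x. face_form n A x = 1}" by (metis hull_minimal)
  then show ?thesis using assms(2) by blast
qed

lemma face_form_other:
  assumes "A \<in> afaces n" "x \<in> convex hull (verts n - A)" shows "face_form n A x \<le> 0"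
proof -
  have "convex {x. face_form n A x \<le> 0}"
    by (auto simp: convex_def face_form_linear mult_nonneg_nonpos intro!: add_nonpos_nonpos)
  moreover have "verts n - A \<subseteq> {x. face_form n A x \<le> 0}"
    using face_form_vertex[OF assms(1)] by auto
  ultimately have "convex hull (verts n - A) \<subseteq> {x. face_form n A x \<le> 0}" by (metis hull_minimal)
  then show ?thesis using assms(2) by blast
qed

lemma vertex_in_hull: "A \<in> afaces n \<Longrightarrow> v \<in> verts n \<Longrightarrow> v \<in> convex hull A \<Longrightarrow> v \<in> A"
  using face_form_hull[of A n v] face_form_vertex[of A n v] convex_hull_subset_affine_hull[of A]
  by (auto split: if_splits)

lemma hull_face:
  assumes "A \<in> afaces n" shows "convex hull A face_of cross_polytope n"
  unfolding cross_polytope_eq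
proof (rule face_of_convex_hulls[OF finite_verts])
  show "A \<subseteq> verts n" using assms by (auto simp: afaces_def)
  show "affine hull A \<inter> convex hull (verts n - A) = {}"
    using face_form_hull[OF assms] face_form_other[OF assms] by fastforce
qed

text \<open>
  In a convex combination of vertices that lies in a face, the vertices with positive weight lie in the
  face as well.
\<close>

lemma face_vertices:
  fixes S :: "'a::real_vector set"
  assumes S: "finite S" and F: "F face_of convex hull S"
  shows "F = convex hull (S \<inter> F)"
proof
  show "convex hull (S \<inter> F) \<subseteq> F"
    using face_of_imp_convex[OF F] by (intro hull_minimal) auto
  show "F \<subseteq> convex hull (S \<inter> F)"
  proof
    fix x assume x: "x \<in> F"
    then have "x \<in> convex hull S" using face_of_imp_subset[OF F] by blast
    then obtain u where u: "\<forall>v\<in>S. 0 \<le> u v" "sum u S = 1" "(\<Sum>v\<in>S. u v *\<^sub>R v) = x"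
      unfolding convex_hull_finite[OF S] by blast
    have vF: "v \<in> F" if v: "v \<in> S" "u v \<noteq> 0" for v
    proof (cases "u v = 1")
      case True
      then have "sum u (S - {v}) = 0" using u(2) S v by (simp add: sum_diff1)
      then have "\<forall>w\<in>S - {v}. u w = 0" using u(1) S by (subst (asm) sum_nonneg_eq_0_iff) auto
      then have "(\<Sum>w\<in>S - {v}. u w *\<^sub>R w) = 0" by (simp add: sum.neutral)
      then have "x = v" using u(3) True sum.remove[OF S v(1), of "\<lambda>w. u w *\<^sub>R w"] by simp
      then show ?thesis using x by simp
    next
      case False
      have le: "u v \<le> 1" using u S v(1) by (metis sum_nonneg_leq_bound member_le_sum)
      then have c: "0 < u v" "0 < 1 - u v" using u(1) v False by (auto simp: less_le)
      define y where "y = (\<Sum>w\<in>S - {v}. (u w / (1 - u v)) *\<^sub>R w)"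
      have s: "sum u (S - {v}) = 1 - u v" using u(2) S v by (simp add: sum_diff1)
      have "y \<in> convex hull (S - {v})"
        unfolding y_def convex_hull_finite[OF finite_Diff[OF S]]
        using u(1) c s by (auto intro!: exI[of _ "\<lambda>w. u w / (1 - u v)"] simp flip: sum_divide_distrib)
      then have yS: "y \<in> convex hull S" using hull_mono[of "S - {v}" S convex] by blast
      have "(1 - u v) *\<^sub>R y = (\<Sum>w\<in>S - {v}. u w *\<^sub>R w)"
        using c by (simp add: y_def scaleR_sum_right)
      then have xe: "x = (1 - u v) *\<^sub>R y + u v *\<^sub>R v"
        using u(3) sum.remove[OF S v(1), of "\<lambda>w. u w *\<^sub>R w"] by (simp add: add.commute)
      show ?thesis
      proof (cases "y = v")
        case True
        then have "x = v" using xe by (simp flip: scaleR_left_distrib)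
        then show ?thesis using x by simp
      next
        case False
        then have "x \<in> open_segment y v" using xe c by (auto simp: in_segment)
        then show ?thesis
          using F x yS hull_inc[OF v(1), of convex] unfolding face_of_def by blast
      qed
    qed
    have "sum u (S \<inter> F) = sum u S" using S vF by (intro sum.mono_neutral_left) auto
    moreover have "(\<Sum>v\<in>S \<inter> F. u v *\<^sub>R v) = (\<Sum>v\<in>S. u v *\<^sub>R v)"
      using S vF by (intro sum.mono_neutral_left) auto
    ultimately show "x \<in> convex hull (S \<inter> F)"
      unfolding convex_hull_finite[OF finite_Int[OF disjI1[OF S]]] using u by auto
  qed
qed

text \<open>
  A face that contains two antipodes contains the center, and with it every pair of antipodes.
\<close>

lemma proper_face:
  assumes F: "F face_of cross_polytope n" "F \<noteq> cross_polytope n"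
  shows "verts n \<inter> F \<in> afaces n" "F = convex hull (verts n \<inter> F)"
proof -
  show e: "F = convex hull (verts n \<inter> F)"
    using face_vertices[OF finite_verts] F(1) unfolding cross_polytope_eq by blast
  have fc: "convex F" by (rule face_of_imp_convex[OF F(1)])
  have "- a \<notin> F" if a: "a \<in> F" "a \<in> verts n" for a
  proof
    assume "- a \<in> F"
    then have "(1/2) *\<^sub>R a + (1/2) *\<^sub>R (- a) \<in> F"
      using a fc unfolding convex_def by (metis add_divide_distrib div_self divide_nonneg_nonneg
          one_add_one zero_le_numeral zero_le_one zero_neq_numeral)
    then have 0: "0 \<in> F" by simp
    have "v \<in> F" if v: "v \<in> verts n" for v
    proof -
      have "v \<noteq> 0" using v by (auto elim!: vertsE simp: single_zero dest!: arg_cong[of _ _ Poly_Mapping.keys])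
      then have "v \<noteq> - v" by simp
      moreover have "0 = (1 - 1/2) *\<^sub>R v + (1/2) *\<^sub>R (- v)" by simp
      ultimately have "0 \<in> open_segment v (- v)" 
        unfolding in_segment by (intro conjI exI[of _ "1/2"]) simp_all
      then show ?thesis
        using F(1) 0 hull_inc[OF v, of convex] hull_inc[OF verts_uminus[OF v], of convex]
        unfolding face_of_def cross_polytope_eq by blast
    qed
    then have "cross_polytope n \<subseteq> F" unfolding cross_polytope_eq using fc by (intro hull_minimal) auto
    then show False using F face_of_imp_subset by blast
  qed
  then show "verts n \<inter> F \<in> afaces n" by (auto simp: afaces_def)
qed

lemma affine_independent_afaces:
  assumes "A \<in> afaces n" shows "\<not> affine_dependent A"
proof
  have A: "A \<subseteq> verts n" and anti: "\<And>a. a \<in> A \<Longrightarrow> - a \<notin> A" using assms by (auto simp: afaces_def)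
  have fin: "finite A" using finite_subset[OF A finite_verts] .
  assume "affine_dependent A"
  then obtain U v where U: "v \<in> A" "U v \<noteq> 0" "(\<Sum>w\<in>A. U w *\<^sub>R w) = 0"
    unfolding affine_dependent_explicit_finite[OF fin] by blast
  obtain i e where i: "i \<in> {1..n}" "e = 1 \<or> e = -1" "v = Poly_Mapping.single i e"
    using vertsE[of v n] A U(1) by blast
  have "coord w i = 0" if w: "w \<in> A" "w \<noteq> v" for w
  proof -
    obtain j e' where j: "e' = 1 \<or> e' = -1" "w = Poly_Mapping.single j e'" using vertsE[of w n] A w(1) by blast
    have "j \<noteq> i"
    proof
      assume "j = i"
      then have "w = - v" using j i w(2) by (auto simp: single_uminus)
      then show False using anti[OF U(1)] w(1) by simp
    qed
    then show ?thesis by (simp add: j lookup_single)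
  qed
  then have "(\<Sum>w\<in>A. U w * coord w i) = U v * coord v i"
    using fin U(1) by (subst sum.remove[of A v]) (auto intro: sum.neutral)
  moreover have "(\<Sum>w\<in>A. U w * coord w i) = coord (\<Sum>w\<in>A. U w *\<^sub>R w) i"
    by (simp add: lookup_sum coord_scaleR)
  ultimately show False using U i by auto
qed

text \<open>
  After translation of a point to the origin this is the exchange lemma for linearly independent sets.
  It makes the number \<open>d\<close> in \<open>has_aff_dim\<close> unique.
\<close>

lemma affine_independent_card_le:
  fixes A B :: "'a::real_vector set"
  assumes A: "finite A" "a \<in> A" and B: "\<not> affine_dependent B" "B \<subseteq> affine hull A" "finite B"
  shows "card B \<le> card A"
proof (cases "B = {}")
  case False
  then obtain b where b: "b \<in> B" by blast
  let ?T = "(\<lambda>x. - a + x) ` (A - {a})"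
  have T: "x - a \<in> span ?T" if "x \<in> B" for x
    using that B(2) unfolding affine_hull_span2[OF A(2)] by (auto simp: algebra_simps)
  have "(\<lambda>x. - b + x) ` (B - {b}) \<subseteq> span ?T"
  proof (rule image_subsetI)
    fix x assume "x \<in> B - {b}"
    then have x: "x \<in> B" by blast
    have "(x - a) - (b - a) \<in> span ?T" by (intro span_diff T x b)
    then show "- b + x \<in> span ?T" by (simp add: algebra_simps)
  qed
  moreover have "independent ((\<lambda>x. - b + x) ` (B - {b}))"
    using B(1) affine_dependent_iff_dependent2[OF b] by simp
  ultimately have "card ((\<lambda>x. - b + x) ` (B - {b})) \<le> card ?T"
    using A(1) by (intro independent_span_bound[THEN conjunct2]) auto
  also have "\<dots> \<le> card (A - {a})" using A(1) by (intro card_image_le) auto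
  finally have "card (B - {b}) \<le> card (A - {a})" by (subst (asm) card_image) auto
  then show ?thesis using A b B(3) by (simp add: card_gt_0_iff) (metis One_nat_def Suc_pred card_gt_0_iff empty_iff le_Suc_eq Suc_le_mono)
qed simp

lemma has_aff_dim_hull:
  assumes "A \<in> afaces n" "A \<noteq> {}"
  shows "has_aff_dim (convex hull A) d \<longleftrightarrow> card A = Suc d"
proof
  have fin: "finite A" using assms finite_subset[OF _ finite_verts] by (auto simp: afaces_def)
  note ind = affine_independent_afaces[OF assms(1)]
  obtain a where a: "a \<in> A" using assms by blast
  show "has_aff_dim (convex hull A) d" if "card A = Suc d"
    unfolding has_aff_dim_def using that ind by (intro exI[of _ A]) simp
  assume "has_aff_dim (convex hull A) d"
  then obtain B where B: "affine hull B = affine hull A" "\<not> affine_dependent B" "card B = Suc d"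
    by (auto simp: has_aff_dim_def)
  have finB: "finite B" using B(3) by (auto intro: card_ge_0_finite)
  then obtain b where b: "b \<in> B" using B(3) by fastforce
  have "A \<subseteq> affine hull B" "B \<subseteq> affine hull A" using B(1) hull_subset by metis+
  then have "card B = card A"
    using affine_independent_card_le[OF fin a B(2) _ finB] affine_independent_card_le[OF finB b ind _ fin] by simp
  then show "card A = Suc d" using B(3) by simp
qed

definition face_family :: "nat set \<Rightarrow> nat \<Rightarrow> vec set set" where
  "face_family S n = (\<lambda>A. convex hull A) ` {A \<in> afaces n. card A \<in> Suc ` S}"

text \<open>
  Adding the cross-polytope itself absorbs the case in which its own dimension lies in \<open>S\<close>.
\<close>

lemma rank_selected_eq: "rank_selected S n = face_family S n \<union> {{}, cross_polytope n}"
proof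
  show "rank_selected S n \<subseteq> face_family S n \<union> {{}, cross_polytope n}"
  proof
    fix F assume F: "F \<in> rank_selected S n"
    show "F \<in> face_family S n \<union> {{}, cross_polytope n}"
    proof (cases "F = {} \<or> F = cross_polytope n")
      case False
      then obtain d where d: "F face_of cross_polytope n" "d \<in> S" "has_aff_dim F d"
        using F by (auto simp: rank_selected_def)
      note p = proper_face[OF d(1)]
      have ne: "verts n \<inter> F \<noteq> {}" using False p(2) by auto
      have "card (verts n \<inter> F) = Suc d" using has_aff_dim_hull[OF p(1) ne, of d] False d(3) p(2) by simp
      then show ?thesis using False p d(2) by (auto simp: face_family_def)
    qed auto
  qed
  show "face_family S n \<union> {{}, cross_polytope n} \<subseteq> rank_selected S n"
  proof -
    have "convex hull A \<in> rank_selected S n" if "A \<in> afaces n" "card A = Suc d" "d \<in> S" for A d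
      using that hull_face[OF that(1)] has_aff_dim_hull[OF that(1), of d] by (force simp: rank_selected_def)
    moreover have "{} \<in> rank_selected S n" "cross_polytope n \<in> rank_selected S n"
      by (simp_all add: rank_selected_def)
    ultimately show ?thesis unfolding face_family_def by blast
  qed
qed

lemma face_family_proper:
  assumes "1 \<le> n" "F \<in> face_family S n"
  shows "F \<noteq> {}" "F \<noteq> cross_polytope n" "F \<subseteq> cross_polytope n"
proof -
  obtain A where A: "A \<in> afaces n" "F = convex hull A" "card A \<noteq> 0" using assms(2) by (auto simp: face_family_def)
  show "F \<noteq> {}" using A by auto
  show "F \<subseteq> cross_polytope n" using hull_face[OF A(1)] A(2) face_of_imp_subset by blast
  let ?v = "Poly_Mapping.single 1 (1::real)"
  have v: "?v \<in> verts n" using assms(1) by (auto simp: verts_def)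
  have "\<not> {?v, - ?v} \<subseteq> convex hull A"
    using vertex_in_hull[OF A(1) v] vertex_in_hull[OF A(1) verts_uminus[OF v]] A(1) by (auto simp: afaces_def)
  moreover have "{?v, - ?v} \<subseteq> cross_polytope n"
    using hull_inc[OF v, of convex] hull_inc[OF verts_uminus[OF v], of convex] unfolding cross_polytope_eq by simp
  ultimately show "F \<noteq> cross_polytope n" using A(2) by auto
qed

lemma finite_face_family: "finite (face_family S n)"
  by (rule finite_surj[of "Pow (verts n)"]) (auto simp: finite_verts face_family_def afaces_def)

section \<open>The action on faces\<close>

lemma coord_act:
  assumes "p permutes {1..n}"
  shows "coord (hyperoct_act (s, p) x) j = of_int (s j) * coord x (inv_into UNIV p j)"
proof -
  have e: "p i = j \<longleftrightarrow> i = inv_into UNIV p j" for i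
    using permutes_inverses[OF assms] by metis
  have "coord (hyperoct_act (s, p) x) j =
    (\<Sum>i\<in>Poly_Mapping.keys x. if i = inv_into UNIV p j then of_int (s j) * coord x i else 0)"
    unfolding hyperoct_act_def prod.case lookup_sum
    by (intro sum.cong) (auto simp: lookup_single when_def e permutes_inverses[OF assms])
  also have "\<dots> = of_int (s j) * coord x (inv_into UNIV p j)"
    by (simp add: in_keys_iff)
  finally show ?thesis .
qed

lemma linear_act: "g \<in> carrier (hyperoct n) \<Longrightarrow> linear (hyperoct_act g)"
proof -
  assume g: "g \<in> carrier (hyperoct n)"
  obtain s p where sp: "g = (s, p)" by (cases g)
  have p: "p permutes {1..n}" using g sp hyperoct_permutes by blast
  show "linear (hyperoct_act g)"
    unfolding sp by (rule linearI; rule poly_mapping_eqI)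
      (simp_all add: coord_act[OF p] coord_scaleR lookup_add distrib_left)
qed

lemma finite_action_hyperoct: "finite_action (hyperoct n) hyperoct_act"
proof -
  interpret group "hyperoct n" by (rule group_hyperoct)
  show ?thesis
  proof
    show "finite (carrier (hyperoct n))" by (rule finite_hyperoct)
    show "hyperoct_act \<one>\<^bsub>hyperoct n\<^esub> x = x" for x
      by (rule poly_mapping_eqI) (simp add: hyperoct_simps(3) coord_act[OF permutes_id])
    fix g h x assume gh: "g \<in> carrier (hyperoct n)" "h \<in> carrier (hyperoct n)"
    obtain s p t q where e: "g = (s, p)" "h = (t, q)" by (cases g, cases h)
    have p: "p permutes {1..n}" "q permutes {1..n}" using gh e by (auto dest: hyperoct_permutes)
    show "hyperoct_act (g \<otimes>\<^bsub>hyperoct n\<^esub> h) x = hyperoct_act g (hyperoct_act h x)"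
      by (rule poly_mapping_eqI)
        (simp add: e hyperoct_simps(2) coord_act[OF permutes_compose[OF p(2,1)]] coord_act[OF p(1)] coord_act[OF p(2)]
          o_inv_distrib[OF permutes_bij[OF p(1)] permutes_bij[OF p(2)]])
  qed
qed

lemma finite_action_faces: "finite_action (hyperoct n) (chain_act hyperoct_act)"
proof -
  interpret finite_action "hyperoct n" hyperoct_act by (rule finite_action_hyperoct)
  show ?thesis by unfold_locales (auto simp: chain_act_def fin act_one act_mult image_image)
qed

lemma act_inverse:
  assumes "g \<in> carrier (hyperoct n)"
  shows "hyperoct_act g (hyperoct_act (inv\<^bsub>hyperoct n\<^esub> g) x) = x"
    "hyperoct_act (inv\<^bsub>hyperoct n\<^esub> g) (hyperoct_act g x) = x"
proof -
  interpret finite_action "hyperoct n" hyperoct_act by (rule finite_action_hyperoct)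
  show "hyperoct_act g (hyperoct_act (inv\<^bsub>hyperoct n\<^esub> g) x) = x"
    "hyperoct_act (inv\<^bsub>hyperoct n\<^esub> g) (hyperoct_act g x) = x"
    using assms act_mult[OF assms inv_closed[OF assms], of x] act_mult[OF inv_closed[OF assms] assms, of x]
    by (simp_all add: act_one)
qed

lemma bij_act: "g \<in> carrier (hyperoct n) \<Longrightarrow> bij (hyperoct_act g)"
  by (rule o_bij[of "hyperoct_act (inv\<^bsub>hyperoct n\<^esub> g)"]) (simp_all add: fun_eq_iff act_inverse)

lemma act_verts:
  assumes g: "g \<in> carrier (hyperoct n)" and v: "v \<in> verts n"
  shows "hyperoct_act g v \<in> verts n"
proof -
  obtain s p where sp: "g = (s, p)" by (cases g)
  have p: "p permutes {1..n}" using g sp hyperoct_permutes by blast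
  obtain i e where i: "i \<in> {1..n}" "e = 1 \<or> e = -1" "v = Poly_Mapping.single i e" by (rule vertsE[OF v])
  have eq: "i = inv_into UNIV p j \<longleftrightarrow> j = p i" for j using permutes_inverses[OF p] by metis
  have "hyperoct_act g v = Poly_Mapping.single (p i) (of_int (s (p i)) * e)"
    unfolding sp i(3) by (rule poly_mapping_eqI) (auto simp: coord_act[OF p] lookup_single when_def eq)
  moreover have "p i \<in> {1..n}" using i(1) permutes_in_image[OF p] by blast
  moreover have "s (p i) = 1 \<or> s (p i) = -1" using hyperoct_sign[OF g[unfolded sp], of "p i"] by simp
  ultimately show ?thesis using i(2) by (auto simp: verts_def single_uminus)
qed

lemma act_afaces:
  assumes g: "g \<in> carrier (hyperoct n)" and A: "A \<in> afaces n"
  shows "hyperoct_act g ` A \<in> afaces n"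
proof -
  have "- hyperoct_act g a \<notin> hyperoct_act g ` A" if "a \<in> A" for a
  proof
    assume "- hyperoct_act g a \<in> hyperoct_act g ` A"
    then obtain b where b: "b \<in> A" "hyperoct_act g (- a) = hyperoct_act g b"
      using linear_neg[OF linear_act[OF g]] by auto
    then have "b = - a" using bij_is_inj[OF bij_act[OF g]] by (metis injD)
    then show False using A b(1) that by (auto simp: afaces_def)
  qed
  then show ?thesis using A act_verts[OF g] by (auto simp: afaces_def)
qed

lemma act_face_family:
  assumes g: "g \<in> carrier (hyperoct n)" and F: "F \<in> face_family S n"
  shows "hyperoct_act g ` F \<in> face_family S n"
proof -
  obtain A where A: "A \<in> afaces n" "card A \<in> Suc ` S" "F = convex hull A" using F by (auto simp: face_family_def)
  have "card (hyperoct_act g ` A) = card A"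
    using bij_is_inj[OF bij_act[OF g]] by (intro card_image) (auto intro: inj_on_subset)
  then show ?thesis
    using A act_afaces[OF g A(1)] unfolding face_family_def A(3) convex_hull_linear_image[OF linear_act[OF g]] by auto
qed

lemma act_cross_polytope:
  assumes g: "g \<in> carrier (hyperoct n)"
  shows "hyperoct_act g ` cross_polytope n = cross_polytope n"
proof -
  have sub: "hyperoct_act h ` cross_polytope n \<subseteq> cross_polytope n" if h: "h \<in> carrier (hyperoct n)" for h
    unfolding cross_polytope_eq convex_hull_linear_image[OF linear_act[OF h]]
    using act_verts[OF h] by (intro hull_mono) auto
  have i: "inv\<^bsub>hyperoct n\<^esub> g \<in> carrier (hyperoct n)" by (rule group.inv_closed[OF group_hyperoct g])
  show ?thesis
  proof
    show "cross_polytope n \<subseteq> hyperoct_act g ` cross_polytope n"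
    proof
      fix x assume "x \<in> cross_polytope n"
      then have "hyperoct_act (inv\<^bsub>hyperoct n\<^esub> g) x \<in> cross_polytope n" using sub[OF i] by blast
      then show "x \<in> hyperoct_act g ` cross_polytope n"
        using act_inverse(1)[OF g, of x] by (metis imageI)
    qed
  qed (rule sub[OF g])
qed

section \<open>Coordinates involved in a chain of faces\<close>

text \<open>
  The greatest element of the poset is represented by \<open>UNIV\<close>, which counts as involving no
  coordinate.
\<close>

definition fsupp :: "vec set \<Rightarrow> nat set" where
  "fsupp F = {i. \<exists>x\<in>F. coord x i \<noteq> 0}"

definition csupp :: "vec set set \<Rightarrow> nat set" where
  "csupp \<sigma> = (\<Union>F\<in>\<sigma> - {UNIV}. fsupp F)"

lemma fsupp_hull: "fsupp (convex hull A) = (\<Union>a\<in>A. Poly_Mapping.keys a)"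
proof
  show "(\<Union>a\<in>A. Poly_Mapping.keys a) \<subseteq> fsupp (convex hull A)"
    using hull_inc[of _ A convex] by (auto simp: fsupp_def in_keys_iff)
  show "fsupp (convex hull A) \<subseteq> (\<Union>a\<in>A. Poly_Mapping.keys a)"
  proof (rule subsetI, rule ccontr)
    fix i assume i: "i \<in> fsupp (convex hull A)" "i \<notin> (\<Union>a\<in>A. Poly_Mapping.keys a)"
    have "convex {x::vec. coord x i = 0}" by (auto simp: convex_def coord_simps)
    moreover have "A \<subseteq> {x. coord x i = 0}" using i(2) by (auto simp: in_keys_iff)
    ultimately have "convex hull A \<subseteq> {x. coord x i = 0}" by (metis hull_minimal)
    then show False using i(1) by (auto simp: fsupp_def)
  qed
qed

lemma face_family_Suc: "F \<in> face_family S n \<longleftrightarrow> F \<in> face_family S (Suc n) \<and> Suc n \<notin> fsupp F"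
proof
  let ?e = "Poly_Mapping.single (Suc n) (1::real)"
  have "verts (Suc n) = insert ?e (insert (- ?e) (verts n))"
    by (auto simp: verts_def atLeastAtMostSuc_conv)
  moreover have "Suc n \<notin> Poly_Mapping.keys v" if "v \<in> verts n" for v
    by (rule vertsE[OF that]) (auto simp: in_keys_iff lookup_single when_def)
  moreover have "Suc n \<in> Poly_Mapping.keys ?e" "Suc n \<in> Poly_Mapping.keys (- ?e)"
    by (simp_all add: in_keys_iff)
  ultimately have V: "v \<in> verts n \<longleftrightarrow> v \<in> verts (Suc n) \<and> Suc n \<notin> Poly_Mapping.keys v" for v
    by auto
  show "F \<in> face_family S n \<Longrightarrow> F \<in> face_family S (Suc n) \<and> Suc n \<notin> fsupp F"
    using V by (force simp: face_family_def afaces_def fsupp_hull)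
  assume F: "F \<in> face_family S (Suc n) \<and> Suc n \<notin> fsupp F"
  then obtain A where A: "A \<in> afaces (Suc n)" "card A \<in> Suc ` S" "F = convex hull A"
    by (auto simp: face_family_def)
  then have "A \<in> afaces n" using V F by (auto simp: afaces_def fsupp_hull)
  then show "F \<in> face_family S n" using A by (auto simp: face_family_def)
qed

lemma UNIV_not_face: "UNIV \<notin> face_family S n"
proof -
  have "Suc n \<in> fsupp UNIV" unfolding fsupp_def
    by (intro CollectI bexI[of _ "Poly_Mapping.single (Suc n) 1"]) auto
  then show ?thesis using face_family_Suc[of UNIV S n] by blast
qed

lemma fsupp_card:
  assumes "finite S" "F \<in> face_family S n"
  shows "finite (fsupp F) \<and> card (fsupp F) \<le> Max (insert 0 (Suc ` S))"
proof -
  obtain A where A: "A \<in> afaces n" "card A \<in> Suc ` S" "F = convex hull A" using assms by (auto simp: face_family_def)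
  have fin: "finite A" using A(1) finite_subset[OF _ finite_verts] by (auto simp: afaces_def)
  have "card (Poly_Mapping.keys a) = 1" if "a \<in> A" for a
  proof -
    have "a \<in> verts n" using A(1) that by (auto simp: afaces_def)
    then obtain i e where "e = 1 \<or> e = -1" "a = Poly_Mapping.single i e" by (rule vertsE)
    then show ?thesis by auto
  qed
  then have "card (fsupp F) \<le> card A"
    unfolding A(3) fsupp_hull using card_UN_le[OF fin, of Poly_Mapping.keys] by simp
  moreover have "card A \<le> Max (insert 0 (Suc ` S))" using assms(1) A(2) by (intro Max_ge) auto
  ultimately show ?thesis unfolding A(3) fsupp_hull using fin by simp
qed

lemma fsupp_act:
  assumes g: "(s, p) \<in> carrier (hyperoct n)"
  shows "fsupp (hyperoct_act (s, p) ` F) = p ` fsupp F"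
proof -
  have p: "p permutes {1..n}" by (rule hyperoct_permutes[OF g])
  have s: "s j \<noteq> 0" for j using hyperoct_sign[OF g, of j] by auto
  have "j \<in> fsupp (hyperoct_act (s, p) ` F) \<longleftrightarrow> inv_into UNIV p j \<in> fsupp F" for j
    by (simp add: fsupp_def coord_act[OF p] s)
  then show ?thesis
    using permutes_inverses[OF p] by (auto simp: image_iff) metis
qed

lemma csupp_act:
  assumes g: "(s, p) \<in> carrier (hyperoct n)"
  shows "csupp (chain_act hyperoct_act (s, p) \<sigma>) = p ` csupp \<sigma>"
proof -
  let ?f = "hyperoct_act (s, p)"
  have "inj ((`) ?f)"
    using inj_image_eq_iff[OF bij_is_inj[OF bij_act[OF g]]] by (intro injI) blast
  from image_set_diff[OF this, of \<sigma> "{UNIV}"]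
  have "chain_act hyperoct_act (s, p) \<sigma> - {UNIV} = (`) ?f ` (\<sigma> - {UNIV})"
    using bij_is_surj[OF bij_act[OF g]] by (simp add: chain_act_def)
  then show ?thesis by (simp add: csupp_def fsupp_act[OF g] image_UN)
qed

lemma act_local:
  assumes g: "(s, p) \<in> carrier (hyperoct n)" "(t, q) \<in> carrier (hyperoct n)"
    and e: "\<And>i. i \<in> csupp \<sigma> \<Longrightarrow> p i = q i \<and> s (p i) = t (q i)"
  shows "chain_act hyperoct_act (s, p) \<sigma> = chain_act hyperoct_act (t, q) \<sigma>"
  unfolding chain_act_def
proof (rule image_cong[OF refl])
  fix F assume F: "F \<in> \<sigma>"
  show "hyperoct_act (s, p) ` F = hyperoct_act (t, q) ` F"
  proof (cases "F = UNIV")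
    case True
    then show ?thesis using bij_act[OF g(1)] bij_act[OF g(2)] by (simp add: bij_is_surj)
  next
    case False
    show ?thesis
    proof (rule image_cong[OF refl])
      fix x assume "x \<in> F"
      then have "Poly_Mapping.keys x \<subseteq> csupp \<sigma>" using F False by (auto simp: csupp_def fsupp_def in_keys_iff)
      then show "hyperoct_act (s, p) x = hyperoct_act (t, q) x"
        unfolding hyperoct_act_def prod.case using e
        by (intro sum.cong refl) (metis subsetD)
    qed
  qed
qed

definition extremes :: "bool \<Rightarrow> vec set \<Rightarrow> vec set set" where
  "extremes w T = (if w then {{}, T} else {})"

text \<open>
  The largest member of the chain other than \<open>UNIV\<close> contains all the others, so it involves all the
  coordinates that the chain involves.
\<close>

lemma csupp_card:
  assumes "finite S" "\<sigma> \<in> order_simplices (face_family S n \<union> extremes w UNIV) i"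
  shows "finite (csupp \<sigma>) \<and> card (csupp \<sigma>) \<le> Max (insert 0 (Suc ` S))"
proof (cases "\<sigma> - {UNIV} = {}")
  case True
  then show ?thesis unfolding csupp_def True by simp
next
  case False
  have \<sigma>: "finite \<sigma>" "\<sigma> \<subseteq> face_family S n \<union> extremes w UNIV" "\<forall>x\<in>\<sigma>. \<forall>y\<in>\<sigma>. x \<noteq> y \<longrightarrow> x \<subset> y \<or> y \<subset> x"
    using assms(2) by (auto simp: order_simplices_iff)
  obtain M where M: "M \<in> \<sigma> - {UNIV}" "\<forall>F\<in>\<sigma> - {UNIV}. M \<subseteq> F \<longrightarrow> M = F"
    using finite_has_maximal[OF finite_Diff[OF \<sigma>(1)] False] by auto
  have "F \<subseteq> M" if F: "F \<in> \<sigma> - {UNIV}" for F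
  proof (cases "F = M")
    case False
    then have "F \<subset> M \<or> M \<subset> F" using \<sigma>(3) F M(1) by simp
    moreover have "\<not> M \<subset> F" using M(2) F False by (metis psubset_imp_subset)
    ultimately show ?thesis by (simp add: psubset_imp_subset)
  qed simp
  then have "csupp \<sigma> = fsupp M" using M(1) by (auto simp: csupp_def fsupp_def)
  moreover have "M \<in> face_family S n \<or> M = {}" using M(1) \<sigma>(2) by (auto simp: extremes_def split: if_splits)
  ultimately show ?thesis using fsupp_card[OF assms(1), of M n] by (auto simp: fsupp_def)
qed

lemma simplices_Suc:
  "order_simplices (face_family S n \<union> extremes w UNIV) i =
    {\<sigma> \<in> order_simplices (face_family S (Suc n) \<union> extremes w UNIV) i. Suc n \<notin> csupp \<sigma>}"
proof -
  have e: "\<sigma> \<subseteq> face_family S n \<union> extremes w UNIV \<longleftrightarrow>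
    \<sigma> \<subseteq> face_family S (Suc n) \<union> extremes w UNIV \<and> Suc n \<notin> csupp \<sigma>" for \<sigma>
  proof -
    have "F \<in> face_family S n \<union> extremes w UNIV \<longleftrightarrow>
      F \<in> face_family S (Suc n) \<union> extremes w UNIV \<and> (F \<noteq> UNIV \<longrightarrow> Suc n \<notin> fsupp F)" for F
      using face_family_Suc[of F S n] UNIV_not_face[of S "Suc n"] UNIV_not_face[of S n]
      by (auto simp: extremes_def fsupp_def)
    then show ?thesis unfolding csupp_def subset_iff by blast
  qed
  show ?thesis
  proof (rule Set.set_eqI)
    fix \<sigma>
    show "\<sigma> \<in> order_simplices (face_family S n \<union> extremes w UNIV) i \<longleftrightarrow>
      \<sigma> \<in> {\<sigma> \<in> order_simplices (face_family S (Suc n) \<union> extremes w UNIV) i. Suc n \<notin> csupp \<sigma>}"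
      unfolding mem_Collect_eq order_simplices_iff e[of \<sigma>]
      by (rule iffI; elim conjE; intro conjI; assumption)
  qed
qed

section \<open>Stability for rank-selected face posets\<close>

lemma order_iso_simplices:
  assumes inj: "inj_on \<Theta> Q" and ord: "\<And>x y. x \<in> Q \<Longrightarrow> y \<in> Q \<Longrightarrow> \<Theta> x \<subset> \<Theta> y \<longleftrightarrow> x \<subset> y"
  shows "bij_betw ((`) \<Theta>) (order_simplices Q i) (order_simplices (\<Theta> ` Q) i)"
proof (rule bij_betw_imageI)
  show "inj_on ((`) \<Theta>) (order_simplices Q i)"
    by (rule inj_on_subset[OF inj_on_image_Pow[OF inj]]) (auto simp: order_simplices_iff)
  have c: "\<Theta> ` \<sigma> \<in> order_simplices (\<Theta> ` Q) i \<longleftrightarrow> \<sigma> \<in> order_simplices Q i" if \<sigma>: "\<sigma> \<subseteq> Q" for \<sigma>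
  proof -
    have i: "inj_on \<Theta> \<sigma>" by (rule inj_on_subset[OF inj \<sigma>])
    have "(\<forall>x\<in>\<sigma>. \<forall>y\<in>\<sigma>. \<Theta> x \<noteq> \<Theta> y \<longrightarrow> \<Theta> x \<subset> \<Theta> y \<or> \<Theta> y \<subset> \<Theta> x) \<longleftrightarrow>
      (\<forall>x\<in>\<sigma>. \<forall>y\<in>\<sigma>. x \<noteq> y \<longrightarrow> x \<subset> y \<or> y \<subset> x)"
    proof (intro ball_cong refl)
      fix x y assume "x \<in> \<sigma>" "y \<in> \<sigma>"
      then have m: "x \<in> Q" "y \<in> Q" using \<sigma> by auto
      show "(\<Theta> x \<noteq> \<Theta> y \<longrightarrow> \<Theta> x \<subset> \<Theta> y \<or> \<Theta> y \<subset> \<Theta> x) \<longleftrightarrow> (x \<noteq> y \<longrightarrow> x \<subset> y \<or> y \<subset> x)"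
        by (simp only: ord[OF m] ord[OF m(2,1)] inj_on_eq_iff[OF inj m])
    qed
    then show ?thesis
      using \<sigma> by (simp add: order_simplices_iff card_image[OF i] finite_image_iff[OF i] image_mono)
  qed
  show "(`) \<Theta> ` order_simplices Q i = order_simplices (\<Theta> ` Q) i"
  proof
    show "(`) \<Theta> ` order_simplices Q i \<subseteq> order_simplices (\<Theta> ` Q) i"
    proof (rule image_subsetI)
      fix \<sigma> assume \<sigma>: "\<sigma> \<in> order_simplices Q i"
      then have "\<sigma> \<subseteq> Q" by (simp add: order_simplices_iff)
      then show "\<Theta> ` \<sigma> \<in> order_simplices (\<Theta> ` Q) i" using c \<sigma> by blast
    qed
    show "order_simplices (\<Theta> ` Q) i \<subseteq> (`) \<Theta> ` order_simplices Q i"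
    proof
      fix \<tau> assume \<tau>: "\<tau> \<in> order_simplices (\<Theta> ` Q) i"
      then have "\<tau> \<subseteq> \<Theta> ` Q" by (simp add: order_simplices_iff)
      then obtain \<sigma> where \<sigma>: "\<sigma> \<subseteq> Q" "\<tau> = \<Theta> ` \<sigma>" by (rule subset_imageE)
      then have "\<sigma> \<in> order_simplices Q i" using c \<tau> by blast
      then show "\<tau> \<in> (`) \<Theta> ` order_simplices Q i" using \<sigma>(2) by blast
    qed
  qed
qed

text \<open>
  The poset with (\<open>w\<close>) or without its least and greatest elements. In the model the greatest element is
  \<open>UNIV\<close> for every \<open>n\<close>, so that the simplices for \<open>n\<close> are literally simplices for \<open>n + 1\<close>.
\<close>

abbreviation face_poset :: "nat set \<Rightarrow> bool \<Rightarrow> nat \<Rightarrow> vec set set" where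
  "face_poset S w n \<equiv> face_family S n \<union> extremes w (cross_polytope n)"

abbreviation model_poset :: "nat set \<Rightarrow> bool \<Rightarrow> nat \<Rightarrow> vec set set" where
  "model_poset S w n \<equiv> face_family S n \<union> extremes w UNIV"

lemma poset_action_extremes:
  assumes "\<And>g. g \<in> carrier (hyperoct n) \<Longrightarrow> hyperoct_act g ` T = T"
  shows "poset_action (hyperoct n) hyperoct_act (face_family S n \<union> extremes w T)"
proof (intro poset_action.intro finite_action_hyperoct poset_action_axioms.intro)
  show "finite (face_family S n \<union> extremes w T)" by (simp add: finite_face_family extremes_def)
  show "hyperoct_act g ` F \<in> face_family S n \<union> extremes w T"
    if "g \<in> carrier (hyperoct n)" "F \<in> face_family S n \<union> extremes w T" for g F
    using that act_face_family[OF that(1), of F S] assms[OF that(1)] by (auto simp: extremes_def split: if_splits)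
qed

lemma poset_action_face: "poset_action (hyperoct n) hyperoct_act (face_poset S w n)"
  by (rule poset_action_extremes) (rule act_cross_polytope)

lemma poset_action_model: "poset_action (hyperoct n) hyperoct_act (model_poset S w n)"
  by (rule poset_action_extremes) (simp add: bij_is_surj[OF bij_act])

lemma act_simplices:
  assumes "poset_action (hyperoct n) hyperoct_act Q" "g \<in> carrier (hyperoct n)" "\<sigma> \<in> order_simplices Q i"
  shows "chain_act hyperoct_act g \<sigma> \<in> order_simplices Q i"
  using poset_action.stable_D[OF assms(1), of i] assms(2,3)
  unfolding finite_action.stable_def[OF finite_action_faces] by blast

lemma stable_family_faces:
  assumes S: "finite S"
  shows "stable_family (chain_act hyperoct_act) (\<lambda>n. order_simplices (model_poset S w n) i) csupp
    (Max (insert 0 (Suc ` S))) (side_label lp lm) (row_label lp lm) (col_label lp lm)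
    (sum_list lp + sum_list lm + sum_list lp)"
proof (rule stable_family.intro)
  show "finite_action (hyperoct n) (chain_act hyperoct_act)" for n by (rule finite_action_faces)
  show "finite (order_simplices (model_poset S w n) i)" for n
    by (rule finite_order_simplices) (simp add: finite_face_family extremes_def)
  show "chain_act hyperoct_act g x \<in> order_simplices (model_poset S w n) i"
    if "g \<in> carrier (hyperoct n)" "x \<in> order_simplices (model_poset S w n) i" for g n x
    by (rule act_simplices[OF poset_action_model that])
  show "order_simplices (model_poset S w n) i =
    {x \<in> order_simplices (model_poset S w (Suc n)) i. Suc n \<notin> csupp x}" for n
    by (rule simplices_Suc)
  show "chain_act hyperoct_act (s, p) x = chain_act hyperoct_act (t, q) x"
    if "(s, p) \<in> carrier (hyperoct n)" "(t, q) \<in> carrier (hyperoct n)"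
      "\<And>i. i \<in> csupp x \<Longrightarrow> p i = q i \<and> s (p i) = t (q i)" for s p n t q x
    by (rule act_local[OF that])
  show "csupp (chain_act hyperoct_act (s, p) x) = p ` csupp x" if "(s, p) \<in> carrier (hyperoct n)" for s p n x
    by (rule csupp_act[OF that])
  show "finite (csupp x) \<and> card (csupp x) \<le> Max (insert 0 (Suc ` S))"
    if "x \<in> order_simplices (model_poset S w n) i" for x n
    by (rule csupp_card[OF S that])
  show "\<not> side_label lp lm i \<and> row_label lp lm i = 0" if "sum_list lp + sum_list lm + sum_list lp < i" for i
    using that by (simp add: side_label_def row_label_def)
  show "j = i" if "sum_list lp + sum_list lm + sum_list lp < i" "0 < j"
    "side_label lp lm j = side_label lp lm i" "col_label lp lm j = col_label lp lm i" for i j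
  proof -
    have i: "col_label lp lm i = i - (sum_list lp + sum_list lm)" "\<not> side_label lp lm i"
      using that(1) by (simp_all add: col_label_def side_label_def)
    have "tableau_col lp j \<le> j" by (simp add: tableau_col_def)
    then show "j = i" using that i by (auto simp: col_label_def side_label_def split: if_splits)
  qed
qed

lemma dim_model_faces:
  assumes n: "1 \<le> n" and RC: "R \<subseteq> carrier (hyperoct n)" "C \<subseteq> carrier (hyperoct n)"
  defines "\<rho> \<equiv> chain_act hyperoct_act"
  shows "fs.dim ((\<lambda>f. wsum (hyperoct n) \<rho> C \<beta> (wsum (hyperoct n) \<rho> R \<alpha> f)) `
      supp_on (order_simplices (face_poset S w n) i)) =
    fs.dim ((\<lambda>f. wsum (hyperoct n) \<rho> C \<beta> (wsum (hyperoct n) \<rho> R \<alpha> f)) `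
      supp_on (order_simplices (model_poset S w n) i))"
    and "card (face_poset S w n) = card (model_poset S w n)"
proof -
  define \<Theta> where "\<Theta> F = (if F = cross_polytope n then UNIV else F)" for F :: "vec set"
  note fp = face_family_proper[OF n]
  have "Poly_Mapping.single 1 1 \<in> verts n" using n by (auto simp: verts_def)
  then have ne: "cross_polytope n \<noteq> {}" unfolding cross_polytope_eq by auto
  have sub: "F \<subseteq> cross_polytope n" if "F \<in> face_poset S w n" for F
    using that fp(3) by (auto simp: extremes_def split: if_splits)
  have top: "F \<noteq> UNIV" if "F \<in> face_poset S w n" "F \<noteq> cross_polytope n" for F
    using that UNIV_not_face[of S n] by (auto simp: extremes_def split: if_splits)
  have "\<Theta> ` face_family S n = face_family S n"
    using fp(2) by (force simp: \<Theta>_def)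
  moreover have "\<Theta> ` extremes w (cross_polytope n) = extremes w UNIV"
    using ne by (simp add: extremes_def \<Theta>_def)
  ultimately have im: "\<Theta> ` face_poset S w n = model_poset S w n" by (simp add: image_Un)
  have inj: "inj_on \<Theta> (face_poset S w n)"
    by (rule inj_onI) (use top in \<open>auto simp: \<Theta>_def simp del: Un_iff split: if_splits\<close>)
  have ord: "\<Theta> F \<subset> \<Theta> F' \<longleftrightarrow> F \<subset> F'" if "F \<in> face_poset S w n" "F' \<in> face_poset S w n" for F F'
    using sub[OF that(1)] sub[OF that(2)] top[OF that(1)] top[OF that(2)] by (auto simp: \<Theta>_def)
  show "card (face_poset S w n) = card (model_poset S w n)" using card_image[OF inj] im by simp
  have eq: "\<Theta> (hyperoct_act g ` F) = hyperoct_act g ` \<Theta> F" if g: "g \<in> carrier (hyperoct n)" for g F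
  proof -
    have "hyperoct_act g ` F = cross_polytope n \<longleftrightarrow> F = cross_polytope n"
      using act_cross_polytope[OF g] inj_image_eq_iff[OF bij_is_inj[OF bij_act[OF g]]] by metis
    then show ?thesis using bij_is_surj[OF bij_act[OF g]] by (auto simp: \<Theta>_def)
  qed
  show "fs.dim ((\<lambda>f. wsum (hyperoct n) \<rho> C \<beta> (wsum (hyperoct n) \<rho> R \<alpha> f)) `
      supp_on (order_simplices (face_poset S w n) i)) =
    fs.dim ((\<lambda>f. wsum (hyperoct n) \<rho> C \<beta> (wsum (hyperoct n) \<rho> R \<alpha> f)) `
      supp_on (order_simplices (model_poset S w n) i))"
    unfolding \<rho>_def
  proof (rule dim_transport[where \<kappa> = "\<lambda>g. g" and h = "(`) \<Theta>"])
    show "bij_betw ((`) \<Theta>) (order_simplices (face_poset S w n) i) (order_simplices (model_poset S w n) i)"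
      using order_iso_simplices[OF inj ord] unfolding im .
    show "\<Theta> ` chain_act hyperoct_act g \<sigma> = chain_act hyperoct_act g (\<Theta> ` \<sigma>)"
      if "g \<in> carrier (hyperoct n)" for g \<sigma>
      by (simp add: chain_act_def image_image eq[OF that])
  qed (use RC finite_action_faces act_simplices[OF poset_action_face] act_simplices[OF poset_action_model]
      in \<open>auto simp: inj_on_def\<close>)
qed

abbreviation stable_dim :: "nat set \<Rightarrow> bool \<Rightarrow> nat list \<Rightarrow> nat list \<Rightarrow> nat \<Rightarrow> nat \<Rightarrow> nat" where
  "stable_dim S w lp lm n i \<equiv> fs.dim (lab_op (chain_act hyperoct_act) n (side_label lp lm)
     (row_label lp lm) (col_label lp lm) ` supp_on (order_simplices (model_poset S w n) i))"

text \<open>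
  The irreducible representation comes with the filling in which the long first row contains the
  smallest numbers; the rotation replaces it by the filling that is compatible for all \<open>n\<close>.
\<close>

lemma multiplicity_lefschetz_faces:
  assumes lp: "is_partition lp" and lm: "is_partition lm"
    and n_ge: "1 \<le> n" "sum_list lp + sum_list lm + sum_list lp \<le> n"
  shows "virtual_multiplicity (hyperoct n) (stable_irrep lp lm n)
      (lefschetz_rep (hyperoct n) hyperoct_act (face_poset S w n)) =
    (\<Sum>i<card (model_poset S w n). (-1) ^ i * int (stable_dim S w lp lm n i))"
proof -
  define K where "K = sum_list lp + sum_list lm"
  define t where "t = n - K"
  have nt: "n = K + t" "sum_list lp \<le> t" using n_ge by (auto simp: t_def K_def)
  define k where "k = t + sum_list lp"
  define m where "m = sum_list lm"
  have nk: "n = k + m" using nt by (simp add: k_def m_def K_def)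
  let ?side = "\<lambda>i. k < i"
  let ?rw = "\<lambda>i. if i \<le> k then tableau_row (t # lp) i else tableau_row lm (i - k)"
  let ?cl = "\<lambda>i. if i \<le> k then tableau_col (t # lp) i else tableau_col lm (i - k)"
  have "x \<le> t" if "x \<in> set lp" for x using member_le_sum_list[OF that] nt(2) by simp
  then have "sorted_wrt (\<ge>) (t # lp)" using lp by (auto simp: is_partition_def)
  moreover have "sorted_wrt (\<ge>) lm" using lm by (simp add: is_partition_def)
  ultimately have L: "labelling n ?side ?rw ?cl" by (rule labelling_blocks) (simp_all add: k_def m_def nk)
  note pair = char_pair_labelling[OF L]
  interpret irrep_blocks k m n "t # lp" lm ?side ?rw ?cl
    by (intro irrep_blocks.intro two_blocks.intro irrep_blocks_axioms.intro pair) (simp_all add: nk k_def m_def)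
  let ?G = "hyperoct n"
  let ?V = "fun_rep V (pact ?G (reg_act ?G))"
  let ?E = "\<lambda>f. wsum ?G (chain_act hyperoct_act) (stab n ?side ?cl) (chi_sign n ?side)
    (wsum ?G (chain_act hyperoct_act) (stab n ?side ?rw) (chi n ?side) f)"
  have st: "stable_irrep lp lm n = hyperoct_irrep (t # lp) lm"
    by (simp add: stable_irrep_def t_def K_def)
  have pp: "poset_pair ?G (stab n ?side ?rw) (chi n ?side) (stab n ?side ?cl) (chi_sign n ?side)
    hyperoct_act (face_poset S w n)"
    by (intro poset_pair.intro pair poset_action_face)
  obtain v where v: "v \<in> V" "wsum ?G (reg_act ?G) (stab n ?side ?cl) (chi_sign n ?side)
    (wsum ?G (reg_act ?G) (stab n ?side ?rw) (chi n ?side) v) \<noteq> 0"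
    using char_pair.exists_E_ne_zero_pair_ideal[OF pair] by blast
  have "virtual_multiplicity ?G (stable_irrep lp lm n) (lefschetz_rep ?G hyperoct_act (face_poset S w n)) =
    virtual_multiplicity ?G ?V (lefschetz_rep ?G hyperoct_act (face_poset S w n))"
    unfolding virtual_multiplicity_def st rep_multiplicity_hyperoct_irrep ..
  also have "\<dots> = (\<Sum>i<card (face_poset S w n). (-1) ^ i *
      int (fs.dim (?E ` supp_on (order_simplices (face_poset S w n) i))))"
    by (rule poset_pair.virtual_multiplicity_lefschetz[OF pp char_pair.finite_action_reg[OF pair]
          char_pair.pair_ideal_irreducible[OF pair] v])
  also have "\<dots> = (\<Sum>i<card (model_poset S w n). (-1) ^ i * int (stable_dim S w lp lm n i))"
    unfolding dim_model_faces(2)[OF n_ge(1) empty_subsetI empty_subsetI]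
  proof (rule sum.cong[OF refl])
    fix i
    have "fs.dim (?E ` supp_on (order_simplices (face_poset S w n) i)) =
      fs.dim (?E ` supp_on (order_simplices (model_poset S w n) i))"
      by (rule dim_model_faces(1)[OF n_ge(1)]) (auto simp: stab_def)
    also have "\<dots> = stable_dim S w lp lm n i"
      unfolding lab_op_def
    proof (rule dim_relabel[symmetric, where \<pi> = "rotation K t"])
      show "rotation K t permutes {1..n}" unfolding nt(1) by (rule rotation_permutes)
      show "(k < rotation K t i) = side_label lp lm i \<and> ?rw (rotation K t i) = row_label lp lm i \<and>
        ?cl (rotation K t i) = col_label lp lm i" if "i \<in> {1..n}" for i
        using rotation_labels[of i lp lm t] that unfolding nt(1) K_def k_def by simp
    qed (rule finite_action_faces act_simplices[OF poset_action_model]; assumption)+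
    finally show "(-1) ^ i * int (fs.dim (?E ` supp_on (order_simplices (face_poset S w n) i))) =
      (-1) ^ i * int (stable_dim S w lp lm n i)" by simp
  qed
  finally show ?thesis .
qed

lemma stable_dim_eventually:
  assumes "finite S" "sum_list lp + sum_list lm + sum_list lp + Max (insert 0 (Suc ` S)) \<le> N" "N \<le> n"
  shows "stable_dim S w lp lm n i = stable_dim S w lp lm N i"
  using assms(3)
proof (induction n rule: dec_induct)
  case (step n)
  then show ?case
    using stable_family.dim_lab_op_Suc[OF stable_family_faces[OF assms(1), of w i lp lm], of n] assms(2) by simp
qed simp

lemma stable_dim_zero:
  assumes "card (model_poset S w n) \<le> i"
  shows "stable_dim S w lp lm n i = 0"
proof -
  have "order_simplices (model_poset S w n) i = {}"
    by (rule order_simplices_empty[OF _ assms]) (simp add: finite_face_family extremes_def)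
  then have "supp_on (order_simplices (model_poset S w n) i) = {0}"
    by (auto simp: supp_on_def fun_eq_iff pointwise)
  moreover have "lab_op \<rho> n side rw cl 0 = 0" for \<rho> :: "signed_perm \<Rightarrow> vec set set \<Rightarrow> vec set set" and side rw cl
    by (rule ext) (simp add: lab_op_def wsum_def pact_def sum_fun_apply pointwise)
  ultimately show ?thesis
    using fs.dim_le_card[of "{0 :: vec set set \<Rightarrow> rat}" "{}"] by (simp add: fs.span_empty)
qed

text \<open>
  The posets grow with \<open>n\<close>, but in the degrees that are new the stable dimension is zero.
\<close>

lemma multiplicity_stable_faces:
  assumes S: "finite S" and L: "\<And>n. 1 \<le> n \<Longrightarrow> L n = lefschetz_rep (hyperoct n) hyperoct_act (face_poset S w n)"
  shows "multiplicity_stable L"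
  unfolding multiplicity_stable_def
proof (intro allI impI)
  fix lp lm assume p: "is_partition lp" "is_partition lm"
  define N where "N = Suc (sum_list lp + sum_list lm + sum_list lp + Max (insert 0 (Suc ` S)))"
  let ?f = "\<lambda>i. (-1) ^ i * int (stable_dim S w lp lm N i)"
  have "virtual_multiplicity (hyperoct n) (stable_irrep lp lm n) (L n) = sum ?f {..<card (model_poset S w N)}"
    if n: "N \<le> n" for n
  proof -
    have n1: "1 \<le> n" "sum_list lp + sum_list lm + sum_list lp \<le> n" using n by (auto simp: N_def)
    have "virtual_multiplicity (hyperoct n) (stable_irrep lp lm n) (L n) =
      (\<Sum>i<card (model_poset S w n). (-1) ^ i * int (stable_dim S w lp lm n i))"
      unfolding L[OF n1(1)] by (rule multiplicity_lefschetz_faces[OF p n1])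
    also have "\<dots> = sum ?f {..<card (model_poset S w n)}"
      by (intro sum.cong refl arg_cong[of _ _ "\<lambda>x. _ * int x"] stable_dim_eventually[OF S _ n])
        (simp add: N_def)
    also have "\<dots> = sum ?f {..<card (model_poset S w N)}"
    proof (rule sum.mono_neutral_right)
      have "face_family S N \<subseteq> face_family S n"
        using n by (induction n rule: dec_induct) (use face_family_Suc in blast)+
      then have "card (model_poset S w N) \<le> card (model_poset S w n)"
        by (intro card_mono) (auto simp: finite_face_family extremes_def)
      then show "{..<card (model_poset S w N)} \<subseteq> {..<card (model_poset S w n)}" by simp
    qed (simp_all add: stable_dim_zero)
    finally show ?thesis .
  qed
  then show "\<exists>c. \<forall>\<^sub>F n in sequentially.
    virtual_multiplicity (hyperoct n) (stable_irrep lp lm n) (L n) = c"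
    by (intro exI eventually_sequentiallyI)
qed

theorem theorem7p7:
  fixes S :: "nat set"
  assumes "finite S"
  shows "multiplicity_stable (lefschetz_cross S) \<and> multiplicity_stable (lefschetz_cross_proper S)"
proof
  show "multiplicity_stable (lefschetz_cross S)"
    by (rule multiplicity_stable_faces[OF assms, where w = True])
      (simp add: lefschetz_cross_def rank_selected_eq extremes_def)
  show "multiplicity_stable (lefschetz_cross_proper S)"
  proof (rule multiplicity_stable_faces[OF assms, where w = False])
    fix n :: nat assume "1 \<le> n"
    then have "rank_selected S n - {{}, cross_polytope n} = face_poset S False n"
      using face_family_proper[of n] by (auto simp: rank_selected_eq extremes_def)
    then show "lefschetz_cross_proper S n = lefschetz_rep (hyperoct n) hyperoct_act (face_poset S False n)"
      by (simp add: lefschetz_cross_proper_def)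
  qed
qed

end
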